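(* Let $k$ be a perfect field of characteristic $p$ and let $X/k$ be a smooth variety. There exists a canonical map from the set of equivalence classes of trivializations of the Hodge--Tate gerbe $X^{\mathrm{HT}}$ to the set of isomorphism classes of Frobenius liftings of $X$ over $\mathrm{W}_2(k)$.
   Context: $\mathrm{W}$ and $\mathrm{W}_2$ denote ($p$-typical, resp. length-2 truncated) Witt vectors, $F$ Frobenius. $X_{\mathrm{fpqc}}$ is the site of $X$-schemes (of cardinality bounded by a fixed sufficiently large cardinal) with fpqc coverings. $\mathbb{G}_a^\sharp$ is the fpqc sheaf $\mathrm{Spec}(B)\mapsto\ker(F:\mathrm{W}(B)\to\mathrm{W}(B))$, which is a $\mathbb{G}_a$-module, and $T^\sharp_{X/k}:=T_{X/k}\otimes_{\mathcal{O}_X}\mathbb{G}_a^\sharp$, with $T_{X/k}$ the tangent bundle. $X^{\mathrm{HT}}$ is the stack on $X_{\mathrm{fpqc}}$ sending $f:\mathrm{Spec}(B)\to X$ to the groupoid of $k$-morphisms $g:\mathrm{Spec}(\mathrm{W}(B)/p)\to X$ whose composite with $\mathrm{Spec}(B)\to\mathrm{Spec}(\mathrm{W}(B)/p)$ is $f$. Here $\mathrm{W}(B)/p$ is the derived quotient, $\mathrm{Spec}(B)\to \mathrm{Spec}(\mathrm{W}(B)/p)$ is induced by the projection $\mathrm{W}(B)\to B$ to the first coordinate, and the $k$-structure on $\mathrm{W}(B)/p$ is $\mathrm{W}(k)\to\mathrm{W}(B)$ modulo $p$. Since $p=VF$, $\mathrm{W}(B)/p\to B$ is a derived square-zero extension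 with fibre $\mathbb{G}_a^\sharp(B)[1]$; by a theorem of Bhatt--Lurie this makes $X^{\mathrm{HT}}$ a gerbe banded by $T^\sharp_{X/k}$. A trivialization of $X^{\mathrm{HT}}$ is an isomorphism of $T^\sharp_{X/k}$-gerbes $\mathbf{B}T^\sharp_{X/k}\cong X^{\mathrm{HT}}$ (equivalently a global section of $X^{\mathrm{HT}}$ over $X$); trivializations are considered up to isomorphism. A Frobenius lifting of $X$ is a pair $(\widetilde X,\phi)$ with $\widetilde X$ a smooth lifting of $X$ over $\mathrm{W}_2(k)$ and $\phi:\widetilde X\to\widetilde X$ a lifting of the Frobenius endomorphism of $X$ compatible with the Frobenius of $\mathrm{W}_2(k)$. Isomorphisms are isomorphisms of liftings of $X$ over $\mathrm{W}_2(k)$ compatible with $\phi$. *)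

theory Defs
  imports
    "HOL-Algebra.QuotRing"
    "HOL-Analysis.Abstract_Topology"
    "HOL-Combinatorics.Permutations"
    "HOL-Computational_Algebra.Primes"
    "HOL-Library.Multiset"
    "HOL-Library.Poly_Mapping"
begin

section \<open>Witt vectors\<close>

text \<open>Integer polynomials in the variables $X_i$ = (False, i) and $Y_i$ = (True, i).\<close>

type_synonym wpoly = "((bool \<times> nat) \<Rightarrow>\<^sub>0 nat) \<Rightarrow>\<^sub>0 int"

definition wvar :: "bool \<times> nat \<Rightarrow> wpoly" where
  "wvar v = Poly_Mapping.single (Poly_Mapping.single v 1) 1"

definition ghost :: "nat \<Rightarrow> bool \<Rightarrow> nat \<Rightarrow> wpoly" where
  "ghost p b n = (\<Sum>i\<le>n. of_nat (p ^ i) * wvar (b, i) ^ (p ^ (n - i)))"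

text \<open>The polynomials $S_n$ with $\sum_{i \le n} p^i S_i^{p^{n-i}} = G_n$. For the two sequences
  $G$ used below, the coefficientwise division by $p^n$ is exact.\<close>

function witt_solve :: "nat \<Rightarrow> (nat \<Rightarrow> wpoly) \<Rightarrow> nat \<Rightarrow> wpoly" where
  "witt_solve p G n =
     Poly_Mapping.map (\<lambda>c. c div int (p ^ n))
       (G n - (\<Sum>i\<leftarrow>[0..<n]. of_nat (p ^ i) * witt_solve p G i ^ (p ^ (n - i))))"
  by pat_completeness auto
termination by (relation "measure (\<lambda>(p, G, n). n)") auto

definition witt_add_poly :: "nat \<Rightarrow> nat \<Rightarrow> wpoly" where
  "witt_add_poly p = witt_solve p (\<lambda>n. ghost p False n + ghost p True n)"

definition witt_mult_poly :: "nat \<Rightarrow> nat \<Rightarrow> wpoly" where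
  "witt_mult_poly p = witt_solve p (\<lambda>n. ghost p False n * ghost p True n)"

definition wpoly_eval ::
    "('a, 'm) ring_scheme \<Rightarrow> wpoly \<Rightarrow> (nat \<Rightarrow> 'a) \<Rightarrow> (nat \<Rightarrow> 'a) \<Rightarrow> 'a" where
  "wpoly_eval B P a b =
     (\<Oplus>\<^bsub>B\<^esub>m\<in>Poly_Mapping.keys P. [Poly_Mapping.lookup P m] \<cdot>\<^bsub>B\<^esub>
        (\<Otimes>\<^bsub>B\<^esub>v\<in>Poly_Mapping.keys m.
           (if fst v then b (snd v) else a (snd v)) [^]\<^bsub>B\<^esub> Poly_Mapping.lookup m v))"

definition witt :: "nat \<Rightarrow> ('a, 'm) ring_scheme \<Rightarrow> (nat \<Rightarrow> 'a) ring" where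
  "witt p B =
     \<lparr>carrier = {a. \<forall>n. a n \<in> carrier B},
      monoid.mult = (\<lambda>a b n. wpoly_eval B (witt_mult_poly p n) a b),
      one = (\<lambda>n. if n = 0 then \<one>\<^bsub>B\<^esub> else \<zero>\<^bsub>B\<^esub>),
      zero = (\<lambda>n. \<zero>\<^bsub>B\<^esub>),
      add = (\<lambda>a b n. wpoly_eval B (witt_add_poly p n) a b)\<rparr>"

definition witt_map :: "('a \<Rightarrow> 'b) \<Rightarrow> (nat \<Rightarrow> 'a) \<Rightarrow> (nat \<Rightarrow> 'b)" where
  "witt_map f a = (\<lambda>n. f (a n))"

definition pad2 :: "('a, 'm) ring_scheme \<Rightarrow> 'a \<times> 'a \<Rightarrow> nat \<Rightarrow> 'a" where
  "pad2 B a = (\<lambda>n. if n = 0 then fst a else if n = 1 then snd a else \<zero>\<^bsub>B\<^esub>)"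

definition witt2 :: "nat \<Rightarrow> ('a, 'm) ring_scheme \<Rightarrow> ('a \<times> 'a) ring" where
  "witt2 p B =
     \<lparr>carrier = carrier B \<times> carrier B,
      monoid.mult = (\<lambda>a b. (wpoly_eval B (witt_mult_poly p 0) (pad2 B a) (pad2 B b),
                     wpoly_eval B (witt_mult_poly p 1) (pad2 B a) (pad2 B b))),
      one = (\<one>\<^bsub>B\<^esub>, \<zero>\<^bsub>B\<^esub>),
      zero = (\<zero>\<^bsub>B\<^esub>, \<zero>\<^bsub>B\<^esub>),
      add = (\<lambda>a b. (wpoly_eval B (witt_add_poly p 0) (pad2 B a) (pad2 B b),
                    wpoly_eval B (witt_add_poly p 1) (pad2 B a) (pad2 B b)))\<rparr>"

text \<open>The Frobenius of $W_2(B)$ for $B$ of characteristic $p$.\<close>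

definition witt2_frob :: "nat \<Rightarrow> ('a, 'm) ring_scheme \<Rightarrow> 'a \<times> 'a \<Rightarrow> 'a \<times> 'a" where
  "witt2_frob p B a = (fst a [^]\<^bsub>B\<^esub> p, snd a [^]\<^bsub>B\<^esub> p)"


section \<open>Schemes\<close>

text \<open>\<open>Res U V\<close> is the restriction map from sections over \<open>U\<close> to sections over \<open>V\<close>.\<close>

record ('x, 'r) ringed_space =
  Top :: "'x topology"
  Sh :: "'x set \<Rightarrow> 'r ring"
  Res :: "'x set \<Rightarrow> 'x set \<Rightarrow> 'r \<Rightarrow> 'r"

definition is_ringed_space :: "('x, 'r, 'z) ringed_space_scheme \<Rightarrow> bool" where
  "is_ringed_space X \<longleftrightarrow>
     (\<forall>U. openin (Top X) U \<longrightarrow> cring (Sh X U)) \<and>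
     (\<forall>U V. openin (Top X) U \<and> openin (Top X) V \<and> V \<subseteq> U \<longrightarrow>
        Res X U V \<in> ring_hom (Sh X U) (Sh X V)) \<and>
     (\<forall>U. openin (Top X) U \<longrightarrow> (\<forall>s\<in>carrier (Sh X U). Res X U U s = s)) \<and>
     (\<forall>U V W. openin (Top X) U \<and> openin (Top X) V \<and> openin (Top X) W \<and> W \<subseteq> V \<and> V \<subseteq> U \<longrightarrow>
        (\<forall>s\<in>carrier (Sh X U). Res X V W (Res X U V s) = Res X U W s)) \<and>
     (\<forall>\<U> s. (\<forall>U\<in>\<U>. openin (Top X) U \<and> s U \<in> carrier (Sh X U)) \<and>
        (\<forall>U\<in>\<U>. \<forall>V\<in>\<U>. Res X U (U \<inter> V) (s U) = Res X V (U \<inter> V) (s V)) \<longrightarrow>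
        (\<exists>!t. t \<in> carrier (Sh X (\<Union>\<U>)) \<and> (\<forall>U\<in>\<U>. Res X (\<Union>\<U>) U t = s U)))"

text \<open>The germ at \<open>x\<close> of the section \<open>s\<close> over \<open>U\<close> is a unit of the stalk at \<open>x\<close>.\<close>

definition germ_unit ::
    "('x, 'r, 'z) ringed_space_scheme \<Rightarrow> 'x \<Rightarrow> 'x set \<Rightarrow> 'r \<Rightarrow> bool" where
  "germ_unit X x U s \<longleftrightarrow>
     (\<exists>W. openin (Top X) W \<and> x \<in> W \<and> W \<subseteq> U \<and> Res X U W s \<in> Units (Sh X W))"

definition spec :: "('r, 'm) ring_scheme \<Rightarrow> 'r set topology" where
  "spec R = topology_generated_by {{P. primeideal P R \<and> s \<notin> P} |s. s \<in> carrier R}"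

definition is_localization ::
    "('a, 'm) ring_scheme \<Rightarrow> 'a \<Rightarrow> ('b, 'n) ring_scheme \<Rightarrow> ('a \<Rightarrow> 'b) \<Rightarrow> bool" where
  "is_localization A s B f \<longleftrightarrow>
     f \<in> ring_hom A B \<and> f s \<in> Units B \<and>
     (\<forall>b\<in>carrier B. \<exists>n::nat. \<exists>a\<in>carrier A. f s [^]\<^bsub>B\<^esub> n \<otimes>\<^bsub>B\<^esub> b = f a) \<and>
     (\<forall>a\<in>carrier A. f a = \<zero>\<^bsub>B\<^esub> \<longrightarrow> (\<exists>n::nat. s [^]\<^bsub>A\<^esub> n \<otimes>\<^bsub>A\<^esub> a = \<zero>\<^bsub>A\<^esub>))"

text \<open>\<open>U\<close> with the restricted sheaf is isomorphic to $\mathrm{Spec}(A)$ for some ring $A$: necessarily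
  $A = \mathcal{O}(U)$ and the isomorphism sends \<open>x\<close> to the prime of sections whose germ at \<open>x\<close> is
  not a unit; the structure sheaf of $\mathrm{Spec}(A)$ is the sheaf with value $A_s$ on each
  basic open $D(s)$.\<close>

definition affine_open :: "('x, 'r, 'z) ringed_space_scheme \<Rightarrow> 'x set \<Rightarrow> bool" where
  "affine_open X U \<longleftrightarrow>
     openin (Top X) U \<and>
     homeomorphic_map (subtopology (Top X) U) (spec (Sh X U))
       (\<lambda>x. {s \<in> carrier (Sh X U). \<not> germ_unit X x U s}) \<and>
     (\<forall>s\<in>carrier (Sh X U).
        is_localization (Sh X U) s (Sh X {x \<in> U. germ_unit X x U s})
          (Res X U {x \<in> U. germ_unit X x U s}))"

definition is_scheme :: "('x, 'r, 'z) ringed_space_scheme \<Rightarrow> bool" where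
  "is_scheme X \<longleftrightarrow>
     is_ringed_space X \<and> (\<forall>x\<in>topspace (Top X). \<exists>U. affine_open X U \<and> x \<in> U)"

text \<open>A morphism of schemes: a map \<open>pt\<close> of points and, for each open \<open>V\<close> of the target, a map
  \<open>sec V\<close> from sections over \<open>V\<close> to sections over the preimage of \<open>V\<close>.\<close>

record ('x, 'r, 'y, 's) mor =
  pt :: "'x \<Rightarrow> 'y"
  sec :: "'y set \<Rightarrow> 's \<Rightarrow> 'r"

definition preim ::
    "('x, 'r, 'z) ringed_space_scheme \<Rightarrow> ('x, 'r, 'y, 's) mor \<Rightarrow> 'y set \<Rightarrow> 'x set" where
  "preim X f V = {x \<in> topspace (Top X). pt f x \<in> V}"

definition is_mor ::
    "('x, 'r, 'z) ringed_space_scheme \<Rightarrow> ('y, 's, 'w) ringed_space_scheme \<Rightarrow>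
     ('x, 'r, 'y, 's) mor \<Rightarrow> bool" where
  "is_mor X Y f \<longleftrightarrow>
     continuous_map (Top X) (Top Y) (pt f) \<and>
     (\<forall>V. openin (Top Y) V \<longrightarrow> sec f V \<in> ring_hom (Sh Y V) (Sh X (preim X f V))) \<and>
     (\<forall>V V'. openin (Top Y) V \<and> openin (Top Y) V' \<and> V' \<subseteq> V \<longrightarrow>
        (\<forall>s\<in>carrier (Sh Y V).
           sec f V' (Res Y V V' s) = Res X (preim X f V) (preim X f V') (sec f V s))) \<and>
     (\<forall>V x s. openin (Top Y) V \<and> x \<in> preim X f V \<and> s \<in> carrier (Sh Y V) \<and>
        germ_unit X x (preim X f V) (sec f V s) \<longrightarrow> germ_unit Y (pt f x) V s)"

definition id_mor :: "('x, 'r, 'x, 'r) mor" where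
  "id_mor = \<lparr>pt = (\<lambda>x. x), sec = (\<lambda>V s. s)\<rparr>"

definition comp_mor ::
    "('y, 's, 'w) ringed_space_scheme \<Rightarrow> ('y, 's, 'z, 't) mor \<Rightarrow> ('x, 'r, 'y, 's) mor \<Rightarrow>
     ('x, 'r, 'z, 't) mor" where
  "comp_mor Y g f = \<lparr>pt = pt g \<circ> pt f, sec = (\<lambda>V s. sec f (preim Y g V) (sec g V s))\<rparr>"

definition mor_eq ::
    "('x, 'r, 'z) ringed_space_scheme \<Rightarrow> ('y, 's, 'w) ringed_space_scheme \<Rightarrow>
     ('x, 'r, 'y, 's) mor \<Rightarrow> ('x, 'r, 'y, 's) mor \<Rightarrow> bool" where
  "mor_eq X Y f g \<longleftrightarrow>
     (\<forall>x\<in>topspace (Top X). pt f x = pt g x) \<and>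
     (\<forall>V. openin (Top Y) V \<longrightarrow> (\<forall>s\<in>carrier (Sh Y V). sec f V s = sec g V s))"

text \<open>A scheme \<open>X\<close> over the affine base $\mathrm{Spec}(R)$, the structure morphism being recorded as
  the ring homomorphism \<open>Str X\<close> from $R$ to the global sections.\<close>

record ('x, 'r, 'w) scheme_over = "('x, 'r) ringed_space" +
  Str :: "'w \<Rightarrow> 'r"

definition is_scheme_over :: "'w ring \<Rightarrow> ('x, 'r, 'w) scheme_over \<Rightarrow> bool" where
  "is_scheme_over R X \<longleftrightarrow>
     is_scheme X \<and> Str X \<in> ring_hom R (Sh X (topspace (Top X)))"

definition Str_on :: "('x, 'r, 'w) scheme_over \<Rightarrow> 'x set \<Rightarrow> 'w \<Rightarrow> 'r" where
  "Str_on X U a = Res X (topspace (Top X)) U (Str X a)"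

text \<open>A morphism of schemes from \<open>X\<close> to \<open>Y\<close> lying over the morphism of bases given by the ring
  homomorphism \<open>\<beta>\<close> from the base ring \<open>R\<close> of \<open>Y\<close> to the base ring of \<open>X\<close>.\<close>

definition is_mor_over ::
    "'w ring \<Rightarrow> ('w \<Rightarrow> 'v) \<Rightarrow> ('x, 'r, 'v) scheme_over \<Rightarrow> ('y, 's, 'w) scheme_over \<Rightarrow>
     ('x, 'r, 'y, 's) mor \<Rightarrow> bool" where
  "is_mor_over R \<beta> X Y f \<longleftrightarrow>
     is_mor X Y f \<and>
     (\<forall>a\<in>carrier R. sec f (topspace (Top Y)) (Str Y a) = Str X (\<beta> a))"


section \<open>Smooth varieties\<close>

text \<open>The polynomial ring in variables indexed by \<open>{..<n}\<close>; monomials are multisets of variables.\<close>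

definition mpoly :: "('a, 'm) ring_scheme \<Rightarrow> nat \<Rightarrow> (nat multiset \<Rightarrow> 'a) ring" where
  "mpoly R n =
     \<lparr>carrier = {P. (\<forall>m. P m \<in> carrier R) \<and> finite {m. P m \<noteq> \<zero>\<^bsub>R\<^esub>} \<and>
                    (\<forall>m. P m \<noteq> \<zero>\<^bsub>R\<^esub> \<longrightarrow> set_mset m \<subseteq> {..<n})},
      monoid.mult = (\<lambda>P Q m. \<Oplus>\<^bsub>R\<^esub>m'\<in>{m'. m' \<subseteq># m}. P m' \<otimes>\<^bsub>R\<^esub> Q (m - m')),
      one = (\<lambda>m. if m = {#} then \<one>\<^bsub>R\<^esub> else \<zero>\<^bsub>R\<^esub>),
      zero = (\<lambda>m. \<zero>\<^bsub>R\<^esub>),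
      add = (\<lambda>P Q m. P m \<oplus>\<^bsub>R\<^esub> Q m)\<rparr>"

definition mpoly_eval ::
    "('a, 'm) ring_scheme \<Rightarrow> ('b, 'l) ring_scheme \<Rightarrow> ('a \<Rightarrow> 'b) \<Rightarrow> (nat \<Rightarrow> 'b) \<Rightarrow>
     (nat multiset \<Rightarrow> 'a) \<Rightarrow> 'b" where
  "mpoly_eval R A \<sigma> a P =
     (\<Oplus>\<^bsub>A\<^esub>m\<in>{m. P m \<noteq> \<zero>\<^bsub>R\<^esub>}. \<sigma> (P m) \<otimes>\<^bsub>A\<^esub>
        (\<Otimes>\<^bsub>A\<^esub>i\<in>set_mset m. a i [^]\<^bsub>A\<^esub> count m i))"

definition mpoly_deriv ::
    "('a, 'm) ring_scheme \<Rightarrow> nat \<Rightarrow> (nat multiset \<Rightarrow> 'a) \<Rightarrow> (nat multiset \<Rightarrow> 'a)" where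
  "mpoly_deriv R j P = (\<lambda>m. [Suc (count m j)] \<cdot>\<^bsub>R\<^esub> P (add_mset j m))"

definition ring_det :: "('a, 'm) ring_scheme \<Rightarrow> nat \<Rightarrow> (nat \<Rightarrow> nat \<Rightarrow> 'a) \<Rightarrow> 'a" where
  "ring_det A c M =
     (\<Oplus>\<^bsub>A\<^esub>\<pi>\<in>{\<pi>. \<pi> permutes {..<c}}. [sign \<pi>] \<cdot>\<^bsub>A\<^esub> (\<Otimes>\<^bsub>A\<^esub>i\<in>{..<c}. M i (\<pi> i)))"

text \<open>$A \cong R[x_1,\dots,x_n]/(P_1,\dots,P_c)$ with the Jacobian minor of the first $c$ variables
  invertible in $A$.\<close>

definition standard_smooth ::
    "('a, 'm) ring_scheme \<Rightarrow> ('b, 'l) ring_scheme \<Rightarrow> ('a \<Rightarrow> 'b) \<Rightarrow> bool" where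
  "standard_smooth R A \<sigma> \<longleftrightarrow>
     (\<exists>n c P a. c \<le> n \<and>
        (\<forall>j<c. P j \<in> carrier (mpoly R n)) \<and> (\<forall>i<n. a i \<in> carrier A) \<and>
        mpoly_eval R A \<sigma> a ` carrier (mpoly R n) = carrier A \<and>
        {Q \<in> carrier (mpoly R n). mpoly_eval R A \<sigma> a Q = \<zero>\<^bsub>A\<^esub>} = Idl\<^bsub>mpoly R n\<^esub> (P ` {..<c}) \<and>
        ring_det A c (\<lambda>i j. mpoly_eval R A \<sigma> a (mpoly_deriv R j (P i))) \<in> Units A)"

definition finitely_generated ::
    "('a, 'm) ring_scheme \<Rightarrow> ('b, 'l) ring_scheme \<Rightarrow> ('a \<Rightarrow> 'b) \<Rightarrow> bool" where
  "finitely_generated R A \<sigma> \<longleftrightarrow>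
     (\<exists>n a. (\<forall>i<n. a i \<in> carrier A) \<and>
        mpoly_eval R A \<sigma> a ` carrier (mpoly R n) = carrier A)"

definition smooth_over :: "'w ring \<Rightarrow> ('x, 'r, 'w) scheme_over \<Rightarrow> bool" where
  "smooth_over R X \<longleftrightarrow>
     is_scheme_over R X \<and>
     (\<forall>x\<in>topspace (Top X). \<exists>U. affine_open X U \<and> x \<in> U \<and>
        standard_smooth R (Sh X U) (Str_on X U))"

text \<open>Over an affine base, the diagonal is a closed immersion iff for all affine opens \<open>U\<close>, \<open>V\<close>
  the intersection is affine and $\mathcal{O}(U) \otimes \mathcal{O}(V) \to \mathcal{O}(U \cap V)$ is
  surjective.\<close>

definition separated :: "('x, 'r, 'z) ringed_space_scheme \<Rightarrow> bool" where
  "separated X \<longleftrightarrow>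
     (\<forall>U V. affine_open X U \<and> affine_open X V \<longrightarrow>
        affine_open X (U \<inter> V) \<and>
        (\<forall>t\<in>carrier (Sh X (U \<inter> V)). \<exists>(n::nat) a b.
           (\<forall>i<n. a i \<in> carrier (Sh X U) \<and> b i \<in> carrier (Sh X V)) \<and>
           t = (\<Oplus>\<^bsub>Sh X (U \<inter> V)\<^esub>i\<in>{..<n}.
                  Res X U (U \<inter> V) (a i) \<otimes>\<^bsub>Sh X (U \<inter> V)\<^esub> Res X V (U \<inter> V) (b i))))"

definition integral_scheme :: "('x, 'r, 'z) ringed_space_scheme \<Rightarrow> bool" where
  "integral_scheme X \<longleftrightarrow>
     topspace (Top X) \<noteq> {} \<and>
     (\<forall>U. openin (Top X) U \<and> U \<noteq> {} \<longrightarrow> domain (Sh X U))"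

definition finite_type :: "'w ring \<Rightarrow> ('x, 'r, 'w) scheme_over \<Rightarrow> bool" where
  "finite_type R X \<longleftrightarrow>
     compact_space (Top X) \<and>
     (\<forall>U. affine_open X U \<longrightarrow> finitely_generated R (Sh X U) (Str_on X U))"

definition smooth_variety :: "'k ring \<Rightarrow> ('x, 'r, 'k) scheme_over \<Rightarrow> bool" where
  "smooth_variety k X \<longleftrightarrow>
     smooth_over k X \<and> integral_scheme X \<and> separated X \<and> finite_type k X"

definition perfect_field :: "nat \<Rightarrow> 'k ring \<Rightarrow> bool" where
  "perfect_field p k \<longleftrightarrow>
     field k \<and> [p] \<cdot>\<^bsub>k\<^esub> \<one>\<^bsub>k\<^esub> = \<zero>\<^bsub>k\<^esub> \<and>
     (\<forall>a\<in>carrier k. \<exists>b\<in>carrier k. b [^]\<^bsub>k\<^esub> p = a)"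


section \<open>Maps into a derived quotient\<close>

text \<open>For a ring $C$ and $c \in C$ the derived quotient $C/c$ is the $1$-truncated animated ring
  given by the quasi-ideal $c : C \to C$, i.e. by the ring groupoid with objects $C$ and with
  morphisms $x \to x + c w$ for $w \in C$. A map from an ordinary ring $A$ to it in animated rings is
  modelled by its homotopy pullback along $C \to C/c$, which is an ordinary ring $E$ (a butterfly):
  an extension
  \[ 0 \to C \to E \to A \to 0 \]
  (maps \<open>bf_incl\<close> and \<open>bf_src\<close>) with a ring map \<open>bf_tgt\<close> from $E$ to $C$ which is multiplication by
  $c$ on the kernel and through which $E$ acts on the kernel. Conversely, $E$ gives
  $A \cong \mathrm{cone}(C \to E) \to \mathrm{cone}(c : C \to C)$. Homotopies between maps correspond to
  isomorphisms of such $E$.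

  If $A$ is an algebra over $R/r$ and $\gamma : R \to C$ sends $r$ to $c$, the derived quotient of $C$
  is an algebra over that of $R$; to make the map linear is to give a map \<open>bf_base\<close> from $R$ to $E$
  over $R \to A$ and $\gamma$ which together with $\gamma$ is a map of quasi-ideals from
  $r : R \to R$ to $C \to E$.\<close>

record ('e, 'w, 'a, 'c) butterfly = "'e ring" +
  bf_base :: "'w \<Rightarrow> 'e"
  bf_incl :: "'c \<Rightarrow> 'e"
  bf_src :: "'e \<Rightarrow> 'a"
  bf_tgt :: "'e \<Rightarrow> 'c"

definition derived_quotient_map ::
    "('w, 'm1) ring_scheme \<Rightarrow> 'w \<Rightarrow> ('a, 'm2) ring_scheme \<Rightarrow> ('w \<Rightarrow> 'a) \<Rightarrow>
     ('c, 'm3) ring_scheme \<Rightarrow> ('w \<Rightarrow> 'c) \<Rightarrow> ('e, 'w, 'a, 'c) butterfly \<Rightarrow> bool" where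
  "derived_quotient_map R r A \<alpha> C \<gamma> E \<longleftrightarrow>
     cring E \<and>
     bf_src E \<in> ring_hom E A \<and> bf_src E ` carrier E = carrier A \<and>
     bf_tgt E \<in> ring_hom E C \<and>
     bf_incl E \<in> hom (add_monoid C) (add_monoid E) \<and> inj_on (bf_incl E) (carrier C) \<and>
     bf_incl E ` carrier C = {e \<in> carrier E. bf_src E e = \<zero>\<^bsub>A\<^esub>} \<and>
     (\<forall>w\<in>carrier C. bf_tgt E (bf_incl E w) = \<gamma> r \<otimes>\<^bsub>C\<^esub> w) \<and>
     (\<forall>e\<in>carrier E. \<forall>w\<in>carrier C.
        e \<otimes>\<^bsub>E\<^esub> bf_incl E w = bf_incl E (bf_tgt E e \<otimes>\<^bsub>C\<^esub> w)) \<and>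
     bf_base E \<in> ring_hom R E \<and>
     (\<forall>a\<in>carrier R. bf_src E (bf_base E a) = \<alpha> a \<and> bf_tgt E (bf_base E a) = \<gamma> a \<and>
        bf_base E (r \<otimes>\<^bsub>R\<^esub> a) = bf_incl E (\<gamma> a))"

text \<open>For ring maps \<open>f\<close> from $A$ to $A'$ and \<open>g\<close> from $C$ to $C'$, a map of butterflies over
  \<open>f\<close> and \<open>g\<close> is the same as a homotopy between the two composites from $A$ to the derived quotient of
  $C'$.\<close>

definition butterfly_map ::
    "('w, 'm1) ring_scheme \<Rightarrow> ('c, 'm3) ring_scheme \<Rightarrow> ('a \<Rightarrow> 'a') \<Rightarrow> ('c \<Rightarrow> 'c') \<Rightarrow>
     ('e, 'w, 'a, 'c) butterfly \<Rightarrow> ('e', 'w, 'a', 'c') butterfly \<Rightarrow> ('e \<Rightarrow> 'e') \<Rightarrow> bool" where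
  "butterfly_map R C f g E E' \<rho> \<longleftrightarrow>
     \<rho> \<in> ring_hom E E' \<and>
     (\<forall>a\<in>carrier R. \<rho> (bf_base E a) = bf_base E' a) \<and>
     (\<forall>w\<in>carrier C. \<rho> (bf_incl E w) = bf_incl E' (g w)) \<and>
     (\<forall>e\<in>carrier E. bf_src E' (\<rho> e) = f (bf_src E e) \<and> bf_tgt E' (\<rho> e) = g (bf_tgt E e))"


section \<open>The Hodge--Tate gerbe\<close>

text \<open>Objects of $X^{\mathrm{HT}}(T)$ for an \<open>X\<close>-scheme \<open>f\<close> from \<open>T\<close> to \<open>X\<close>. For affine opens \<open>U\<close> of
  \<open>X\<close> and \<open>V\<close> of \<open>T\<close> with $f(V) \subseteq U$ (see \<open>HT_index\<close>) one has a map of animated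
  $W(k)/p$-algebras $\mathcal{O}_X(U) \to W(\mathcal{O}_T(V))/p$ lifting
  $f^\sharp : \mathcal{O}_X(U) \to \mathcal{O}_T(V)$, and these are glued: the restriction maps \<open>ht_res\<close>
  between the butterflies are the homotopies comparing the values on different \<open>(U, V)\<close>, and
  their functoriality is the cocycle condition. As $\mathrm{Spec}(\mathcal{O}_T(V))$ and
  $\mathrm{Spec}(W(\mathcal{O}_T(V))/p)$ have the same points, this is a \<open>k\<close>-morphism to \<open>X\<close>.

  The ring of a butterfly is in bijection with $\mathcal{O}_X(U) \times W(\mathcal{O}_T(V))$, so its
  elements may be taken from the type \<open>'r \<times> (nat \<Rightarrow> 's)\<close>.\<close>

record ('x, 'r, 't, 's, 'k) ht_point =
  ht_bf :: "'x set \<Rightarrow> 't set \<Rightarrow> ('r \<times> (nat \<Rightarrow> 's), nat \<Rightarrow> 'k, 'r, nat \<Rightarrow> 's) butterfly"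
  ht_res :: "'x set \<Rightarrow> 't set \<Rightarrow> 'x set \<Rightarrow> 't set \<Rightarrow> 'r \<times> (nat \<Rightarrow> 's) \<Rightarrow> 'r \<times> (nat \<Rightarrow> 's)"

definition HT_index ::
    "('x, 'r, 'k) scheme_over \<Rightarrow> ('t, 's, 'k) scheme_over \<Rightarrow> ('t, 's, 'x, 'r) mor \<Rightarrow>
     ('x set \<times> 't set) set" where
  "HT_index X T f = {(U, V). affine_open X U \<and> affine_open T V \<and> V \<subseteq> preim T f U}"

definition HT_points ::
    "nat \<Rightarrow> 'k ring \<Rightarrow> ('x, 'r, 'k) scheme_over \<Rightarrow> ('t, 's, 'k) scheme_over \<Rightarrow>
     ('t, 's, 'x, 'r) mor \<Rightarrow> ('x, 'r, 't, 's, 'k) ht_point set" where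
  "HT_points p k X T f = {g.
     (\<forall>(U, V)\<in>HT_index X T f.
        derived_quotient_map (witt p k) ([p] \<cdot>\<^bsub>witt p k\<^esub> \<one>\<^bsub>witt p k\<^esub>)
          (Sh X U) (\<lambda>a. Str_on X U (a 0))
          (witt p (Sh T V)) (witt_map (Str_on T V)) (ht_bf g U V) \<and>
        (\<forall>e\<in>carrier (ht_bf g U V).
           bf_tgt (ht_bf g U V) e 0 = Res T (preim T f U) V (sec f U (bf_src (ht_bf g U V) e)))) \<and>
     (\<forall>(U, V)\<in>HT_index X T f. \<forall>(U', V')\<in>HT_index X T f. U' \<subseteq> U \<and> V' \<subseteq> V \<longrightarrow>
        butterfly_map (witt p k) (witt p (Sh T V)) (Res X U U') (witt_map (Res T V V'))
          (ht_bf g U V) (ht_bf g U' V') (ht_res g U V U' V')) \<and>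
     (\<forall>(U, V)\<in>HT_index X T f. \<forall>e\<in>carrier (ht_bf g U V). ht_res g U V U V e = e) \<and>
     (\<forall>(U, V)\<in>HT_index X T f. \<forall>(U', V')\<in>HT_index X T f. \<forall>(U'', V'')\<in>HT_index X T f.
        U'' \<subseteq> U' \<and> U' \<subseteq> U \<and> V'' \<subseteq> V' \<and> V' \<subseteq> V \<longrightarrow>
        (\<forall>e\<in>carrier (ht_bf g U V).
           ht_res g U' V' U'' V'' (ht_res g U V U' V' e) = ht_res g U V U'' V'' e))}"

definition HT_iso ::
    "nat \<Rightarrow> 'k ring \<Rightarrow> ('x, 'r, 'k) scheme_over \<Rightarrow> ('t, 's, 'k) scheme_over \<Rightarrow>
     ('t, 's, 'x, 'r) mor \<Rightarrow>
     ('x, 'r, 't, 's, 'k) ht_point \<Rightarrow> ('x, 'r, 't, 's, 'k) ht_point \<Rightarrow> bool" where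
  "HT_iso p k X T f g g' \<longleftrightarrow>
     (\<exists>\<rho>.
       (\<forall>(U, V)\<in>HT_index X T f.
          bij_betw (\<rho> U V) (carrier (ht_bf g U V)) (carrier (ht_bf g' U V)) \<and>
          butterfly_map (witt p k) (witt p (Sh T V)) (\<lambda>s. s) (\<lambda>w. w)
            (ht_bf g U V) (ht_bf g' U V) (\<rho> U V)) \<and>
       (\<forall>(U, V)\<in>HT_index X T f. \<forall>(U', V')\<in>HT_index X T f. U' \<subseteq> U \<and> V' \<subseteq> V \<longrightarrow>
          (\<forall>e\<in>carrier (ht_bf g U V).
             \<rho> U' V' (ht_res g U V U' V' e) = ht_res g' U V U' V' (\<rho> U V e))))"

text \<open>A trivialization is a global section of $X^{\mathrm{HT}}$, i.e. an object over the terminal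
  \<open>X\<close>-scheme \<open>X\<close>.\<close>

type_synonym ('x, 'r, 'k) trivialization = "('x, 'r, 'x, 'r, 'k) ht_point"

definition trivializations ::
    "nat \<Rightarrow> 'k ring \<Rightarrow> ('x, 'r, 'k) scheme_over \<Rightarrow> ('x, 'r, 'k) trivialization set" where
  "trivializations p k X = HT_points p k X X id_mor"

definition trivialization_rel ::
    "nat \<Rightarrow> 'k ring \<Rightarrow> ('x, 'r, 'k) scheme_over \<Rightarrow> ('x, 'r, 'k) trivialization rel" where
  "trivialization_rel p k X =
     {(g, g'). g \<in> trivializations p k X \<and> g' \<in> trivializations p k X \<and>
               HT_iso p k X X id_mor g g'}"

text \<open>For \<open>h\<close> from \<open>X'\<close> to \<open>X\<close> and global sections \<open>g\<close> of $X^{\mathrm{HT}}$ and \<open>g'\<close> of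
  $X'^{\mathrm{HT}}$, the pullback of \<open>g\<close> to \<open>X'\<close> and the composite of \<open>g'\<close> with \<open>h\<close> are isomorphic
  objects of $X^{\mathrm{HT}}(X')$: an isomorphism is a family of homotopies between
  $\mathcal{O}_X(U) \to W(\mathcal{O}_X(V))/p \to W(\mathcal{O}_{X'}(V'))/p$ and
  $\mathcal{O}_X(U) \to \mathcal{O}_{X'}(U') \to W(\mathcal{O}_{X'}(V'))/p$.\<close>

definition compatible_trivializations ::
    "nat \<Rightarrow> 'k ring \<Rightarrow> ('x, 'r, 'k) scheme_over \<Rightarrow> ('x', 'r', 'k) scheme_over \<Rightarrow>
     ('x', 'r', 'x, 'r) mor \<Rightarrow>
     ('x, 'r, 'k) trivialization \<Rightarrow> ('x', 'r', 'k) trivialization \<Rightarrow> bool" where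
  "compatible_trivializations p k X X' h g g' \<longleftrightarrow>
     (\<exists>\<rho>.
       (\<forall>(U, V)\<in>HT_index X X id_mor. \<forall>(U', V')\<in>HT_index X' X' id_mor.
          U' \<subseteq> preim X' h U \<and> V' \<subseteq> preim X' h V \<longrightarrow>
          butterfly_map (witt p k) (witt p (Sh X V))
            (\<lambda>s. Res X' (preim X' h U) U' (sec h U s))
            (witt_map (\<lambda>s. Res X' (preim X' h V) V' (sec h V s)))
            (ht_bf g U V) (ht_bf g' U' V') (\<rho> U V U' V')) \<and>
       (\<forall>(U, V)\<in>HT_index X X id_mor. \<forall>(U1, V1)\<in>HT_index X X id_mor.
        \<forall>(U', V')\<in>HT_index X' X' id_mor. \<forall>(U1', V1')\<in>HT_index X' X' id_mor.
          U1 \<subseteq> U \<and> V1 \<subseteq> V \<and> U1' \<subseteq> U' \<and> V1' \<subseteq> V' \<and>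
          U' \<subseteq> preim X' h U \<and> V' \<subseteq> preim X' h V \<and>
          U1' \<subseteq> preim X' h U1 \<and> V1' \<subseteq> preim X' h V1 \<longrightarrow>
          (\<forall>e\<in>carrier (ht_bf g U V).
             \<rho> U1 V1 U1' V1' (ht_res g U V U1 V1 e) =
             ht_res g' U' V' U1' V1' (\<rho> U V U' V' e))))"


section \<open>Frobenius liftings\<close>

definition frob_mor :: "nat \<Rightarrow> ('x, 'r, 'z) ringed_space_scheme \<Rightarrow> ('x, 'r, 'x, 'r) mor" where
  "frob_mor p X = \<lparr>pt = (\<lambda>x. x), sec = (\<lambda>U s. s [^]\<^bsub>Sh X U\<^esub> p)\<rparr>"

text \<open>A lifting has the same points as \<open>X\<close>, and, being flat, its sections over an open set \<open>U\<close> inject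
  into $\mathcal{O}(U) \times \mathcal{O}(U)$. Hence every isomorphism class of liftings is represented by
  one with points of type \<open>'x\<close> and sections of type \<open>'r \<times> 'r\<close>.\<close>

record ('x, 'r, 'k) frob_lift =
  Lift :: "('x, 'r \<times> 'r, 'k \<times> 'k) scheme_over"
  Emb :: "('x, 'r, 'x, 'r \<times> 'r) mor"
  Phi :: "('x, 'r \<times> 'r, 'x, 'r \<times> 'r) mor"

text \<open>\<open>Emb\<close> identifies \<open>X\<close> with the base change of \<open>Lift\<close> to $k = W_2(k)/p$.\<close>

definition frob_lifts ::
    "nat \<Rightarrow> 'k ring \<Rightarrow> ('x, 'r, 'k) scheme_over \<Rightarrow> ('x, 'r, 'k) frob_lift set" where
  "frob_lifts p k X = {L.
     smooth_over (witt2 p k) (Lift L) \<and>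
     is_mor_over (witt2 p k) fst X (Lift L) (Emb L) \<and>
     homeomorphic_map (Top X) (Top (Lift L)) (pt (Emb L)) \<and>
     (\<forall>V. affine_open (Lift L) V \<longrightarrow>
        sec (Emb L) V ` carrier (Sh (Lift L) V) = carrier (Sh X (preim X (Emb L) V)) \<and>
        {s \<in> carrier (Sh (Lift L) V). sec (Emb L) V s = \<zero>\<^bsub>Sh X (preim X (Emb L) V)\<^esub>} =
          (\<lambda>s. [p] \<cdot>\<^bsub>Sh (Lift L) V\<^esub> s) ` carrier (Sh (Lift L) V)) \<and>
     is_mor_over (witt2 p k) (witt2_frob p k) (Lift L) (Lift L) (Phi L) \<and>
     mor_eq X (Lift L) (comp_mor (Lift L) (Phi L) (Emb L)) (comp_mor X (Emb L) (frob_mor p X))}"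

text \<open>A morphism of Frobenius liftings over \<open>h\<close> from \<open>X'\<close> to \<open>X\<close>.\<close>

definition is_frob_lift_mor ::
    "nat \<Rightarrow> 'k ring \<Rightarrow> ('x, 'r, 'k) scheme_over \<Rightarrow> ('x', 'r', 'k) scheme_over \<Rightarrow>
     ('x', 'r', 'x, 'r) mor \<Rightarrow> ('x, 'r, 'k) frob_lift \<Rightarrow> ('x', 'r', 'k) frob_lift \<Rightarrow>
     ('x', 'r' \<times> 'r', 'x, 'r \<times> 'r) mor \<Rightarrow> bool" where
  "is_frob_lift_mor p k X X' h L L' u \<longleftrightarrow>
     is_mor_over (witt2 p k) (\<lambda>a. a) (Lift L') (Lift L) u \<and>
     mor_eq X' (Lift L) (comp_mor (Lift L') u (Emb L')) (comp_mor X (Emb L) h) \<and>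
     mor_eq (Lift L') (Lift L) (comp_mor (Lift L) (Phi L) u) (comp_mor (Lift L') u (Phi L'))"

definition frob_lift_rel ::
    "nat \<Rightarrow> 'k ring \<Rightarrow> ('x, 'r, 'k) scheme_over \<Rightarrow> ('x, 'r, 'k) frob_lift rel" where
  "frob_lift_rel p k X =
     {(L, L'). L \<in> frob_lifts p k X \<and> L' \<in> frob_lifts p k X \<and>
        (\<exists>u v. is_frob_lift_mor p k X X id_mor L L' u \<and> is_frob_lift_mor p k X X id_mor L' L v \<and>
           mor_eq (Lift L') (Lift L') (comp_mor (Lift L) v u) id_mor \<and>
           mor_eq (Lift L) (Lift L) (comp_mor (Lift L') u v) id_mor)}"


section \<open>Canonical maps\<close>

text \<open>A family of maps, one for every smooth variety over \<open>k\<close>, from equivalence classes of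
  trivializations to isomorphism classes of Frobenius liftings is canonical if it is functorial: whenever
  a morphism \<open>h\<close> carries one trivialization to another, it lifts to a morphism between the associated
  Frobenius liftings.\<close>

definition canonical_map ::
    "nat \<Rightarrow> 'k ring \<Rightarrow>
     (('x, 'r, 'k) scheme_over \<Rightarrow> ('x, 'r, 'k) trivialization set \<Rightarrow> ('x, 'r, 'k) frob_lift set) \<Rightarrow>
     bool" where
  "canonical_map p k \<Phi> \<longleftrightarrow>
     (\<forall>X X' h. smooth_variety k X \<and> smooth_variety k X' \<and> is_mor_over k (\<lambda>a. a) X' X h \<longrightarrow>
        (\<forall>g\<in>trivializations p k X. \<forall>g'\<in>trivializations p k X'.
           compatible_trivializations p k X X' h g g' \<longrightarrow>
           (\<forall>L\<in>\<Phi> X (trivialization_rel p k X `` {g}).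
            \<forall>L'\<in>\<Phi> X' (trivialization_rel p k X' `` {g'}).
              \<exists>u. is_frob_lift_mor p k X X' h L L' u)))"

end

theory Submission
  imports Defs "HOL-Algebra.UnivPoly" "HOL-Algebra.Weak_Morphisms"
begin

text \<open>Let \<open>E\<close> be the butterfly over an affine open set with ring $A$, an extension of $A$ by
  $W(A)$. The copy of $V W(A)$ in \<open>E\<close> is an ideal, and the quotient $\widetilde A$ by it is an extension
  of $A$ by $W(A)/V W(A) = A$ in which the kernel is $p \widetilde A$: a flat lifting of $A$. In every such
  lifting $(a_0, a_1) \mapsto \tilde a_0^p + p \tilde a_1$ is a well defined ring map $\theta$ from $W_2(A)$.
  Composing $\theta$ with the target map of the butterfly and truncation gives a lift of Frobenius
  $\widetilde A \to \widetilde A$, and composing it with the inverse Frobenius of $W_2(k)$ gives the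
  $W_2(k)$-structure. All this is natural, so it glues over the affine open sets and is functorial in
  compatible morphisms of trivializations.\<close>

section \<open>Witt vectors of length two\<close>

text \<open>In a butterfly \<open>p e = incl (tgt e)\<close>, and modulo the copy of $V W(A)$ this
  depends only on the zeroth component of \<open>tgt e\<close>. The lifting condition says that this
  component is \<open>src e\<close>, so multiplication by $p$ induces the identity of $A$ onto the
  kernel: this is where flatness comes from. The target map descends to the quotient because $p V$
  vanishes in $W_2(A)$ when $p = 0$ in $A$. Three obstacles shape the development. The ring axioms
  are proved for $W_2$ only; full Witt vectors are reached through truncation or through differences
  formed inside the butterfly. Reduction is onto over affine open sets but need not be so over
  others, hence extensions with and without surjectivity are kept apart. A Frobenius lifting must be
  tested on every affine open set of the lifted scheme, which is not known to be affine downstairs;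
  there surjectivity comes from a partition-of-unity argument. Separatedness enters when morphisms
  are glued, through intersections of affine sets.\<close>

lemma wpoly_induct [case_names single add]:
  fixes P :: "'a \<Rightarrow>\<^sub>0 'b::comm_monoid_add"
  assumes "\<And>m c. Q (Poly_Mapping.single m c)" "\<And>P P'. Q P \<Longrightarrow> Q P' \<Longrightarrow> Q (P + P')"
  shows "Q P"
proof -
  have eq: "P = (\<Sum>m\<in>Poly_Mapping.keys P. Poly_Mapping.single m (Poly_Mapping.lookup P m))"
    by (rule poly_mapping_eqI)
      (simp add: lookup_sum lookup_single when_def sum.delta in_keys_iff)
  have "Q (\<Sum>m\<in>S. Poly_Mapping.single m (Poly_Mapping.lookup P m))" if "finite S" for S
    using that
  proof (induction S)
    case empty
    have "Q (Poly_Mapping.single undefined 0)" by (rule assms(1))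
    then show ?case by simp
  next
    case (insert x F)
    then show ?case by (simp add: assms)
  qed
  then show ?thesis using eq by (metis finite_keys)
qed

definition wmono :: "('a, 'm) ring_scheme \<Rightarrow> (nat \<Rightarrow> 'a) \<Rightarrow> (nat \<Rightarrow> 'a) \<Rightarrow> ((bool \<times> nat) \<Rightarrow>\<^sub>0 nat) \<Rightarrow> 'a" where
  "wmono B a b m = (\<Otimes>\<^bsub>B\<^esub>v\<in>Poly_Mapping.keys m.
           (if fst v then b (snd v) else a (snd v)) [^]\<^bsub>B\<^esub> Poly_Mapping.lookup m v)"

context cring
begin

lemma add_pow_int_0 [simp]: "add_pow R (0::int) x = \<zero>"
  by (simp add: add_pow_int_ge)

text \<open>Outside the support the exponent is 0 and the factor is one. This allows two monomials
  with different supports to be compared over a common index set.\<close>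

lemma wmono_superset:
  assumes ab: "\<forall>n. a n \<in> carrier R" "\<forall>n. b n \<in> carrier R"
    and S: "finite S" "Poly_Mapping.keys m \<subseteq> S"
  shows "wmono R a b m =
    (\<Otimes>v\<in>S. (if fst v then b (snd v) else a (snd v)) [^] Poly_Mapping.lookup m v)"
  unfolding wmono_def
  by (rule finprod_mono_neutral_cong_left) (use ab S in \<open>auto simp: in_keys_iff\<close>)

lemma wmono_closed [simp]:
  assumes "\<forall>n. a n \<in> carrier R" "\<forall>n. b n \<in> carrier R"
  shows "wmono R a b m \<in> carrier R"
  unfolding wmono_def using assms by (auto intro!: finprod_closed)

lemma wmono_add:
  assumes ab: "\<forall>n. a n \<in> carrier R" "\<forall>n. b n \<in> carrier R"
  shows "wmono R a b (m + m') = wmono R a b m \<otimes> wmono R a b m'"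
proof -
  let ?S = "Poly_Mapping.keys m \<union> Poly_Mapping.keys m'"
  have c: "(if fst v then b (snd v) else a (snd v)) \<in> carrier R" for v using ab by auto
  have "wmono R a b (m + m') = (\<Otimes>v\<in>?S. (if fst v then b (snd v) else a (snd v)) [^] Poly_Mapping.lookup (m + m') v)"
    by (rule wmono_superset[OF ab]) (use Poly_Mapping.keys_add[of m m'] in auto)
  also have "\<dots> = (\<Otimes>v\<in>?S. (if fst v then b (snd v) else a (snd v)) [^] Poly_Mapping.lookup m v \<otimes>
     (if fst v then b (snd v) else a (snd v)) [^] Poly_Mapping.lookup m' v)"
    by (rule finprod_cong') (use c ab in \<open>auto simp: lookup_add nat_pow_mult\<close>)
  also have "\<dots> = wmono R a b m \<otimes> wmono R a b m'"
    by (subst finprod_multf)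
      (use c ab in \<open>auto simp: wmono_superset[of a b ?S m] wmono_superset[of a b ?S m']\<close>)
  finally show ?thesis .
qed

lemma wpoly_eval_superset:
  assumes ab: "\<forall>n. a n \<in> carrier R" "\<forall>n. b n \<in> carrier R"
    and S: "finite S" "Poly_Mapping.keys P \<subseteq> S"
  shows "wpoly_eval R P a b = (\<Oplus>m\<in>S. [Poly_Mapping.lookup P m] \<cdot> wmono R a b m)"
  unfolding wpoly_eval_def wmono_def[symmetric]
  by (rule add.finprod_mono_neutral_cong_left) (use ab S in \<open>auto simp: in_keys_iff add.int_pow_closed\<close>)

lemma wpoly_eval_closed [simp]:
  assumes "\<forall>n. a n \<in> carrier R" "\<forall>n. b n \<in> carrier R"
  shows "wpoly_eval R P a b \<in> carrier R"
  unfolding wpoly_eval_def wmono_def[symmetric] using assms by (auto intro!: finsum_closed simp: add.int_pow_closed)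

lemma wpoly_eval_add:
  assumes ab: "\<forall>n. a n \<in> carrier R" "\<forall>n. b n \<in> carrier R"
  shows "wpoly_eval R (P + Q) a b = wpoly_eval R P a b \<oplus> wpoly_eval R Q a b"
proof -
  let ?S = "Poly_Mapping.keys P \<union> Poly_Mapping.keys Q"
  have "wpoly_eval R (P + Q) a b = (\<Oplus>m\<in>?S. [Poly_Mapping.lookup (P + Q) m] \<cdot> wmono R a b m)"
    by (rule wpoly_eval_superset[OF ab]) (use Poly_Mapping.keys_add[of P Q] in auto)
  also have "\<dots> = (\<Oplus>m\<in>?S. [Poly_Mapping.lookup P m] \<cdot> wmono R a b m \<oplus> [Poly_Mapping.lookup Q m] \<cdot> wmono R a b m)"
    by (rule add.finprod_cong') (use ab in \<open>auto simp: lookup_add add.int_pow_mult add.int_pow_closed\<close>)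
  also have "\<dots> = wpoly_eval R P a b \<oplus> wpoly_eval R Q a b"
    by (subst finsum_addf)
      (use ab in \<open>auto simp: wpoly_eval_superset[of a b ?S P] wpoly_eval_superset[of a b ?S Q] add.int_pow_closed\<close>)
  finally show ?thesis .
qed

lemma wpoly_eval_single:
  assumes ab: "\<forall>n. a n \<in> carrier R" "\<forall>n. b n \<in> carrier R"
  shows "wpoly_eval R (Poly_Mapping.single m c) a b = [c] \<cdot> wmono R a b m"
  by (subst wpoly_eval_superset[OF ab, of "{m}"]) (use ab in \<open>auto simp: add.int_pow_closed\<close>)

lemma wmono_0 [simp]: "wmono R a b 0 = \<one>" by (simp add: wmono_def)

lemma wpoly_eval_0 [simp]: "wpoly_eval R 0 a b = \<zero>" by (simp add: wpoly_eval_def)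

lemma add_pow_int_mult:
  assumes "x \<in> carrier R" "y \<in> carrier R"
  shows "[(i::int)] \<cdot> x \<otimes> [(j::int)] \<cdot> y = [(i * j)] \<cdot> (x \<otimes> y)"
  using assms by (simp add: add_pow_ldistr_int add_pow_rdistr_int add.int_pow_pow add.int_pow_closed mult.commute)

text \<open>Both arguments are reduced to single monomials, where exponents add and coefficients
  multiply. Evaluation is thereby a ring homomorphism, so identities between Witt polynomials proved
  once over the integers hold in every commutative ring.\<close>

lemma wpoly_eval_mult:
  assumes ab: "\<forall>n. a n \<in> carrier R" "\<forall>n. b n \<in> carrier R"
  shows "wpoly_eval R (P * Q) a b = wpoly_eval R P a b \<otimes> wpoly_eval R Q a b"
proof (induction P rule: wpoly_induct)
  case (single m c)
  show ?case
  proof (induction Q rule: wpoly_induct)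
    case (single m' c')
    then show ?case using ab by (simp add: mult_single wpoly_eval_single wmono_add add_pow_int_mult)
  next
    case (add P P')
    then show ?case using ab by (simp add: distrib_left wpoly_eval_add r_distr)
  qed
next
  case (add P P')
  then show ?case using ab by (simp add: distrib_right wpoly_eval_add l_distr)
qed

lemma wpoly_eval_of_int:
  assumes ab: "\<forall>n. a n \<in> carrier R" "\<forall>n. b n \<in> carrier R"
  shows "wpoly_eval R (of_int c) a b = [c] \<cdot> \<one>"
proof -
  have "(of_int c :: wpoly) = Poly_Mapping.single 0 c"
    by (metis of_int_eq_id id_apply single_of_int)
  then show ?thesis using wpoly_eval_single[OF ab, of 0 c] by simp
qed

lemma wpoly_eval_1:
  assumes ab: "\<forall>n. a n \<in> carrier R" "\<forall>n. b n \<in> carrier R"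
  shows "wpoly_eval R 1 a b = \<one>"
  using wpoly_eval_of_int[OF ab, of 1] by simp

lemma wpoly_eval_power:
  assumes ab: "\<forall>n. a n \<in> carrier R" "\<forall>n. b n \<in> carrier R"
  shows "wpoly_eval R (P ^ n) a b = wpoly_eval R P a b [^] n"
  by (induction n) (use ab in \<open>simp_all add: wpoly_eval_1 wpoly_eval_mult nat_pow_Suc2 m_comm\<close>)

lemma wpoly_eval_sum:
  assumes ab: "\<forall>n. a n \<in> carrier R" "\<forall>n. b n \<in> carrier R" and "finite S"
  shows "wpoly_eval R (\<Sum>i\<in>S. f i) a b = (\<Oplus>i\<in>S. wpoly_eval R (f i) a b)"
  using assms(3) by (induction S) (use ab in \<open>simp_all add: wpoly_eval_add\<close>)

lemma wpoly_eval_wvar: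
  assumes ab: "\<forall>n. a n \<in> carrier R" "\<forall>n. b n \<in> carrier R"
  shows "wpoly_eval R (wvar v) a b = (if fst v then b (snd v) else a (snd v))"
  using ab by (auto simp: wvar_def wpoly_eval_single wmono_def)

end

section \<open>The Witt polynomials of index 0 and 1\<close>

text \<open>The coefficients of $(x^p + y^p - (x+y)^p)/p$, the correction term in the second
  component of a sum of Witt vectors. For a prime $p$ and $0 < i < p$ the division is exact.\<close>

definition wcoef :: "nat \<Rightarrow> nat \<Rightarrow> int" where
  "wcoef p i = - int ((p choose i) div p)"

definition wcorr :: "nat \<Rightarrow> 'a::comm_ring_1 \<Rightarrow> 'a \<Rightarrow> 'a" where
  "wcorr p x y = (\<Sum>i\<in>{1..<p}. of_int (wcoef p i) * (x ^ i * y ^ (p - i)))"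

lemma of_nat_mult_wcorr:
  assumes "prime p"
  shows "of_nat p * wcorr p x y = x ^ p + y ^ p - (x + y) ^ p"
proof -
  have p: "p > 1" using assms prime_gt_1_nat by blast
  have "(x + y) ^ p = (\<Sum>i\<le>p. of_nat (p choose i) * x ^ i * y ^ (p - i))"
    by (rule binomial_ring)
  also have "{..p} = insert 0 (insert p {1..<p})" using p by auto
  also have "(\<Sum>i\<in>insert 0 (insert p {1..<p}). of_nat (p choose i) * x ^ i * y ^ (p - i)) =
     y ^ p + x ^ p + (\<Sum>i\<in>{1..<p}. of_nat (p choose i) * x ^ i * y ^ (p - i))"
    using p by (simp add: add.assoc)
  also have "(\<Sum>i\<in>{1..<p}. of_nat (p choose i) * x ^ i * y ^ (p - i)) = - (of_nat p * wcorr p x y)"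
    unfolding wcorr_def sum_distrib_left sum_negf[symmetric]
  proof (rule sum.cong)
    fix i assume i: "i \<in> {1..<p}"
    then have "p dvd (p choose i)" using assms by (intro dvd_choose_prime) auto
    then have "(of_nat (p choose i) :: 'a) = of_nat p * of_nat ((p choose i) div p)"
      by (metis dvd_mult_div_cancel of_nat_mult)
    then show "of_nat (p choose i) * x ^ i * y ^ (p - i) = - (of_nat p * (of_int (wcoef p i) * (x ^ i * y ^ (p - i))))"
      by (simp add: wcoef_def mult.assoc)
  qed simp
  finally show ?thesis by simp
qed

lemma wpoly_of_nat_mult: "Poly_Mapping.lookup (of_nat n * P :: wpoly) m = int n * Poly_Mapping.lookup P m"
  by (induction n) (auto simp: lookup_add distrib_right)

text \<open>Coefficients are integers, so dividing an exact multiple recovers the polynomial. This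
  evaluates the division in \<open>witt_solve\<close> and also shows that polynomials have no
  torsion.\<close>

lemma wpoly_map_div:
  assumes "n > 0"
  shows "Poly_Mapping.map (\<lambda>c. c div int n) (of_nat n * P :: wpoly) = P"
  by (rule poly_mapping_eqI) (use assms in \<open>simp add: Poly_Mapping.map.rep_eq wpoly_of_nat_mult when_def\<close>)

lemma wpoly_of_nat_cancel:
  assumes "n > 0" "of_nat n * P = of_nat n * (Q :: wpoly)"
  shows "P = Q"
  using assms wpoly_map_div by metis

declare witt_solve.simps [simp del]

lemma ghost_0: "ghost p b 0 = wvar (b, 0)"
  and ghost_1: "ghost p b 1 = wvar (b, 0) ^ p + of_nat p * wvar (b, 1)"
  by (simp_all add: ghost_def)

lemma witt_solve_0: "witt_solve p G 0 = G 0"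
  using wpoly_map_div[of 1 "G 0"] by (simp add: witt_solve.simps[of p G 0])

text \<open>At index 1 the sum over smaller indices has the single term $i = 0$, which is the $p$-th
  power of $G_0$.\<close>

lemma witt_solve_1:
  assumes "p > 0" "G 1 - G 0 ^ p = of_nat p * P"
  shows "witt_solve p G 1 = P"
  using wpoly_map_div[of p P] assms by (simp add: witt_solve.simps[of p G "Suc 0"] witt_solve_0)

lemma witt_add_poly_0: "witt_add_poly p 0 = wvar (False, 0) + wvar (True, 0)"
  by (simp add: witt_add_poly_def witt_solve_0 ghost_0)

lemma witt_mult_poly_0: "witt_mult_poly p 0 = wvar (False, 0) * wvar (True, 0)"
  by (simp add: witt_mult_poly_def witt_solve_0 ghost_0)

lemma witt_add_poly_1:
  assumes "prime p"
  shows "witt_add_poly p 1 =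
    wvar (False, 1) + wvar (True, 1) + wcorr p (wvar (False, 0)) (wvar (True, 0))"
  unfolding witt_add_poly_def
  by (rule witt_solve_1)
    (use assms in \<open>auto simp: ghost_0 ghost_1[unfolded One_nat_def] distrib_left of_nat_mult_wcorr prime_gt_0_nat\<close>)

lemma witt_mult_poly_1:
  assumes "prime p"
  shows "witt_mult_poly p 1 =
    wvar (False, 0) ^ p * wvar (True, 1) + wvar (False, 1) * wvar (True, 0) ^ p +
    of_nat p * (wvar (False, 1) * wvar (True, 1))"
  unfolding witt_mult_poly_def
  by (rule witt_solve_1)
    (use assms in \<open>auto simp: ghost_0 ghost_1[unfolded One_nat_def] algebra_simps power_mult_distrib prime_gt_0_nat\<close>)

text \<open>Of the higher addition polynomials only the vanishing of the constant terms is needed: it makes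
  $0 + 0 = 0$ in the Witt vectors, hence additive maps from them preserve $0$.\<close>

lemma lookup_mult_0: "Poly_Mapping.lookup (P * Q :: wpoly) 0 = Poly_Mapping.lookup P 0 * Poly_Mapping.lookup Q 0"
proof (induction P rule: wpoly_induct)
  case (single m c)
  show ?case
  proof (induction Q rule: wpoly_induct)
    case (single m' c')
    have "m + m' = 0 \<longleftrightarrow> m = 0 \<and> m' = 0"
      by (metis (mono_tags) add_eq_0_iff_both_eq_0 lookup_add lookup_zero poly_mapping_eqI add.right_neutral)
    then show ?case by (auto simp: mult_single lookup_single when_def)
  next
    case (add P P')
    then show ?case by (simp add: distrib_left lookup_add)
  qed
next
  case (add P P')
  then show ?case by (simp add: distrib_right lookup_add)
qed

lemma lookup_power_0: "n > 0 \<Longrightarrow> Poly_Mapping.lookup P 0 = 0 \<Longrightarrow> Poly_Mapping.lookup (P ^ n :: wpoly) 0 = 0"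
  by (cases n) (auto simp: lookup_mult_0)

lemma wvar_const: "Poly_Mapping.lookup (wvar v) 0 = 0"
proof -
  have "Poly_Mapping.single v (1::nat) \<noteq> 0" by (metis lookup_single_eq lookup_zero zero_neq_one)
  then show ?thesis by (simp add: wvar_def lookup_single_not_eq)
qed

lemma ghost_const: "p > 0 \<Longrightarrow> Poly_Mapping.lookup (ghost p b n) 0 = 0"
  unfolding ghost_def lookup_sum wpoly_of_nat_mult
  by (intro sum.neutral) (simp add: lookup_power_0 wvar_const)

lemma witt_add_poly_const:
  assumes "p > 0"
  shows "Poly_Mapping.lookup (witt_add_poly p n) 0 = 0"
  unfolding witt_add_poly_def
proof (induction n rule: less_induct)
  case (less n)
  let ?G = "\<lambda>n. ghost p False n + ghost p True n"
  \<comment> \<open>The index list is generalized to any list of numbers below \<open>n\<close>, so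
    that list induction applies. Each exponent \<open>p ^ (n - i)\<close> is positive, hence the
    powers keep a zero constant term.\<close>
  have "Poly_Mapping.lookup (\<Sum>i\<leftarrow>xs. of_nat (p ^ i) * witt_solve p ?G i ^ (p ^ (n - i))) 0 = 0"
    if "set xs \<subseteq> {..<n}" for xs
    using that
  proof (induction xs)
    case (Cons i xs)
    then have "Poly_Mapping.lookup (witt_solve p ?G i ^ (p ^ (n - i))) 0 = 0"
      using less assms by (intro lookup_power_0) auto
    with Cons show ?case by (simp add: lookup_add lookup_mult_0)
  qed simp
  from this[of "[0..<n]"] show ?case
    by (simp add: witt_solve.simps[of p ?G n] Poly_Mapping.map.rep_eq lookup_minus lookup_add ghost_const assms atLeast0LessThan)
qed

text \<open>Counterpart of \<open>wcorr\<close> for a ring given by its carrier;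
  \<open>wcorr\<close> itself belongs to a type class and serves for the polynomials. Evaluation
  carries one to the other (\<open>wpoly_eval_wcorr\<close>).\<close>

definition (in cring) ring_wcorr :: "nat \<Rightarrow> 'a \<Rightarrow> 'a \<Rightarrow> 'a" where
  "ring_wcorr p x y = (\<Oplus>i\<in>{1..<p}. add_pow R (wcoef p i) (x [^] i \<otimes> y [^] (p - i)))"

context cring
begin

lemma ring_wcorr_closed [simp]: "x \<in> carrier R \<Longrightarrow> y \<in> carrier R \<Longrightarrow> ring_wcorr p x y \<in> carrier R"
  unfolding ring_wcorr_def by (auto intro!: finsum_closed simp: add.int_pow_closed)

lemma wpoly_eval_wcorr:
  assumes ab: "\<forall>n. a n \<in> carrier R" "\<forall>n. b n \<in> carrier R"
  shows "wpoly_eval R (wcorr p P Q) a b = ring_wcorr p (wpoly_eval R P a b) (wpoly_eval R Q a b)"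
  unfolding wcorr_def ring_wcorr_def
  using ab by (auto simp: wpoly_eval_sum wpoly_eval_mult wpoly_eval_of_int wpoly_eval_power
       add_pow_ldistr_int intro!: add.finprod_cong')

lemma keys_eq_empty_aux: "Poly_Mapping.keys m = {} \<Longrightarrow> m = 0"
  by (rule poly_mapping_eqI) (auto simp: in_keys_iff)

text \<open>Every monomial that occurs contains some variable, and splitting off one occurrence of
  it leaves a factor zero.\<close>

lemma wpoly_eval_const0:
  assumes "Poly_Mapping.lookup P 0 = 0"
  shows "wpoly_eval R P (\<lambda>_. \<zero>) (\<lambda>_. \<zero>) = \<zero>"
proof -
  have "wmono R (\<lambda>_. \<zero>) (\<lambda>_. \<zero>) m = \<zero>" if "m \<in> Poly_Mapping.keys P" for m
  proof -
    have "m \<noteq> 0" using that assms by (auto simp: in_keys_iff)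
    then obtain v where v: "v \<in> Poly_Mapping.keys m"
      by (metis equals0I keys_eq_empty_aux)
    have "wmono R (\<lambda>_. \<zero>) (\<lambda>_. \<zero>) m = wmono R (\<lambda>_. \<zero>) (\<lambda>_. \<zero>) ((m - Poly_Mapping.single v 1) + Poly_Mapping.single v 1)"
      by (rule arg_cong[where f="wmono R _ _"], rule poly_mapping_eqI)
         (use v in \<open>auto simp: lookup_add lookup_minus lookup_single when_def in_keys_iff\<close>)
    also have "\<dots> = wmono R (\<lambda>_. \<zero>) (\<lambda>_. \<zero>) (m - Poly_Mapping.single v 1) \<otimes> \<zero>"
      by (subst wmono_add) (auto simp: wmono_def)
    finally show ?thesis by simp
  qed
  then have "(\<Oplus>m\<in>Poly_Mapping.keys P. [Poly_Mapping.lookup P m] \<cdot> wmono R (\<lambda>_. \<zero>) (\<lambda>_. \<zero>) m) = \<zero>"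
    by (intro add.finprod_one_eqI) (simp add: add.int_pow_one)
  then show ?thesis
    using wpoly_eval_superset[of "\<lambda>_. \<zero>" "\<lambda>_. \<zero>" "Poly_Mapping.keys P" P] by simp
qed

end

section \<open>Ring identities in $W_2$ by reduction to the universal case\<close>

type_synonym wpair = "wpoly \<times> wpoly"

text \<open>Witt vectors of length two over the polynomial ring, with the addition polynomial of
  index 1 written out. Elements of an arbitrary $W_2(R)$ arise from these by evaluation.\<close>

definition wpair_add :: "nat \<Rightarrow> wpair \<Rightarrow> wpair \<Rightarrow> wpair" where
  "wpair_add p x y = (fst x + fst y, snd x + snd y + wcorr p (fst x) (fst y))"

definition wpair_mult :: "nat \<Rightarrow> wpair \<Rightarrow> wpair \<Rightarrow> wpair" where
  "wpair_mult p x y = (fst x * fst y, fst x ^ p * snd y + snd x * fst y ^ p + of_nat p * (snd x * snd y))"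

text \<open>The ghost component of index 1. It turns both operations into the ordinary ones of the
  polynomial ring and, as there is no $p$-torsion, determines a pair together with its first
  entry.\<close>

definition wpair_ghost :: "nat \<Rightarrow> wpair \<Rightarrow> wpoly" where
  "wpair_ghost p x = fst x ^ p + of_nat p * snd x"

lemma wpair_ghost_wpair_add: "prime p \<Longrightarrow> wpair_ghost p (wpair_add p x y) = wpair_ghost p x + wpair_ghost p y"
  by (simp add: wpair_ghost_def wpair_add_def distrib_left of_nat_mult_wcorr)

lemma wpair_ghost_wpair_mult: "wpair_ghost p (wpair_mult p x y) = wpair_ghost p x * wpair_ghost p y"
  by (simp add: wpair_ghost_def wpair_mult_def power_mult_distrib distrib_left distrib_right mult.assoc mult.left_commute)

lemma fst_wpair_add [simp]: "fst (wpair_add p x y) = fst x + fst y"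
  and fst_wpair_mult [simp]: "fst (wpair_mult p x y) = fst x * fst y"
  by (simp_all add: wpair_add_def wpair_mult_def)

lemma wpair_eqI:
  assumes "prime p" "fst x = fst y" "wpair_ghost p x = wpair_ghost p y"
  shows "x = y"
proof -
  have "of_nat p * snd x = of_nat p * snd y" using assms by (simp add: wpair_ghost_def)
  then have "snd x = snd y" by (rule wpoly_of_nat_cancel[OF prime_gt_0_nat[OF assms(1)]])
  with assms show ?thesis by (simp add: prod_eq_iff)
qed

text \<open>Each identity holds for first entries and for ghost components, where it is an identity
  of commutative rings.\<close>

lemma wpair_add_assoc: "prime p \<Longrightarrow> wpair_add p (wpair_add p x y) z = wpair_add p x (wpair_add p y z)"
  and wpair_add_commute: "prime p \<Longrightarrow> wpair_add p x y = wpair_add p y x"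
  and wpair_mult_assoc: "prime p \<Longrightarrow> wpair_mult p (wpair_mult p x y) z = wpair_mult p x (wpair_mult p y z)"
  and wpair_mult_commute: "prime p \<Longrightarrow> wpair_mult p x y = wpair_mult p y x"
  and wpair_mult_wpair_add: "prime p \<Longrightarrow> wpair_mult p (wpair_add p x y) z = wpair_add p (wpair_mult p x z) (wpair_mult p y z)"
  by (rule wpair_eqI[of p]; simp add: wpair_ghost_wpair_add wpair_ghost_wpair_mult algebra_simps)+

lemma carrier_witt2 [simp]: "carrier (witt2 p B) = carrier B \<times> carrier B"
  and zero_witt2 [simp]: "\<zero>\<^bsub>witt2 p B\<^esub> = (\<zero>\<^bsub>B\<^esub>, \<zero>\<^bsub>B\<^esub>)"
  and one_witt2 [simp]: "\<one>\<^bsub>witt2 p B\<^esub> = (\<one>\<^bsub>B\<^esub>, \<zero>\<^bsub>B\<^esub>)"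
  by (simp_all add: witt2_def)

lemma carrier_witt: "carrier (witt p B) = {a. \<forall>n. a n \<in> carrier B}"
  and zero_witt: "\<zero>\<^bsub>witt p B\<^esub> = (\<lambda>n. \<zero>\<^bsub>B\<^esub>)"
  and one_witt: "\<one>\<^bsub>witt p B\<^esub> = (\<lambda>n. if n = 0 then \<one>\<^bsub>B\<^esub> else \<zero>\<^bsub>B\<^esub>)"
  by (simp_all add: witt_def)

definition wtrunc :: "(nat \<Rightarrow> 'a) \<Rightarrow> 'a \<times> 'a" where
  "wtrunc a = (a 0, a 1)"

context cring
begin

lemma wpoly_eval_add_poly_0:
  assumes "\<forall>n. a n \<in> carrier R" "\<forall>n. b n \<in> carrier R"
  shows "wpoly_eval R (witt_add_poly p 0) a b = a 0 \<oplus> b 0"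
    and "wpoly_eval R (witt_mult_poly p 0) a b = a 0 \<otimes> b 0"
  using assms by (simp_all add: witt_add_poly_0 witt_mult_poly_0 wpoly_eval_add wpoly_eval_mult wpoly_eval_wvar)

lemma wpoly_eval_of_nat:
  assumes "\<forall>n. a n \<in> carrier R" "\<forall>n. b n \<in> carrier R"
  shows "wpoly_eval R (of_nat n) a b = add_pow R n \<one>"
  using assms by (induction n) (simp_all add: wpoly_eval_add wpoly_eval_1 a_comm)

lemma wpoly_eval_poly_1:
  assumes "prime p" "\<forall>n. a n \<in> carrier R" "\<forall>n. b n \<in> carrier R"
  shows "wpoly_eval R (witt_add_poly p (Suc 0)) a b = a 1 \<oplus> b 1 \<oplus> ring_wcorr p (a 0) (b 0)"
    and "wpoly_eval R (witt_mult_poly p (Suc 0)) a b =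
      a 0 [^] p \<otimes> b 1 \<oplus> a 1 \<otimes> b 0 [^] p \<oplus> add_pow R p (a 1 \<otimes> b 1)"
  using assms by (simp_all add: witt_add_poly_1[unfolded One_nat_def] witt_mult_poly_1[unfolded One_nat_def] wpoly_eval_add
      wpoly_eval_mult wpoly_eval_wvar wpoly_eval_wcorr wpoly_eval_power wpoly_eval_of_nat add_pow_ldistr)

lemma witt2_add:
  assumes "prime p" "x \<in> carrier R \<times> carrier R" "y \<in> carrier R \<times> carrier R"
  shows "x \<oplus>\<^bsub>witt2 p R\<^esub> y = (fst x \<oplus> fst y, snd x \<oplus> snd y \<oplus> ring_wcorr p (fst x) (fst y))"
  using assms by (auto simp: witt2_def pad2_def wpoly_eval_add_poly_0 wpoly_eval_poly_1)

lemma witt2_mult: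
  assumes "prime p" "x \<in> carrier R \<times> carrier R" "y \<in> carrier R \<times> carrier R"
  shows "x \<otimes>\<^bsub>witt2 p R\<^esub> y = (fst x \<otimes> fst y,
    fst x [^] p \<otimes> snd y \<oplus> snd x \<otimes> fst y [^] p \<oplus> add_pow R p (snd x \<otimes> snd y))"
  using assms by (auto simp: witt2_def pad2_def wpoly_eval_add_poly_0 wpoly_eval_poly_1)

lemma witt_add_closed:
  assumes "a \<in> carrier (witt p R)" "b \<in> carrier (witt p R)"
  shows "a \<oplus>\<^bsub>witt p R\<^esub> b \<in> carrier (witt p R)" "a \<otimes>\<^bsub>witt p R\<^esub> b \<in> carrier (witt p R)"
  using assms by (simp_all add: witt_def)

lemma wtrunc_closed: "a \<in> carrier (witt p R) \<Longrightarrow> wtrunc a \<in> carrier (witt2 p R)"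
  by (simp add: carrier_witt wtrunc_def)

text \<open>The operations in degrees 0 and 1 involve only components of index 0 and 1, so
  truncation respects them. This is the passage from the full Witt vectors, whose ring axioms are
  not established, to $W_2$.\<close>

lemma wtrunc_add:
  assumes "prime p" "a \<in> carrier (witt p R)" "b \<in> carrier (witt p R)"
  shows "wtrunc (a \<oplus>\<^bsub>witt p R\<^esub> b) = wtrunc a \<oplus>\<^bsub>witt2 p R\<^esub> wtrunc b"
  using assms
  by (simp add: witt2_add wtrunc_def carrier_witt) (simp add: witt_def wpoly_eval_add_poly_0 wpoly_eval_poly_1)

lemma wtrunc_mult:
  assumes "prime p" "a \<in> carrier (witt p R)" "b \<in> carrier (witt p R)"
  shows "wtrunc (a \<otimes>\<^bsub>witt p R\<^esub> b) = wtrunc a \<otimes>\<^bsub>witt2 p R\<^esub> wtrunc b"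
  using assms
  by (simp add: witt2_mult wtrunc_def carrier_witt) (simp add: witt_def wpoly_eval_add_poly_0 wpoly_eval_poly_1)

lemma wtrunc_one: "wtrunc \<one>\<^bsub>witt p R\<^esub> = \<one>\<^bsub>witt2 p R\<^esub>"
  and wtrunc_zero: "wtrunc \<zero>\<^bsub>witt p R\<^esub> = \<zero>\<^bsub>witt2 p R\<^esub>"
  by (simp_all add: wtrunc_def witt_def)

text \<open>A single instance of the unit law for the full Witt vectors. It forces an additive map
  out of them into a ring to send zero to zero.\<close>

lemma witt_zero_add_zero:
  assumes "prime p"
  shows "\<zero>\<^bsub>witt p R\<^esub> \<oplus>\<^bsub>witt p R\<^esub> \<zero>\<^bsub>witt p R\<^esub> = \<zero>\<^bsub>witt p R\<^esub>"
  using assms by (simp add: witt_def wpoly_eval_const0 witt_add_poly_const prime_gt_0_nat)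

definition wpair_eval :: "(nat \<Rightarrow> 'a) \<Rightarrow> (nat \<Rightarrow> 'a) \<Rightarrow> wpair \<Rightarrow> 'a \<times> 'a" where
  "wpair_eval a b x = (wpoly_eval R (fst x) a b, wpoly_eval R (snd x) a b)"

lemma wpair_eval:
  assumes "prime p" and ab: "\<forall>n. a n \<in> carrier R" "\<forall>n. b n \<in> carrier R"
  shows "wpair_eval a b (wpair_add p x y) = wpair_eval a b x \<oplus>\<^bsub>witt2 p R\<^esub> wpair_eval a b y"
    and "wpair_eval a b (wpair_mult p x y) = wpair_eval a b x \<otimes>\<^bsub>witt2 p R\<^esub> wpair_eval a b y"
  using assms by (simp_all add: wpair_eval_def witt2_add witt2_mult wpair_add_def wpair_mult_def wpoly_eval_add
     wpoly_eval_mult wpoly_eval_wcorr wpoly_eval_power wpoly_eval_of_nat add_pow_ldistr)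

text \<open>The ring axioms have at most three arguments, hence need six independent variables,
  while the polynomials offer two sequences. The choice is $X_0, X_1$ for \<open>x\<close>, $Y_0,
  Y_1$ for \<open>y\<close> and $X_2, X_3$ for \<open>z\<close>.\<close>

lemma wpair_eval_surj:
  assumes "x \<in> carrier R \<times> carrier R" "y \<in> carrier R \<times> carrier R" "z \<in> carrier R \<times> carrier R"
  obtains a b u v w where "\<forall>n. a n \<in> carrier R" "\<forall>n. b n \<in> carrier R"
    "x = wpair_eval a b u" "y = wpair_eval a b v" "z = wpair_eval a b w"
proof -
  define a where "a = (\<lambda>n::nat. if n = 0 then fst x else if n = 1 then snd x else if n = 2 then fst z else snd z)"
  define b where "b = (\<lambda>n::nat. if n = 0 then fst y else snd y)"
  have ab: "\<forall>n. a n \<in> carrier R" "\<forall>n. b n \<in> carrier R"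
    using assms by (auto simp: a_def b_def)
  show thesis
    by (rule that[OF ab, of "(wvar (False, 0), wvar (False, 1))" "(wvar (True, 0), wvar (True, 1))"
          "(wvar (False, 2), wvar (False, 3))"])
      (use ab in \<open>simp_all add: wpair_eval_def wpoly_eval_wvar\<close>, simp_all add: a_def b_def)
qed

lemma witt2_cring:
  assumes p: "prime p"
  shows "cring (witt2 p R)"
proof (intro cringI abelian_groupI comm_monoidI)
  note s = witt2_add[OF p] witt2_mult[OF p]
  have wc0: "ring_wcorr p \<zero> x = \<zero>" if "x \<in> carrier R" for x
    unfolding ring_wcorr_def using that
    by (intro add.finprod_one_eqI) (auto simp: nat_pow_zero add.int_pow_one)
  fix x assume x: "x \<in> carrier (witt2 p R)"
  show "\<zero>\<^bsub>witt2 p R\<^esub> \<oplus>\<^bsub>witt2 p R\<^esub> x = x"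
    using x by (auto simp: s wc0)
  show "\<one>\<^bsub>witt2 p R\<^esub> \<otimes>\<^bsub>witt2 p R\<^esub> x = x"
    using x by (auto simp: s nat_pow_zero)
  \<comment> \<open>The second entry of the inverse also has to cancel the correction term of the
    sum of $-x_0$ and $x_0$.\<close>
  show "\<exists>y\<in>carrier (witt2 p R). y \<oplus>\<^bsub>witt2 p R\<^esub> x = \<zero>\<^bsub>witt2 p R\<^esub>"
    by (rule bexI[of _ "(\<ominus> fst x, \<ominus> snd x \<oplus> \<ominus> ring_wcorr p (\<ominus> fst x) (fst x))"])
      (use x in \<open>auto simp: s l_neg r_neg a_ac r_neg1 r_neg2\<close>)
  fix y assume y: "y \<in> carrier (witt2 p R)"
  show "x \<oplus>\<^bsub>witt2 p R\<^esub> y \<in> carrier (witt2 p R)" "x \<otimes>\<^bsub>witt2 p R\<^esub> y \<in> carrier (witt2 p R)"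
    using x y by (auto simp: s)
  obtain a b u v w where uv: "\<forall>n. a n \<in> carrier R" "\<forall>n. b n \<in> carrier R"
    "x = wpair_eval a b u" "y = wpair_eval a b v" "x = wpair_eval a b w"
    by (rule wpair_eval_surj[of x y x]) (use x y in simp_all)
  from uv(1-4) show "x \<oplus>\<^bsub>witt2 p R\<^esub> y = y \<oplus>\<^bsub>witt2 p R\<^esub> x" "x \<otimes>\<^bsub>witt2 p R\<^esub> y = y \<otimes>\<^bsub>witt2 p R\<^esub> x"
    by (simp_all add: wpair_eval[OF p, symmetric] wpair_add_commute[OF p, of u v] wpair_mult_commute[OF p, of u v])
  fix z assume z: "z \<in> carrier (witt2 p R)"
  obtain a b u v w where uv: "\<forall>n. a n \<in> carrier R" "\<forall>n. b n \<in> carrier R"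
    "x = wpair_eval a b u" "y = wpair_eval a b v" "z = wpair_eval a b w"
    by (rule wpair_eval_surj[of x y z]) (use x y z in simp_all)
  then show "x \<oplus>\<^bsub>witt2 p R\<^esub> y \<oplus>\<^bsub>witt2 p R\<^esub> z = x \<oplus>\<^bsub>witt2 p R\<^esub> (y \<oplus>\<^bsub>witt2 p R\<^esub> z)"
   "x \<otimes>\<^bsub>witt2 p R\<^esub> y \<otimes>\<^bsub>witt2 p R\<^esub> z = x \<otimes>\<^bsub>witt2 p R\<^esub> (y \<otimes>\<^bsub>witt2 p R\<^esub> z)"
   "(x \<oplus>\<^bsub>witt2 p R\<^esub> y) \<otimes>\<^bsub>witt2 p R\<^esub> z = x \<otimes>\<^bsub>witt2 p R\<^esub> z \<oplus>\<^bsub>witt2 p R\<^esub> y \<otimes>\<^bsub>witt2 p R\<^esub> z"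
    by (simp_all add: wpair_eval[OF p, symmetric] wpair_add_assoc[OF p] wpair_mult_assoc[OF p] wpair_mult_wpair_add[OF p])
qed (use assms in \<open>auto simp: witt2_mult witt2_add\<close>)

fun wpair_multiple :: "nat \<Rightarrow> nat \<Rightarrow> wpair \<Rightarrow> wpair" where
  "wpair_multiple p 0 x = (0, 0)" | "wpair_multiple p (Suc n) x = wpair_add p (wpair_multiple p n x) x"

lemma wpair_multiple:
  assumes "prime p"
  shows "fst (wpair_multiple p n x) = of_nat n * fst x" "wpair_ghost p (wpair_multiple p n x) = of_nat n * wpair_ghost p x"
  using assms by (induction n) (simp_all add: wpair_ghost_wpair_add algebra_simps, simp add: wpair_ghost_def prime_gt_0_nat zero_power)

text \<open>The second entry solves the ghost equation: it is $p a^p + p^2 b - (pa)^p$ divided by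
  $p$, for the pair $(a, b)$. Since $p \<ge> 2$ the last term still carries a factor $p$, which
  leaves $a^p$ modulo $p$.\<close>

lemma wpair_multiple_p:
  assumes p: "prime p"
  shows "wpair_multiple p p x = (of_nat p * fst x, fst x ^ p + of_nat p * (snd x - of_nat (p ^ (p - 2)) * fst x ^ p))"
proof (rule wpair_eqI[OF p])
  have "p ^ p = p * (p * p ^ (p - 2))"
    using prime_ge_2_nat[OF p] power_add[of p 2 "p - 2"] by (simp only: le_add_diff_inverse power2_eq_square mult.assoc)
  then have e: "(of_nat p :: wpoly) ^ p = of_nat p * (of_nat p * of_nat (p ^ (p - 2)))"
    by (simp only: of_nat_mult[symmetric] of_nat_power[symmetric])
  have "wpair_ghost p (wpair_multiple p p x) = of_nat p * (fst x ^ p + of_nat p * snd x)"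
    by (simp only: wpair_multiple(2)[OF p]) (simp add: wpair_ghost_def)
  then show "wpair_ghost p (wpair_multiple p p x) = wpair_ghost p (of_nat p * fst x, fst x ^ p + of_nat p * (snd x - of_nat (p ^ (p - 2)) * fst x ^ p))"
    unfolding wpair_ghost_def fst_conv snd_conv power_mult_distrib e by (simp add: algebra_simps del: of_nat_power)
qed (simp add: wpair_multiple[OF p])

text \<open>This is $p = VF$ in characteristic $p$, read off from the universal formula.\<close>

lemma witt2_p_mult:
  assumes p: "prime p" and char: "add_pow R p \<one> = \<zero>" and x: "x \<in> carrier R \<times> carrier R"
  shows "add_pow (witt2 p R) p x = (\<zero>, fst x [^] p)"
proof -
  interpret W: cring "witt2 p R" by (rule witt2_cring[OF p])
  obtain a b u v w where uv: "\<forall>n. a n \<in> carrier R" "\<forall>n. b n \<in> carrier R"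
    "x = wpair_eval a b u" "x = wpair_eval a b v" "x = wpair_eval a b w"
    by (rule wpair_eval_surj[of x x x]) (use x in simp_all)
  have "wpair_eval a b (wpair_multiple p n u) = add_pow (witt2 p R) n x" for n
    by (induction n) (use uv(1-3) in \<open>simp_all add: wpair_eval[OF p]\<close>, simp add: wpair_eval_def)
  from this[of p] show ?thesis using uv(1-3)
    by (simp add: wpair_multiple_p[OF p] wpair_eval_def wpoly_eval_of_nat wpoly_eval_mult wpoly_eval_add wpoly_eval_power char
        del: of_nat_power)
qed

end

section \<open>Extensions of $A$ by $A$ with kernel generated by $p$\<close>

lemma ring_hom_add_pow_int:
  assumes "ring R" "ring S" "f \<in> ring_hom R S" "x \<in> carrier R"
  shows "f (add_pow R (c::int) x) = add_pow S c (f x)"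
proof -
  interpret R: ring R by fact
  interpret S: ring S by fact
  interpret f: ring_hom_ring R S f by unfold_locales fact
  have n: "f (add_pow R (n::nat) x) = add_pow S n (f x)" for n
    by (induction n) (use assms in auto)
  show ?thesis
    using assms by (cases "c \<ge> 0") (simp_all add: add_pow_int_ge add_pow_int_lt n)
qed

lemma ring_hom_add_pow_nat:
  assumes "ring R" "ring S" "f \<in> ring_hom R S" "x \<in> carrier R"
  shows "f (add_pow R (n::nat) x) = add_pow S n (f x)"
  using ring_hom_add_pow_int[OF assms, of "int n"] by (simp add: add_pow_int_ge)

definition witt2_map :: "('a \<Rightarrow> 'b) \<Rightarrow> 'a \<times> 'a \<Rightarrow> 'b \<times> 'b" where
  "witt2_map f x = (f (fst x), f (snd x))"

lemma ring_wcorr_hom: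
  assumes "cring R" "cring S" "f \<in> ring_hom R S" "x \<in> carrier R" "y \<in> carrier R"
  shows "f (cring.ring_wcorr R p x y) = cring.ring_wcorr S p (f x) (f y)"
proof -
  interpret R: cring R by fact
  interpret S: cring S by fact
  interpret f: ring_hom_cring R S f by unfold_locales fact
  show ?thesis
    unfolding R.ring_wcorr_def S.ring_wcorr_def
    using assms
    by (subst f.hom_finsum)
       (auto simp: R.add.int_pow_closed S.add.int_pow_closed ring_hom_add_pow_int[OF R.ring_axioms S.ring_axioms assms(3)]
          intro!: S.add.finprod_cong')
qed

lemma witt2_map_hom:
  assumes "prime p" "cring R" "cring S" "f \<in> ring_hom R S"
  shows "witt2_map f \<in> ring_hom (witt2 p R) (witt2 p S)"
proof -
  interpret R: cring R by fact
  interpret S: cring S by fact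
  interpret f: ring_hom_cring R S f by unfold_locales fact
  show ?thesis
    by (rule ring_hom_memI)
       (auto simp: witt2_map_def R.witt2_add[OF assms(1)] S.witt2_add[OF assms(1)]
         R.witt2_mult[OF assms(1)] S.witt2_mult[OF assms(1)] ring_wcorr_hom[OF assms(2-4)]
         ring_hom_add_pow_nat[OF R.ring_axioms S.ring_axioms assms(4)])
qed

context cring
begin

text \<open>The universal identity \<open>of_nat_mult_wcorr\<close> is evaluated at constant
  sequences. No restriction on the characteristic enters: it serves in $A$, to see that Frobenius is
  additive, as well as in liftings, where $p$ is not zero.\<close>

lemma ring_wcorr_binomial:
  assumes p: "prime p" and xy: "x \<in> carrier R" "y \<in> carrier R"
  shows "(x \<oplus> y) [^] p \<oplus> add_pow R p (ring_wcorr p x y) = x [^] p \<oplus> y [^] p"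
proof -
  let ?a = "\<lambda>_::nat. x" and ?b = "\<lambda>_::nat. y"
  have "(wvar (False, 0) + wvar (True, 0)) ^ p + of_nat p * wcorr p (wvar (False, 0)) (wvar (True, 0)) =
     wvar (False, 0) ^ p + wvar (True, 0) ^ p"
    by (simp add: of_nat_mult_wcorr[OF p])
  then have "wpoly_eval R ((wvar (False, 0) + wvar (True, 0)) ^ p + of_nat p * wcorr p (wvar (False, 0)) (wvar (True, 0))) ?a ?b =
     wpoly_eval R (wvar (False, 0) ^ p + wvar (True, 0) ^ p) ?a ?b" by simp
  then show ?thesis
    using xy by (simp add: wpoly_eval_add wpoly_eval_mult wpoly_eval_power wpoly_eval_wvar wpoly_eval_wcorr
        wpoly_eval_of_nat add_pow_ldistr)
qed

lemma UnitI:
  assumes "x \<in> carrier R" "y \<in> carrier R" "x \<otimes> y = \<one>"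
  shows "x \<in> Units R"
  using assms m_comm[of x y] by (auto simp: Units_def)

lemma unit_factor:
  assumes "a \<otimes> b \<in> Units R" "a \<in> carrier R" "b \<in> carrier R"
  shows "a \<in> Units R"
proof (rule UnitI)
  show "a \<otimes> (b \<otimes> inv (a \<otimes> b)) = \<one>"
    using m_assoc[of a b "inv (a \<otimes> b)"] assms by (simp del: m_assoc)
qed (use assms in auto)

lemma char_add_pow:
  assumes "add_pow R (p::nat) \<one> = \<zero>" "x \<in> carrier R"
  shows "add_pow R p x = \<zero>"
  using add_pow_ldistr[of \<one> x p] assms by simp

lemma frobenius_hom:
  fixes p :: nat
  assumes p: "prime p" and c: "add_pow R p \<one> = \<zero>"
  shows "(\<lambda>x. x [^] p) \<in> ring_hom R R"
proof (rule ring_hom_memI)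
  fix x y assume xy: "x \<in> carrier R" "y \<in> carrier R"
  then show "(x \<oplus> y) [^] p = x [^] p \<oplus> y [^] p"
    using ring_wcorr_binomial[OF p xy] by (simp add: char_add_pow[OF c])
  show "(x \<otimes> y) [^] p = x [^] p \<otimes> y [^] p" using xy by (simp add: nat_pow_distrib)
qed auto

lemma ring_wcorr_0 [simp]: "x \<in> carrier R \<Longrightarrow> ring_wcorr p x \<zero> = \<zero>"
  unfolding ring_wcorr_def
  by (intro add.finprod_one_eqI) (auto simp: nat_pow_zero add.int_pow_one)

lemma witt2_frob_hom:
  fixes p :: nat
  assumes p: "prime p" and c: "add_pow R p \<one> = \<zero>"
  shows "witt2_frob p R \<in> ring_hom (witt2 p R) (witt2 p R)"
proof -
  have "witt2_frob p R = witt2_map (\<lambda>x. x [^] p)" by (auto simp: witt2_frob_def witt2_map_def)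
  then show ?thesis using witt2_map_hom[OF p is_cring is_cring frobenius_hom[OF p c]] by simp
qed

end

text \<open>A commutative ring \<open>S\<close> with a map \<open>em\<close> to \<open>A\<close> whose kernel is a copy of \<open>A\<close>, the map
  \<open>j\<close> being division by \<open>p\<close> followed by reduction, inverted.\<close>

locale p_ext =
  fixes p :: nat and S :: "('e, 'm) ring_scheme" and A :: "('a, 'n) ring_scheme"
    and em :: "'e \<Rightarrow> 'a" and j :: "'a \<Rightarrow> 'e"
  assumes prime: "prime p" and S: "cring S" and A: "cring A"
    and em: "em \<in> ring_hom S A"
    and j_closed: "a \<in> carrier A \<Longrightarrow> j a \<in> carrier S"
    and j_add: "a \<in> carrier A \<Longrightarrow> b \<in> carrier A \<Longrightarrow> j (a \<oplus>\<^bsub>A\<^esub> b) = j a \<oplus>\<^bsub>S\<^esub> j b"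
    and j_inj: "inj_on j (carrier A)"
    and em_j: "a \<in> carrier A \<Longrightarrow> em (j a) = \<zero>\<^bsub>A\<^esub>"
    and ker: "s \<in> carrier S \<Longrightarrow> em s = \<zero>\<^bsub>A\<^esub> \<Longrightarrow> \<exists>a\<in>carrier A. s = j a"
    and j_mult: "s \<in> carrier S \<Longrightarrow> a \<in> carrier A \<Longrightarrow> j (em s \<otimes>\<^bsub>A\<^esub> a) = s \<otimes>\<^bsub>S\<^esub> j a"
    and j_em: "s \<in> carrier S \<Longrightarrow> j (em s) = add_pow S p s"
begin

sublocale S: cring S by (rule S)
sublocale A: cring A by (rule A)
sublocale em: ring_hom_cring S A em by unfold_locales (rule em)

lemma j_zero [simp]: "j \<zero>\<^bsub>A\<^esub> = \<zero>\<^bsub>S\<^esub>"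
  using j_em[of "\<zero>\<^bsub>S\<^esub>"] by simp

lemma j_neg: "a \<in> carrier A \<Longrightarrow> j (\<ominus>\<^bsub>A\<^esub> a) = \<ominus>\<^bsub>S\<^esub> j a"
  using j_add[of a "\<ominus>\<^bsub>A\<^esub> a"] by (metis A.a_inv_closed A.r_neg S.minus_equality S.a_comm j_closed j_zero)

text \<open>The ring \<open>S\<close> acts on the image of \<open>j\<close> through
  \<open>em\<close>, and \<open>em\<close> kills that image; hence the kernel has square
  zero.\<close>

lemma j_j: "a \<in> carrier A \<Longrightarrow> b \<in> carrier A \<Longrightarrow> j a \<otimes>\<^bsub>S\<^esub> j b = \<zero>\<^bsub>S\<^esub>"
  using j_mult[of "j a" b] by (simp add: em_j j_closed)

lemma j_eq_zero: "a \<in> carrier A \<Longrightarrow> j a = \<zero>\<^bsub>S\<^esub> \<Longrightarrow> a = \<zero>\<^bsub>A\<^esub>"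
  using j_inj j_zero by (metis A.zero_closed inj_on_eq_iff)

text \<open>The element \<open>j (em 1)\<close> is $p$ in \<open>S\<close>, and \<open>em\<close>
  kills everything in the image of \<open>j\<close>.\<close>

lemma charA: "add_pow A p \<one>\<^bsub>A\<^esub> = \<zero>\<^bsub>A\<^esub>"
proof -
  have "em (j (em \<one>\<^bsub>S\<^esub>)) = add_pow A p (em \<one>\<^bsub>S\<^esub>)"
    by (subst j_em) (auto simp: ring_hom_add_pow_nat[OF S.ring_axioms A.ring_axioms em])
  then show ?thesis by (simp add: em_j)
qed

lemma em_eqE:
  assumes "s \<in> carrier S" "t \<in> carrier S" "em s = em t"
  obtains a where "a \<in> carrier A" "s = t \<oplus>\<^bsub>S\<^esub> j a"
proof -
  have "em (s \<ominus>\<^bsub>S\<^esub> t) = \<zero>\<^bsub>A\<^esub>" using assms by (simp add: S.minus_eq A.r_neg)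
  then obtain a where a: "a \<in> carrier A" "s \<ominus>\<^bsub>S\<^esub> t = j a" using ker assms by blast
  have "s = t \<oplus>\<^bsub>S\<^esub> (s \<ominus>\<^bsub>S\<^esub> t)" using assms
    by (simp add: S.minus_eq S.a_comm[of s] S.r_neg2)
  with a that show thesis by metis
qed

text \<open>Write $s = t + j a$. The power \<open>(j a)^p\<close> vanishes because $p \<ge> 2$. The
  binomial correction is multiplied by $p$, hence equals \<open>j\<close> of its reduction, and that
  reduction is the correction term of \<open>em t\<close> and 0, which is zero.\<close>

lemma pow_p_eq:
  assumes "s \<in> carrier S" "t \<in> carrier S" "em s = em t"
  shows "s [^]\<^bsub>S\<^esub> p = t [^]\<^bsub>S\<^esub> p"
proof -
  obtain a where a: "a \<in> carrier A" "s = t \<oplus>\<^bsub>S\<^esub> j a" using em_eqE assms by blast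
  have p2: "p = Suc (Suc (p - 2))" using prime_ge_2_nat[OF prime] by simp
  have "j a [^]\<^bsub>S\<^esub> p = \<zero>\<^bsub>S\<^esub>"
    by (subst p2) (use a in \<open>simp add: S.m_assoc j_closed j_j\<close>)
  moreover have "add_pow S p (S.ring_wcorr p t (j a)) = j (em (S.ring_wcorr p t (j a)))"
    using a assms by (simp add: j_em j_closed)
  moreover have "em (S.ring_wcorr p t (j a)) = \<zero>\<^bsub>A\<^esub>"
    using a assms by (simp add: ring_wcorr_hom[OF S A em] j_closed em_j)
  ultimately show ?thesis
    using S.ring_wcorr_binomial[OF prime, of t "j a"] a assms by (simp add: j_closed)
qed

text \<open>An inverse modulo the kernel is lifted. The product is then \<open>1 + j a\<close>, and
  \<open>1 - j a\<close> inverts it since the kernel has square zero.\<close>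

lemma unit_of_surj:
  assumes s: "s \<in> carrier S" "em s \<in> Units A" and surj: "em ` carrier S = carrier A"
  shows "s \<in> Units S"
proof -
  obtain b where b: "b \<in> carrier A" "em s \<otimes>\<^bsub>A\<^esub> b = \<one>\<^bsub>A\<^esub>" using s A.Units_r_inv_ex by blast
  then obtain t where t: "t \<in> carrier S" "b = em t" using surj by auto
  have "em (s \<otimes>\<^bsub>S\<^esub> t) = em \<one>\<^bsub>S\<^esub>" using b t s by simp
  then obtain a where a: "a \<in> carrier A" "s \<otimes>\<^bsub>S\<^esub> t = \<one>\<^bsub>S\<^esub> \<oplus>\<^bsub>S\<^esub> j a"
    using em_eqE s t by (metis S.m_closed S.one_closed)
  have "(\<one>\<^bsub>S\<^esub> \<oplus>\<^bsub>S\<^esub> j a) \<otimes>\<^bsub>S\<^esub> (\<one>\<^bsub>S\<^esub> \<oplus>\<^bsub>S\<^esub> j (\<ominus>\<^bsub>A\<^esub> a)) = \<one>\<^bsub>S\<^esub>"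
    using a by (simp add: S.l_distr S.r_distr j_closed j_neg S.r_minus j_j S.a_ac S.r_neg S.l_neg)
  then have "s \<otimes>\<^bsub>S\<^esub> (t \<otimes>\<^bsub>S\<^esub> (\<one>\<^bsub>S\<^esub> \<oplus>\<^bsub>S\<^esub> j (\<ominus>\<^bsub>A\<^esub> a))) = \<one>\<^bsub>S\<^esub>"
    using a s t by (simp add: S.m_assoc[symmetric] j_closed)
  then show ?thesis using s t a by (intro S.UnitI) (auto simp: j_closed)
qed

lemma unit_em:
  assumes "s \<in> Units S"
  shows "em s \<in> Units A"
proof (rule A.UnitI)
  show "em s \<otimes>\<^bsub>A\<^esub> em (inv\<^bsub>S\<^esub> s) = \<one>\<^bsub>A\<^esub>"
    using assms by (metis S.Units_closed S.Units_inv_closed S.Units_r_inv em.hom_mult em.hom_one)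
qed (use assms in auto)

definition some_lift :: "'a \<Rightarrow> 'e" where "some_lift a = (SOME s. s \<in> carrier S \<and> em s = a)"

text \<open>Since $p^2 = 0$ in \<open>S\<close>, the power $s^p$ depends only on \<open>em s\<close>, and \<open>j (snd x)\<close> is
  $p$ times a lift of \<open>snd x\<close>.\<close>

definition theta :: "'a \<times> 'a \<Rightarrow> 'e" where
  "theta x = some_lift (fst x) [^]\<^bsub>S\<^esub> p \<oplus>\<^bsub>S\<^esub> j (snd x)"

end

text \<open>Kept apart from \<open>p_ext\<close> because sections over a general open set need not
  lift. With surjectivity the kernel of \<open>em\<close> becomes $p S$, and lifts of elements of
  \<open>A\<close> can be chosen.\<close>

locale p_ext_surj = p_ext +
  assumes surj: "em ` carrier S = carrier A"
begin

lemma surjE: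
  assumes "a \<in> carrier A"
  obtains s where "s \<in> carrier S" "a = em s"
  using assms surj by (metis image_iff)

lemma some_lift: "a \<in> carrier A \<Longrightarrow> some_lift a \<in> carrier S" "a \<in> carrier A \<Longrightarrow> em (some_lift a) = a"
proof -
  assume "a \<in> carrier A"
  then have "\<exists>s. s \<in> carrier S \<and> em s = a" using surj by (metis image_iff)
  then show "some_lift a \<in> carrier S" "em (some_lift a) = a" unfolding some_lift_def by (metis (mono_tags, lifting) someI_ex)+
qed

lemma theta_eq:
  assumes "s \<in> carrier S"
  shows "theta (em s, b) = s [^]\<^bsub>S\<^esub> p \<oplus>\<^bsub>S\<^esub> j b"
  unfolding theta_def using pow_p_eq[of "some_lift (em s)" s] assms by (simp add: some_lift)

text \<open>In a sum, the correction in the second Witt component becomes $p$ times the correction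
  in \<open>S\<close>, exactly what the binomial identity needs. In a product,
  \<open>j x1 * j y1\<close> vanishes on one side and $p x_1 y_1$ vanishes in \<open>A\<close> on
  the other.\<close>

lemma theta_hom: "theta \<in> ring_hom (witt2 p A) S"
proof (rule ring_hom_memI)
  fix x assume "x \<in> carrier (witt2 p A)"
  then show "theta x \<in> carrier S" by (auto simp: theta_def some_lift j_closed)
  from \<open>x \<in> _\<close> obtain s x1 where x: "s \<in> carrier S" "x1 \<in> carrier A" "x = (em s, x1)"
    by (metis surjE carrier_witt2 mem_Sigma_iff prod.collapse)
  fix y assume "y \<in> carrier (witt2 p A)"
  then obtain t y1 where y: "t \<in> carrier S" "y1 \<in> carrier A" "y = (em t, y1)"
    by (metis surjE carrier_witt2 mem_Sigma_iff prod.collapse)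
  have "theta (x \<oplus>\<^bsub>witt2 p A\<^esub> y) = theta (em (s \<oplus>\<^bsub>S\<^esub> t), x1 \<oplus>\<^bsub>A\<^esub> y1 \<oplus>\<^bsub>A\<^esub> em (S.ring_wcorr p s t))"
    using x y by (simp add: A.witt2_add[OF prime] ring_wcorr_hom[OF S A em])
  also have "\<dots> = (s \<oplus>\<^bsub>S\<^esub> t) [^]\<^bsub>S\<^esub> p \<oplus>\<^bsub>S\<^esub> (j x1 \<oplus>\<^bsub>S\<^esub> j y1 \<oplus>\<^bsub>S\<^esub> add_pow S p (S.ring_wcorr p s t))"
    using x y by (subst theta_eq) (simp_all add: j_add j_em)
  also have "\<dots> = ((s \<oplus>\<^bsub>S\<^esub> t) [^]\<^bsub>S\<^esub> p \<oplus>\<^bsub>S\<^esub> add_pow S p (S.ring_wcorr p s t)) \<oplus>\<^bsub>S\<^esub> (j x1 \<oplus>\<^bsub>S\<^esub> j y1)"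
    using x y by (simp add: S.a_ac j_closed)
  also have "\<dots> = theta x \<oplus>\<^bsub>S\<^esub> theta y"
    using x y by (simp add: S.ring_wcorr_binomial[OF prime] theta_eq S.a_ac j_closed)
  finally show "theta (x \<oplus>\<^bsub>witt2 p A\<^esub> y) = theta x \<oplus>\<^bsub>S\<^esub> theta y" .
  have "theta (x \<otimes>\<^bsub>witt2 p A\<^esub> y) = theta (em (s \<otimes>\<^bsub>S\<^esub> t), em (s [^]\<^bsub>S\<^esub> p) \<otimes>\<^bsub>A\<^esub> y1 \<oplus>\<^bsub>A\<^esub> em (t [^]\<^bsub>S\<^esub> p) \<otimes>\<^bsub>A\<^esub> x1)"
    using x y by (simp add: A.witt2_mult[OF prime] A.char_add_pow[OF charA] A.m_comm)
  also have "\<dots> = s [^]\<^bsub>S\<^esub> p \<otimes>\<^bsub>S\<^esub> t [^]\<^bsub>S\<^esub> p \<oplus>\<^bsub>S\<^esub> (s [^]\<^bsub>S\<^esub> p \<otimes>\<^bsub>S\<^esub> j y1 \<oplus>\<^bsub>S\<^esub> t [^]\<^bsub>S\<^esub> p \<otimes>\<^bsub>S\<^esub> j x1)"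
    using x y by (subst theta_eq) (simp_all add: j_add j_mult S.nat_pow_distrib del: em.hom_pow)
  also have "\<dots> = theta x \<otimes>\<^bsub>S\<^esub> theta y"
    using x y by (simp add: theta_eq S.l_distr S.r_distr j_closed j_j S.a_ac S.m_comm)
  finally show "theta (x \<otimes>\<^bsub>witt2 p A\<^esub> y) = theta x \<otimes>\<^bsub>S\<^esub> theta y" .
next
  have "theta (em \<one>\<^bsub>S\<^esub>, \<zero>\<^bsub>A\<^esub>) = \<one>\<^bsub>S\<^esub>" by (subst theta_eq) auto
  then show "theta \<one>\<^bsub>witt2 p A\<^esub> = \<one>\<^bsub>S\<^esub>" by simp
qed

lemma em_theta: "x \<in> carrier (witt2 p A) \<Longrightarrow> em (theta x) = fst x [^]\<^bsub>A\<^esub> p"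
  by (auto simp: theta_def some_lift j_closed em_j)

end

text \<open>Since \<open>theta\<close> may be computed with any lift of the first entry, the image
  of a chosen lift serves as the lift in the target.\<close>

lemma theta_natural:
  assumes "p_ext_surj p S A em j" "p_ext_surj p S' A' em' j'"
    and "f \<in> ring_hom S S'"
    and "\<And>s. s \<in> carrier S \<Longrightarrow> em' (f s) = h (em s)"
    and "\<And>a. a \<in> carrier A \<Longrightarrow> f (j a) = j' (h a)"
    and x: "x \<in> carrier (witt2 p A)"
  shows "f (p_ext.theta p S em j x) = p_ext.theta p S' em' j' (witt2_map h x)"
proof -
  interpret E: p_ext_surj p S A em j by fact
  interpret E': p_ext_surj p S' A' em' j' by fact
  interpret f: ring_hom_cring S S' f by unfold_locales fact
  obtain s b where s: "s \<in> carrier S" "b \<in> carrier A" "x = (em s, b)"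
    using x by (metis E.surjE carrier_witt2 mem_Sigma_iff prod.collapse)
  then have "f (E.theta x) = f s [^]\<^bsub>S'\<^esub> p \<oplus>\<^bsub>S'\<^esub> j' (h b)"
    by (simp add: E.theta_eq E.j_closed assms)
  also have "\<dots> = E'.theta (em' (f s), h b)" using s by (subst E'.theta_eq) auto
  finally show ?thesis using s assms by (simp add: witt2_map_def)
qed

section \<open>Affine open sets\<close>

text \<open>The topology is only generated by the sets $D(s)$; they form a basis because $D(s)$ and
  $D(t)$ meet in $D(st)$.\<close>

lemma spec_basis:
  assumes "cring R" "openin (spec R) O'" "P \<in> O'"
  shows "primeideal P R \<and> (\<exists>s\<in>carrier R. s \<notin> P \<and> (\<forall>Q. primeideal Q R \<and> s \<notin> Q \<longrightarrow> Q \<in> O'))"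
proof -
  interpret cring R by fact
  have "generate_topology_on {{P. primeideal P R \<and> s \<notin> P} |s. s \<in> carrier R} O'"
    using assms(2) by (simp add: spec_def openin_topology_generated_by)
  then show ?thesis using assms(3)
  proof (induction O')
    case (Int a b)
    then obtain s t where st: "s \<in> carrier R" "s \<notin> P" "\<forall>Q. primeideal Q R \<and> s \<notin> Q \<longrightarrow> Q \<in> a"
      "t \<in> carrier R" "t \<notin> P" "\<forall>Q. primeideal Q R \<and> t \<notin> Q \<longrightarrow> Q \<in> b" "primeideal P R" by blast
    have n1: "s \<otimes>\<^bsub>R\<^esub> t \<notin> P" using primeideal.I_prime[OF st(7) st(1) st(4)] st(2,5) by blast
    have n2: "Q \<in> a \<inter> b" if Q: "primeideal Q R" "s \<otimes>\<^bsub>R\<^esub> t \<notin> Q" for Q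
    proof -
      have "s \<notin> Q" "t \<notin> Q"
        using Q(2) ideal.I_l_closed[OF primeideal.axioms(1)[OF Q(1)] _ st(1)]
          ideal.I_r_closed[OF primeideal.axioms(1)[OF Q(1)] _ st(4)] by auto
      then show ?thesis using st(3,6) Q(1) by simp
    qed
    have n3: "s \<otimes>\<^bsub>R\<^esub> t \<in> carrier R" using st by simp
    show ?case by (intro conjI[OF st(7)] bexI[OF _ n3] conjI[OF n1] allI impI n2) simp_all
  next
    case (UN K)
    then obtain k where k: "k \<in> K" "P \<in> k" by blast
    from UN.IH[OF k] k(1) show ?case by auto
  next
    case (Basis s)
    then show ?case by auto
  qed auto
qed

lemma ring_hom_Units:
  assumes "cring R" "cring S" "f \<in> ring_hom R S" "x \<in> Units R"
  shows "f x \<in> Units S"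
proof -
  interpret h: ring_hom_cring R S f using assms by (intro ring_hom_cring.intro ring_hom_cring_axioms.intro)
  show ?thesis
  proof (rule h.S.UnitI)
    show "f x \<otimes>\<^bsub>S\<^esub> f (inv\<^bsub>R\<^esub> x) = \<one>\<^bsub>S\<^esub>"
      using assms(4) by (metis h.R.Units_closed h.R.Units_inv_closed h.R.Units_r_inv h.hom_mult h.hom_one)
  qed (use assms(4) in auto)
qed

lemma topspace_spec: "cring R \<Longrightarrow> topspace (spec R) = {P. primeideal P R}"
proof -
  assume "cring R"
  then interpret cring R .
  have "\<one>\<^bsub>R\<^esub> \<notin> P" if "primeideal P R" for P
    using that ideal.one_imp_carrier primeideal.I_notcarr primeideal.axioms(1) by metis
  then show ?thesis unfolding spec_def topology_generated_by_topspace by blast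
qed

lemma openin_spec: "s \<in> carrier R \<Longrightarrow> openin (spec R) {P. primeideal P R \<and> s \<notin> P}"
  unfolding spec_def by (rule topology_generated_by_Basis) auto

section \<open>Sections, germs and basic open sets of a ringed space\<close>

text \<open>The ideal that \<open>affine_open\<close> attaches to a point, given a name; on an
  affine open set it is prime.\<close>

definition nonunits :: "('x, 'r, 'z) ringed_space_scheme \<Rightarrow> 'x set \<Rightarrow> 'x \<Rightarrow> 'r set" where
  "nonunits X U x = {s \<in> carrier (Sh X U). \<not> germ_unit X x U s}"

definition basic_open :: "('x, 'r, 'z) ringed_space_scheme \<Rightarrow> 'x set \<Rightarrow> 'r \<Rightarrow> 'x set" where
  "basic_open X U s = {x \<in> U. germ_unit X x U s}"

locale rspace =
  fixes X :: "('x, 'r, 'z) ringed_space_scheme"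
  assumes rs: "is_ringed_space X"
begin

abbreviation op where "op \<equiv> openin (Top X)"

lemma Sh_cring: "op U \<Longrightarrow> cring (Sh X U)"
  using rs by (simp add: is_ringed_space_def)

lemma Res_hom: "op U \<Longrightarrow> op V \<Longrightarrow> V \<subseteq> U \<Longrightarrow> Res X U V \<in> ring_hom (Sh X U) (Sh X V)"
  using rs by (simp add: is_ringed_space_def)

lemma Res_closed: "op U \<Longrightarrow> op V \<Longrightarrow> V \<subseteq> U \<Longrightarrow> s \<in> carrier (Sh X U) \<Longrightarrow> Res X U V s \<in> carrier (Sh X V)"
  using Res_hom ring_hom_closed by metis

lemma Res_id: "op U \<Longrightarrow> s \<in> carrier (Sh X U) \<Longrightarrow> Res X U U s = s"
  using rs by (simp add: is_ringed_space_def)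

lemma Res_comp: "op U \<Longrightarrow> op V \<Longrightarrow> op W \<Longrightarrow> W \<subseteq> V \<Longrightarrow> V \<subseteq> U \<Longrightarrow> s \<in> carrier (Sh X U) \<Longrightarrow>
   Res X V W (Res X U V s) = Res X U W s"
  using rs by (simp add: is_ringed_space_def)

lemma Res_ring_hom: "op U \<Longrightarrow> op V \<Longrightarrow> V \<subseteq> U \<Longrightarrow> ring_hom_cring (Sh X U) (Sh X V) (Res X U V)"
  by (intro ring_hom_cring.intro ring_hom_cring_axioms.intro Sh_cring Res_hom)

lemma sheaf_glue:
  assumes "\<And>V. V \<in> \<U> \<Longrightarrow> op V" "\<And>V. V \<in> \<U> \<Longrightarrow> s V \<in> carrier (Sh X V)"
    and "\<And>V W. V \<in> \<U> \<Longrightarrow> W \<in> \<U> \<Longrightarrow> Res X V (V \<inter> W) (s V) = Res X W (V \<inter> W) (s W)"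
  shows "\<exists>!t. t \<in> carrier (Sh X (\<Union>\<U>)) \<and> (\<forall>V\<in>\<U>. Res X (\<Union>\<U>) V t = s V)"
proof -
  have sh: "\<forall>\<U> s. (\<forall>U\<in>\<U>. openin (Top X) U \<and> s U \<in> carrier (Sh X U)) \<and>
        (\<forall>U\<in>\<U>. \<forall>V\<in>\<U>. Res X U (U \<inter> V) (s U) = Res X V (U \<inter> V) (s V)) \<longrightarrow>
        (\<exists>!t. t \<in> carrier (Sh X (\<Union>\<U>)) \<and> (\<forall>U\<in>\<U>. Res X (\<Union>\<U>) U t = s U))"
    using rs[unfolded is_ringed_space_def] by (elim conjE) assumption
  show ?thesis by (rule sh[THEN spec, THEN spec, THEN mp]) (intro conjI ballI assms; assumption)
qed

lemma sections_eqI: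
  assumes U: "op U" and s: "s \<in> carrier (Sh X U)" and t: "t \<in> carrier (Sh X U)"
    and loc: "\<And>x. x \<in> U \<Longrightarrow> \<exists>V. op V \<and> x \<in> V \<and> V \<subseteq> U \<and> Res X U V s = Res X U V t"
  shows "s = t"
proof -
  define \<U> where "\<U> = {V. op V \<and> V \<subseteq> U \<and> Res X U V s = Res X U V t}"
  have eq: "\<Union>\<U> = U" unfolding \<U>_def using loc by blast
  have "\<exists>!r. r \<in> carrier (Sh X (\<Union>\<U>)) \<and> (\<forall>V\<in>\<U>. Res X (\<Union>\<U>) V r = Res X U V s)"
    by (rule sheaf_glue) (auto simp: \<U>_def Res_closed Res_comp U s t openin_Int)
  then show ?thesis unfolding eq using s t by (auto simp: \<U>_def)
qed

text \<open>Agreement is required only near each common point, since the intersection of two members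
  of the family may fail to be a member. Uniqueness of sections upgrades this to agreement on the
  intersection.\<close>

lemma glue_basis:
  assumes U: "op U"
    and cover: "\<And>V. V \<in> \<U> \<Longrightarrow> op V \<and> V \<subseteq> U" "\<And>x. x \<in> U \<Longrightarrow> \<exists>V\<in>\<U>. x \<in> V"
    and s: "\<And>V. V \<in> \<U> \<Longrightarrow> s V \<in> carrier (Sh X V)"
    and agree: "\<And>V W x. V \<in> \<U> \<Longrightarrow> W \<in> \<U> \<Longrightarrow> x \<in> V \<Longrightarrow> x \<in> W \<Longrightarrow>
       \<exists>O'. op O' \<and> x \<in> O' \<and> O' \<subseteq> V \<and> O' \<subseteq> W \<and> Res X V O' (s V) = Res X W O' (s W)"
  obtains t where "t \<in> carrier (Sh X U)" "\<And>V. V \<in> \<U> \<Longrightarrow> Res X U V t = s V"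
proof -
  have eq: "\<Union>\<U> = U" using cover by blast
  have "\<exists>!t. t \<in> carrier (Sh X (\<Union>\<U>)) \<and> (\<forall>V\<in>\<U>. Res X (\<Union>\<U>) V t = s V)"
  proof (rule sheaf_glue)
    fix V W assume VW: "V \<in> \<U>" "W \<in> \<U>"
    then have o: "op V" "op W" "op (V \<inter> W)" using cover by (auto intro: openin_Int)
    show "Res X V (V \<inter> W) (s V) = Res X W (V \<inter> W) (s W)"
    proof (rule sections_eqI[OF o(3)])
      fix x assume "x \<in> V \<inter> W"
      then obtain O' where O': "op O'" "x \<in> O'" "O' \<subseteq> V" "O' \<subseteq> W" "Res X V O' (s V) = Res X W O' (s W)"
        using agree[OF VW, of x] by auto
      then show "\<exists>O'. op O' \<and> x \<in> O' \<and> O' \<subseteq> V \<inter> W \<and>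
          Res X (V \<inter> W) O' (Res X V (V \<inter> W) (s V)) = Res X (V \<inter> W) O' (Res X W (V \<inter> W) (s W))"
        using VW o s by (intro exI[of _ O']) (simp add: Res_comp)
    qed (use VW o s in \<open>auto intro: Res_closed\<close>)
  qed (simp_all add: cover s)
  then obtain t where "t \<in> carrier (Sh X U)" "\<forall>V\<in>\<U>. Res X U V t = s V" unfolding eq by auto
  then show thesis using that[of t] by simp
qed

lemma germ_unit_Res:
  assumes "op U" "op V" "V \<subseteq> U" "x \<in> V" "s \<in> carrier (Sh X U)"
  shows "germ_unit X x V (Res X U V s) \<longleftrightarrow> germ_unit X x U s"
proof
  assume "germ_unit X x V (Res X U V s)"
  then show "germ_unit X x U s"
    unfolding germ_unit_def using assms by (metis Res_comp order_trans)
next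
  assume "germ_unit X x U s"
  then obtain W where W: "op W" "x \<in> W" "W \<subseteq> U" "Res X U W s \<in> Units (Sh X W)"
    unfolding germ_unit_def by blast
  have o: "op (W \<inter> V)" using W assms by (simp add: openin_Int)
  interpret h: ring_hom_cring "Sh X W" "Sh X (W \<inter> V)" "Res X W (W \<inter> V)"
    using Res_ring_hom W o by auto
  have "Res X W (W \<inter> V) (Res X U W s) \<in> Units (Sh X (W \<inter> V))"
    by (rule ring_hom_Units[OF Sh_cring Sh_cring Res_hom]) (use W o in auto)
  then show "germ_unit X x V (Res X U V s)"
    unfolding germ_unit_def using assms W o
    by (intro exI[of _ "W \<inter> V"]) (simp add: Res_comp)
qed

lemma germ_unit_of_Unit:
  assumes "op U" "x \<in> U" "s \<in> Units (Sh X U)"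
  shows "germ_unit X x U s"
proof -
  have "s \<in> carrier (Sh X U)" using assms by (simp add: Units_def)
  then show ?thesis unfolding germ_unit_def using assms by (intro exI[of _ U]) (simp add: Res_id)
qed

lemma germ_unit_mult:
  assumes "op U" "x \<in> U" "s \<in> carrier (Sh X U)" "t \<in> carrier (Sh X U)"
  shows "germ_unit X x U (s \<otimes>\<^bsub>Sh X U\<^esub> t) \<longleftrightarrow> germ_unit X x U s \<and> germ_unit X x U t"
proof safe
  interpret U: cring "Sh X U" using Sh_cring assms by simp
  assume "germ_unit X x U (s \<otimes>\<^bsub>Sh X U\<^esub> t)"
  then obtain W where W: "op W" "x \<in> W" "W \<subseteq> U" "Res X U W (s \<otimes>\<^bsub>Sh X U\<^esub> t) \<in> Units (Sh X W)"
    unfolding germ_unit_def by blast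
  interpret h: ring_hom_cring "Sh X U" "Sh X W" "Res X U W"
    using Res_ring_hom W assms by auto
  have "Res X U W s \<in> Units (Sh X W)" "Res X U W t \<in> Units (Sh X W)"
    using W(4) assms h.S.unit_factor[of "Res X U W s" "Res X U W t"] h.S.unit_factor[of "Res X U W t" "Res X U W s"]
    by (simp_all add: h.S.m_comm)
  then show "germ_unit X x U s" "germ_unit X x U t" unfolding germ_unit_def using W by blast+
next
  interpret U: cring "Sh X U" using Sh_cring assms by simp
  assume "germ_unit X x U s" "germ_unit X x U t"
  then obtain V W where V: "op V" "x \<in> V" "V \<subseteq> U" "Res X U V s \<in> Units (Sh X V)"
    and W: "op W" "x \<in> W" "W \<subseteq> U" "Res X U W t \<in> Units (Sh X W)"
    unfolding germ_unit_def by blast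
  have o: "op (V \<inter> W)" using V W by (simp add: openin_Int)
  interpret h: ring_hom_cring "Sh X U" "Sh X (V \<inter> W)" "Res X U (V \<inter> W)"
    using Res_ring_hom W V o assms by auto
  have 1: "Res X V (V \<inter> W) (Res X U V s) \<in> Units (Sh X (V \<inter> W))"
    by (rule ring_hom_Units[OF Sh_cring Sh_cring Res_hom]) (use V o in auto)
  have 2: "Res X W (V \<inter> W) (Res X U W t) \<in> Units (Sh X (V \<inter> W))"
    by (rule ring_hom_Units[OF Sh_cring Sh_cring Res_hom]) (use W o in auto)
  have "Res X U (V \<inter> W) (s \<otimes>\<^bsub>Sh X U\<^esub> t) \<in> Units (Sh X (V \<inter> W))"
    using 1 2 assms V W o by (simp add: Res_comp)
  then show "germ_unit X x U (s \<otimes>\<^bsub>Sh X U\<^esub> t)"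
    unfolding germ_unit_def using V W o by (intro exI[of _ "V \<inter> W"]) auto
qed

lemma openin_basic_open:
  assumes "op U" "s \<in> carrier (Sh X U)"
  shows "op (basic_open X U s)"
proof (subst openin_subopen, safe)
  fix x assume "x \<in> basic_open X U s"
  then obtain W where W: "op W" "x \<in> W" "W \<subseteq> U" "Res X U W s \<in> Units (Sh X W)"
    unfolding basic_open_def germ_unit_def by blast
  then have "W \<subseteq> basic_open X U s" unfolding basic_open_def germ_unit_def by blast
  then show "\<exists>T. op T \<and> x \<in> T \<and> T \<subseteq> basic_open X U s" using W by blast
qed

lemma basic_open_Res:
  "op U \<Longrightarrow> op V \<Longrightarrow> V \<subseteq> U \<Longrightarrow> s \<in> carrier (Sh X U) \<Longrightarrow>
    basic_open X V (Res X U V s) = V \<inter> basic_open X U s"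
  unfolding basic_open_def using germ_unit_Res by blast

lemma basic_open_mult:
  "op U \<Longrightarrow> s \<in> carrier (Sh X U) \<Longrightarrow> t \<in> carrier (Sh X U) \<Longrightarrow>
    basic_open X U (s \<otimes>\<^bsub>Sh X U\<^esub> t) = basic_open X U s \<inter> basic_open X U t"
  unfolding basic_open_def using germ_unit_mult by blast

text \<open>Continuity of the map to the spectrum holds because the preimage of $D(s)$ is a basic
  open set; \<open>basis\<close> together with \<open>surj\<close> makes the map open.\<close>

lemma affine_openI:
  assumes U: "op U"
    and prime: "\<And>x. x \<in> U \<Longrightarrow> primeideal (nonunits X U x) (Sh X U)"
    and inj: "inj_on (nonunits X U) U"
    and surj: "\<And>Q. primeideal Q (Sh X U) \<Longrightarrow> \<exists>x\<in>U. Q = nonunits X U x"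
    and basis: "\<And>W x. op W \<Longrightarrow> x \<in> W \<Longrightarrow> W \<subseteq> U \<Longrightarrow> \<exists>s\<in>carrier (Sh X U). x \<in> basic_open X U s \<and> basic_open X U s \<subseteq> W"
    and loc: "\<And>s. s \<in> carrier (Sh X U) \<Longrightarrow>
      is_localization (Sh X U) s (Sh X (basic_open X U s)) (Res X U (basic_open X U s))"
  shows "affine_open X U"
proof -
  have R: "cring (Sh X U)" using Sh_cring U by simp
  have ts: "topspace (subtopology (Top X) U) = U" using U by (simp add: openin_subset Int_absorb1)
  have "homeomorphic_map (subtopology (Top X) U) (spec (Sh X U)) (nonunits X U)"
  proof (rule bijective_open_imp_homeomorphic_map)
    show "continuous_map (subtopology (Top X) U) (spec (Sh X U)) (nonunits X U)"
      unfolding spec_def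
    proof (rule continuous_on_generated_topo)
      fix O' assume "O' \<in> {{P. primeideal P (Sh X U) \<and> s \<notin> P} |s. s \<in> carrier (Sh X U)}"
      then obtain s where s: "s \<in> carrier (Sh X U)" "O' = {P. primeideal P (Sh X U) \<and> s \<notin> P}" by blast
      have "nonunits X U -` O' \<inter> topspace (subtopology (Top X) U) = basic_open X U s"
        unfolding ts basic_open_def s using prime s by (auto simp: nonunits_def)
      then show "openin (subtopology (Top X) U) (nonunits X U -` O' \<inter> topspace (subtopology (Top X) U))"
        using openin_basic_open[OF U s(1)] by (simp add: openin_open_subtopology[OF U] basic_open_def)
    next
      have "topspace (spec (Sh X U)) = {P. primeideal P (Sh X U)}" by (rule topspace_spec[OF R])
      then show "nonunits X U ` topspace (subtopology (Top X) U) \<subseteq> \<Union> {{P. primeideal P (Sh X U) \<and> s \<notin> P} |s. s \<in> carrier (Sh X U)}"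
        unfolding ts spec_def topology_generated_by_topspace using prime by auto
    qed
    show "open_map (subtopology (Top X) U) (spec (Sh X U)) (nonunits X U)"
      unfolding open_map_def
    proof safe
      fix W assume "openin (subtopology (Top X) U) W"
      then have W: "op W" "W \<subseteq> U" using openin_open_subtopology[OF U] by auto
      show "openin (spec (Sh X U)) (nonunits X U ` W)"
      proof (subst openin_subopen, safe)
        fix x assume x: "x \<in> W"
        then obtain s where s: "s \<in> carrier (Sh X U)" "x \<in> basic_open X U s" "basic_open X U s \<subseteq> W"
          using basis W by blast
        have "{P. primeideal P (Sh X U) \<and> s \<notin> P} \<subseteq> nonunits X U ` W"
        proof safe
          fix Q assume Q: "primeideal Q (Sh X U)" "s \<notin> Q"
          then obtain y where y: "y \<in> U" "Q = nonunits X U y" using surj by blast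
          then have "y \<in> basic_open X U s" using Q s by (auto simp: nonunits_def basic_open_def)
          then show "Q \<in> nonunits X U ` W" using s y by blast
        qed
        moreover have "nonunits X U x \<in> {P. primeideal P (Sh X U) \<and> s \<notin> P}"
          using x W s prime by (auto simp: nonunits_def basic_open_def)
        ultimately show "\<exists>T. openin (spec (Sh X U)) T \<and> nonunits X U x \<in> T \<and> T \<subseteq> nonunits X U ` W"
          using openin_spec[OF s(1)] by blast
      qed
    qed
    show "nonunits X U ` topspace (subtopology (Top X) U) = topspace (spec (Sh X U))"
      unfolding ts topspace_spec[OF R] using prime surj by auto
    show "inj_on (nonunits X U) (topspace (subtopology (Top X) U))"
      unfolding ts by (rule inj)
  qed
  then show ?thesis
    unfolding affine_open_def using U loc
    by (simp add: nonunits_def[abs_def] basic_open_def)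
qed

context
  fixes U assumes aff: "affine_open X U"
begin

lemma affine_open: "op U" using aff by (simp add: affine_open_def)

lemma affine_hom: "homeomorphic_map (subtopology (Top X) U) (spec (Sh X U)) (nonunits X U)"
  using aff by (simp add: affine_open_def nonunits_def[abs_def])

lemma affine_topspace: "topspace (subtopology (Top X) U) = U"
  using affine_open by (simp add: openin_subset Int_absorb1)

lemma affine_prime: "x \<in> U \<Longrightarrow> primeideal (nonunits X U x) (Sh X U)"
  using homeomorphic_imp_surjective_map[OF affine_hom]
  unfolding affine_topspace topspace_spec[OF Sh_cring[OF affine_open]] by blast

lemma affine_surj: "primeideal Q (Sh X U) \<Longrightarrow> \<exists>x\<in>U. Q = nonunits X U x"
  using homeomorphic_imp_surjective_map[OF affine_hom]
  unfolding affine_topspace topspace_spec[OF Sh_cring[OF affine_open]] by blast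

lemma affine_inj: "inj_on (nonunits X U) U"
  using homeomorphic_imp_injective_map[OF affine_hom] unfolding affine_topspace .

lemma affine_loc: "s \<in> carrier (Sh X U) \<Longrightarrow>
   is_localization (Sh X U) s (Sh X (basic_open X U s)) (Res X U (basic_open X U s))"
  using aff by (simp add: affine_open_def basic_open_def)

lemma affine_basis:
  assumes W: "op W" "x \<in> W" "W \<subseteq> U"
  shows "\<exists>s\<in>carrier (Sh X U). x \<in> basic_open X U s \<and> basic_open X U s \<subseteq> W"
proof -
  have "openin (spec (Sh X U)) (nonunits X U ` W)"
    using homeomorphic_imp_open_map[OF affine_hom] W affine_open
    by (auto simp: open_map_def openin_open_subtopology)
  from spec_basis[OF Sh_cring[OF affine_open] this, of "nonunits X U x"] W
  obtain s where s: "s \<in> carrier (Sh X U)" "s \<notin> nonunits X U x"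
    "\<forall>Q. primeideal Q (Sh X U) \<and> s \<notin> Q \<longrightarrow> Q \<in> nonunits X U ` W" by blast
  have "basic_open X U s \<subseteq> W"
  proof
    fix y assume "y \<in> basic_open X U s"
    then have y: "y \<in> U" "s \<notin> nonunits X U y" by (auto simp: basic_open_def nonunits_def)
    then have "nonunits X U y \<in> nonunits X U ` W" using s affine_prime by blast
    then obtain z where "z \<in> W" "nonunits X U y = nonunits X U z" by blast
    then show "y \<in> W" using inj_onD[OF affine_inj, of y z] y W by blast
  qed
  then show ?thesis using s W by (auto simp: basic_open_def nonunits_def)
qed

end

end

section \<open>Localization and basic open subsets of affine sets\<close>

context cring
begin

lemma idealI':
  assumes "I \<subseteq> carrier R" "\<zero> \<in> I"
    and add: "\<And>a b. a \<in> I \<Longrightarrow> b \<in> I \<Longrightarrow> a \<oplus> b \<in> I"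
    and mult: "\<And>a r. a \<in> I \<Longrightarrow> r \<in> carrier R \<Longrightarrow> r \<otimes> a \<in> I"
  shows "ideal I R"
proof (rule idealI[OF ring_axioms])
  show "subgroup I (add_monoid R)"
  proof
    fix x assume x: "x \<in> I"
    have "(\<ominus> \<one>) \<otimes> x \<in> I" by (rule mult) (use x in auto)
    moreover have "inv\<^bsub>add_monoid R\<^esub> x = (\<ominus> \<one>) \<otimes> x"
      using x assms(1) by (simp add: a_inv_def[symmetric] l_minus subsetD)
    ultimately show "inv\<^bsub>add_monoid R\<^esub> x \<in> I" by simp
  qed (use assms in auto)
  fix a x assume ax: "a \<in> I" "x \<in> carrier R"
  then show "x \<otimes> a \<in> I" by (rule mult)
  then show "a \<otimes> x \<in> I" using ax assms(1) m_comm[of a x] by auto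
qed

lemma primeidealI':
  assumes "I \<subseteq> carrier R" "\<zero> \<in> I" "\<one> \<notin> I"
    and add: "\<And>a b. a \<in> I \<Longrightarrow> b \<in> I \<Longrightarrow> a \<oplus> b \<in> I"
    and mult: "\<And>a r. a \<in> I \<Longrightarrow> r \<in> carrier R \<Longrightarrow> r \<otimes> a \<in> I"
    and prime: "\<And>a b. a \<in> carrier R \<Longrightarrow> b \<in> carrier R \<Longrightarrow> a \<otimes> b \<in> I \<Longrightarrow> a \<in> I \<or> b \<in> I"
  shows "primeideal I R"
proof (rule primeidealI)
  show "ideal I R" using assms by (intro idealI')
  show "carrier R \<noteq> I" using assms(3) by auto
qed (use prime is_cring in auto)

lemma primeideal_add:
  assumes "ideal I R" "a \<in> I" "b \<in> I" shows "a \<oplus> b \<in> I"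
  using assms by (simp add: additive_subgroup.a_closed ideal.axioms(1))

lemma prime_ideal_mult_iff:
  assumes "primeideal P R" "a \<in> carrier R" "b \<in> carrier R"
  shows "a \<otimes> b \<in> P \<longleftrightarrow> a \<in> P \<or> b \<in> P"
  using primeideal.I_prime[OF assms] ideal.I_l_closed[OF primeideal.axioms(1)[OF assms(1)] _ assms(2)]
    ideal.I_r_closed[OF primeideal.axioms(1)[OF assms(1)] _ assms(3)] by auto

lemma prime_ideal_one: "primeideal P R \<Longrightarrow> \<one> \<notin> P"
  using ideal.one_imp_carrier[OF primeideal.axioms(1)] primeideal.I_notcarr by fastforce

lemma prime_ideal_Units:
  assumes "primeideal P R" "u \<in> Units R" shows "u \<notin> P"
  using prime_ideal_mult_iff[OF assms(1), of u "inv u"] prime_ideal_one[OF assms(1)] assms(2)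
  by auto

lemma Units_nat_pow: "u \<in> Units R \<Longrightarrow> u [^] (n::nat) \<in> Units R"
  by (induction n) auto

lemma Units_cancel_zero:
  assumes "u \<in> Units R" "x \<in> carrier R" "u \<otimes> x = \<zero>" shows "x = \<zero>"
proof -
  have "x = (inv u \<otimes> u) \<otimes> x" using assms by simp
  also have "\<dots> = inv u \<otimes> (u \<otimes> x)" by (rule m_assoc) (use assms in auto)
  also have "\<dots> = \<zero>" unfolding assms(3) using assms(1) by simp
  finally show ?thesis .
qed

end

lemma primeideal_vimage':
  assumes "cring R" "cring S" "f \<in> ring_hom R S" "primeideal Q S"
  shows "primeideal {r \<in> carrier R. f r \<in> Q} R"
proof -
  interpret h: ring_hom_cring R S f using assms by (intro ring_hom_cring.intro ring_hom_cring_axioms.intro)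
  show ?thesis
  proof (rule h.R.primeidealI')
    show "\<zero>\<^bsub>R\<^esub> \<in> {r \<in> carrier R. f r \<in> Q}"
      using additive_subgroup.zero_closed[OF ideal.axioms(1)[OF primeideal.axioms(1)[OF assms(4)]]] by simp
    show "\<one>\<^bsub>R\<^esub> \<notin> {r \<in> carrier R. f r \<in> Q}" using h.S.prime_ideal_one[OF assms(4)] by simp
  qed (auto simp: h.S.primeideal_add[OF primeideal.axioms(1)[OF assms(4)]] h.S.prime_ideal_mult_iff[OF assms(4)])
qed

lemma is_localizationD:
  assumes "is_localization A s B f"
  shows "f \<in> ring_hom A B" "f s \<in> Units B"
   "\<And>b. b \<in> carrier B \<Longrightarrow> \<exists>n::nat. \<exists>a\<in>carrier A. f s [^]\<^bsub>B\<^esub> n \<otimes>\<^bsub>B\<^esub> b = f a"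
   "\<And>a. a \<in> carrier A \<Longrightarrow> f a = \<zero>\<^bsub>B\<^esub> \<Longrightarrow> \<exists>n::nat. s [^]\<^bsub>A\<^esub> n \<otimes>\<^bsub>A\<^esub> a = \<zero>\<^bsub>A\<^esub>"
  using assms by (auto simp: is_localization_def)

text \<open>With $B = A_s$ and $t = a / s^n$, the ring $B_t$ is $A_{sa}$: the image of $s a$ in $B$
  differs from $t$ by the unit $s^{n+1}$.\<close>

lemma localization_trans:
  fixes n :: nat
  assumes A: "cring A" and B: "cring B" and C: "cring C"
    and AB: "is_localization A s B f" and s: "s \<in> carrier A" and a: "a \<in> carrier A" and t: "t \<in> carrier B"
    and eq: "f s [^]\<^bsub>B\<^esub> n \<otimes>\<^bsub>B\<^esub> t = f a"
    and AC: "is_localization A (s \<otimes>\<^bsub>A\<^esub> a) C h"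
    and g: "g \<in> ring_hom B C" and gf: "\<And>x. x \<in> carrier A \<Longrightarrow> h x = g (f x)"
  shows "is_localization B t C g"
proof -
  note AB' = is_localizationD[OF AB] and AC' = is_localizationD[OF AC]
  interpret f: ring_hom_cring A B f using A B AB'(1) by (intro ring_hom_cring.intro ring_hom_cring_axioms.intro)
  interpret g: ring_hom_cring B C g using B C g by (intro ring_hom_cring.intro ring_hom_cring_axioms.intro)
  interpret h: ring_hom_cring A C h using A C AC'(1) by (intro ring_hom_cring.intro ring_hom_cring_axioms.intro)
  define u where "u = f s"
  have u: "u \<in> Units B" "u \<in> carrier B" using AB'(2) unfolding u_def by auto
  have fsa: "f (s \<otimes>\<^bsub>A\<^esub> a) = (u \<otimes>\<^bsub>B\<^esub> u [^]\<^bsub>B\<^esub> n) \<otimes>\<^bsub>B\<^esub> t"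
    using s a t u(2) by (simp add: eq[symmetric] u_def f.S.m_assoc)
  have pw: "f (s \<otimes>\<^bsub>A\<^esub> a) [^]\<^bsub>B\<^esub> m = (u \<otimes>\<^bsub>B\<^esub> u [^]\<^bsub>B\<^esub> n) [^]\<^bsub>B\<^esub> m \<otimes>\<^bsub>B\<^esub> t [^]\<^bsub>B\<^esub> m" for m :: nat
    unfolding fsa using u t by (simp add: f.S.nat_pow_distrib)
  \<comment> \<open>The unit by which the $m$-th powers of \<open>f (s a)\<close> and of
    \<open>t\<close> differ. Dividing by it translates denominators of one localization into those
    of the other.\<close>
  define w where "w m = (u \<otimes>\<^bsub>B\<^esub> u [^]\<^bsub>B\<^esub> n) [^]\<^bsub>B\<^esub> (m::nat)" for m
  have w: "w m \<in> Units B" for m unfolding w_def using u by (intro f.S.Units_nat_pow f.S.Units_m_closed)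
  have wc: "w m \<in> carrier B" for m using w f.S.Units_closed by blast
  show ?thesis unfolding is_localization_def
  proof (intro conjI ballI impI)
    show "g t \<in> Units C"
    proof (rule g.S.unit_factor)
      have "h (s \<otimes>\<^bsub>A\<^esub> a) = g t \<otimes>\<^bsub>C\<^esub> g (u \<otimes>\<^bsub>B\<^esub> u [^]\<^bsub>B\<^esub> n)"
        using s a t u by (simp add: gf fsa g.S.m_comm del: h.hom_mult f.hom_mult)
      then show "g t \<otimes>\<^bsub>C\<^esub> g (u \<otimes>\<^bsub>B\<^esub> u [^]\<^bsub>B\<^esub> n) \<in> Units C" using AC'(2) by simp
    qed (use t u in auto)
  next
    fix c assume c: "c \<in> carrier C"
    obtain m :: nat and a' where m: "a' \<in> carrier A" "h (s \<otimes>\<^bsub>A\<^esub> a) [^]\<^bsub>C\<^esub> m \<otimes>\<^bsub>C\<^esub> c = h a'"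
      using AC'(3)[OF c] by blast
    have "h (s \<otimes>\<^bsub>A\<^esub> a) [^]\<^bsub>C\<^esub> m = g (w m) \<otimes>\<^bsub>C\<^esub> g t [^]\<^bsub>C\<^esub> m"
    proof -
      have "h (s \<otimes>\<^bsub>A\<^esub> a) [^]\<^bsub>C\<^esub> m = g (f (s \<otimes>\<^bsub>A\<^esub> a) [^]\<^bsub>B\<^esub> m)"
        using s a by (simp add: gf del: h.hom_mult f.hom_mult)
      also have "\<dots> = g (w m) \<otimes>\<^bsub>C\<^esub> g t [^]\<^bsub>C\<^esub> m"
        unfolding pw w_def[symmetric] using w[of m] wc[of m] t by simp
      finally show ?thesis .
    qed
    then have e: "g (w m) \<otimes>\<^bsub>C\<^esub> (g t [^]\<^bsub>C\<^esub> m \<otimes>\<^bsub>C\<^esub> c) = g (f a')"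
      using m w[of m] wc[of m] t c by (simp add: gf g.S.m_assoc)
    have "g t [^]\<^bsub>C\<^esub> m \<otimes>\<^bsub>C\<^esub> c = g (inv\<^bsub>B\<^esub> (w m) \<otimes>\<^bsub>B\<^esub> w m) \<otimes>\<^bsub>C\<^esub> (g t [^]\<^bsub>C\<^esub> m \<otimes>\<^bsub>C\<^esub> c)"
      using w[of m] wc[of m] t c by (simp del: g.hom_mult)
    also have "\<dots> = g (inv\<^bsub>B\<^esub> (w m)) \<otimes>\<^bsub>C\<^esub> (g (w m) \<otimes>\<^bsub>C\<^esub> (g t [^]\<^bsub>C\<^esub> m \<otimes>\<^bsub>C\<^esub> c))"
      using w[of m] wc[of m] t c by (subst g.hom_mult) (simp_all add: g.S.m_assoc)
    also have "\<dots> = g (inv\<^bsub>B\<^esub> (w m) \<otimes>\<^bsub>B\<^esub> f a')"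
      unfolding e using w[of m] m by simp
    finally show "\<exists>n::nat. \<exists>b\<in>carrier B. g t [^]\<^bsub>C\<^esub> n \<otimes>\<^bsub>C\<^esub> c = g b"
      using w[of m] wc[of m] m by (intro exI[of _ m] bexI[of _ "inv\<^bsub>B\<^esub> (w m) \<otimes>\<^bsub>B\<^esub> f a'"]) auto
  next
    fix b assume b: "b \<in> carrier B" "g b = \<zero>\<^bsub>C\<^esub>"
    obtain k :: nat and a' where k: "a' \<in> carrier A" "f s [^]\<^bsub>B\<^esub> k \<otimes>\<^bsub>B\<^esub> b = f a'"
      using AB'(3)[OF b(1)] by blast
    have "h a' = \<zero>\<^bsub>C\<^esub>"
    proof -
      have "h a' = g (f s [^]\<^bsub>B\<^esub> k \<otimes>\<^bsub>B\<^esub> b)" by (simp add: gf k)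
      also have "\<dots> = \<zero>\<^bsub>C\<^esub>" using b s by simp
      finally show ?thesis .
    qed
    then obtain m :: nat where m: "(s \<otimes>\<^bsub>A\<^esub> a) [^]\<^bsub>A\<^esub> m \<otimes>\<^bsub>A\<^esub> a' = \<zero>\<^bsub>A\<^esub>"
      using AC'(4)[OF k(1)] by blast
    have "f ((s \<otimes>\<^bsub>A\<^esub> a) [^]\<^bsub>A\<^esub> m \<otimes>\<^bsub>A\<^esub> a') = f (s \<otimes>\<^bsub>A\<^esub> a) [^]\<^bsub>B\<^esub> m \<otimes>\<^bsub>B\<^esub> f a'"
      using s a k by (simp del: f.hom_mult add: ring_hom_mult[OF AB'(1)] f.hom_pow[OF f.R.m_closed])
    then have "f (s \<otimes>\<^bsub>A\<^esub> a) [^]\<^bsub>B\<^esub> m \<otimes>\<^bsub>B\<^esub> (u [^]\<^bsub>B\<^esub> k \<otimes>\<^bsub>B\<^esub> b) = \<zero>\<^bsub>B\<^esub>"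
      unfolding m k(2)[folded u_def] by simp
    then have "(w m \<otimes>\<^bsub>B\<^esub> u [^]\<^bsub>B\<^esub> k) \<otimes>\<^bsub>B\<^esub> (t [^]\<^bsub>B\<^esub> m \<otimes>\<^bsub>B\<^esub> b) = \<zero>\<^bsub>B\<^esub>"
      unfolding pw w_def[symmetric] using w[of m] wc[of m] u t b by (simp add: f.S.m_ac)
    then have "t [^]\<^bsub>B\<^esub> m \<otimes>\<^bsub>B\<^esub> b = \<zero>\<^bsub>B\<^esub>"
      by (rule f.S.Units_cancel_zero[rotated 2]) (use w wc u t b in \<open>auto simp: f.S.Units_nat_pow\<close>)
    then show "\<exists>n::nat. t [^]\<^bsub>B\<^esub> n \<otimes>\<^bsub>B\<^esub> b = \<zero>\<^bsub>B\<^esub>" by blast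
  qed (rule g)
qed

context rspace
begin

text \<open>The points of $D(s)$ correspond to the primes of $A_s$, as these are the primes of $A$
  that avoid $s$. This is what makes the affine open sets a base of the topology of a
  scheme.\<close>

lemma affine_basic_open:
  assumes aff: "affine_open X U" and s: "s \<in> carrier (Sh X U)"
  shows "affine_open X (basic_open X U s)"
proof -
  define D where "D = basic_open X U s"
  define f where "f = Res X U D"
  have U: "op U" using affine_open aff .
  have D: "op D" "D \<subseteq> U" unfolding D_def using openin_basic_open[OF U s] by (auto simp: basic_open_def)
  have A: "cring (Sh X U)" and B: "cring (Sh X D)" using Sh_cring U D by auto
  note loc0 = affine_loc[OF aff s, folded D_def, folded f_def]
  note loc = is_localizationD[OF loc0]
  interpret f: ring_hom_cring "Sh X U" "Sh X D" f
    using A B loc(1) by (intro ring_hom_cring.intro ring_hom_cring_axioms.intro)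
  have fa: "germ_unit X x D (f a) \<longleftrightarrow> germ_unit X x U a" if "a \<in> carrier (Sh X U)" "x \<in> D" for a x
    unfolding f_def using germ_unit_Res U D that by simp
  have fsn: "f s [^]\<^bsub>Sh X D\<^esub> (n::nat) \<in> Units (Sh X D)" for n using loc(2) by (rule f.S.Units_nat_pow)
  have gb: "germ_unit X x D b \<longleftrightarrow> germ_unit X x U a"
    if "b \<in> carrier (Sh X D)" "a \<in> carrier (Sh X U)" "x \<in> D" "f s [^]\<^bsub>Sh X D\<^esub> (n::nat) \<otimes>\<^bsub>Sh X D\<^esub> b = f a" for a b x n
    using germ_unit_mult[OF D(1) that(3) f.S.Units_closed[OF fsn] that(1), of n] germ_unit_of_Unit[OF D(1) that(3) fsn, of n]
      fa[OF that(2,3)] that(4) by simp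
  note pU = affine_prime[OF aff]
  have prime: "primeideal (nonunits X D x) (Sh X D)" if x: "x \<in> D" for x
  proof (rule f.S.primeidealI')
    have xU: "x \<in> U" using x D by auto
    note P = pU[OF xU]
    have gu: "germ_unit X x D (c \<otimes>\<^bsub>Sh X D\<^esub> d) \<longleftrightarrow> germ_unit X x D c \<and> germ_unit X x D d"
      if "c \<in> carrier (Sh X D)" "d \<in> carrier (Sh X D)" for c d
      using germ_unit_mult D(1) x that by blast
    have "\<zero>\<^bsub>Sh X U\<^esub> \<in> nonunits X U x"
      using additive_subgroup.zero_closed[OF ideal.axioms(1)[OF primeideal.axioms(1)[OF P]]] .
    then show "\<zero>\<^bsub>Sh X D\<^esub> \<in> nonunits X D x"
      using fa[OF f.R.zero_closed x] by (simp add: nonunits_def)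
    show "\<one>\<^bsub>Sh X D\<^esub> \<notin> nonunits X D x"
      using germ_unit_of_Unit[OF D(1) x f.S.Units_one_closed] by (simp add: nonunits_def)
    fix b c assume bc: "b \<in> nonunits X D x"
    then have b: "b \<in> carrier (Sh X D)" "\<not> germ_unit X x D b" by (auto simp: nonunits_def)
    { assume "c \<in> carrier (Sh X D)"
      then show "c \<otimes>\<^bsub>Sh X D\<^esub> b \<in> nonunits X D x" using b gu by (auto simp: nonunits_def)
    }
    assume "c \<in> nonunits X D x"
    then have c: "c \<in> carrier (Sh X D)" "\<not> germ_unit X x D c" by (auto simp: nonunits_def)
    obtain n :: nat and a where a: "a \<in> carrier (Sh X U)" "f s [^]\<^bsub>Sh X D\<^esub> n \<otimes>\<^bsub>Sh X D\<^esub> b = f a"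
      using loc(3)[OF b(1)] by blast
    obtain m :: nat and a' where a': "a' \<in> carrier (Sh X U)" "f s [^]\<^bsub>Sh X D\<^esub> m \<otimes>\<^bsub>Sh X D\<^esub> c = f a'"
      using loc(3)[OF c(1)] by blast
    have "a \<in> nonunits X U x" "a' \<in> nonunits X U x"
      using gb[OF b(1) a(1) x a(2)] gb[OF c(1) a'(1) x a'(2)] b c a a' by (auto simp: nonunits_def)
    \<comment> \<open>A ringed space carries no locality axiom, so closure of non-units under
      addition is inherited from the prime ideal of sections over \<open>U\<close>. Over the common
      denominator $s^{n+m}$ the sum $b + c$ comes from $s^m a + s^n a'$.\<close>
    then have in_P: "s [^]\<^bsub>Sh X U\<^esub> m \<otimes>\<^bsub>Sh X U\<^esub> a \<oplus>\<^bsub>Sh X U\<^esub> s [^]\<^bsub>Sh X U\<^esub> n \<otimes>\<^bsub>Sh X U\<^esub> a' \<in> nonunits X U x"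
      using s by (intro f.R.primeideal_add[OF primeideal.axioms(1)[OF P]] ideal.I_l_closed[OF primeideal.axioms(1)[OF P]]) auto
    have "f (s [^]\<^bsub>Sh X U\<^esub> m \<otimes>\<^bsub>Sh X U\<^esub> a \<oplus>\<^bsub>Sh X U\<^esub> s [^]\<^bsub>Sh X U\<^esub> n \<otimes>\<^bsub>Sh X U\<^esub> a') =
      f s [^]\<^bsub>Sh X D\<^esub> m \<otimes>\<^bsub>Sh X D\<^esub> f a \<oplus>\<^bsub>Sh X D\<^esub> f s [^]\<^bsub>Sh X D\<^esub> n \<otimes>\<^bsub>Sh X D\<^esub> f a'"
      using s a a' by simp
    also have "\<dots> = f s [^]\<^bsub>Sh X D\<^esub> (n + m) \<otimes>\<^bsub>Sh X D\<^esub> (b \<oplus>\<^bsub>Sh X D\<^esub> c)"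
      using s b c by (simp add: a(2)[symmetric] a'(2)[symmetric] f.S.r_distr f.S.l_distr f.S.m_ac f.S.nat_pow_mult[symmetric])
    finally have "\<not> germ_unit X x D (b \<oplus>\<^bsub>Sh X D\<^esub> c)"
      using gb[of "b \<oplus>\<^bsub>Sh X D\<^esub> c" "s [^]\<^bsub>Sh X U\<^esub> m \<otimes>\<^bsub>Sh X U\<^esub> a \<oplus>\<^bsub>Sh X U\<^esub> s [^]\<^bsub>Sh X U\<^esub> n \<otimes>\<^bsub>Sh X U\<^esub> a'" x "n + m"]
        in_P b c a a' s x by (simp add: nonunits_def)
    then show "b \<oplus>\<^bsub>Sh X D\<^esub> c \<in> nonunits X D x" using b c by (simp add: nonunits_def)
  next
    fix b c assume "b \<in> carrier (Sh X D)" "c \<in> carrier (Sh X D)" "b \<otimes>\<^bsub>Sh X D\<^esub> c \<in> nonunits X D x"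
    then show "b \<in> nonunits X D x \<or> c \<in> nonunits X D x"
      using germ_unit_mult[OF D(1) x, of b c] by (simp add: nonunits_def)
  qed (auto simp: nonunits_def)
  have "affine_open X D"
  proof (rule affine_openI[OF D(1) prime])
    have nu: "a \<in> nonunits X U x \<longleftrightarrow> a \<in> carrier (Sh X U) \<and> f a \<in> nonunits X D x" if "x \<in> D" for a x
      using fa[of a x] that by (auto simp: nonunits_def)
    show "inj_on (nonunits X D) D"
    proof (rule inj_onI)
      fix x y assume xy: "x \<in> D" "y \<in> D" "nonunits X D x = nonunits X D y"
      then have "nonunits X U x = nonunits X U y" using nu by blast
      then show "x = y" using inj_onD[OF affine_inj[OF aff]] xy D by blast
    qed
    fix Q assume Q: "primeideal Q (Sh X D)"
    have "primeideal {a \<in> carrier (Sh X U). f a \<in> Q} (Sh X U)"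
      by (rule primeideal_vimage'[OF A B loc(1) Q])
    then obtain x where x: "x \<in> U" "{a \<in> carrier (Sh X U). f a \<in> Q} = nonunits X U x"
      using affine_surj[OF aff] by blast
    have "f s \<notin> Q" using f.S.prime_ideal_Units[OF Q loc(2)] .
    then have "s \<notin> nonunits X U x" using x(2) by blast
    then have xD: "x \<in> D" using x s by (auto simp: nonunits_def D_def basic_open_def)
    have "b \<in> Q \<longleftrightarrow> b \<in> nonunits X D x" if b: "b \<in> carrier (Sh X D)" for b
    proof -
      obtain n :: nat and a where a: "a \<in> carrier (Sh X U)" "f s [^]\<^bsub>Sh X D\<^esub> n \<otimes>\<^bsub>Sh X D\<^esub> b = f a"
        using loc(3)[OF b] by blast
      have "b \<in> Q \<longleftrightarrow> f a \<in> Q"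
        using f.S.prime_ideal_mult_iff[OF Q f.S.Units_closed[OF fsn] b, of n] f.S.prime_ideal_Units[OF Q fsn, of n] a by simp
      also have "\<dots> \<longleftrightarrow> a \<in> nonunits X U x" using x(2) a(1) by blast
      also have "\<dots> \<longleftrightarrow> b \<in> nonunits X D x"
        using gb[OF b a(1) xD a(2)] a b by (simp add: nonunits_def)
      finally show ?thesis .
    qed
    moreover have "Q \<subseteq> carrier (Sh X D)"
      using ideal.Icarr[OF primeideal.axioms(1)[OF Q]] by blast
    ultimately show "\<exists>x\<in>D. Q = nonunits X D x" using xD by (intro bexI[of _ x]) (auto simp: nonunits_def)
  next
    fix W x assume W: "op W" "x \<in> W" "W \<subseteq> D"
    then obtain t where t: "t \<in> carrier (Sh X U)" "x \<in> basic_open X U t" "basic_open X U t \<subseteq> W"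
      using affine_basis[OF aff, of W x] D by blast
    show "\<exists>s\<in>carrier (Sh X D). x \<in> basic_open X D s \<and> basic_open X D s \<subseteq> W"
      by (rule bexI[of _ "f t"]) (use t W D in \<open>auto simp: f_def basic_open_Res[OF U D t(1)] Res_closed U\<close>)
  next
    fix t assume t: "t \<in> carrier (Sh X D)"
    obtain n :: nat and a where a: "a \<in> carrier (Sh X U)" "f s [^]\<^bsub>Sh X D\<^esub> n \<otimes>\<^bsub>Sh X D\<^esub> t = f a"
      using loc(3)[OF t] by blast
    let ?E = "basic_open X D t"
    have E: "?E = basic_open X U (s \<otimes>\<^bsub>Sh X U\<^esub> a)"
      using gb[OF t a(1) _ a(2)] D(2) unfolding basic_open_mult[OF U s a(1)] D_def[symmetric]
      by (auto simp: basic_open_def)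
    have oE: "op ?E" "?E \<subseteq> D" using openin_basic_open[OF D(1) t] by (auto simp: basic_open_def)
    show "is_localization (Sh X D) t (Sh X ?E) (Res X D ?E)"
    proof (rule localization_trans[OF A B Sh_cring[OF oE(1)] loc0 s a(1) t a(2)])
      show "is_localization (Sh X U) (s \<otimes>\<^bsub>Sh X U\<^esub> a) (Sh X ?E) (Res X U ?E)"
        unfolding E by (rule affine_loc[OF aff]) (use s a in simp)
      show "Res X D ?E \<in> ring_hom (Sh X D) (Sh X ?E)" using Res_hom D oE by simp
      show "Res X U ?E x = Res X D ?E (f x)" if "x \<in> carrier (Sh X U)" for x
        unfolding f_def using Res_comp U D oE that by simp
    qed
  qed
  then show ?thesis unfolding D_def .
qed

end

locale scheme = fixes X :: "('x, 'r, 'z) ringed_space_scheme" assumes sch: "is_scheme X"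

sublocale scheme \<subseteq> rspace using sch by unfold_locales (simp add: is_scheme_def)

context scheme begin

lemma affine_nbhd:
  assumes "op V" "x \<in> V"
  obtains U where "affine_open X U" "x \<in> U" "U \<subseteq> V"
proof -
  have "x \<in> topspace (Top X)" using assms openin_subset by blast
  then obtain W where W: "affine_open X W" "x \<in> W" using sch by (auto simp: is_scheme_def)
  have o: "op (W \<inter> V)" using affine_open[OF W(1)] assms by (simp add: openin_Int)
  obtain s where s: "s \<in> carrier (Sh X W)" "x \<in> basic_open X W s" "basic_open X W s \<subseteq> W \<inter> V"
    using affine_basis[OF W(1) o] W assms by blast
  show thesis by (rule that[OF affine_basic_open[OF W(1) s(1)] s(2)]) (use s in blast)
qed

end

section \<open>Lifting the structure sheaf\<close>

lemma (in cring) minus_eq_zeroD: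
  assumes "a \<ominus> b = \<zero>" "a \<in> carrier R" "b \<in> carrier R"
  shows "a = b"
proof -
  have "a = (a \<ominus> b) \<oplus> b" using assms(2,3) by (simp add: minus_eq a_assoc l_neg)
  then show ?thesis using assms by simp
qed

lemma (in cring) ex_primeideal:
  assumes I: "ideal I R" and one: "\<one> \<notin> I"
  shows "\<exists>P. primeideal P R \<and> I \<subseteq> P"
proof -
  define \<A> where "\<A> = {J. ideal J R \<and> I \<subseteq> J \<and> \<one> \<notin> J}"
  have "\<exists>M\<in>\<A>. \<forall>J\<in>\<A>. M \<subseteq> J \<longrightarrow> J = M"
  proof (rule subset_Zorn_nonempty)
    show "\<A> \<noteq> {}" using assms by (auto simp: \<A>_def)
    fix C assume C: "C \<noteq> {}" "subset.chain \<A> C"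
    then have CA: "C \<subseteq> \<A>" by (simp add: subset_chain_def)
    have "ideal (\<Union>C) R"
    proof (rule idealI')
      have id: "ideal J R" if "J \<in> C" for J using that CA by (auto simp: \<A>_def)
      show "\<Union>C \<subseteq> carrier R" using ideal.Icarr[OF id] by auto
      obtain J where "J \<in> C" using C(1) by blast
      then show "\<zero> \<in> \<Union>C"
        using additive_subgroup.zero_closed[OF ideal.axioms(1)[OF id]] by blast
      fix a b assume a: "a \<in> \<Union>C"
      then obtain J where J: "J \<in> C" "a \<in> J" by blast
      { assume "b \<in> carrier R"
        then show "b \<otimes> a \<in> \<Union>C" using ideal.I_l_closed[OF id[OF J(1)] J(2), of b] J(1) by auto
      }
      assume "b \<in> \<Union>C"
      then obtain J' where J': "J' \<in> C" "b \<in> J'" by blast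
      have "J \<subseteq> J' \<or> J' \<subseteq> J" using C(2) J(1) J'(1) by (auto simp: subset_chain_def)
      then obtain K where "K \<in> C" "a \<in> K" "b \<in> K" using J J' by blast
      then show "a \<oplus> b \<in> \<Union>C" using primeideal_add[OF id[of K], of a b] by auto
    qed
    then show "\<Union>C \<in> \<A>" using C(1) CA unfolding \<A>_def by auto
  qed
  then obtain M where M: "ideal M R" "I \<subseteq> M" "\<one> \<notin> M" and max: "\<And>J. J \<in> \<A> \<Longrightarrow> M \<subseteq> J \<Longrightarrow> J = M"
    unfolding \<A>_def by auto
  have "maximalideal M R"
  proof (rule maximalidealI[OF M(1)])
    show "carrier R \<noteq> M" using M(3) by auto
    fix J assume J: "ideal J R" "M \<subseteq> J" "J \<subseteq> carrier R"
    show "J = M \<or> J = carrier R"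
    proof (cases "\<one> \<in> J")
      case True
      then show ?thesis using ideal.one_imp_carrier[OF J(1)] by simp
    next
      case False
      then have "J \<in> \<A>" using J M by (auto simp: \<A>_def)
      then show ?thesis using max J by simp
    qed
  qed
  then show ?thesis using maximalideal_prime M(2) by blast
qed

text \<open>A sheaf of rings \<open>Z\<close> on the space of \<open>X\<close> with a map \<open>em\<close> to the structure sheaf whose
  kernel \<open>p Z\<close> is identified by \<open>j\<close> with the structure sheaf.\<close>

locale lift_space = X: scheme X
  for X :: "('x, 'r, 'z) ringed_space_scheme" +
  fixes p :: nat and Z :: "('x, 't, 'w) ringed_space_scheme"
    and em :: "'x set \<Rightarrow> 't \<Rightarrow> 'r" and j :: "'x set \<Rightarrow> 'r \<Rightarrow> 't"
  assumes rsZ: "is_ringed_space Z" and Top_Z: "Top Z = Top X"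
    and ext: "openin (Top X) U \<Longrightarrow> p_ext p (Sh Z U) (Sh X U) (em U) (j U)"
    and em_Res: "\<And>U V s. openin (Top X) U \<Longrightarrow> openin (Top X) V \<Longrightarrow> V \<subseteq> U \<Longrightarrow> s \<in> carrier (Sh Z U) \<Longrightarrow>
       em V (Res Z U V s) = Res X U V (em U s)"
    and j_Res: "\<And>U V a. openin (Top X) U \<Longrightarrow> openin (Top X) V \<Longrightarrow> V \<subseteq> U \<Longrightarrow> a \<in> carrier (Sh X U) \<Longrightarrow>
       j V (Res X U V a) = Res Z U V (j U a)"
    and surjA: "affine_open X U \<Longrightarrow> em U ` carrier (Sh Z U) = carrier (Sh X U)"
begin

sublocale Z: rspace Z by unfold_locales (rule rsZ)

lemma op_Z [simp]: "openin (Top Z) = openin (Top X)" by (simp add: Top_Z)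

lemma ext_surj: "affine_open X U \<Longrightarrow> p_ext_surj p (Sh Z U) (Sh X U) (em U) (j U)"
  by (intro p_ext_surj.intro p_ext_surj_axioms.intro ext surjA X.affine_open)

lemma em_hom: "openin (Top X) U \<Longrightarrow> em U \<in> ring_hom (Sh Z U) (Sh X U)"
  using p_ext.em[OF ext] .

lemma em_closed: "openin (Top X) U \<Longrightarrow> s \<in> carrier (Sh Z U) \<Longrightarrow> em U s \<in> carrier (Sh X U)"
  using em_hom ring_hom_closed by metis

text \<open>After shrinking to an affine neighbourhood the reduction is onto, and units lift along
  it. Hence basic open sets and the ideals of points are the same for both sheaves.\<close>

lemma germ_unit_em:
  assumes U: "openin (Top X) U" and x: "x \<in> U" and s: "s \<in> carrier (Sh Z U)"
  shows "germ_unit X x U (em U s) \<longleftrightarrow> germ_unit Z x U s"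
proof
  assume "germ_unit X x U (em U s)"
  then obtain W where W: "openin (Top X) W" "x \<in> W" "W \<subseteq> U" "Res X U W (em U s) \<in> Units (Sh X W)"
    unfolding germ_unit_def by blast
  obtain V where V: "affine_open X V" "x \<in> V" "V \<subseteq> W" using X.affine_nbhd W by blast
  have oV: "openin (Top X) V" using X.affine_open V by blast
  interpret V: p_ext_surj p "Sh Z V" "Sh X V" "em V" "j V" using ext_surj V by blast
  have "Res X W V (Res X U W (em U s)) \<in> Units (Sh X V)"
    by (rule ring_hom_Units[OF X.Sh_cring X.Sh_cring X.Res_hom]) (use W V oV in auto)
  then have "em V (Res Z U V s) \<in> Units (Sh X V)"
    using U V W oV s by (simp add: em_Res X.Res_comp em_closed)
  then have "Res Z U V s \<in> Units (Sh Z V)"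
    using U V W oV s by (intro V.unit_of_surj V.surj Z.Res_closed) auto
  then show "germ_unit Z x U s" unfolding germ_unit_def using oV V W by auto
next
  assume "germ_unit Z x U s"
  then obtain W where W: "openin (Top X) W" "x \<in> W" "W \<subseteq> U" "Res Z U W s \<in> Units (Sh Z W)"
    unfolding germ_unit_def op_Z by blast
  interpret W: p_ext p "Sh Z W" "Sh X W" "em W" "j W" using ext W by blast
  have "em W (Res Z U W s) \<in> Units (Sh X W)" using W W.unit_em by blast
  then show "germ_unit X x U (em U s)" unfolding germ_unit_def using W em_Res U s by auto
qed

lemma basic_open_em:
  "openin (Top X) U \<Longrightarrow> s \<in> carrier (Sh Z U) \<Longrightarrow> basic_open Z U s = basic_open X U (em U s)"
  unfolding basic_open_def using germ_unit_em by blast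

lemma nonunits_em:
  "openin (Top X) U \<Longrightarrow> x \<in> U \<Longrightarrow> nonunits Z U x = {s \<in> carrier (Sh Z U). em U s \<in> nonunits X U x}"
  unfolding nonunits_def using germ_unit_em em_closed by blast

text \<open>The kernel of \<open>em\<close> has square zero and so lies in every prime, which
  identifies the two spectra. The localization property is checked first for the reduction and then
  for the remaining part in the kernel, both being governed by the structure sheaf.\<close>

lemma affine_lift:
  assumes aff: "affine_open X U"
  shows "affine_open Z U"
proof (rule Z.affine_openI; (unfold op_Z)?)
  have U: "openin (Top X) U" using X.affine_open aff .
  interpret U: p_ext_surj p "Sh Z U" "Sh X U" "em U" "j U" using ext_surj aff by blast
  show "openin (Top X) U" by fact
  show "primeideal (nonunits Z U x) (Sh Z U)" if "x \<in> U" for x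
    unfolding nonunits_em[OF U that]
    by (rule primeideal_vimage'[OF U.S U.A U.em X.affine_prime[OF aff that]])
  have inj: "a \<in> nonunits X U x \<longleftrightarrow> (\<exists>s \<in> nonunits Z U x. a = em U s)" if "x \<in> U" for x a
    unfolding nonunits_em[OF U that] using U.surjE[of a] by (auto simp: nonunits_def)
  show "inj_on (nonunits Z U) U"
  proof (rule inj_onI)
    fix x y assume "x \<in> U" "y \<in> U" "nonunits Z U x = nonunits Z U y"
    then show "x = y" using inj inj_onD[OF X.affine_inj[OF aff], of x y] by blast
  qed
  show "\<exists>x\<in>U. Q = nonunits Z U x" if Q: "primeideal Q (Sh Z U)" for Q
  proof -
    have Qc: "Q \<subseteq> carrier (Sh Z U)" using ideal.Icarr[OF primeideal.axioms(1)[OF Q]] by blast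
    have zQ: "\<zero>\<^bsub>Sh Z U\<^esub> \<in> Q"
      using additive_subgroup.zero_closed[OF ideal.axioms(1)[OF primeideal.axioms(1)[OF Q]]] .
    have jQ: "j U a \<in> Q" if "a \<in> carrier (Sh X U)" for a
      using U.S.prime_ideal_mult_iff[OF Q, of "j U a" "j U a"] that zQ by (simp add: U.j_closed U.j_j)
    have emQ: "em U s \<in> em U ` Q \<longleftrightarrow> s \<in> Q" if s: "s \<in> carrier (Sh Z U)" for s
    proof
      assume "em U s \<in> em U ` Q"
      then obtain q where q: "q \<in> Q" "em U s = em U q" by blast
      then obtain a where "a \<in> carrier (Sh X U)" "s = q \<oplus>\<^bsub>Sh Z U\<^esub> j U a"
        using U.em_eqE[OF s] Qc by blast
      then show "s \<in> Q" using U.S.primeideal_add[OF primeideal.axioms(1)[OF Q]] q jQ by simp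
    qed simp
    have "primeideal (em U ` Q) (Sh X U)"
    proof (rule U.A.primeidealI')
      show "em U ` Q \<subseteq> carrier (Sh X U)" using Qc by auto
      show "\<zero>\<^bsub>Sh X U\<^esub> \<in> em U ` Q" using emQ[OF U.S.zero_closed] zQ by simp
      show "\<one>\<^bsub>Sh X U\<^esub> \<notin> em U ` Q" using emQ[OF U.S.one_closed] U.S.prime_ideal_one[OF Q] by simp
      fix a b assume a: "a \<in> em U ` Q"
      then obtain s where s: "s \<in> Q" "s \<in> carrier (Sh Z U)" "a = em U s" using Qc by blast
      { assume "b \<in> em U ` Q"
        then obtain t where t: "t \<in> Q" "t \<in> carrier (Sh Z U)" "b = em U t" using Qc by blast
        have "em U (s \<oplus>\<^bsub>Sh Z U\<^esub> t) \<in> em U ` Q"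
          using U.S.primeideal_add[OF primeideal.axioms(1)[OF Q]] s t by blast
        then show "a \<oplus>\<^bsub>Sh X U\<^esub> b \<in> em U ` Q" using s t by simp
      }
      assume "b \<in> carrier (Sh X U)"
      then obtain t where t: "t \<in> carrier (Sh Z U)" "b = em U t" using U.surjE by blast
      have "em U (t \<otimes>\<^bsub>Sh Z U\<^esub> s) \<in> em U ` Q"
        using U.S.prime_ideal_mult_iff[OF Q t(1) s(2)] s by blast
      then show "b \<otimes>\<^bsub>Sh X U\<^esub> a \<in> em U ` Q" using s t by simp
    next
      fix a b assume ab: "a \<in> carrier (Sh X U)" "b \<in> carrier (Sh X U)" "a \<otimes>\<^bsub>Sh X U\<^esub> b \<in> em U ` Q"
      then obtain s t where st: "s \<in> carrier (Sh Z U)" "a = em U s" "t \<in> carrier (Sh Z U)" "b = em U t"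
        using U.surjE by metis
      then show "a \<in> em U ` Q \<or> b \<in> em U ` Q"
        using ab(3) emQ[of s] emQ[of t] emQ[of "s \<otimes>\<^bsub>Sh Z U\<^esub> t"] U.S.prime_ideal_mult_iff[OF Q st(1) st(3)] by simp
    qed
    then obtain x where x: "x \<in> U" "em U ` Q = nonunits X U x" using X.affine_surj[OF aff] by blast
    then have "Q = nonunits Z U x" unfolding nonunits_em[OF U x(1)] x(2)[symmetric] using emQ Qc by blast
    then show ?thesis using x by blast
  qed
  show "\<exists>s\<in>carrier (Sh Z U). x \<in> basic_open Z U s \<and> basic_open Z U s \<subseteq> W"
    if W: "openin (Top X) W" "x \<in> W" "W \<subseteq> U" for W x
  proof -
    obtain a where a: "a \<in> carrier (Sh X U)" "x \<in> basic_open X U a" "basic_open X U a \<subseteq> W"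
      using X.affine_basis[OF aff W] by blast
    then obtain s where "s \<in> carrier (Sh Z U)" "a = em U s" using U.surjE by blast
    then show ?thesis using a basic_open_em[OF U] by blast
  qed
  show "is_localization (Sh Z U) s (Sh Z (basic_open Z U s)) (Res Z U (basic_open Z U s))"
    if s: "s \<in> carrier (Sh Z U)" for s
  proof -
    define D where "D = basic_open Z U s"
    have DX: "D = basic_open X U (em U s)" unfolding D_def by (rule basic_open_em[OF U s])
    have aD: "affine_open X D" unfolding DX by (rule X.affine_basic_open[OF aff]) (use s in auto)
    have oD: "openin (Top X) D" "D \<subseteq> U" using X.affine_open[OF aD] by (auto simp: D_def basic_open_def)
    interpret D: p_ext_surj p "Sh Z D" "Sh X D" "em D" "j D" using ext_surj aD by blast
    interpret f: ring_hom_cring "Sh Z U" "Sh Z D" "Res Z U D"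
      using Z.Res_ring_hom U oD by simp
    interpret g: ring_hom_cring "Sh X U" "Sh X D" "Res X U D"
      using X.Res_ring_hom U oD by simp
    have "em U s \<in> carrier (Sh X U)" using s by simp
    note loc = is_localizationD[OF X.affine_loc[OF aff this, folded DX]]
    have eR: "em D (Res Z U D t) = Res X U D (em U t)" if "t \<in> carrier (Sh Z U)" for t
      using em_Res U oD that by blast
    have jR: "j D (Res X U D a) = Res Z U D (j U a)" if "a \<in> carrier (Sh X U)" for a
      using j_Res U oD that by blast
    let ?s = "Res Z U D s"
    show ?thesis unfolding D_def[symmetric] is_localization_def
    proof (intro conjI ballI impI)
      show "?s \<in> Units (Sh Z D)"
        by (rule D.unit_of_surj[OF _ _ D.surj]) (use s loc(2) in \<open>auto simp: eR\<close>)
    next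
      fix b assume b: "b \<in> carrier (Sh Z D)"
      then have "em D b \<in> carrier (Sh X D)" by simp
      then obtain n :: nat and a' where n0: "a' \<in> carrier (Sh X U)"
         "Res X U D (em U s) [^]\<^bsub>Sh X D\<^esub> n \<otimes>\<^bsub>Sh X D\<^esub> em D b = Res X U D a'"
        using loc(3) by blast
      then obtain a where a: "a \<in> carrier (Sh Z U)" "a' = em U a" using U.surjE by blast
      \<comment> \<open>Clearing denominators of the reduction leaves an error \<open>j D c\<close>.
        A second power of \<open>s\<close> clears the denominator of \<open>c\<close>, so the
        product comes from a section over \<open>U\<close>.\<close>
      have "em D (?s [^]\<^bsub>Sh Z D\<^esub> n \<otimes>\<^bsub>Sh Z D\<^esub> b) = em D (Res Z U D a)"
        using s a b n0 by (simp add: eR)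
      then obtain c where c: "c \<in> carrier (Sh X D)"
        "?s [^]\<^bsub>Sh Z D\<^esub> n \<otimes>\<^bsub>Sh Z D\<^esub> b = Res Z U D a \<oplus>\<^bsub>Sh Z D\<^esub> j D c"
        by (rule D.em_eqE[rotated 2]) (use s a b in auto)
      obtain m :: nat and d where d: "d \<in> carrier (Sh X U)"
         "Res X U D (em U s) [^]\<^bsub>Sh X D\<^esub> m \<otimes>\<^bsub>Sh X D\<^esub> c = Res X U D d"
        using loc(3)[OF c(1)] by blast
      have sm: "?s [^]\<^bsub>Sh Z D\<^esub> m \<otimes>\<^bsub>Sh Z D\<^esub> j D c = Res Z U D (j U d)"
        using D.j_mult[of "?s [^]\<^bsub>Sh Z D\<^esub> m" c] s c d by (simp add: eR jR)
      have "?s [^]\<^bsub>Sh Z D\<^esub> (m + n) \<otimes>\<^bsub>Sh Z D\<^esub> b = ?s [^]\<^bsub>Sh Z D\<^esub> m \<otimes>\<^bsub>Sh Z D\<^esub> (?s [^]\<^bsub>Sh Z D\<^esub> n \<otimes>\<^bsub>Sh Z D\<^esub> b)"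
        using s b by (simp add: D.S.nat_pow_mult[symmetric] D.S.m_assoc)
      also have "\<dots> = Res Z U D (s [^]\<^bsub>Sh Z U\<^esub> m \<otimes>\<^bsub>Sh Z U\<^esub> a \<oplus>\<^bsub>Sh Z U\<^esub> j U d)"
        unfolding c(2) using s a c d by (simp add: D.S.r_distr sm D.j_closed U.j_closed)
      finally show "\<exists>n::nat. \<exists>a\<in>carrier (Sh Z U). ?s [^]\<^bsub>Sh Z D\<^esub> n \<otimes>\<^bsub>Sh Z D\<^esub> b = Res Z U D a"
        by (rule exI[where x="m + n", OF bexI[where x="s [^]\<^bsub>Sh Z U\<^esub> m \<otimes>\<^bsub>Sh Z U\<^esub> a \<oplus>\<^bsub>Sh Z U\<^esub> j U d"]])
           (use s a d in \<open>auto simp: U.j_closed\<close>)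
    next
      fix a assume a: "a \<in> carrier (Sh Z U)" "Res Z U D a = \<zero>\<^bsub>Sh Z D\<^esub>"
      \<comment> \<open>A power of \<open>s\<close> annihilates the reduction and moves
        \<open>a\<close> into the kernel, where it is \<open>j U c\<close>. As \<open>j\<close> is
        injective, \<open>c\<close> dies on \<open>D\<close>, and another power of \<open>s\<close>
        annihilates it.\<close>
      have "Res X U D (em U a) = \<zero>\<^bsub>Sh X D\<^esub>" using eR[OF a(1)] a(2) by simp
      moreover have "em U a \<in> carrier (Sh X U)" using a by simp
      ultimately obtain n :: nat where n: "em U s [^]\<^bsub>Sh X U\<^esub> n \<otimes>\<^bsub>Sh X U\<^esub> em U a = \<zero>\<^bsub>Sh X U\<^esub>"
        using loc(4) by blast
      then have "em U (s [^]\<^bsub>Sh Z U\<^esub> n \<otimes>\<^bsub>Sh Z U\<^esub> a) = \<zero>\<^bsub>Sh X U\<^esub>" using s a by simp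
      then obtain c where c: "c \<in> carrier (Sh X U)" "s [^]\<^bsub>Sh Z U\<^esub> n \<otimes>\<^bsub>Sh Z U\<^esub> a = j U c"
        using U.ker[of "s [^]\<^bsub>Sh Z U\<^esub> n \<otimes>\<^bsub>Sh Z U\<^esub> a"] s a by auto
      have "j D (Res X U D c) = Res Z U D (s [^]\<^bsub>Sh Z U\<^esub> n \<otimes>\<^bsub>Sh Z U\<^esub> a)" unfolding c(2) by (rule jR[OF c(1)])
      also have "\<dots> = \<zero>\<^bsub>Sh Z D\<^esub>" using s a by simp
      finally have "Res X U D c = \<zero>\<^bsub>Sh X D\<^esub>" using D.j_eq_zero c(1) by simp
      then obtain m :: nat where m: "em U s [^]\<^bsub>Sh X U\<^esub> m \<otimes>\<^bsub>Sh X U\<^esub> c = \<zero>\<^bsub>Sh X U\<^esub>"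
        using loc(4)[OF c(1)] by blast
      have "s [^]\<^bsub>Sh Z U\<^esub> (m + n) \<otimes>\<^bsub>Sh Z U\<^esub> a = s [^]\<^bsub>Sh Z U\<^esub> m \<otimes>\<^bsub>Sh Z U\<^esub> j U c"
        unfolding c(2)[symmetric] using s a by (simp add: U.S.nat_pow_mult[symmetric] U.S.m_assoc)
      also have "\<dots> = \<zero>\<^bsub>Sh Z U\<^esub>"
        using U.j_mult[of "s [^]\<^bsub>Sh Z U\<^esub> m" c] s c m by simp
      finally show "\<exists>n::nat. s [^]\<^bsub>Sh Z U\<^esub> n \<otimes>\<^bsub>Sh Z U\<^esub> a = \<zero>\<^bsub>Sh Z U\<^esub>" by blast
    qed (use f.homh in simp)
  qed
qed

lemma lift_is_scheme: "is_scheme Z"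
  unfolding is_scheme_def
proof (intro conjI ballI rsZ)
  fix x assume "x \<in> topspace (Top Z)"
  then obtain U where "affine_open X U" "x \<in> U" using X.sch by (auto simp: is_scheme_def Top_Z)
  then show "\<exists>U. affine_open Z U \<and> x \<in> U" using affine_lift by blast
qed

text \<open>An affine open set of the lift is not known to be affine in \<open>X\<close>, so
  \<open>surjA\<close> does not apply. Instead, the functions whose multiple of a given section
  lifts form an ideal, and near every point a power of a function not vanishing there lies in it;
  hence it contains 1.\<close>

lemma em_surj_affine_lift:
  assumes aff: "affine_open Z V"
  shows "em V ` carrier (Sh Z V) = carrier (Sh X V)"
proof -
  have V: "openin (Top X) V" using Z.affine_open[OF aff] by simp
  interpret V: p_ext p "Sh Z V" "Sh X V" "em V" "j V" using ext V by blast
  have "a \<in> em V ` carrier (Sh Z V)" if a: "a \<in> carrier (Sh X V)" for a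
  proof -
    \<comment> \<open>The denominators of \<open>a\<close>: the functions that make it liftable. The
      section lifts as soon as 1 belongs to this ideal.\<close>
    define I where "I = {r \<in> carrier (Sh Z V). \<exists>t\<in>carrier (Sh Z V). em V r \<otimes>\<^bsub>Sh X V\<^esub> a = em V t}"
    have ide: "ideal I (Sh Z V)"
    proof (rule V.S.idealI')
      fix r x assume r: "r \<in> I"
      then obtain t where t: "t \<in> carrier (Sh Z V)" "r \<in> carrier (Sh Z V)" "em V r \<otimes>\<^bsub>Sh X V\<^esub> a = em V t"
        by (auto simp: I_def)
      { assume x: "x \<in> carrier (Sh Z V)"
        then have "em V (x \<otimes>\<^bsub>Sh Z V\<^esub> r) \<otimes>\<^bsub>Sh X V\<^esub> a = em V (x \<otimes>\<^bsub>Sh Z V\<^esub> t)"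
          using t a by (simp add: V.A.m_assoc)
        then show "x \<otimes>\<^bsub>Sh Z V\<^esub> r \<in> I" unfolding I_def using t x by blast
      }
      assume "x \<in> I"
      then obtain t' where t': "t' \<in> carrier (Sh Z V)" "x \<in> carrier (Sh Z V)" "em V x \<otimes>\<^bsub>Sh X V\<^esub> a = em V t'"
        by (auto simp: I_def)
      have "em V (r \<oplus>\<^bsub>Sh Z V\<^esub> x) \<otimes>\<^bsub>Sh X V\<^esub> a = em V (t \<oplus>\<^bsub>Sh Z V\<^esub> t')"
        using t t' a by (simp add: V.A.l_distr)
      moreover have "r \<oplus>\<^bsub>Sh Z V\<^esub> x \<in> carrier (Sh Z V)" "t \<oplus>\<^bsub>Sh Z V\<^esub> t' \<in> carrier (Sh Z V)"
        using t t' by simp_all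
      ultimately show "r \<oplus>\<^bsub>Sh Z V\<^esub> x \<in> I" unfolding I_def by blast
    next
      have "em V \<zero>\<^bsub>Sh Z V\<^esub> \<otimes>\<^bsub>Sh X V\<^esub> a = em V \<zero>\<^bsub>Sh Z V\<^esub>" using a by simp
      then show "\<zero>\<^bsub>Sh Z V\<^esub> \<in> I" unfolding I_def using V.S.zero_closed by blast
    qed (auto simp: I_def)
    have "\<one>\<^bsub>Sh Z V\<^esub> \<in> I"
    proof (rule ccontr)
      assume "\<one>\<^bsub>Sh Z V\<^esub> \<notin> I"
      then obtain M where M: "primeideal M (Sh Z V)" "I \<subseteq> M" using V.S.ex_primeideal ide by blast
      then obtain x where x: "x \<in> V" "M = nonunits Z V x" using Z.affine_surj[OF aff] by blast
      obtain W where W: "affine_open X W" "x \<in> W" "W \<subseteq> V" using X.affine_nbhd V x by blast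
      have oW: "openin (Top X) W" using X.affine_open W by blast
      then obtain s where s: "s \<in> carrier (Sh Z V)" "x \<in> basic_open Z V s" "basic_open Z V s \<subseteq> W"
        using Z.affine_basis[OF aff, of W x] W by auto
      define E where "E = basic_open Z V s"
      \<comment> \<open>Inside the affine set \<open>W\<close> of \<open>X\<close>, the set
        \<open>E\<close> is basic open for the reduction of \<open>s\<close>, hence affine in
        \<open>X\<close>. There \<open>a\<close> does lift.\<close>
      have "E = W \<inter> basic_open Z V s" unfolding E_def using s by blast
      also have "\<dots> = basic_open Z W (Res Z V W s)"
        using Z.basic_open_Res[of V W s] V oW W s by simp
      also have "\<dots> = basic_open X W (em W (Res Z V W s))"
        using V oW W s by (intro basic_open_em Z.Res_closed) auto
      finally have EX: "E = basic_open X W (em W (Res Z V W s))" .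
      have aE: "affine_open X E" unfolding EX
        using V oW W s by (intro X.affine_basic_open em_closed Z.Res_closed) auto
      have oE: "openin (Top X) E" "E \<subseteq> V" using X.affine_open[OF aE] by (auto simp: E_def basic_open_def)
      interpret E: p_ext_surj p "Sh Z E" "Sh X E" "em E" "j E" using ext_surj aE by blast
      interpret f: ring_hom_cring "Sh Z V" "Sh Z E" "Res Z V E" using Z.Res_ring_hom V oE by simp
      interpret g: ring_hom_cring "Sh X V" "Sh X E" "Res X V E" using X.Res_ring_hom V oE by simp
      note loc = is_localizationD[OF Z.affine_loc[OF aff s(1), folded E_def]]
      obtain r where r: "r \<in> carrier (Sh Z E)" "Res X V E a = em E r" using E.surjE[of "Res X V E a"] a by auto
      obtain n :: nat and t where t: "t \<in> carrier (Sh Z V)" "Res Z V E s [^]\<^bsub>Sh Z E\<^esub> n \<otimes>\<^bsub>Sh Z E\<^esub> r = Res Z V E t"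
        using loc(3)[OF r(1)] by blast
      \<comment> \<open>The defect of the lift of $s^n a$. It vanishes on \<open>E\<close>; to
        conclude that a power of \<open>s\<close> kills it, \<open>j\<close> carries it into the
        sheaf of the lift, where \<open>V\<close> is affine and localization is available.\<close>
      define d where "d = em V (s [^]\<^bsub>Sh Z V\<^esub> n) \<otimes>\<^bsub>Sh X V\<^esub> a \<ominus>\<^bsub>Sh X V\<^esub> em V t"
      have d: "d \<in> carrier (Sh X V)" using s a t by (simp add: d_def)
      have eR: "em E (Res Z V E t) = Res X V E (em V t)" if "t \<in> carrier (Sh Z V)" for t
        using em_Res V oE that by blast
      have "Res X V E (em V (s [^]\<^bsub>Sh Z V\<^esub> n) \<otimes>\<^bsub>Sh X V\<^esub> a) = em E (Res Z V E s [^]\<^bsub>Sh Z E\<^esub> n \<otimes>\<^bsub>Sh Z E\<^esub> r)"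
        using s a r by (simp add: eR)
      also have "\<dots> = Res X V E (em V t)" unfolding t(2) by (rule eR[OF t(1)])
      finally have "Res X V E d = \<zero>\<^bsub>Sh X E\<^esub>"
        unfolding d_def using s a t by (simp add: V.A.minus_eq E.A.r_neg del: V.em.hom_pow)
      then have "Res Z V E (j V d) = \<zero>\<^bsub>Sh Z E\<^esub>"
        using j_Res[OF V oE(1) oE(2) d] by simp
      then obtain m :: nat where "s [^]\<^bsub>Sh Z V\<^esub> m \<otimes>\<^bsub>Sh Z V\<^esub> j V d = \<zero>\<^bsub>Sh Z V\<^esub>"
        using loc(4)[OF V.j_closed[OF d]] by blast
      then have "j V (em V (s [^]\<^bsub>Sh Z V\<^esub> m) \<otimes>\<^bsub>Sh X V\<^esub> d) = \<zero>\<^bsub>Sh Z V\<^esub>"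
        using V.j_mult[of "s [^]\<^bsub>Sh Z V\<^esub> m" d] s d by (simp del: V.em.hom_pow)
      then have z: "em V (s [^]\<^bsub>Sh Z V\<^esub> m) \<otimes>\<^bsub>Sh X V\<^esub> d = \<zero>\<^bsub>Sh X V\<^esub>"
        using V.j_eq_zero s d by simp
      have dz: "em V (s [^]\<^bsub>Sh Z V\<^esub> m) \<otimes>\<^bsub>Sh X V\<^esub> d =
         em V (s [^]\<^bsub>Sh Z V\<^esub> (m + n)) \<otimes>\<^bsub>Sh X V\<^esub> a \<ominus>\<^bsub>Sh X V\<^esub> em V (s [^]\<^bsub>Sh Z V\<^esub> m \<otimes>\<^bsub>Sh Z V\<^esub> t)"
        unfolding d_def using s a t
        by (simp add: V.A.minus_eq V.A.r_distr V.A.r_minus V.A.nat_pow_mult[symmetric] V.A.m_assoc)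
      have "em V (s [^]\<^bsub>Sh Z V\<^esub> (m + n)) \<otimes>\<^bsub>Sh X V\<^esub> a = em V (s [^]\<^bsub>Sh Z V\<^esub> m \<otimes>\<^bsub>Sh Z V\<^esub> t)"
        by (rule V.A.minus_eq_zeroD[OF trans[OF dz[symmetric] z]]) (use s a t in simp_all)
      then have "s [^]\<^bsub>Sh Z V\<^esub> (m + n) \<in> I" unfolding I_def using s t by blast
      then have "s [^]\<^bsub>Sh Z V\<^esub> (m + n) \<in> M" using M by blast
      moreover have "s \<notin> M" using s x by (auto simp: nonunits_def basic_open_def)
      moreover have "s [^]\<^bsub>Sh Z V\<^esub> k \<in> M \<Longrightarrow> s \<in> M" for k :: nat
        using s V.S.prime_ideal_one[OF M(1)]
        by (induction k) (auto simp: V.S.prime_ideal_mult_iff[OF M(1)])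
      ultimately show False by blast
    qed
    then show ?thesis unfolding I_def using a by (auto intro: sym)
  qed
  then show ?thesis by auto
qed

end

section \<open>Polynomial rings and smoothness\<close>

lemma (in abelian_monoid) finsum_Sigma:
  assumes "finite A" "\<And>x. x \<in> A \<Longrightarrow> finite (B x)"
    and "\<And>x y. x \<in> A \<Longrightarrow> y \<in> B x \<Longrightarrow> f x y \<in> carrier G"
  shows "(\<Oplus>x\<in>A. \<Oplus>y\<in>B x. f x y) = (\<Oplus>z\<in>Sigma A B. f (fst z) (snd z))"
  using assms
proof (induction A)
  case (insert a A)
  have "Sigma (insert a A) B = Pair a ` B a \<union> Sigma A B" by auto
  moreover have "(\<Oplus>z\<in>Pair a ` B a. f (fst z) (snd z)) = (\<Oplus>y\<in>B a. f a y)"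
    using insert by (subst finsum_reindex) (auto simp: inj_on_def)
  moreover have "(\<Oplus>z\<in>Pair a ` B a \<union> Sigma A B. f (fst z) (snd z)) =
     (\<Oplus>z\<in>Pair a ` B a. f (fst z) (snd z)) \<oplus> (\<Oplus>z\<in>Sigma A B. f (fst z) (snd z))"
    using insert by (intro finsum_Un_disjoint) auto
  moreover have "(\<Oplus>x\<in>insert a A. \<Oplus>y\<in>B x. f x y) = (\<Oplus>y\<in>B a. f a y) \<oplus> (\<Oplus>x\<in>A. \<Oplus>y\<in>B x. f x y)"
    using insert by (intro finsum_insert) auto
  ultimately show ?case using insert by simp
qed simp

lemma finite_submultisets: "finite {m'. m' \<subseteq># (m :: 'a multiset)}"
proof (induction m)
  case (add x m)
  have "{m'. m' \<subseteq># add_mset x m} \<subseteq> {m'. m' \<subseteq># m} \<union> add_mset x ` {m'. m' \<subseteq># m}"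
  proof
    fix m' assume "m' \<in> {m'. m' \<subseteq># add_mset x m}"
    then have m': "m' \<subseteq># add_mset x m" by simp
    show "m' \<in> {m'. m' \<subseteq># m} \<union> add_mset x ` {m'. m' \<subseteq># m}"
    proof (cases "x \<in># m'")
      case True
      then obtain m'' where "m' = add_mset x m''" by (metis multi_member_split)
      with m' show ?thesis by auto
    next
      case False
      then have "m' \<subseteq># m" using m'
        by (intro mset_subset_eqI) (metis mset_subset_eq_count count_add_mset not_in_iff le0)
      then show ?thesis by simp
    qed
  qed
  then show ?case using add by (meson finite_UnI finite_imageI finite_subset)
qed simp

text \<open>Finitely supported coefficient functions with no bound on the variables. Convolution is
  studied here, and the bound \<open>n\<close> is imposed only when the carrier of
  \<open>mpoly\<close> is treated.\<close>

definition mcarrier :: "('a, 'm) ring_scheme \<Rightarrow> (nat multiset \<Rightarrow> 'a) set" where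
  "mcarrier R = {P. (\<forall>m. P m \<in> carrier R) \<and> finite {m. P m \<noteq> \<zero>\<^bsub>R\<^esub>}}"

abbreviation msupp :: "('a, 'm) ring_scheme \<Rightarrow> (nat multiset \<Rightarrow> 'a) \<Rightarrow> nat multiset set" where
  "msupp R P \<equiv> {m. P m \<noteq> \<zero>\<^bsub>R\<^esub>}"

lemma mpoly_mult: "P \<otimes>\<^bsub>mpoly R n\<^esub> Q = (\<lambda>m. \<Oplus>\<^bsub>R\<^esub>m'\<in>{m'. m' \<subseteq># m}. P m' \<otimes>\<^bsub>R\<^esub> Q (m - m'))"
  and mpoly_add: "P \<oplus>\<^bsub>mpoly R n\<^esub> Q = (\<lambda>m. P m \<oplus>\<^bsub>R\<^esub> Q m)"
  and mpoly_one: "\<one>\<^bsub>mpoly R n\<^esub> = (\<lambda>m. if m = {#} then \<one>\<^bsub>R\<^esub> else \<zero>\<^bsub>R\<^esub>)"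
  and mpoly_zero: "\<zero>\<^bsub>mpoly R n\<^esub> = (\<lambda>m. \<zero>\<^bsub>R\<^esub>)"
  and mpoly_carrier: "carrier (mpoly R n) = {P \<in> mcarrier R. \<forall>m. P m \<noteq> \<zero>\<^bsub>R\<^esub> \<longrightarrow> set_mset m \<subseteq> {..<n}}"
  by (simp_all add: mpoly_def mcarrier_def conj_assoc)

context cring
begin

lemma mcarrierD: "P \<in> mcarrier R \<Longrightarrow> P m \<in> carrier R" "P \<in> mcarrier R \<Longrightarrow> finite (msupp R P)"
  by (simp_all add: mcarrier_def)

text \<open>Submultisets of \<open>m\<close> correspond to pairs with sum \<open>m\<close>, by
  sending \<open>m'\<close> to \<open>(m', m - m')\<close>. This symmetric form, over any finite
  sets containing the supports, makes the ring laws and evaluation a matter of reindexing.\<close>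

lemma mpoly_mult_superset:
  assumes P: "P \<in> mcarrier R" and Q: "Q \<in> mcarrier R"
    and S: "finite S" "msupp R P \<subseteq> S" and T: "finite T" "msupp R Q \<subseteq> T"
  shows "(P \<otimes>\<^bsub>mpoly R n\<^esub> Q) m = (\<Oplus>z\<in>{z \<in> S \<times> T. fst z + snd z = m}. P (fst z) \<otimes> Q (snd z))"
proof -
  let ?D = "{m'. m' \<subseteq># m}"
  let ?h = "\<lambda>m'. (m', m - m')"
  have fin: "finite ?D" by (rule finite_submultisets)
  have im: "z \<in> ?h ` ?D \<longleftrightarrow> fst z + snd z = m" for z
    by (cases z) (auto simp: image_iff)
  have "(P \<otimes>\<^bsub>mpoly R n\<^esub> Q) m = (\<Oplus>z\<in>?h ` ?D. P (fst z) \<otimes> Q (snd z))"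
    unfolding mpoly_mult using P Q
    by (subst finsum_reindex) (auto simp: inj_on_def mcarrierD)
  also have "\<dots> = (\<Oplus>z\<in>?h ` ?D \<inter> S \<times> T. P (fst z) \<otimes> Q (snd z))"
  proof (rule add.finprod_mono_neutral_cong_right)
    show "P (fst i) \<otimes> Q (snd i) = \<zero>" if "i \<in> ?h ` ?D - ?h ` ?D \<inter> S \<times> T" for i
    proof -
      have "fst i \<notin> S \<or> snd i \<notin> T" using that by (cases i) auto
      then have "P (fst i) = \<zero> \<or> Q (snd i) = \<zero>" using S T by blast
      then show ?thesis using mcarrierD(1)[OF P] mcarrierD(1)[OF Q] by auto
    qed
  qed (use fin P Q in \<open>auto simp: mcarrierD\<close>)
  also have "?h ` ?D \<inter> S \<times> T = {z \<in> S \<times> T. fst z + snd z = m}" using im by blast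
  finally show ?thesis .
qed

lemma msupp_mult:
  assumes P: "P \<in> mcarrier R" and Q: "Q \<in> mcarrier R"
  shows "msupp R (P \<otimes>\<^bsub>mpoly R n\<^esub> Q) \<subseteq> (\<lambda>z. fst z + snd z) ` (msupp R P \<times> msupp R Q)"
proof
  fix m assume m: "m \<in> msupp R (P \<otimes>\<^bsub>mpoly R n\<^esub> Q)"
  show "m \<in> (\<lambda>z. fst z + snd z) ` (msupp R P \<times> msupp R Q)"
  proof (rule ccontr)
    assume "m \<notin> (\<lambda>z. fst z + snd z) ` (msupp R P \<times> msupp R Q)"
    then have "{z \<in> msupp R P \<times> msupp R Q. fst z + snd z = m} = {}" by blast
    then have "(P \<otimes>\<^bsub>mpoly R n\<^esub> Q) m = \<zero>"
      by (subst mpoly_mult_superset[OF P Q mcarrierD(2)[OF P] subset_refl mcarrierD(2)[OF Q] subset_refl])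
        (simp only: add.finprod_empty)
    with m show False by simp
  qed
qed

lemma mcarrier_mult:
  assumes P: "P \<in> mcarrier R" and Q: "Q \<in> mcarrier R"
  shows "P \<otimes>\<^bsub>mpoly R n\<^esub> Q \<in> mcarrier R"
proof -
  have "finite (msupp R (P \<otimes>\<^bsub>mpoly R n\<^esub> Q))"
    by (rule finite_subset[OF msupp_mult[OF P Q]]) (use mcarrierD(2)[OF P] mcarrierD(2)[OF Q] in simp)
  moreover have "(P \<otimes>\<^bsub>mpoly R n\<^esub> Q) m \<in> carrier R" for m
    unfolding mpoly_mult using P Q by (auto intro!: finsum_closed simp: mcarrierD)
  ultimately show ?thesis by (simp add: mcarrier_def)
qed

lemma mcarrier_add:
  assumes P: "P \<in> mcarrier R" and Q: "Q \<in> mcarrier R"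
  shows "P \<oplus>\<^bsub>mpoly R n\<^esub> Q \<in> mcarrier R"
proof -
  have "finite (msupp R (P \<oplus>\<^bsub>mpoly R n\<^esub> Q))"
    by (rule finite_subset[of _ "msupp R P \<union> msupp R Q"])
      (use P Q in \<open>auto simp: mpoly_add mcarrierD\<close>)
  then show ?thesis using P Q by (simp add: mcarrier_def mpoly_add)
qed

text \<open>Both bracketings are regrouped into one sum over the triples of support monomials with
  sum \<open>m\<close>.\<close>

lemma mpoly_mult_assoc:
  assumes P: "P \<in> mcarrier R" and Q: "Q \<in> mcarrier R" and T: "T \<in> mcarrier R"
  shows "P \<otimes>\<^bsub>mpoly R n\<^esub> Q \<otimes>\<^bsub>mpoly R n\<^esub> T = P \<otimes>\<^bsub>mpoly R n\<^esub> (Q \<otimes>\<^bsub>mpoly R n\<^esub> T)"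
proof
  fix m
  note fP = mcarrierD(2)[OF P] and fQ = mcarrierD(2)[OF Q] and fT = mcarrierD(2)[OF T]
  let ?PQ = "(\<lambda>z. fst z + snd z) ` (msupp R P \<times> msupp R Q)"
  let ?QT = "(\<lambda>z. fst z + snd z) ` (msupp R Q \<times> msupp R T)"
  let ?I = "{(a, b, c). a \<in> msupp R P \<and> b \<in> msupp R Q \<and> c \<in> msupp R T \<and> a + b + c = m}"
  have finI: "finite ?I"
    by (rule finite_subset[of _ "msupp R P \<times> msupp R Q \<times> msupp R T"]) (use fP fQ fT in auto)
  have "(P \<otimes>\<^bsub>mpoly R n\<^esub> Q \<otimes>\<^bsub>mpoly R n\<^esub> T) m =
    (\<Oplus>z\<in>{z \<in> ?PQ \<times> msupp R T. fst z + snd z = m}. (P \<otimes>\<^bsub>mpoly R n\<^esub> Q) (fst z) \<otimes> T (snd z))"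
    by (rule mpoly_mult_superset[OF mcarrier_mult[OF P Q] T _ msupp_mult[OF P Q] fT subset_refl])
      (use fP fQ in simp)
  also have "\<dots> = (\<Oplus>z\<in>{z \<in> ?PQ \<times> msupp R T. fst z + snd z = m}.
      \<Oplus>w\<in>{w \<in> msupp R P \<times> msupp R Q. fst w + snd w = fst z}. P (fst w) \<otimes> Q (snd w) \<otimes> T (snd z))"
    using P Q T fP fQ
    by (intro add.finprod_cong' refl)
       (auto simp: mpoly_mult_superset[OF P Q fP subset_refl fQ subset_refl] finsum_ldistr mcarrierD
         intro!: finsum_closed)
  also have "\<dots> = (\<Oplus>u\<in>(SIGMA z:{z \<in> ?PQ \<times> msupp R T. fst z + snd z = m}. {w \<in> msupp R P \<times> msupp R Q. fst w + snd w = fst z}).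
     P (fst (snd u)) \<otimes> Q (snd (snd u)) \<otimes> T (snd (fst u)))"
    using P Q T fP fQ fT by (intro finsum_Sigma) (auto simp: mcarrierD)
  also have "(SIGMA z:{z \<in> ?PQ \<times> msupp R T. fst z + snd z = m}. {w \<in> msupp R P \<times> msupp R Q. fst w + snd w = fst z}) =
     (\<lambda>(a, b, c). ((a + b, c), (a, b))) ` ?I" by (auto simp: image_iff) blast
  also have "(\<Oplus>u\<in>(\<dots>). P (fst (snd u)) \<otimes> Q (snd (snd u)) \<otimes> T (snd (fst u))) =
      (\<Oplus>t\<in>?I. P (fst t) \<otimes> Q (fst (snd t)) \<otimes> T (snd (snd t)))"
    using P Q T by (subst finsum_reindex) (auto simp: mcarrierD inj_on_def intro!: add.finprod_cong')
  finally have 1: "(P \<otimes>\<^bsub>mpoly R n\<^esub> Q \<otimes>\<^bsub>mpoly R n\<^esub> T) m = (\<Oplus>t\<in>?I. P (fst t) \<otimes> Q (fst (snd t)) \<otimes> T (snd (snd t)))" .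
  have "(P \<otimes>\<^bsub>mpoly R n\<^esub> (Q \<otimes>\<^bsub>mpoly R n\<^esub> T)) m =
    (\<Oplus>z\<in>{z \<in> msupp R P \<times> ?QT. fst z + snd z = m}. P (fst z) \<otimes> (Q \<otimes>\<^bsub>mpoly R n\<^esub> T) (snd z))"
    by (rule mpoly_mult_superset[OF P mcarrier_mult[OF Q T] fP subset_refl _ msupp_mult[OF Q T]])
      (use fQ fT in simp)
  also have "\<dots> = (\<Oplus>z\<in>{z \<in> msupp R P \<times> ?QT. fst z + snd z = m}.
      \<Oplus>w\<in>{w \<in> msupp R Q \<times> msupp R T. fst w + snd w = snd z}. P (fst z) \<otimes> (Q (fst w) \<otimes> T (snd w)))"
    using P Q T fQ fT
    by (intro add.finprod_cong' refl)
       (auto simp: mpoly_mult_superset[OF Q T fQ subset_refl fT subset_refl] finsum_rdistr mcarrierD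
         intro!: finsum_closed)
  also have "\<dots> = (\<Oplus>u\<in>(SIGMA z:{z \<in> msupp R P \<times> ?QT. fst z + snd z = m}. {w \<in> msupp R Q \<times> msupp R T. fst w + snd w = snd z}).
     P (fst (fst u)) \<otimes> (Q (fst (snd u)) \<otimes> T (snd (snd u))))"
    using P Q T fP fQ fT by (intro finsum_Sigma) (auto simp: mcarrierD)
  also have "(SIGMA z:{z \<in> msupp R P \<times> ?QT. fst z + snd z = m}. {w \<in> msupp R Q \<times> msupp R T. fst w + snd w = snd z}) =
     (\<lambda>(a, b, c). ((a, b + c), (b, c))) ` ?I" by (auto simp: image_iff add.assoc) blast
  also have "(\<Oplus>u\<in>(\<dots>). P (fst (fst u)) \<otimes> (Q (fst (snd u)) \<otimes> T (snd (snd u)))) =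
      (\<Oplus>t\<in>?I. P (fst t) \<otimes> Q (fst (snd t)) \<otimes> T (snd (snd t)))"
    using P Q T by (subst finsum_reindex) (auto simp: mcarrierD inj_on_def m_assoc intro!: add.finprod_cong')
  finally show "(P \<otimes>\<^bsub>mpoly R n\<^esub> Q \<otimes>\<^bsub>mpoly R n\<^esub> T) m = (P \<otimes>\<^bsub>mpoly R n\<^esub> (Q \<otimes>\<^bsub>mpoly R n\<^esub> T)) m"
    using 1 by simp
qed

lemma mpoly_mult_comm:
  assumes P: "P \<in> mcarrier R" and Q: "Q \<in> mcarrier R"
  shows "P \<otimes>\<^bsub>mpoly R n\<^esub> Q = Q \<otimes>\<^bsub>mpoly R n\<^esub> P"
proof
  fix m
  have e: "{z \<in> msupp R P \<times> msupp R Q. fst z + snd z = m} =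
     prod.swap ` {z \<in> msupp R Q \<times> msupp R P. fst z + snd z = m}"
    by (auto simp: image_iff add.commute)
  show "(P \<otimes>\<^bsub>mpoly R n\<^esub> Q) m = (Q \<otimes>\<^bsub>mpoly R n\<^esub> P) m"
    unfolding mpoly_mult_superset[OF P Q mcarrierD(2)[OF P] subset_refl mcarrierD(2)[OF Q] subset_refl]
      mpoly_mult_superset[OF Q P mcarrierD(2)[OF Q] subset_refl mcarrierD(2)[OF P] subset_refl] e
    using P Q by (subst finsum_reindex) (auto simp: mcarrierD m_comm intro!: add.finprod_cong')
qed

lemma mpoly_cring: "cring (mpoly R n)"
proof (intro cringI abelian_groupI comm_monoidI)
  note c = mpoly_carrier
  have one: "\<one>\<^bsub>mpoly R n\<^esub> \<in> mcarrier R" by (simp add: mpoly_one mcarrier_def)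
  then show "\<one>\<^bsub>mpoly R n\<^esub> \<in> carrier (mpoly R n)" by (simp add: c mpoly_one)
  show "\<zero>\<^bsub>mpoly R n\<^esub> \<in> carrier (mpoly R n)" by (simp add: c mcarrier_def mpoly_zero)
  fix P assume P: "P \<in> carrier (mpoly R n)"
  then have P': "P \<in> mcarrier R" by (simp add: c)
  show "\<zero>\<^bsub>mpoly R n\<^esub> \<oplus>\<^bsub>mpoly R n\<^esub> P = P" using P' by (simp add: mpoly_add mpoly_zero mcarrierD)
  show "\<exists>Q\<in>carrier (mpoly R n). Q \<oplus>\<^bsub>mpoly R n\<^esub> P = \<zero>\<^bsub>mpoly R n\<^esub>"
  proof (rule bexI[of _ "\<lambda>m. \<ominus> P m"])
    have "msupp R (\<lambda>m. \<ominus> P m) \<subseteq> msupp R P" using P' by auto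
    then show "(\<lambda>m. \<ominus> P m) \<in> carrier (mpoly R n)" using P P'
      by (auto simp: c mcarrier_def dest: finite_subset)
  qed (use P' in \<open>simp add: mpoly_add mpoly_zero mcarrierD l_neg\<close>)
  show "\<one>\<^bsub>mpoly R n\<^esub> \<otimes>\<^bsub>mpoly R n\<^esub> P = P"
  proof
    fix m
    have "(\<one>\<^bsub>mpoly R n\<^esub> \<otimes>\<^bsub>mpoly R n\<^esub> P) m = (\<Oplus>m'\<in>{m'. m' \<subseteq># m}. if m' = {#} then P m else \<zero>)"
      unfolding mpoly_mult mpoly_one using P' by (intro add.finprod_cong' refl) (auto simp: mcarrierD)
    also have "\<dots> = P m"
      using add.finprod_singleton_swap[of "{#}" "{m'. m' \<subseteq># m}" "\<lambda>_. P m"] finite_submultisets[of m] P'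
      by (simp add: mcarrierD)
    finally show "(\<one>\<^bsub>mpoly R n\<^esub> \<otimes>\<^bsub>mpoly R n\<^esub> P) m = P m" .
  qed
  fix Q assume Q: "Q \<in> carrier (mpoly R n)"
  then have Q': "Q \<in> mcarrier R" by (simp add: c)
  show "P \<oplus>\<^bsub>mpoly R n\<^esub> Q = Q \<oplus>\<^bsub>mpoly R n\<^esub> P" using P' Q' by (simp add: mpoly_add mcarrierD a_comm)
  show "P \<otimes>\<^bsub>mpoly R n\<^esub> Q = Q \<otimes>\<^bsub>mpoly R n\<^esub> P" using mpoly_mult_comm P' Q' .
  show "P \<oplus>\<^bsub>mpoly R n\<^esub> Q \<in> carrier (mpoly R n)"
    unfolding c
  proof (intro CollectI conjI mcarrier_add P' Q' allI impI)
    fix m assume "(P \<oplus>\<^bsub>mpoly R n\<^esub> Q) m \<noteq> \<zero>"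
    then have "P m \<noteq> \<zero> \<or> Q m \<noteq> \<zero>" by (auto simp: mpoly_add)
    then show "set_mset m \<subseteq> {..<n}" using P Q by (auto simp: c)
  qed
  show "P \<otimes>\<^bsub>mpoly R n\<^esub> Q \<in> carrier (mpoly R n)"
    unfolding c
  proof (intro CollectI conjI mcarrier_mult P' Q' allI impI)
    fix m assume "(P \<otimes>\<^bsub>mpoly R n\<^esub> Q) m \<noteq> \<zero>"
    then have "m \<in> (\<lambda>z. fst z + snd z) ` (msupp R P \<times> msupp R Q)" using msupp_mult[OF P' Q', of n] by blast
    then obtain a b where "m = a + b" "P a \<noteq> \<zero>" "Q b \<noteq> \<zero>" by auto
    moreover from this have "set_mset a \<subseteq> {..<n}" "set_mset b \<subseteq> {..<n}" using P Q by (auto simp only: c mem_Collect_eq)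
    ultimately show "set_mset m \<subseteq> {..<n}" by simp
  qed
  fix T assume T: "T \<in> carrier (mpoly R n)"
  then have T': "T \<in> mcarrier R" by (simp add: c)
  show "P \<oplus>\<^bsub>mpoly R n\<^esub> Q \<oplus>\<^bsub>mpoly R n\<^esub> T = P \<oplus>\<^bsub>mpoly R n\<^esub> (Q \<oplus>\<^bsub>mpoly R n\<^esub> T)"
    using P' Q' T' by (simp add: mpoly_add mcarrierD a_assoc)
  show "P \<otimes>\<^bsub>mpoly R n\<^esub> Q \<otimes>\<^bsub>mpoly R n\<^esub> T = P \<otimes>\<^bsub>mpoly R n\<^esub> (Q \<otimes>\<^bsub>mpoly R n\<^esub> T)"
    by (rule mpoly_mult_assoc[OF P' Q' T'])
  show "(P \<oplus>\<^bsub>mpoly R n\<^esub> Q) \<otimes>\<^bsub>mpoly R n\<^esub> T = P \<otimes>\<^bsub>mpoly R n\<^esub> T \<oplus>\<^bsub>mpoly R n\<^esub> Q \<otimes>\<^bsub>mpoly R n\<^esub> T"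
  proof
    fix m
    show "((P \<oplus>\<^bsub>mpoly R n\<^esub> Q) \<otimes>\<^bsub>mpoly R n\<^esub> T) m = (P \<otimes>\<^bsub>mpoly R n\<^esub> T \<oplus>\<^bsub>mpoly R n\<^esub> Q \<otimes>\<^bsub>mpoly R n\<^esub> T) m"
      unfolding mpoly_mult mpoly_add using P' Q' T'
      by (subst finsum_addf[symmetric]) (auto simp: mcarrierD l_distr intro!: add.finprod_cong')
  qed
qed

end

definition mmon :: "('a, 'm) ring_scheme \<Rightarrow> (nat \<Rightarrow> 'a) \<Rightarrow> nat multiset \<Rightarrow> 'a" where
  "mmon A a m = (\<Otimes>\<^bsub>A\<^esub>i\<in>set_mset m. a i [^]\<^bsub>A\<^esub> count m i)"

definition cmap :: "('a \<Rightarrow> 'b) \<Rightarrow> (nat multiset \<Rightarrow> 'a) \<Rightarrow> nat multiset \<Rightarrow> 'b" where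
  "cmap f P = (\<lambda>m. f (P m))"

lemma mmon_superset:
  assumes "cring A" "\<forall>i<n. a i \<in> carrier A" "set_mset m \<subseteq> {..<n}"
  shows "mmon A a m = (\<Otimes>\<^bsub>A\<^esub>i\<in>{..<n}. a i [^]\<^bsub>A\<^esub> count m i)"
proof -
  interpret cring A by fact
  show ?thesis unfolding mmon_def
    by (rule finprod_mono_neutral_cong_left) (use assms in \<open>auto simp: not_in_iff\<close>)
qed

lemma mmon_closed:
  assumes "cring A" "\<forall>i<n. a i \<in> carrier A" "set_mset m \<subseteq> {..<n}"
  shows "mmon A a m \<in> carrier A"
proof -
  interpret cring A by fact
  show ?thesis unfolding mmon_superset[OF assms] using assms by (auto intro!: finprod_closed)
qed

lemma mmon_add:
  assumes "cring A" "\<forall>i<n. a i \<in> carrier A" "set_mset m \<subseteq> {..<n}" "set_mset m' \<subseteq> {..<n}"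
  shows "mmon A a (m + m') = mmon A a m \<otimes>\<^bsub>A\<^esub> mmon A a m'"
proof -
  interpret cring A by fact
  have "set_mset (m + m') \<subseteq> {..<n}" using assms by auto
  then have "mmon A a (m + m') = (\<Otimes>\<^bsub>A\<^esub>i\<in>{..<n}. a i [^]\<^bsub>A\<^esub> count m i \<otimes>\<^bsub>A\<^esub> a i [^]\<^bsub>A\<^esub> count m' i)"
    unfolding mmon_superset[OF assms(1,2) \<open>set_mset (m + m') \<subseteq> {..<n}\<close>]
    by (intro finprod_cong' refl) (use assms in \<open>auto simp: nat_pow_mult\<close>)
  also have "\<dots> = mmon A a m \<otimes>\<^bsub>A\<^esub> mmon A a m'"
    unfolding mmon_superset[OF assms(1,2,3)] mmon_superset[OF assms(1,2,4)]
    by (rule finprod_multf) (use assms in auto)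
  finally show ?thesis .
qed

lemma mmon_hom:
  assumes "cring A" "cring A'" "g \<in> ring_hom A A'" "\<forall>i<n. a i \<in> carrier A" "\<forall>i<n. g (a i) = a' i"
    "set_mset m \<subseteq> {..<n}"
  shows "g (mmon A a m) = mmon A' a' m"
proof -
  interpret g: ring_hom_cring A A' g using assms by (intro ring_hom_cring.intro ring_hom_cring_axioms.intro)
  have "\<forall>i<n. a' i \<in> carrier A'" using assms(4,5) g.hom_closed by metis
  with assms show ?thesis
    by (simp add: mmon_superset[of _ n] g.hom_finprod Pi_def cong: g.S.finprod_cong)
qed

locale mpoly_ev = R: cring R + A: cring A for R :: "('a, 'm) ring_scheme" and A :: "('b, 'l) ring_scheme" +
  fixes \<sigma> :: "'a \<Rightarrow> 'b" and n :: nat and a :: "nat \<Rightarrow> 'b"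
  assumes \<sigma>: "\<sigma> \<in> ring_hom R A" and a: "\<forall>i<n. a i \<in> carrier A"
begin

sublocale \<sigma>: ring_hom_cring R A \<sigma> by unfold_locales (rule \<sigma>)

abbreviation ev where "ev \<equiv> mpoly_eval R A \<sigma> a"

lemma ev_superset:
  assumes P: "P \<in> carrier (mpoly R n)" and S: "finite S" "msupp R P \<subseteq> S" "\<And>m. m \<in> S \<Longrightarrow> set_mset m \<subseteq> {..<n}"
  shows "ev P = (\<Oplus>\<^bsub>A\<^esub>m\<in>S. \<sigma> (P m) \<otimes>\<^bsub>A\<^esub> mmon A a m)"
  unfolding mpoly_eval_def mmon_def[symmetric]
  using P S mmon_closed[OF A.is_cring a]
  by (intro A.add.finprod_mono_neutral_cong_left) (auto simp: mpoly_carrier mcarrier_def)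

lemma supp:
  assumes P: "P \<in> carrier (mpoly R n)"
  shows "finite (msupp R P)" "m \<in> msupp R P \<Longrightarrow> set_mset m \<subseteq> {..<n}" "P m \<in> carrier R"
  using P by (simp_all add: mpoly_carrier mcarrier_def)

lemma ev_eq: "P \<in> carrier (mpoly R n) \<Longrightarrow> ev P = (\<Oplus>\<^bsub>A\<^esub>m\<in>msupp R P. \<sigma> (P m) \<otimes>\<^bsub>A\<^esub> mmon A a m)"
  by (rule ev_superset) (auto simp: supp(1) dest: supp(2))

sublocale M: cring "mpoly R n" by (rule R.mpoly_cring)

text \<open>For products, the double sum over pairs of monomials is regrouped according to the sum
  of the pair, which gives the coefficients of the product.\<close>

lemma ev_hom: "ev \<in> ring_hom (mpoly R n) A"
proof (rule ring_hom_memI)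
  note mc = mmon_closed[OF A.is_cring a]
  fix P assume P: "P \<in> carrier (mpoly R n)"
  note sP = supp[OF P]
  show "ev P \<in> carrier A"
    unfolding ev_eq[OF P] using sP mc by (auto intro!: A.finsum_closed)
  fix Q assume Q: "Q \<in> carrier (mpoly R n)"
  note sQ = supp[OF Q]
  have P': "P \<in> mcarrier R" and Q': "Q \<in> mcarrier R" using P Q by (simp_all add: mpoly_carrier)
  let ?S = "msupp R P \<union> msupp R Q"
  have S: "finite ?S" "\<And>m. m \<in> ?S \<Longrightarrow> set_mset m \<subseteq> {..<n}" using sP sQ by auto
  have PQ: "P \<oplus>\<^bsub>mpoly R n\<^esub> Q \<in> carrier (mpoly R n)" using P Q by simp
  have "ev (P \<oplus>\<^bsub>mpoly R n\<^esub> Q) = (\<Oplus>\<^bsub>A\<^esub>m\<in>?S. \<sigma> ((P \<oplus>\<^bsub>mpoly R n\<^esub> Q) m) \<otimes>\<^bsub>A\<^esub> mmon A a m)"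
    by (rule ev_superset[OF PQ S(1) _ S(2)]) (use sP sQ in \<open>auto simp: mpoly_add\<close>)
  also have "\<dots> = (\<Oplus>\<^bsub>A\<^esub>m\<in>?S. \<sigma> (P m) \<otimes>\<^bsub>A\<^esub> mmon A a m \<oplus>\<^bsub>A\<^esub> \<sigma> (Q m) \<otimes>\<^bsub>A\<^esub> mmon A a m)"
    by (rule A.add.finprod_cong') (use S sP sQ mc in \<open>auto simp: mpoly_add A.l_distr\<close>)
  also have "\<dots> = (\<Oplus>\<^bsub>A\<^esub>m\<in>?S. \<sigma> (P m) \<otimes>\<^bsub>A\<^esub> mmon A a m) \<oplus>\<^bsub>A\<^esub> (\<Oplus>\<^bsub>A\<^esub>m\<in>?S. \<sigma> (Q m) \<otimes>\<^bsub>A\<^esub> mmon A a m)"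
    by (rule A.finsum_addf) (use S sP sQ mc in auto)
  also have "\<dots> = ev P \<oplus>\<^bsub>A\<^esub> ev Q"
    using ev_superset[OF P S(1) _ S(2)] ev_superset[OF Q S(1) _ S(2)] by simp
  finally show "ev (P \<oplus>\<^bsub>mpoly R n\<^esub> Q) = ev P \<oplus>\<^bsub>A\<^esub> ev Q" .
  let ?I = "msupp R P \<times> msupp R Q"
  let ?M = "(\<lambda>z. fst z + snd z) ` ?I"
  let ?f = "\<lambda>z. (\<sigma> (P (fst z)) \<otimes>\<^bsub>A\<^esub> mmon A a (fst z)) \<otimes>\<^bsub>A\<^esub> (\<sigma> (Q (snd z)) \<otimes>\<^bsub>A\<^esub> mmon A a (snd z))"
  have PQ: "P \<otimes>\<^bsub>mpoly R n\<^esub> Q \<in> carrier (mpoly R n)" using P Q by simp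
  have M: "finite ?M" using sP sQ by simp
  have M2: "set_mset m \<subseteq> {..<n}" if m: "m \<in> ?M" for m
  proof -
    obtain b c where "b \<in> msupp R P" "c \<in> msupp R Q" "m = b + c" using m by auto
    with sP(2)[of b] sQ(2)[of c] show ?thesis by simp
  qed
  have fc: "?f z \<in> carrier A" if "z \<in> ?I" for z
  proof -
    have "fst z \<in> msupp R P" "snd z \<in> msupp R Q" using that by auto
    then show ?thesis using sP(3) sQ(3) mc[OF sP(2)] mc[OF sQ(2)] by simp
  qed
  have "ev (P \<otimes>\<^bsub>mpoly R n\<^esub> Q) = (\<Oplus>\<^bsub>A\<^esub>m\<in>?M. \<sigma> ((P \<otimes>\<^bsub>mpoly R n\<^esub> Q) m) \<otimes>\<^bsub>A\<^esub> mmon A a m)"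
    by (rule ev_superset[OF PQ M R.msupp_mult[OF P' Q'] M2])
  also have "\<dots> = (\<Oplus>\<^bsub>A\<^esub>m\<in>?M. \<Oplus>\<^bsub>A\<^esub>z\<in>{z \<in> ?I. fst z + snd z = m}. ?f z)"
  proof (rule A.add.finprod_cong')
    fix m assume m: "m \<in> ?M"
    have "\<sigma> ((P \<otimes>\<^bsub>mpoly R n\<^esub> Q) m) = \<sigma> (\<Oplus>\<^bsub>R\<^esub>z\<in>{z \<in> ?I. fst z + snd z = m}. P (fst z) \<otimes>\<^bsub>R\<^esub> Q (snd z))"
      by (subst R.mpoly_mult_superset[OF P' Q' sP(1) subset_refl sQ(1) subset_refl]) simp
    also have "\<dots> = (\<Oplus>\<^bsub>A\<^esub>z\<in>{z \<in> ?I. fst z + snd z = m}. \<sigma> (P (fst z)) \<otimes>\<^bsub>A\<^esub> \<sigma> (Q (snd z)))"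
      using sP(3) sQ(3) by (subst \<sigma>.hom_finsum) (auto intro!: A.add.finprod_cong')
    finally have "\<sigma> ((P \<otimes>\<^bsub>mpoly R n\<^esub> Q) m) \<otimes>\<^bsub>A\<^esub> mmon A a m =
      (\<Oplus>\<^bsub>A\<^esub>z\<in>{z \<in> ?I. fst z + snd z = m}. \<sigma> (P (fst z)) \<otimes>\<^bsub>A\<^esub> \<sigma> (Q (snd z)) \<otimes>\<^bsub>A\<^esub> mmon A a m)"
      using sP sQ mc[OF M2[OF m]] by (simp add: A.finsum_ldistr Pi_def)
    also have "\<dots> = (\<Oplus>\<^bsub>A\<^esub>z\<in>{z \<in> ?I. fst z + snd z = m}. ?f z)"
    proof (rule A.add.finprod_cong')
      fix z assume z: "z \<in> {z \<in> ?I. fst z + snd z = m}"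
      then have zz: "set_mset (fst z) \<subseteq> {..<n}" "set_mset (snd z) \<subseteq> {..<n}" "m = fst z + snd z"
        using sP(2)[of "fst z"] sQ(2)[of "snd z"] by auto
      show "\<sigma> (P (fst z)) \<otimes>\<^bsub>A\<^esub> \<sigma> (Q (snd z)) \<otimes>\<^bsub>A\<^esub> mmon A a m = ?f z"
        unfolding zz(3) mmon_add[OF A.is_cring a zz(1,2)] using sP(3) sQ(3) mc[OF zz(1)] mc[OF zz(2)]
        by (simp add: A.m_ac)
    qed (use fc in auto)
    finally show "\<sigma> ((P \<otimes>\<^bsub>mpoly R n\<^esub> Q) m) \<otimes>\<^bsub>A\<^esub> mmon A a m = (\<Oplus>\<^bsub>A\<^esub>z\<in>{z \<in> ?I. fst z + snd z = m}. ?f z)" .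
  qed (use fc in \<open>auto intro!: A.finsum_closed\<close>)
  also have "\<dots> = (\<Oplus>\<^bsub>A\<^esub>w\<in>(SIGMA m:?M. {z \<in> ?I. fst z + snd z = m}). ?f (snd w))"
    using M fc sP sQ by (intro A.finsum_Sigma) auto
  also have "(SIGMA m:?M. {z \<in> ?I. fst z + snd z = m}) = (\<lambda>z. (fst z + snd z, z)) ` ?I" by (auto simp: image_iff)
  also have "(\<Oplus>\<^bsub>A\<^esub>w\<in>(\<dots>). ?f (snd w)) = (\<Oplus>\<^bsub>A\<^esub>z\<in>?I. ?f z)"
    using fc by (subst A.finsum_reindex) (auto simp: inj_on_def)
  also have "\<dots> = (\<Oplus>\<^bsub>A\<^esub>x\<in>msupp R P. \<Oplus>\<^bsub>A\<^esub>y\<in>msupp R Q. ?f (x, y))"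
    using fc sP sQ by (subst A.finsum_Sigma) auto
  also have "\<dots> = (\<Oplus>\<^bsub>A\<^esub>x\<in>msupp R P. (\<sigma> (P x) \<otimes>\<^bsub>A\<^esub> mmon A a x) \<otimes>\<^bsub>A\<^esub> ev Q)"
    unfolding ev_eq[OF Q] using sP sQ mc
    by (intro A.add.finprod_cong' refl) (auto simp: A.finsum_rdistr Pi_def intro!: A.finsum_closed)
  also have "\<dots> = ev P \<otimes>\<^bsub>A\<^esub> ev Q"
  proof -
    have "ev Q \<in> carrier A" unfolding ev_eq[OF Q] using sQ mc by (auto intro!: A.finsum_closed)
    then show ?thesis unfolding ev_eq[OF P] using sP mc by (simp add: A.finsum_ldistr Pi_def)
  qed
  finally show "ev (P \<otimes>\<^bsub>mpoly R n\<^esub> Q) = ev P \<otimes>\<^bsub>A\<^esub> ev Q" .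
next
  have "ev \<one>\<^bsub>mpoly R n\<^esub> = (\<Oplus>\<^bsub>A\<^esub>m\<in>{{#}}. \<sigma> (\<one>\<^bsub>mpoly R n\<^esub> m) \<otimes>\<^bsub>A\<^esub> mmon A a m)"
    by (rule ev_superset[OF M.one_closed]) (auto simp: mpoly_one)
  also have "\<dots> = \<one>\<^bsub>A\<^esub>" by (simp add: mpoly_one mmon_def)
  finally show "ev \<one>\<^bsub>mpoly R n\<^esub> = \<one>\<^bsub>A\<^esub>" .
qed

text \<open>Serves to compare evaluation in a lifting with evaluation in its reduction, with
  \<open>g\<close> the reduction of algebras and \<open>f\<close> that of base rings.\<close>

lemma ev_natural:
  assumes A': "cring A'" and R': "cring R'" and g: "g \<in> ring_hom A A'" and f: "f \<in> ring_hom R R'"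
    and gs: "\<And>x. x \<in> carrier R \<Longrightarrow> g (\<sigma> x) = \<sigma>' (f x)" and s': "\<sigma>' \<in> ring_hom R' A'"
    and ga: "\<forall>i<n. g (a i) = a' i"
    and P: "P \<in> carrier (mpoly R n)" and fP: "cmap f P \<in> carrier (mpoly R' n)"
  shows "g (ev P) = mpoly_eval R' A' \<sigma>' a' (cmap f P)"
proof -
  interpret g: ring_hom_cring A A' g using A.is_cring A' g by (intro ring_hom_cring.intro ring_hom_cring_axioms.intro)
  interpret f: ring_hom_cring R R' f using R.is_cring R' f by (intro ring_hom_cring.intro ring_hom_cring_axioms.intro)
  have a': "\<forall>i<n. a' i \<in> carrier A'" using a ga g.hom_closed by metis
  interpret E: mpoly_ev R' A' \<sigma>' n a' by unfold_locales (use s' a' in auto)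
  note sP = supp[OF P]
  have mc: "mmon A a m \<in> carrier A" if "m \<in> msupp R P" for m
    using mmon_closed[OF A.is_cring a] sP(2) that by blast
  have "g (ev P) = (\<Oplus>\<^bsub>A'\<^esub>m\<in>msupp R P. g (\<sigma> (P m) \<otimes>\<^bsub>A\<^esub> mmon A a m))"
    unfolding ev_eq[OF P] using sP(3) mc by (subst g.hom_finsum) (auto simp: comp_def)
  also have "\<dots> = (\<Oplus>\<^bsub>A'\<^esub>m\<in>msupp R P. \<sigma>' (cmap f P m) \<otimes>\<^bsub>A'\<^esub> mmon A' a' m)"
    using sP mc mmon_hom[OF A.is_cring A' g a ga] mmon_closed[OF A' a']
    by (intro g.S.add.finprod_cong' refl) (auto simp: gs cmap_def)
  also have "\<dots> = mpoly_eval R' A' \<sigma>' a' (cmap f P)"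
    by (rule E.ev_superset[OF fP sP(1) _ sP(2), symmetric]) (auto simp: cmap_def)
  finally show ?thesis .
qed

end

lemma cmap_hom:
  assumes R: "cring R" and R': "cring R'" and f: "f \<in> ring_hom R R'"
  shows "cmap f \<in> ring_hom (mpoly R n) (mpoly R' n)"
proof -
  interpret f: ring_hom_cring R R' f using R R' f by (intro ring_hom_cring.intro ring_hom_cring_axioms.intro)
  show ?thesis
  proof (rule ring_hom_memI)
    fix P assume P: "P \<in> carrier (mpoly R n)"
    have sub: "msupp R' (cmap f P) \<subseteq> msupp R P" by (auto simp: cmap_def)
    show "cmap f P \<in> carrier (mpoly R' n)" using P sub
      unfolding mpoly_carrier mcarrier_def by (auto simp: cmap_def intro: finite_subset)
    fix Q assume Q: "Q \<in> carrier (mpoly R n)"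
    show "cmap f (P \<oplus>\<^bsub>mpoly R n\<^esub> Q) = cmap f P \<oplus>\<^bsub>mpoly R' n\<^esub> cmap f Q"
      using P Q by (simp add: mpoly_add cmap_def mpoly_carrier f.R.mcarrierD)
    show "cmap f (P \<otimes>\<^bsub>mpoly R n\<^esub> Q) = cmap f P \<otimes>\<^bsub>mpoly R' n\<^esub> cmap f Q"
    proof
      fix m
      show "cmap f (P \<otimes>\<^bsub>mpoly R n\<^esub> Q) m = (cmap f P \<otimes>\<^bsub>mpoly R' n\<^esub> cmap f Q) m"
        using P Q unfolding mpoly_mult cmap_def
        by (subst f.hom_finsum) (auto simp: mpoly_carrier f.R.mcarrierD comp_def intro!: f.S.add.finprod_cong')
    qed
  next
    show "cmap f \<one>\<^bsub>mpoly R n\<^esub> = \<one>\<^bsub>mpoly R' n\<^esub>" by (auto simp: mpoly_one cmap_def)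
  qed
qed

lemma mpoly_deriv_closed:
  assumes R: "cring R" and P: "P \<in> carrier (mpoly R n)" and j: "j < n"
  shows "mpoly_deriv R j P \<in> carrier (mpoly R n)"
proof -
  interpret cring R by fact
  have "msupp R (mpoly_deriv R j P) \<subseteq> add_mset j -` msupp R P"
    by (auto simp: mpoly_deriv_def)
  then have "finite (msupp R (mpoly_deriv R j P))"
    by (rule finite_subset, intro finite_vimageI) (use P in \<open>auto simp: mpoly_carrier mcarrier_def inj_def\<close>)
  moreover have "set_mset m \<subseteq> {..<n}" if "mpoly_deriv R j P m \<noteq> \<zero>\<^bsub>R\<^esub>" for m
  proof -
    have "P (add_mset j m) \<noteq> \<zero>\<^bsub>R\<^esub>" using that by (auto simp: mpoly_deriv_def)
    then have "set_mset (add_mset j m) \<subseteq> {..<n}" using P unfolding mpoly_carrier by blast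
    then show ?thesis by simp
  qed
  ultimately show ?thesis using P by (auto simp: mpoly_carrier mcarrier_def mpoly_deriv_def)
qed

lemma cmap_deriv:
  assumes R: "cring R" and R': "cring R'" and f: "f \<in> ring_hom R R'" and P: "P \<in> carrier (mpoly R n)"
  shows "cmap f (mpoly_deriv R j P) = mpoly_deriv R' j (cmap f P)"
  using P ring_hom_add_pow_nat[OF cring.axioms(1)[OF R] cring.axioms(1)[OF R'] f]
  by (auto simp: cmap_def mpoly_deriv_def mpoly_carrier mcarrier_def)

lemma ring_det_hom:
  assumes A: "cring A" and A': "cring A'" and g: "g \<in> ring_hom A A'"
    and M: "\<And>i l. i < c \<Longrightarrow> l < c \<Longrightarrow> M i l \<in> carrier A"
    and M': "\<And>i l. i < c \<Longrightarrow> l < c \<Longrightarrow> M' i l = g (M i l)"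
  shows "g (ring_det A c M) = ring_det A' c M'"
proof -
  interpret g: ring_hom_cring A A' g using A A' g by (intro ring_hom_cring.intro ring_hom_cring_axioms.intro)
  have pm: "\<pi> i < c" if "\<pi> permutes {..<c}" "i < c" for \<pi> i
    using permutes_in_image[OF that(1), of i] that(2) by simp
  have pr: "(\<Otimes>\<^bsub>A\<^esub>i\<in>{..<c}. M i (\<pi> i)) \<in> carrier A" if "\<pi> permutes {..<c}" for \<pi>
    using M pm[OF that] by (auto intro!: g.R.finprod_closed)
  have eq: "g (\<Otimes>\<^bsub>A\<^esub>i\<in>{..<c}. M i (\<pi> i)) = (\<Otimes>\<^bsub>A'\<^esub>i\<in>{..<c}. M' i (\<pi> i))" if "\<pi> permutes {..<c}" for \<pi>
    using M M' pm[OF that] by (subst g.hom_finprod) (auto intro!: g.S.finprod_cong')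
  have "g (ring_det A c M) = (\<Oplus>\<^bsub>A'\<^esub>\<pi>\<in>{\<pi>. \<pi> permutes {..<c}}. g (add_pow A (sign \<pi>) (\<Otimes>\<^bsub>A\<^esub>i\<in>{..<c}. M i (\<pi> i))))"
    unfolding ring_det_def using pr by (subst g.hom_finsum) (auto simp: comp_def g.R.add.int_pow_closed)
  also have "\<dots> = ring_det A' c M'"
    unfolding ring_det_def using pr g.hom_closed[OF pr]
    by (intro g.S.add.finprod_cong' refl)
      (auto simp: ring_hom_add_pow_int[OF g.R.ring_axioms g.S.ring_axioms g] eq g.S.add.int_pow_closed simp flip: eq)
  finally show ?thesis .
qed

lemma mpoly_add_pow:
  assumes "cring R" "P \<in> carrier (mpoly R n)"
  shows "add_pow (mpoly R n) (q::nat) P = (\<lambda>m. add_pow R q (P m))"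
proof -
  interpret R: cring R by fact
  interpret M: cring "mpoly R n" by (rule R.mpoly_cring)
  show ?thesis by (induction q) (simp_all add: mpoly_zero mpoly_add)
qed

section \<open>Lifting a smooth presentation\<close>

text \<open>Isolates the properties of $W_2(k)$ over a perfect field on which the lifting of a
  presentation rests; \<open>smooth_lift_W2\<close> verifies them.\<close>

locale smooth_lift = p_ext_surj p S A em j + W: cring W + k: cring k
  for p :: nat and S :: "('e, 'm) ring_scheme" and A :: "('a, 'n) ring_scheme" and em j
    and W :: "('w, 'm1) ring_scheme" and k :: "('k, 'm2) ring_scheme" +
  fixes f :: "'w \<Rightarrow> 'k" and \<sigma> :: "'k \<Rightarrow> 'a" and \<tau> :: "'w \<Rightarrow> 'e"
  assumes f: "f \<in> ring_hom W k" and f_surj: "f ` carrier W = carrier k"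
    and f_ker: "x \<in> carrier W \<Longrightarrow> f x = \<zero>\<^bsub>k\<^esub> \<Longrightarrow> \<exists>y\<in>carrier W. x = add_pow W p y"
    and char_k: "add_pow k p \<one>\<^bsub>k\<^esub> = \<zero>\<^bsub>k\<^esub>"
    and pp_W: "x \<in> carrier W \<Longrightarrow> add_pow W p (add_pow W p x) = \<zero>\<^bsub>W\<^esub>"
    and \<sigma>: "\<sigma> \<in> ring_hom k A" and \<tau>: "\<tau> \<in> ring_hom W S"
    and em_\<tau>: "x \<in> carrier W \<Longrightarrow> em (\<tau> x) = \<sigma> (f x)"
begin

sublocale f: ring_hom_cring W k f by unfold_locales (rule f)

text \<open>The section has to send zero to zero, so that lifting a polynomial coefficient by
  coefficient keeps its support finite.\<close>

lemma f_lift: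
  obtains g where "\<And>x. x \<in> carrier k \<Longrightarrow> g x \<in> carrier W" "\<And>x. x \<in> carrier k \<Longrightarrow> f (g x) = x" "g \<zero>\<^bsub>k\<^esub> = \<zero>\<^bsub>W\<^esub>"
proof -
  have "\<forall>x. \<exists>y. x \<in> carrier k \<longrightarrow> y \<in> carrier W \<and> f y = x \<and> (x = \<zero>\<^bsub>k\<^esub> \<longrightarrow> y = \<zero>\<^bsub>W\<^esub>)"
  proof
    fix x
    show "\<exists>y. x \<in> carrier k \<longrightarrow> y \<in> carrier W \<and> f y = x \<and> (x = \<zero>\<^bsub>k\<^esub> \<longrightarrow> y = \<zero>\<^bsub>W\<^esub>)"
    proof (cases "x = \<zero>\<^bsub>k\<^esub>")
      case True
      then show ?thesis by (intro exI[of _ "\<zero>\<^bsub>W\<^esub>"]) simp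
    next
      case False
      show ?thesis
      proof (cases "x \<in> carrier k")
        case True
        then obtain y where "y \<in> carrier W" "x = f y" using f_surj by (metis imageE)
        with False show ?thesis by blast
      qed simp
    qed
  qed
  then obtain g where "\<forall>x. x \<in> carrier k \<longrightarrow> g x \<in> carrier W \<and> f (g x) = x \<and> (x = \<zero>\<^bsub>k\<^esub> \<longrightarrow> g x = \<zero>\<^bsub>W\<^esub>)"
    by metis
  with that[of g] show thesis by simp
qed

lemma cmap_lift:
  assumes P: "P \<in> carrier (mpoly k n)"
  obtains Q where "Q \<in> carrier (mpoly W n)" "cmap f Q = P"
proof -
  obtain g where g: "\<And>x. x \<in> carrier k \<Longrightarrow> g x \<in> carrier W" "\<And>x. x \<in> carrier k \<Longrightarrow> f (g x) = x" "g \<zero>\<^bsub>k\<^esub> = \<zero>\<^bsub>W\<^esub>"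
    using f_lift by blast
  have "msupp W (cmap g P) \<subseteq> msupp k P" using g(3) by (auto simp: cmap_def)
  with P g have "cmap g P \<in> carrier (mpoly W n)"
    by (auto simp: mpoly_carrier mcarrier_def cmap_def intro: finite_subset)
  moreover have "cmap f (cmap g P) = P" using P g(2) by (auto simp: cmap_def mpoly_carrier mcarrier_def)
  ultimately show thesis using that by blast
qed

lemma cmap_ker:
  assumes P: "P \<in> carrier (mpoly W n)" and z: "cmap f P = \<zero>\<^bsub>mpoly k n\<^esub>"
  obtains Q where "Q \<in> carrier (mpoly W n)" "P = add_pow (mpoly W n) p Q"
proof -
  \<comment> \<open>Choosing 0 wherever the coefficient vanishes keeps the support of the quotient
    polynomial finite.\<close>
  have "\<forall>m. \<exists>y. y \<in> carrier W \<and> P m = add_pow W p y \<and> (P m = \<zero>\<^bsub>W\<^esub> \<longrightarrow> y = \<zero>\<^bsub>W\<^esub>)"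
  proof
    fix m
    show "\<exists>y. y \<in> carrier W \<and> P m = add_pow W p y \<and> (P m = \<zero>\<^bsub>W\<^esub> \<longrightarrow> y = \<zero>\<^bsub>W\<^esub>)"
    proof (cases "P m = \<zero>\<^bsub>W\<^esub>")
      case True
      then show ?thesis by (intro exI[of _ "\<zero>\<^bsub>W\<^esub>"]) simp
    next
      case False
      have "P m \<in> carrier W" "f (P m) = \<zero>\<^bsub>k\<^esub>"
        using P fun_cong[OF z, of m] by (simp_all add: mpoly_carrier mcarrier_def cmap_def mpoly_zero)
      with f_ker False show ?thesis by blast
    qed
  qed
  then obtain Q where Q: "\<And>m. Q m \<in> carrier W" "\<And>m. P m = add_pow W p (Q m)" "\<And>m. P m = \<zero>\<^bsub>W\<^esub> \<Longrightarrow> Q m = \<zero>\<^bsub>W\<^esub>"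
    by metis
  have "msupp W Q \<subseteq> msupp W P" using Q(3) by auto
  with P Q(1,3) have Qc: "Q \<in> carrier (mpoly W n)"
    unfolding mpoly_carrier mcarrier_def by (auto intro: finite_subset)
  moreover have "P = add_pow (mpoly W n) p Q"
    unfolding mpoly_add_pow[OF W.is_cring Qc] using Q(2) by auto
  ultimately show thesis using that by blast
qed

text \<open>Each relation is lifted to $W$ and corrected by a multiple of $p$ so as to vanish in \<open>S\<close>. An
  element of the kernel is a combination of these up to \<open>p Q\<close>, and then \<open>Q\<close> vanishes modulo
  $p$, so that a second application of the same argument finishes.\<close>

lemma standard_smooth_lift:
  assumes "standard_smooth k A \<sigma>"
  shows "standard_smooth W S \<tau>"
proof -
  obtain n c P a where cn: "c \<le> n" and P: "\<And>i. i < c \<Longrightarrow> P i \<in> carrier (mpoly k n)" and a: "\<forall>i<n. a i \<in> carrier A"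
    and onto: "mpoly_eval k A \<sigma> a ` carrier (mpoly k n) = carrier A"
    and kern: "{Q \<in> carrier (mpoly k n). mpoly_eval k A \<sigma> a Q = \<zero>\<^bsub>A\<^esub>} = Idl\<^bsub>mpoly k n\<^esub> (P ` {..<c})"
    and jac: "ring_det A c (\<lambda>i j. mpoly_eval k A \<sigma> a (mpoly_deriv k j (P i))) \<in> Units A"
    using assms unfolding standard_smooth_def by auto
  define b where "b i = some_lift (a i)" for i
  have b: "\<forall>i<n. b i \<in> carrier S" and em_b: "\<forall>i<n. em (b i) = a i" using a some_lift by (auto simp: b_def)
  interpret e: mpoly_ev k A \<sigma> n a by unfold_locales (use \<sigma> a in auto)
  interpret E: mpoly_ev W S \<tau> n b by unfold_locales (use \<tau> b in auto)
  interpret ev: ring_hom_cring "mpoly k n" A e.ev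
    by (intro ring_hom_cring.intro ring_hom_cring_axioms.intro e.ev_hom e.M.is_cring A)
  interpret Ev: ring_hom_cring "mpoly W n" S E.ev
    by (intro ring_hom_cring.intro ring_hom_cring_axioms.intro E.ev_hom E.M.is_cring S)
  interpret \<pi>: ring_hom_cring "mpoly W n" "mpoly k n" "cmap f"
    by (intro ring_hom_cring.intro ring_hom_cring_axioms.intro cmap_hom W.is_cring k.is_cring f e.M.is_cring E.M.is_cring)
  have em_ev: "em (E.ev Q) = e.ev (cmap f Q)" if "Q \<in> carrier (mpoly W n)" for Q
    by (rule E.ev_natural[OF A k.is_cring em f em_\<tau> \<sigma> em_b that]) (use that in simp_all)
  have ev_p: "E.ev (add_pow (mpoly W n) p Q) = j (e.ev (cmap f Q))" if "Q \<in> carrier (mpoly W n)" for Q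
    using that by (simp add: ring_hom_add_pow_nat[OF E.M.ring_axioms S.ring_axioms E.ev_hom] em_ev[symmetric] j_em)
  have \<pi>_p: "cmap f (add_pow (mpoly W n) p Q) = \<zero>\<^bsub>mpoly k n\<^esub>" if "Q \<in> carrier (mpoly W n)" for Q
  proof -
    have "cmap f Q m \<in> carrier k" for m using \<pi>.hom_closed[OF that] by (simp add: mpoly_carrier mcarrier_def)
    then show ?thesis
      unfolding ring_hom_add_pow_nat[OF E.M.ring_axioms e.M.ring_axioms \<pi>.homh that]
        mpoly_add_pow[OF k.is_cring \<pi>.hom_closed[OF that]] mpoly_zero
      by (simp add: k.char_add_pow[OF char_k])
  qed
  have evP: "e.ev (P i) = \<zero>\<^bsub>A\<^esub>" if "i < c" for i
    using e.M.genideal_self[of "P ` {..<c}"] P that kern by blast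
  have "\<exists>Q. Q \<in> carrier (mpoly W n) \<and> cmap f Q = P i \<and> E.ev Q = \<zero>\<^bsub>S\<^esub>" if i: "i < c" for i
  proof -
    obtain Q where Q: "Q \<in> carrier (mpoly W n)" "cmap f Q = P i" using cmap_lift P[OF i] by blast
    have "em (E.ev Q) = \<zero>\<^bsub>A\<^esub>" using em_ev[OF Q(1)] Q evP[OF i] by simp
    then obtain x where x: "x \<in> carrier A" "E.ev Q = j x" using ker[OF Ev.hom_closed[OF Q(1)]] by blast
    obtain B where B: "B \<in> carrier (mpoly k n)" "x = e.ev B" using x onto by (metis imageE)
    obtain B' where B': "B' \<in> carrier (mpoly W n)" "cmap f B' = B" using cmap_lift B by blast
    let ?Q = "Q \<ominus>\<^bsub>mpoly W n\<^esub> add_pow (mpoly W n) p B'"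
    have "?Q \<in> carrier (mpoly W n)" using Q B' by simp
    moreover have "cmap f ?Q = P i" using Q B' P[OF i] by (simp add: E.M.minus_eq \<pi>_p)
    moreover have "E.ev ?Q = \<zero>\<^bsub>S\<^esub>"
      using Q B' x B by (simp add: E.M.minus_eq ev_p j_closed S.r_neg)
    ultimately show ?thesis by blast
  qed
  then obtain Q where Q: "\<And>i. i < c \<Longrightarrow> Q i \<in> carrier (mpoly W n)" "\<And>i. i < c \<Longrightarrow> cmap f (Q i) = P i"
    "\<And>i. i < c \<Longrightarrow> E.ev (Q i) = \<zero>\<^bsub>S\<^esub>" by metis
  define I where "I = Idl\<^bsub>mpoly W n\<^esub> (Q ` {..<c})"
  have I: "ideal I (mpoly W n)" unfolding I_def by (rule E.M.genideal_ideal) (use Q in auto)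
  have IQ: "Q i \<in> I" if "i < c" for i
    unfolding I_def using E.M.genideal_self[of "Q ` {..<c}"] Q that by blast
  have Ic: "x \<in> carrier (mpoly W n)" if "x \<in> I" for x using ideal.Icarr[OF I that] .
  have Iadd: "x \<oplus>\<^bsub>mpoly W n\<^esub> y \<in> I" if "x \<in> I" "y \<in> I" for x y using E.M.primeideal_add[OF I that] .
  have kerI: "ideal {R \<in> carrier (mpoly W n). E.ev R = \<zero>\<^bsub>S\<^esub>} (mpoly W n)"
    by (rule E.M.idealI') auto
  have I_ker: "E.ev x = \<zero>\<^bsub>S\<^esub>" if "x \<in> I" for x
  proof -
    have "I \<subseteq> {R \<in> carrier (mpoly W n). E.ev R = \<zero>\<^bsub>S\<^esub>}"
      unfolding I_def by (rule E.M.genideal_minimal[OF kerI]) (use Q in auto)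
    then show ?thesis using that by blast
  qed
  have "ideal (cmap f ` I) (mpoly k n)"
  proof (rule e.M.idealI')
    show "cmap f ` I \<subseteq> carrier (mpoly k n)" using Ic by auto
    have "\<zero>\<^bsub>mpoly W n\<^esub> \<in> I" using additive_subgroup.zero_closed[OF ideal.axioms(1)[OF I]] .
    then show "\<zero>\<^bsub>mpoly k n\<^esub> \<in> cmap f ` I" by (rule rev_image_eqI) simp
    fix x y assume x: "x \<in> cmap f ` I"
    then obtain x' where x': "x' \<in> I" "x = cmap f x'" by blast
    { assume "y \<in> cmap f ` I"
      then obtain y' where y': "y' \<in> I" "y = cmap f y'" by blast
      show "x \<oplus>\<^bsub>mpoly k n\<^esub> y \<in> cmap f ` I"
        by (rule rev_image_eqI[OF Iadd[OF x'(1) y'(1)]]) (use x' y' Ic in simp)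
    }
    assume "y \<in> carrier (mpoly k n)"
    then obtain y' where y': "y' \<in> carrier (mpoly W n)" "cmap f y' = y" using cmap_lift by blast
    show "y \<otimes>\<^bsub>mpoly k n\<^esub> x \<in> cmap f ` I"
      by (rule rev_image_eqI[OF ideal.I_l_closed[OF I x'(1) y'(1)]]) (use x' y' Ic in simp)
  qed
  then have "Idl\<^bsub>mpoly k n\<^esub> (P ` {..<c}) \<subseteq> cmap f ` I"
    by (rule e.M.genideal_minimal) (use IQ Q in force)
  then have red: "\<exists>Q'\<in>I. cmap f R = cmap f Q'" if "R \<in> carrier (mpoly W n)" "e.ev (cmap f R) = \<zero>\<^bsub>A\<^esub>" for R
    using that kern \<pi>.hom_closed[OF that(1)] by blast
  have "x \<in> I" if x: "x \<in> carrier (mpoly W n)" "E.ev x = \<zero>\<^bsub>S\<^esub>" for x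
  proof -
    have "e.ev (cmap f x) = \<zero>\<^bsub>A\<^esub>" using em_ev[OF x(1)] x(2) by simp
    then obtain y where y: "y \<in> I" "cmap f x = cmap f y" using red[OF x(1)] by blast
    let ?D = "x \<ominus>\<^bsub>mpoly W n\<^esub> y"
    have "?D \<in> carrier (mpoly W n)" "cmap f ?D = \<zero>\<^bsub>mpoly k n\<^esub>"
      using x y Ic by (simp_all add: E.M.minus_eq e.M.r_neg)
    then obtain T where T: "T \<in> carrier (mpoly W n)" "?D = add_pow (mpoly W n) p T" using cmap_ker by blast
    have "E.ev ?D = \<zero>\<^bsub>S\<^esub>" using x y Ic I_ker by (simp add: E.M.minus_eq)
    then have "e.ev (cmap f T) = \<zero>\<^bsub>A\<^esub>" unfolding T(2) ev_p[OF T(1)] using j_eq_zero T by simp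
    then obtain t where t: "t \<in> I" "cmap f T = cmap f t" using red[OF T(1)] by blast
    let ?D' = "T \<ominus>\<^bsub>mpoly W n\<^esub> t"
    have D': "?D' \<in> carrier (mpoly W n)" "cmap f ?D' = \<zero>\<^bsub>mpoly k n\<^esub>"
      using T t Ic by (simp_all add: E.M.minus_eq e.M.r_neg)
    then obtain T' where T': "T' \<in> carrier (mpoly W n)" "?D' = add_pow (mpoly W n) p T'" using cmap_ker by blast
    have z: "add_pow (mpoly W n) p (add_pow (mpoly W n) p T') = \<zero>\<^bsub>mpoly W n\<^esub>"
    proof -
      have c1: "add_pow (mpoly W n) p T' \<in> carrier (mpoly W n)" using T' by simp
      show ?thesis
        using T'(1) pp_W by (simp add: mpoly_add_pow[OF W.is_cring c1] mpoly_zero)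
          (simp add: mpoly_add_pow[OF W.is_cring T'(1)] mpoly_carrier mcarrier_def)
    qed
    have "T = ?D' \<oplus>\<^bsub>mpoly W n\<^esub> t" using T(1) Ic[OF t(1)] by (simp add: E.M.minus_eq E.M.a_assoc E.M.l_neg)
    then have "add_pow (mpoly W n) p T = add_pow (mpoly W n) p t"
      unfolding T'(2) using T' Ic[OF t(1)] z by (simp add: E.M.add.nat_pow_distrib)
    also have "\<dots> = add_pow (mpoly W n) p \<one>\<^bsub>mpoly W n\<^esub> \<otimes>\<^bsub>mpoly W n\<^esub> t"
      using Ic[OF t(1)] by (simp add: E.M.add_pow_ldistr)
    finally have "?D \<in> I" unfolding T(2) using ideal.I_l_closed[OF I t(1)] by simp
    moreover have "x = ?D \<oplus>\<^bsub>mpoly W n\<^esub> y" using x Ic[OF y(1)] by (simp add: E.M.minus_eq E.M.a_assoc E.M.l_neg)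
    ultimately show ?thesis using Iadd y(1) by metis
  qed
  then have kern': "{R \<in> carrier (mpoly W n). E.ev R = \<zero>\<^bsub>S\<^esub>} = I" using I_ker Ic by blast
  have "s \<in> E.ev ` carrier (mpoly W n)" if s: "s \<in> carrier S" for s
  proof -
    obtain B where B: "B \<in> carrier (mpoly k n)" "em s = e.ev B" using s onto em.hom_closed by (metis imageE)
    obtain B' where B': "B' \<in> carrier (mpoly W n)" "cmap f B' = B" using cmap_lift B by blast
    have "em s = em (E.ev B')" using em_ev B B' by simp
    then obtain x where x: "x \<in> carrier A" "s = E.ev B' \<oplus>\<^bsub>S\<^esub> j x" using em_eqE s B' by (metis Ev.hom_closed)
    obtain C where C: "C \<in> carrier (mpoly k n)" "x = e.ev C" using x onto by (metis imageE)
    obtain C' where C': "C' \<in> carrier (mpoly W n)" "cmap f C' = C" using cmap_lift C by blast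
    have "s = E.ev (B' \<oplus>\<^bsub>mpoly W n\<^esub> add_pow (mpoly W n) p C')"
      using x C C' B' ev_p by simp
    then show ?thesis using B' C' by blast
  qed
  then have onto': "E.ev ` carrier (mpoly W n) = carrier S" by auto
  have ld: "l < n" if "l < c" for l using that cn by simp
  have dc: "mpoly_deriv W l (Q i) \<in> carrier (mpoly W n)" if "i < c" "l < c" for i l
    by (rule mpoly_deriv_closed[OF W.is_cring Q(1)[OF that(1)] ld[OF that(2)]])
  \<comment> \<open>The Jacobian of the lifted relations reduces to the given one, because reduction
    commutes with derivatives, evaluation and determinants; units lift along
    \<open>em\<close>.\<close>
  have "em (ring_det S c (\<lambda>i l. E.ev (mpoly_deriv W l (Q i)))) =
     ring_det A c (\<lambda>i l. e.ev (mpoly_deriv k l (P i)))"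
    by (rule ring_det_hom[OF S A em])
      (use dc Q cmap_deriv[OF W.is_cring k.is_cring f Q(1)] in \<open>simp_all add: em_ev\<close>)
  moreover have "ring_det S c (\<lambda>i l. E.ev (mpoly_deriv W l (Q i))) \<in> carrier S"
  proof -
    have "\<pi> i < c" if "\<pi> permutes {..<c}" "i < c" for \<pi> i
      using permutes_in_image[OF that(1), of i] that(2) by simp
    then show ?thesis unfolding ring_det_def using dc
      by (auto intro!: S.finsum_closed S.add.int_pow_closed S.finprod_closed)
  qed
  ultimately have "ring_det S c (\<lambda>i l. E.ev (mpoly_deriv W l (Q i))) \<in> Units S"
    using unit_of_surj surj jac by simp
  then show ?thesis unfolding standard_smooth_def
    using cn Q(1) b onto' kern' unfolding I_def
    by (intro exI[of _ n] exI[of _ c] exI[of _ Q] exI[of _ b]) simp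
qed

end

section \<open>Gluing local liftings\<close>

lemma image_ring_iso:
  assumes R: "cring R" and inj: "inj_on f (carrier R)"
  shows "cring (image_ring f R)" "f \<in> ring_hom R (image_ring f R)"
    "inv_into (carrier R) f \<in> ring_hom (image_ring f R) R"
proof -
  interpret cring R by fact
  have iso: "f \<in> ring_iso R (image_ring f R)" by (rule inj_imp_image_ring_iso[OF inj])
  show "cring (image_ring f R)" by (rule ring_iso_imp_img_cring[OF iso, simplified image_ring_zero[symmetric] image_ring_one[symmetric], simplified])
  show "f \<in> ring_hom R (image_ring f R)" using iso by (simp add: ring_iso_def)
  show "inv_into (carrier R) f \<in> ring_hom (image_ring f R) R"
    using inj_imp_image_ring_inv_iso[of f] ring_iso_set_sym[OF ring_axioms iso] by (simp add: ring_iso_def)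
qed

lemma p_ext_image:
  assumes "p_ext p S A em j" and inj: "inj_on f (carrier S)"
  shows "p_ext p (image_ring f S) A (\<lambda>x. em (inv_into (carrier S) f x)) (\<lambda>a. f (j a))"
proof -
  interpret p_ext p S A em j by fact
  note iso = image_ring_iso[OF S inj]
  define g where "g = inv_into (carrier S) f"
  have gf: "g (f s) = s" if "s \<in> carrier S" for s unfolding g_def using inj that by simp
  interpret f: ring_hom_cring S "image_ring f S" f
    using S iso by (intro ring_hom_cring.intro ring_hom_cring_axioms.intro)
  interpret g: ring_hom_cring "image_ring f S" S g
    unfolding g_def using S iso by (intro ring_hom_cring.intro ring_hom_cring_axioms.intro)
  show ?thesis
    unfolding g_def[symmetric]
  proof (rule p_ext.intro)
    show "cring (image_ring f S)" by (rule iso)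
    show "(\<lambda>x. em (g x)) \<in> ring_hom (image_ring f S) A"
      by (rule ring_hom_memI) simp_all
    show "inj_on (\<lambda>a. f (j a)) (carrier A)"
      by (rule inj_onI) (metis gf j_closed j_inj inj_onD)
    fix s assume s: "s \<in> carrier (image_ring f S)"
    then obtain t where t: "t \<in> carrier S" "s = f t" by (auto simp: image_ring_carrier)
    show "\<exists>a\<in>carrier A. s = f (j a)" if "em (g s) = \<zero>\<^bsub>A\<^esub>"
      using ker[OF t(1)] that t gf by auto
    show "f (j (em (g s))) = add_pow (image_ring f S) p s"
      using t gf by (simp add: j_em ring_hom_add_pow_nat[OF S.ring_axioms f.S.ring_axioms f.homh])
    fix a assume "a \<in> carrier A"
    then show "f (j (em (g s) \<otimes>\<^bsub>A\<^esub> a)) = s \<otimes>\<^bsub>image_ring f S\<^esub> f (j a)"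
      using t gf by (simp add: j_mult j_closed)
  qed (simp_all add: A.is_cring j_closed j_add gf em_j A prime)
qed

text \<open>Renames sections through injections \<open>c U\<close> into another type. The sheaf is
  first built from families of cosets, whereas a Frobenius lifting must have sections of type
  \<open>'r \<times> 'r\<close>. The structure map is a parameter because the source is a bare
  ringed space.\<close>

definition transport ::
  "('x set \<Rightarrow> 't \<Rightarrow> 'u) \<Rightarrow> ('x, 't, 'z) ringed_space_scheme \<Rightarrow> ('w \<Rightarrow> 'u) \<Rightarrow> ('x, 'u, 'w) scheme_over" where
  "transport c Z st = \<lparr>Top = Top Z, Sh = (\<lambda>U. image_ring (c U) (Sh Z U)),
     Res = (\<lambda>U V x. c V (Res Z U V (inv_into (carrier (Sh Z U)) (c U) x))), Str = st\<rparr>"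

lemma transport_simps [simp]:
  "Top (transport c Z st) = Top Z" "Sh (transport c Z st) U = image_ring (c U) (Sh Z U)"
  "Res (transport c Z st) U V x = c V (Res Z U V (inv_into (carrier (Sh Z U)) (c U) x))"
  "Str (transport c Z st) = st"
  by (simp_all add: transport_def)

lemma transport_ringed_space:
  assumes "is_ringed_space Z" and inj: "\<And>U. openin (Top Z) U \<Longrightarrow> inj_on (c U) (carrier (Sh Z U))"
  shows "is_ringed_space (transport c Z st)"
proof -
  interpret rspace Z by unfold_locales fact
  define g where "g U = inv_into (carrier (Sh Z U)) (c U)" for U
  note iso = image_ring_iso[OF Sh_cring inj]
  have gf: "g U (c U s) = s" if "op U" "s \<in> carrier (Sh Z U)" for U s
    unfolding g_def using inj that by simp
  have gc: "g U x \<in> carrier (Sh Z U)" "c U (g U x) = x" if "x \<in> c U ` carrier (Sh Z U)" for U x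
    using that unfolding g_def by (auto intro: inv_into_into simp: f_inv_into_f)
  have res: "Res (transport c Z st) U V \<in> ring_hom (image_ring (c U) (Sh Z U)) (image_ring (c V) (Sh Z V))"
    if "op U" "op V" "V \<subseteq> U" for U V
  proof -
    have "c V \<circ> (Res Z U V \<circ> g U) \<in> ring_hom (image_ring (c U) (Sh Z U)) (image_ring (c V) (Sh Z V))"
      unfolding g_def using that by (intro ring_hom_trans[of _ _ "Sh Z V"] ring_hom_trans[of _ _ "Sh Z U"] iso Res_hom)
    then show ?thesis by (simp add: comp_def g_def[symmetric] transport_def)
  qed
  show ?thesis
    unfolding is_ringed_space_def
  proof (intro conjI allI impI ballI; (elim conjE)?; (unfold transport_simps(1,2) image_ring_carrier)?)
    show "cring (image_ring (c U) (Sh Z U))" if "op U" for U using iso(1)[OF that that] .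
    show "Res (transport c Z st) U V \<in> ring_hom (image_ring (c U) (Sh Z U)) (image_ring (c V) (Sh Z V))"
      if "op U" "op V" "V \<subseteq> U" for U V using res that .
    show "Res (transport c Z st) U U s = s" if "op U" "s \<in> c U ` carrier (Sh Z U)" for U s
      using that by (auto simp: g_def[symmetric] gf Res_id)
    show "Res (transport c Z st) V W (Res (transport c Z st) U V s) = Res (transport c Z st) U W s"
      if "op U" "op V" "op W" "W \<subseteq> V" "V \<subseteq> U" "s \<in> c U ` carrier (Sh Z U)" for U V W s
      using that by (auto simp: g_def[symmetric] gf Res_comp Res_closed)
  next
    fix \<U> s
    assume 1: "\<forall>U\<in>\<U>. op U \<and> s U \<in> c U ` carrier (Sh Z U)"
      and 2: "\<forall>U\<in>\<U>. \<forall>V\<in>\<U>. Res (transport c Z st) U (U \<inter> V) (s U) = Res (transport c Z st) V (U \<inter> V) (s V)"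
    have oU: "op (\<Union>\<U>)" using 1 by blast
    have "\<exists>!t. t \<in> carrier (Sh Z (\<Union>\<U>)) \<and> (\<forall>V\<in>\<U>. Res Z (\<Union>\<U>) V t = g V (s V))"
    proof (rule sheaf_glue)
      fix V W assume VW: "V \<in> \<U>" "W \<in> \<U>"
      then have "op (V \<inter> W)" using 1 by (simp add: openin_Int)
      moreover have "c (V \<inter> W) (Res Z V (V \<inter> W) (g V (s V))) = c (V \<inter> W) (Res Z W (V \<inter> W) (g W (s W)))"
        using bspec[OF bspec[OF 2 VW(1)] VW(2)] by (simp add: g_def)
      ultimately show "Res Z V (V \<inter> W) (g V (s V)) = Res Z W (V \<inter> W) (g W (s W))"
        using inj_onD[OF inj] 1 VW gc by (auto simp: Res_closed)
    qed (use 1 gc in auto)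
    then obtain t where t: "t \<in> carrier (Sh Z (\<Union>\<U>))" "\<forall>V\<in>\<U>. Res Z (\<Union>\<U>) V t = g V (s V)"
      and uniq: "\<And>t'. t' \<in> carrier (Sh Z (\<Union>\<U>)) \<Longrightarrow> \<forall>V\<in>\<U>. Res Z (\<Union>\<U>) V t' = g V (s V) \<Longrightarrow> t' = t" by metis
    show "\<exists>!t. t \<in> c (\<Union>\<U>) ` carrier (Sh Z (\<Union>\<U>)) \<and> (\<forall>U\<in>\<U>. Res (transport c Z st) (\<Union>\<U>) U t = s U)"
    proof (rule ex1I[of _ "c (\<Union>\<U>) t"])
      show "c (\<Union>\<U>) t \<in> c (\<Union>\<U>) ` carrier (Sh Z (\<Union>\<U>)) \<and> (\<forall>U\<in>\<U>. Res (transport c Z st) (\<Union>\<U>) U (c (\<Union>\<U>) t) = s U)"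
        using t 1 gc oU by (simp add: g_def[symmetric] gf)
      fix t' assume t': "t' \<in> c (\<Union>\<U>) ` carrier (Sh Z (\<Union>\<U>)) \<and> (\<forall>U\<in>\<U>. Res (transport c Z st) (\<Union>\<U>) U t' = s U)"
      then obtain t'' where t'': "t'' \<in> carrier (Sh Z (\<Union>\<U>))" "t' = c (\<Union>\<U>) t''" by blast
      have "Res Z (\<Union>\<U>) V t'' = g V (s V)" if V: "V \<in> \<U>" for V
      proof -
        have "c V (Res Z (\<Union>\<U>) V t'') = s V" using t' t'' V oU by (simp add: g_def[symmetric] gf)
        moreover have "Res Z (\<Union>\<U>) V t'' \<in> carrier (Sh Z V)" using 1 V oU t'' by (intro Res_closed) auto
        ultimately show ?thesis using gf 1 V by metis
      qed
      then show "t' = c (\<Union>\<U>) t" using uniq t'' by blast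
    qed
  qed
qed

lemma transport_lift_space:
  assumes "lift_space X p Z em j" and inj: "\<And>U. openin (Top X) U \<Longrightarrow> inj_on (c U) (carrier (Sh Z U))"
  shows "lift_space X p (transport c Z st) (\<lambda>U x. em U (inv_into (carrier (Sh Z U)) (c U) x)) (\<lambda>U a. c U (j U a))"
proof -
  interpret lift_space X p Z em j by fact
  define g where "g U = inv_into (carrier (Sh Z U)) (c U)" for U
  have gf: "g U (c U s) = s" if "openin (Top X) U" "s \<in> carrier (Sh Z U)" for U s
    unfolding g_def using inj that by simp
  have jc: "j U a \<in> carrier (Sh Z U)" if "openin (Top X) U" "a \<in> carrier (Sh X U)" for U a
    using p_ext.j_closed[OF ext] that by blast
  show ?thesis
  proof (intro lift_space.intro lift_space_axioms.intro X.scheme_axioms)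
    show "is_ringed_space (transport c Z st)"
      by (rule transport_ringed_space[OF rsZ]) (use inj in simp)
    show "Top (transport c Z st) = Top X" by (simp add: Top_Z)
    show "p_ext p (Sh (transport c Z st) U) (Sh X U) (\<lambda>x. em U (inv_into (carrier (Sh Z U)) (c U) x)) (\<lambda>a. c U (j U a))"
      if "openin (Top X) U" for U
      using p_ext_image[OF ext[OF that] inj[OF that]] by simp
    show "em V (inv_into (carrier (Sh Z V)) (c V) (Res (transport c Z st) U V s)) =
       Res X U V (em U (inv_into (carrier (Sh Z U)) (c U) s))"
      if "openin (Top X) U" "openin (Top X) V" "V \<subseteq> U" "s \<in> carrier (Sh (transport c Z st) U)" for U V s
      using that em_Res by (auto simp: g_def[symmetric] gf image_ring_carrier Z.Res_closed)
    show "c V (j V (Res X U V a)) = Res (transport c Z st) U V (c U (j U a))"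
      if "openin (Top X) U" "openin (Top X) V" "V \<subseteq> U" "a \<in> carrier (Sh X U)" for U V a
      using that by (simp add: g_def[symmetric] gf jc j_Res)
    show "(\<lambda>x. em U (inv_into (carrier (Sh Z U)) (c U) x)) ` carrier (Sh (transport c Z st) U) = carrier (Sh X U)"
      if "affine_open X U" for U
    proof -
      have "(\<lambda>x. em U (inv_into (carrier (Sh Z U)) (c U) x)) ` carrier (Sh (transport c Z st) U) = em U ` carrier (Sh Z U)"
        using gf[OF X.affine_open[OF that]] by (force simp: g_def[symmetric] image_ring_carrier image_image)
      then show ?thesis using surjA[OF that] by simp
    qed
  qed
qed

lemma (in cring) cancel_left:
  assumes "x \<in> carrier R" "y \<in> carrier R" "z \<in> carrier R" "x \<oplus> y = x \<oplus> z"
  shows "y = z"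
  using assms by simp

section \<open>Liftings given on the affine open sets only\<close>

locale local_lift = X: scheme X
  for X :: "('x, 'r, 'z) ringed_space_scheme" +
  fixes p :: nat and L :: "'x set \<Rightarrow> ('e, 'm) ring_scheme" and r :: "'x set \<Rightarrow> 'x set \<Rightarrow> 'e \<Rightarrow> 'e"
    and em :: "'x set \<Rightarrow> 'e \<Rightarrow> 'r" and j :: "'x set \<Rightarrow> 'r \<Rightarrow> 'e"
  assumes prime: "prime p"
    and ext: "affine_open X U \<Longrightarrow> p_ext_surj p (L U) (Sh X U) (em U) (j U)"
    and r_hom: "affine_open X U \<Longrightarrow> affine_open X V \<Longrightarrow> V \<subseteq> U \<Longrightarrow> r U V \<in> ring_hom (L U) (L V)"
    and r_id: "affine_open X U \<Longrightarrow> x \<in> carrier (L U) \<Longrightarrow> r U U x = x"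
    and r_comp: "affine_open X U \<Longrightarrow> affine_open X V \<Longrightarrow> affine_open X W \<Longrightarrow> W \<subseteq> V \<Longrightarrow> V \<subseteq> U \<Longrightarrow>
       x \<in> carrier (L U) \<Longrightarrow> r V W (r U V x) = r U W x"
    and em_r: "affine_open X U \<Longrightarrow> affine_open X V \<Longrightarrow> V \<subseteq> U \<Longrightarrow> x \<in> carrier (L U) \<Longrightarrow>
       em V (r U V x) = Res X U V (em U x)"
    and j_r: "affine_open X U \<Longrightarrow> affine_open X V \<Longrightarrow> V \<subseteq> U \<Longrightarrow> a \<in> carrier (Sh X U) \<Longrightarrow>
       j V (Res X U V a) = r U V (j U a)"
begin

lemma r_closed: "affine_open X U \<Longrightarrow> affine_open X V \<Longrightarrow> V \<subseteq> U \<Longrightarrow> x \<in> carrier (L U) \<Longrightarrow> r U V x \<in> carrier (L V)"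
  using r_hom ring_hom_closed by metis

lemma em_closed: "affine_open X U \<Longrightarrow> x \<in> carrier (L U) \<Longrightarrow> em U x \<in> carrier (Sh X U)"
  using p_ext.em[OF p_ext_surj.axioms(1)[OF ext]] ring_hom_closed by metis

lemma j_closed: "affine_open X U \<Longrightarrow> a \<in> carrier (Sh X U) \<Longrightarrow> j U a \<in> carrier (L U)"
  using p_ext.j_closed[OF p_ext_surj.axioms(1)[OF ext]] by blast

lemma r_ring_hom: "affine_open X U \<Longrightarrow> affine_open X V \<Longrightarrow> V \<subseteq> U \<Longrightarrow> ring_hom_cring (L U) (L V) (r U V)"
  using ext p_ext.S p_ext_surj.axioms(1) r_hom
  by (metis ring_hom_cring.intro ring_hom_cring_axioms.intro)

text \<open>Two stages: the reductions agree by the sheaf property of \<open>X\<close>, so the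
  elements differ by \<open>j V a\<close>; then \<open>a\<close> vanishes locally by injectivity of
  \<open>j\<close>, hence vanishes.\<close>

lemma L_eqI:
  assumes V: "affine_open X V" and t: "t \<in> carrier (L V)" "t' \<in> carrier (L V)"
    and loc: "\<And>x. x \<in> V \<Longrightarrow> \<exists>W. affine_open X W \<and> x \<in> W \<and> W \<subseteq> V \<and> r V W t = r V W t'"
  shows "t = t'"
proof -
  interpret V: p_ext_surj p "L V" "Sh X V" "em V" "j V" using ext V .
  note oV = X.affine_open[OF V]
  have "em V t = em V t'"
  proof (rule X.sections_eqI[OF oV])
    fix x assume "x \<in> V"
    then obtain W where W: "affine_open X W" "x \<in> W" "W \<subseteq> V" "r V W t = r V W t'" using loc by blast
    then show "\<exists>W. openin (Top X) W \<and> x \<in> W \<and> W \<subseteq> V \<and> Res X V W (em V t) = Res X V W (em V t')"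
      using em_r[OF V W(1,3) t(1)] em_r[OF V W(1,3) t(2)] X.affine_open[OF W(1)] by metis
  qed (use t in auto)
  then obtain a where a: "a \<in> carrier (Sh X V)" "t = t' \<oplus>\<^bsub>L V\<^esub> j V a" using V.em_eqE t by blast
  have "a = \<zero>\<^bsub>Sh X V\<^esub>"
  proof (rule X.sections_eqI[OF oV])
    fix x assume "x \<in> V"
    then obtain W where W: "affine_open X W" "x \<in> W" "W \<subseteq> V" "r V W t = r V W t'" using loc by blast
    note oW = X.affine_open[OF W(1)]
    interpret W: p_ext_surj p "L W" "Sh X W" "em W" "j W" using ext W by blast
    interpret h: ring_hom_cring "L V" "L W" "r V W" using r_ring_hom V W by blast
    interpret h': ring_hom_cring "Sh X V" "Sh X W" "Res X V W" using X.Res_ring_hom oV oW W by blast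
    have "r V W t = r V W t' \<oplus>\<^bsub>L W\<^esub> r V W (j V a)" unfolding a(2) using t a by (simp add: V.j_closed)
    then have "r V W t' \<oplus>\<^bsub>L W\<^esub> r V W (j V a) = r V W t' \<oplus>\<^bsub>L W\<^esub> \<zero>\<^bsub>L W\<^esub>"
      unfolding W(4) using t by simp
    then have "r V W (j V a) = \<zero>\<^bsub>L W\<^esub>"
      by (rule W.S.cancel_left[rotated 3]) (use t a in \<open>simp_all add: V.j_closed\<close>)
    then have "j W (Res X V W a) = \<zero>\<^bsub>L W\<^esub>" using j_r[OF V W(1,3) a(1)] by simp
    then have "Res X V W a = \<zero>\<^bsub>Sh X W\<^esub>" using W.j_eq_zero a by simp
    then show "\<exists>W. openin (Top X) W \<and> x \<in> W \<and> W \<subseteq> V \<and> Res X V W a = Res X V W \<zero>\<^bsub>Sh X V\<^esub>"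
      using oW W by (intro exI[of _ W]) simp
  qed (use a in auto)
  then show ?thesis using a t by simp
qed

text \<open>The reductions glue to a section over the affine set \<open>V\<close>, which therefore
  lifts to some \<open>t0\<close>. The errors left on the members of the cover lie in the kernel;
  injectivity of \<open>j\<close> makes them compatible sections of the structure sheaf, and these
  glue to the correction of \<open>t0\<close>.\<close>

lemma L_glue:
  assumes V: "affine_open X V"
    and B: "\<And>W. W \<in> B \<Longrightarrow> affine_open X W \<and> W \<subseteq> V" and cover: "\<And>x. x \<in> V \<Longrightarrow> \<exists>W\<in>B. x \<in> W"
    and s: "\<And>W. W \<in> B \<Longrightarrow> s W \<in> carrier (L W)"
    and agree: "\<And>W W' x. W \<in> B \<Longrightarrow> W' \<in> B \<Longrightarrow> x \<in> W \<Longrightarrow> x \<in> W' \<Longrightarrow>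
       \<exists>O'. affine_open X O' \<and> x \<in> O' \<and> O' \<subseteq> W \<and> O' \<subseteq> W' \<and> r W O' (s W) = r W' O' (s W')"
  obtains t where "t \<in> carrier (L V)" "\<And>W. W \<in> B \<Longrightarrow> r V W t = s W"
proof -
  interpret V: p_ext_surj p "L V" "Sh X V" "em V" "j V" using ext V .
  note oV = X.affine_open[OF V]
  have oB: "openin (Top X) W \<and> W \<subseteq> V" if "W \<in> B" for W using B[OF that] X.affine_open by blast
  obtain a where a: "a \<in> carrier (Sh X V)" "\<And>W. W \<in> B \<Longrightarrow> Res X V W a = em W (s W)"
  proof (rule X.glue_basis[OF oV oB cover, of "\<lambda>W. em W (s W)"])
    fix W W' x assume W: "W \<in> B" "W' \<in> B" "x \<in> W" "x \<in> W'"
    obtain O' where O': "affine_open X O'" "x \<in> O'" "O' \<subseteq> W" "O' \<subseteq> W'" "r W O' (s W) = r W' O' (s W')"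
      using agree[OF W] by blast
    then have "Res X W O' (em W (s W)) = Res X W' O' (em W' (s W'))"
      using em_r[of W O' "s W"] em_r[of W' O' "s W'"] B[OF W(1)] B[OF W(2)] s[OF W(1)] s[OF W(2)] by simp
    then show "\<exists>O'. openin (Top X) O' \<and> x \<in> O' \<and> O' \<subseteq> W \<and> O' \<subseteq> W' \<and>
       Res X W O' (em W (s W)) = Res X W' O' (em W' (s W'))"
      using O' X.affine_open by blast
  qed (use B s em_closed in auto)
  obtain t0 where t0: "t0 \<in> carrier (L V)" "a = em V t0" using V.surjE a by blast
  have "\<exists>b. b \<in> carrier (Sh X W) \<and> s W = r V W t0 \<oplus>\<^bsub>L W\<^esub> j W b" if W: "W \<in> B" for W
  proof -
    interpret W: p_ext_surj p "L W" "Sh X W" "em W" "j W" using ext B W by blast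
    have "em W (s W) = em W (r V W t0)" using em_r[OF V _ _ t0(1)] B[OF W] a(2)[OF W] t0 by simp
    then show ?thesis using W.em_eqE[OF s[OF W] r_closed[OF V _ _ t0(1)]] B[OF W] by metis
  qed
  then obtain b where b: "\<And>W. W \<in> B \<Longrightarrow> b W \<in> carrier (Sh X W)"
    "\<And>W. W \<in> B \<Longrightarrow> s W = r V W t0 \<oplus>\<^bsub>L W\<^esub> j W (b W)" by metis
  obtain c where c: "c \<in> carrier (Sh X V)" "\<And>W. W \<in> B \<Longrightarrow> Res X V W c = b W"
  proof (rule X.glue_basis[OF oV oB cover, of b])
    fix W W' x assume W: "W \<in> B" "W' \<in> B" "x \<in> W" "x \<in> W'"
    obtain O' where O': "affine_open X O'" "x \<in> O'" "O' \<subseteq> W" "O' \<subseteq> W'" "r W O' (s W) = r W' O' (s W')"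
      using agree[OF W] by blast
    interpret O': p_ext_surj p "L O'" "Sh X O'" "em O'" "j O'" using ext O' by blast
    have eq: "r W O' (s W) = r V O' t0 \<oplus>\<^bsub>L O'\<^esub> j O' (Res X W O' (b W))" if W: "W \<in> B" "O' \<subseteq> W" for W
    proof -
      interpret h: ring_hom_cring "L W" "L O'" "r W O'" using r_ring_hom B[OF W(1)] W O' by blast
      have "r W O' (s W) = r W O' (r V W t0) \<oplus>\<^bsub>L O'\<^esub> r W O' (j W (b W))"
        unfolding b(2)[OF W(1)] using r_closed[OF V _ _ t0(1)] j_closed B[OF W(1)] b(1)[OF W(1)] by simp
      then show ?thesis using r_comp[OF V _ O'(1)] j_r[OF _ O'(1) W(2) b(1)[OF W(1)]] B[OF W(1)] W t0 by simp
    qed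
    have cl: "Res X W O' (b W) \<in> carrier (Sh X O')" if "W \<in> B" "O' \<subseteq> W" for W
      using X.Res_closed oB[OF that(1)] X.affine_open[OF O'(1)] b(1) that by blast
    have "O' \<subseteq> V" using O' B W by blast
    then have "r V O' t0 \<in> carrier (L O')" using r_closed V O' t0 by blast
    then have "j O' (Res X W O' (b W)) = j O' (Res X W' O' (b W'))"
      using O'(5) eq[OF W(1) O'(3)] eq[OF W(2) O'(4)] O'.j_closed[OF cl[OF W(1) O'(3)]] O'.j_closed[OF cl[OF W(2) O'(4)]]
      by simp
    then have "Res X W O' (b W) = Res X W' O' (b W')"
      using inj_onD[OF O'.j_inj] cl W O' by blast
    then show "\<exists>O'. openin (Top X) O' \<and> x \<in> O' \<and> O' \<subseteq> W \<and> O' \<subseteq> W' \<and> Res X W O' (b W) = Res X W' O' (b W')"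
      using O' X.affine_open by blast
  qed (use b in auto)
  show thesis
  proof (rule that)
    show "t0 \<oplus>\<^bsub>L V\<^esub> j V c \<in> carrier (L V)" using t0 c V.j_closed by simp
    fix W assume W: "W \<in> B"
    interpret h: ring_hom_cring "L V" "L W" "r V W" using r_ring_hom B[OF W] V by blast
    have "r V W (j V c) = j W (b W)"
      using j_r[OF V _ _ c(1), of W] B[OF W] c(2)[OF W] by simp
    then show "r V W (t0 \<oplus>\<^bsub>L V\<^esub> j V c) = s W"
      using t0(1) c(1) V.j_closed b(2)[OF W] by simp
  qed
qed

definition aff_in :: "'x set \<Rightarrow> 'x set set" where
  "aff_in U = {V. affine_open X V \<and> V \<subseteq> U}"

text \<open>Sections over an arbitrary open set are the compatible families over the affine open sets in
  it.\<close>

definition fam :: "'x set \<Rightarrow> ('x set \<Rightarrow> 'e) ring" where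
  "fam U = \<lparr>carrier = {e \<in> extensional (aff_in U). (\<forall>V\<in>aff_in U. e V \<in> carrier (L V)) \<and>
        (\<forall>V\<in>aff_in U. \<forall>W\<in>aff_in V. r V W (e V) = e W)},
      monoid.mult = (\<lambda>e e'. \<lambda>V\<in>aff_in U. e V \<otimes>\<^bsub>L V\<^esub> e' V),
      one = (\<lambda>V\<in>aff_in U. \<one>\<^bsub>L V\<^esub>), zero = (\<lambda>V\<in>aff_in U. \<zero>\<^bsub>L V\<^esub>),
      add = (\<lambda>e e'. \<lambda>V\<in>aff_in U. e V \<oplus>\<^bsub>L V\<^esub> e' V)\<rparr>"

lemma aff_inD: "V \<in> aff_in U \<Longrightarrow> affine_open X V" "V \<in> aff_in U \<Longrightarrow> V \<subseteq> U"
  by (auto simp: aff_in_def)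

lemma aff_in_trans: "V \<in> aff_in U \<Longrightarrow> W \<in> aff_in V \<Longrightarrow> W \<in> aff_in U"
  by (auto simp: aff_in_def)

lemma famD:
  assumes "e \<in> carrier (fam U)"
  shows "e \<in> extensional (aff_in U)" "V \<in> aff_in U \<Longrightarrow> e V \<in> carrier (L V)"
    "V \<in> aff_in U \<Longrightarrow> W \<in> aff_in V \<Longrightarrow> r V W (e V) = e W"
  using assms by (auto simp: fam_def)

lemma famI:
  assumes "e \<in> extensional (aff_in U)" "\<And>V. V \<in> aff_in U \<Longrightarrow> e V \<in> carrier (L V)"
    "\<And>V W. V \<in> aff_in U \<Longrightarrow> W \<in> aff_in V \<Longrightarrow> r V W (e V) = e W"
  shows "e \<in> carrier (fam U)"
  using assms by (auto simp: fam_def)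

lemma fam_simps:
  "\<one>\<^bsub>fam U\<^esub> = (\<lambda>V\<in>aff_in U. \<one>\<^bsub>L V\<^esub>)" "\<zero>\<^bsub>fam U\<^esub> = (\<lambda>V\<in>aff_in U. \<zero>\<^bsub>L V\<^esub>)"
  "e \<otimes>\<^bsub>fam U\<^esub> e' = (\<lambda>V\<in>aff_in U. e V \<otimes>\<^bsub>L V\<^esub> e' V)" "e \<oplus>\<^bsub>fam U\<^esub> e' = (\<lambda>V\<in>aff_in U. e V \<oplus>\<^bsub>L V\<^esub> e' V)"
  by (simp_all add: fam_def)

lemma L_cring: "V \<in> aff_in U \<Longrightarrow> cring (L V)"
  using p_ext.S[OF p_ext_surj.axioms(1)[OF ext]] aff_inD by blast

lemma r_rhc: "V \<in> aff_in U \<Longrightarrow> W \<in> aff_in V \<Longrightarrow> ring_hom_cring (L V) (L W) (r V W)"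
  using r_ring_hom aff_inD by blast

lemma fam_cring: "cring (fam U)"
proof (intro cringI abelian_groupI comm_monoidI)
  have Lc: "cring (L V)" if "V \<in> aff_in U" for V using L_cring that .
  have h: "r V W \<one>\<^bsub>L V\<^esub> = \<one>\<^bsub>L W\<^esub>" "r V W \<zero>\<^bsub>L V\<^esub> = \<zero>\<^bsub>L W\<^esub>" if "V \<in> aff_in U" "W \<in> aff_in V" for V W
  proof -
    interpret ring_hom_cring "L V" "L W" "r V W" using r_rhc that .
    show "r V W \<one>\<^bsub>L V\<^esub> = \<one>\<^bsub>L W\<^esub>" "r V W \<zero>\<^bsub>L V\<^esub> = \<zero>\<^bsub>L W\<^esub>" by simp_all
  qed
  have c: "\<one>\<^bsub>L V\<^esub> \<in> carrier (L V)" "\<zero>\<^bsub>L V\<^esub> \<in> carrier (L V)" if "V \<in> aff_in U" for V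
    using L_cring[OF that] by (simp_all add: cring.cring_simprules)
  show "\<one>\<^bsub>fam U\<^esub> \<in> carrier (fam U)" "\<zero>\<^bsub>fam U\<^esub> \<in> carrier (fam U)"
    by (auto intro!: famI simp: fam_simps h c intro: aff_in_trans)
  fix e assume e: "e \<in> carrier (fam U)"
  note eD = famD[OF e]
  have ext: "x = y" if "x \<in> extensional (aff_in U)" "y \<in> extensional (aff_in U)"
    "\<And>V. V \<in> aff_in U \<Longrightarrow> x V = y V" for x y :: "'x set \<Rightarrow> 'e" using extensionalityI that by blast
  show "\<zero>\<^bsub>fam U\<^esub> \<oplus>\<^bsub>fam U\<^esub> e = e" "\<one>\<^bsub>fam U\<^esub> \<otimes>\<^bsub>fam U\<^esub> e = e"
    by (rule ext; use eD Lc in \<open>simp add: fam_simps cring.cring_simprules monoid.r_one[OF ring.is_monoid[OF cring.axioms(1)]]\<close>)+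
  show "\<exists>e'\<in>carrier (fam U). e' \<oplus>\<^bsub>fam U\<^esub> e = \<zero>\<^bsub>fam U\<^esub>"
  proof (rule bexI)
    show "(\<lambda>V\<in>aff_in U. \<ominus>\<^bsub>L V\<^esub> e V) \<oplus>\<^bsub>fam U\<^esub> e = \<zero>\<^bsub>fam U\<^esub>"
      by (rule ext; use eD Lc in \<open>simp add: fam_simps cring.cring_simprules\<close>)
    show "(\<lambda>V\<in>aff_in U. \<ominus>\<^bsub>L V\<^esub> e V) \<in> carrier (fam U)"
    proof (rule famI)
      fix V assume V: "V \<in> aff_in U"
      show "(\<lambda>V\<in>aff_in U. \<ominus>\<^bsub>L V\<^esub> e V) V \<in> carrier (L V)"
        using V eD(2)[OF V] Lc[OF V] by (simp add: cring.cring_simprules)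
      fix W assume VW: "W \<in> aff_in V"
      interpret ring_hom_cring "L V" "L W" "r V W" using r_rhc V VW .
      show "r V W ((\<lambda>V\<in>aff_in U. \<ominus>\<^bsub>L V\<^esub> e V) V) = (\<lambda>V\<in>aff_in U. \<ominus>\<^bsub>L V\<^esub> e V) W"
        using V VW eD(2)[OF V] eD(3)[OF V VW] aff_in_trans[OF V VW] by simp
    qed simp
  qed
  fix e' assume e': "e' \<in> carrier (fam U)"
  note eD' = famD[OF e']
  show "e \<oplus>\<^bsub>fam U\<^esub> e' \<in> carrier (fam U)"
  proof (rule famI)
    fix V assume V: "V \<in> aff_in U"
    show "(e \<oplus>\<^bsub>fam U\<^esub> e') V \<in> carrier (L V)"
      using V eD(2)[OF V] eD'(2)[OF V] Lc[OF V] by (simp add: fam_simps cring.cring_simprules)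
    fix W assume VW: "W \<in> aff_in V"
    interpret ring_hom_cring "L V" "L W" "r V W" using r_rhc V VW .
    show "r V W ((e \<oplus>\<^bsub>fam U\<^esub> e') V) = (e \<oplus>\<^bsub>fam U\<^esub> e') W"
      using V VW eD(2)[OF V] eD'(2)[OF V] eD(3)[OF V VW] eD'(3)[OF V VW] aff_in_trans[OF V VW] by (simp add: fam_simps)
  qed (simp add: fam_simps)
  show "e \<otimes>\<^bsub>fam U\<^esub> e' \<in> carrier (fam U)"
  proof (rule famI)
    fix V assume V: "V \<in> aff_in U"
    show "(e \<otimes>\<^bsub>fam U\<^esub> e') V \<in> carrier (L V)"
      using V eD(2)[OF V] eD'(2)[OF V] Lc[OF V] by (simp add: fam_simps cring.cring_simprules)
    fix W assume VW: "W \<in> aff_in V"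
    interpret ring_hom_cring "L V" "L W" "r V W" using r_rhc V VW .
    show "r V W ((e \<otimes>\<^bsub>fam U\<^esub> e') V) = (e \<otimes>\<^bsub>fam U\<^esub> e') W"
      using V VW eD(2)[OF V] eD'(2)[OF V] eD(3)[OF V VW] eD'(3)[OF V VW] aff_in_trans[OF V VW] by (simp add: fam_simps)
  qed (simp add: fam_simps)
  show "e \<oplus>\<^bsub>fam U\<^esub> e' = e' \<oplus>\<^bsub>fam U\<^esub> e" "e \<otimes>\<^bsub>fam U\<^esub> e' = e' \<otimes>\<^bsub>fam U\<^esub> e"
    by (rule ext; use eD eD' cring.cring_simprules[OF Lc] in \<open>simp add: fam_simps\<close>)+
  fix e'' assume e'': "e'' \<in> carrier (fam U)"
  note eD'' = famD[OF e'']
  show "e \<oplus>\<^bsub>fam U\<^esub> e' \<oplus>\<^bsub>fam U\<^esub> e'' = e \<oplus>\<^bsub>fam U\<^esub> (e' \<oplus>\<^bsub>fam U\<^esub> e'')"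
    "e \<otimes>\<^bsub>fam U\<^esub> e' \<otimes>\<^bsub>fam U\<^esub> e'' = e \<otimes>\<^bsub>fam U\<^esub> (e' \<otimes>\<^bsub>fam U\<^esub> e'')"
    "(e \<oplus>\<^bsub>fam U\<^esub> e') \<otimes>\<^bsub>fam U\<^esub> e'' = e \<otimes>\<^bsub>fam U\<^esub> e'' \<oplus>\<^bsub>fam U\<^esub> e' \<otimes>\<^bsub>fam U\<^esub> e''"
    by (rule ext; use eD eD' eD'' Lc in \<open>simp add: fam_simps cring.cring_simprules\<close>)+
qed

definition famspace :: "('x, 'x set \<Rightarrow> 'e) ringed_space" where
  "famspace = \<lparr>Top = Top X, Sh = fam, Res = (\<lambda>U V e. restrict e (aff_in V))\<rparr>"

lemma famspace_simps [simp]: "Top famspace = Top X" "Sh famspace = fam" "Res famspace U V e = restrict e (aff_in V)"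
  by (simp_all add: famspace_def)

lemma fam_restrict_hom: "V \<subseteq> U \<Longrightarrow> (\<lambda>e. restrict e (aff_in V)) \<in> ring_hom (fam U) (fam V)"
proof (rule ring_hom_memI)
  assume VU: "V \<subseteq> U"
  have sub: "aff_in V \<subseteq> aff_in U" using VU by (auto simp: aff_in_def)
  fix e e' assume e: "e \<in> carrier (fam U)"
  show "restrict e (aff_in V) \<in> carrier (fam V)"
  proof (rule famI)
    fix W assume W: "W \<in> aff_in V"
    then have W': "W \<in> aff_in U" using sub by blast
    show "restrict e (aff_in V) W \<in> carrier (L W)" using W famD(2)[OF e W'] by simp
    fix W1 assume W1: "W1 \<in> aff_in W"
    show "r W W1 (restrict e (aff_in V) W) = restrict e (aff_in V) W1"
      using W famD(3)[OF e W' W1] aff_in_trans[OF W W1] by simp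
  qed simp
  show "restrict (e \<otimes>\<^bsub>fam U\<^esub> e') (aff_in V) = restrict e (aff_in V) \<otimes>\<^bsub>fam V\<^esub> restrict e' (aff_in V)"
    "restrict (e \<oplus>\<^bsub>fam U\<^esub> e') (aff_in V) = restrict e (aff_in V) \<oplus>\<^bsub>fam V\<^esub> restrict e' (aff_in V)"
    using sub by (auto simp: fam_simps restrict_def fun_eq_iff)
next
  assume VU: "V \<subseteq> U"
  have sub: "aff_in V \<subseteq> aff_in U" using VU by (auto simp: aff_in_def)
  then show "restrict \<one>\<^bsub>fam U\<^esub> (aff_in V) = \<one>\<^bsub>fam V\<^esub>" by (auto simp: fam_simps restrict_def fun_eq_iff)
qed

lemma aff_in_nbhd:
  assumes "openin (Top X) U" "x \<in> U"
  obtains V where "V \<in> aff_in U" "x \<in> V"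
  using X.affine_nbhd[OF assms] by (metis aff_in_def mem_Collect_eq)

text \<open>An affine subset of a union may lie in no member of the cover. The value of the glued
  family there is obtained from \<open>L_glue\<close>, applied to those of its affine subsets that
  do lie in some member.\<close>

lemma famspace_ringed: "is_ringed_space famspace"
  unfolding is_ringed_space_def
proof (intro conjI allI impI ballI; (elim conjE)?)
  show "cring (Sh famspace U)" for U by (simp add: fam_cring)
  show "Res famspace U V \<in> ring_hom (Sh famspace U) (Sh famspace V)" if "V \<subseteq> U" for U V
    using fam_restrict_hom[OF that] by (simp add: famspace_def)
  show "Res famspace U U s = s" if "s \<in> carrier (Sh famspace U)" for U s
    using famD(1)[of s U] that by (simp add: extensional_restrict)
  show "Res famspace V W (Res famspace U V s) = Res famspace U W s" if "W \<subseteq> V" for U V W s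
    using that by (auto simp: restrict_def fun_eq_iff aff_in_def)
next
  fix \<U> and s :: "'x set \<Rightarrow> 'x set \<Rightarrow> 'e"
  assume 10: "\<forall>U\<in>\<U>. openin (Top famspace) U \<and> s U \<in> carrier (Sh famspace U)"
    and 20: "\<forall>U\<in>\<U>. \<forall>V\<in>\<U>. Res famspace U (U \<inter> V) (s U) = Res famspace V (U \<inter> V) (s V)"
  have 1: "\<forall>U\<in>\<U>. openin (Top X) U \<and> s U \<in> carrier (fam U)" using 10 by simp
  have 2: "\<forall>U\<in>\<U>. \<forall>V\<in>\<U>. restrict (s U) (aff_in (U \<inter> V)) = restrict (s V) (aff_in (U \<inter> V))"
    using 20 by simp
  have sD: "U \<in> \<U> \<Longrightarrow> V \<in> aff_in U \<Longrightarrow> s U V \<in> carrier (L V)"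
    "U \<in> \<U> \<Longrightarrow> V \<in> aff_in U \<Longrightarrow> W \<in> aff_in V \<Longrightarrow> r V W (s U V) = s U W" for U V W
    using 1 famD by blast+
  have same: "s U W = s V W" if "U \<in> \<U>" "V \<in> \<U>" "W \<in> aff_in U" "W \<in> aff_in V" for U V W
  proof -
    have "W \<in> aff_in (U \<inter> V)" using that by (auto simp: aff_in_def)
    then show ?thesis using fun_cong[OF bspec[OF bspec[OF 2 that(1)] that(2)], of W] by simp
  qed
  have "\<exists>t. t \<in> carrier (L V) \<and> (\<forall>U\<in>\<U>. \<forall>W. W \<in> aff_in V \<and> W \<in> aff_in U \<longrightarrow> r V W t = s U W)"
    if V: "V \<in> aff_in (\<Union>\<U>)" for V
  proof -
    define B where "B = {W \<in> aff_in V. \<exists>U\<in>\<U>. W \<in> aff_in U}"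
    have "\<forall>W. \<exists>U. W \<in> B \<longrightarrow> U \<in> \<U> \<and> W \<in> aff_in U" by (auto simp: B_def)
    then obtain u where u: "\<And>W. W \<in> B \<Longrightarrow> u W \<in> \<U> \<and> W \<in> aff_in (u W)" by metis
    have V': "affine_open X V" using V by (rule aff_inD)
    obtain t where t: "t \<in> carrier (L V)" "\<And>W. W \<in> B \<Longrightarrow> r V W t = s (u W) W"
    proof (rule L_glue[OF V', of B "\<lambda>W. s (u W) W"])
      show "affine_open X W \<and> W \<subseteq> V" if "W \<in> B" for W using that by (auto simp: B_def aff_in_def)
      show "s (u W) W \<in> carrier (L W)" if "W \<in> B" for W using u[OF that] sD by blast
      show "\<exists>W\<in>B. x \<in> W" if x: "x \<in> V" for x
      proof -
        obtain U where U: "U \<in> \<U>" "x \<in> U" using x V by (auto simp: aff_in_def)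
        then have "openin (Top X) (V \<inter> U)" using 1 X.affine_open[OF V'] by (simp add: openin_Int)
        then obtain W where "W \<in> aff_in (V \<inter> U)" "x \<in> W" using aff_in_nbhd x U by blast
        then show ?thesis using U by (intro bexI[of _ W]) (auto simp: B_def aff_in_def)
      qed
      fix W W' x assume W: "W \<in> B" "W' \<in> B" "x \<in> W" "x \<in> W'"
      then have "openin (Top X) (W \<inter> W')" using X.affine_open by (auto simp: B_def aff_in_def openin_Int)
      then obtain O' where O': "O' \<in> aff_in (W \<inter> W')" "x \<in> O'" using aff_in_nbhd W by blast
      then have O'': "O' \<in> aff_in W" "O' \<in> aff_in W'" by (auto simp: aff_in_def)
      have "r W O' (s (u W) W) = r W' O' (s (u W') W')"
        using u[OF W(1)] u[OF W(2)] O'' sD(2) same aff_in_trans by metis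
      then show "\<exists>O'. affine_open X O' \<and> x \<in> O' \<and> O' \<subseteq> W \<and> O' \<subseteq> W' \<and> r W O' (s (u W) W) = r W' O' (s (u W') W')"
        using O' by (auto simp: aff_in_def)
    qed blast
    have "r V W t = s U W" if "U \<in> \<U>" "W \<in> aff_in V" "W \<in> aff_in U" for U W
    proof -
      have "W \<in> B" using that by (auto simp: B_def)
      then show ?thesis using t(2) u same that by metis
    qed
    then show ?thesis using t(1) by blast
  qed
  then obtain t where t: "\<And>V. V \<in> aff_in (\<Union>\<U>) \<Longrightarrow> t V \<in> carrier (L V)"
    "\<And>V U W. V \<in> aff_in (\<Union>\<U>) \<Longrightarrow> U \<in> \<U> \<Longrightarrow> W \<in> aff_in V \<Longrightarrow> W \<in> aff_in U \<Longrightarrow> r V W (t V) = s U W"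
    by metis
  have uniq: "x = y" if V: "V \<in> aff_in (\<Union>\<U>)" and x: "x \<in> carrier (L V)" and y: "y \<in> carrier (L V)"
    and xy: "\<And>U W. U \<in> \<U> \<Longrightarrow> W \<in> aff_in V \<Longrightarrow> W \<in> aff_in U \<Longrightarrow> r V W x = r V W y" for V x y
  proof (rule L_eqI[OF aff_inD(1)[OF V] x y])
    fix z assume z: "z \<in> V"
    obtain U where U: "U \<in> \<U>" "z \<in> U" using z V by (auto simp: aff_in_def)
    then have "openin (Top X) (V \<inter> U)" using 1 X.affine_open[OF aff_inD(1)[OF V]] by (simp add: openin_Int)
    then obtain W where W: "W \<in> aff_in (V \<inter> U)" "z \<in> W" using aff_in_nbhd z U by blast
    then have "W \<in> aff_in V" "W \<in> aff_in U" by (auto simp: aff_in_def)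
    then show "\<exists>W. affine_open X W \<and> z \<in> W \<and> W \<subseteq> V \<and> r V W x = r V W y"
      using xy[OF U(1)] W aff_inD by blast
  qed
  define T where "T = (\<lambda>V\<in>aff_in (\<Union>\<U>). t V)"
  show "\<exists>!t. t \<in> carrier (Sh famspace (\<Union>\<U>)) \<and> (\<forall>U\<in>\<U>. Res famspace (\<Union>\<U>) U t = s U)"
    unfolding famspace_simps
  proof (rule ex1I[of _ T])
    show "T \<in> carrier (fam (\<Union>\<U>)) \<and> (\<forall>U\<in>\<U>. restrict T (aff_in U) = s U)"
    proof (intro conjI ballI famI)
      show "T \<in> extensional (aff_in (\<Union>\<U>))" by (simp add: T_def)
      show "T V \<in> carrier (L V)" if "V \<in> aff_in (\<Union>\<U>)" for V using t(1) that by (simp add: T_def)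
      show "r V W (T V) = T W" if VW: "V \<in> aff_in (\<Union>\<U>)" "W \<in> aff_in V" for V W
      proof -
        have W: "W \<in> aff_in (\<Union>\<U>)" using aff_in_trans VW .
        have "r V W (t V) = t W"
        proof (rule uniq[OF W r_closed[OF aff_inD(1)[OF VW(1)] aff_inD[OF VW(2)] t(1)[OF VW(1)]] t(1)[OF W]])
          fix U W' assume *: "U \<in> \<U>" "W' \<in> aff_in W" "W' \<in> aff_in U"
          have "r W W' (r V W (t V)) = r V W' (t V)"
            using r_comp[OF aff_inD(1)[OF VW(1)] aff_inD(1)[OF VW(2)] aff_inD(1)[OF *(2)] aff_inD(2)[OF *(2)] aff_inD(2)[OF VW(2)] t(1)[OF VW(1)]] .
          also have "\<dots> = s U W'" using t(2)[OF VW(1) *(1) _ *(3)] aff_in_trans[OF VW(2) *(2)] by simp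
          also have "\<dots> = r W W' (t W)" using t(2)[OF W *(1) *(2) *(3)] by simp
          finally show "r W W' (r V W (t V)) = r W W' (t W)" .
        qed
        then show ?thesis using VW W by (simp add: T_def)
      qed
      fix U assume U: "U \<in> \<U>"
      have ext: "s U \<in> extensional (aff_in U)" using 1 U famD(1) by blast
      show "restrict T (aff_in U) = s U"
      proof (rule extensionalityI[OF restrict_extensional ext])
        fix V assume V: "V \<in> aff_in U"
        then have V': "V \<in> aff_in (\<Union>\<U>)" using U by (auto simp: aff_in_def)
        have VV: "V \<in> aff_in V" using V by (auto simp: aff_in_def)
        have "r V V (t V) = s U V" by (rule t(2)[OF V' U VV V])
        then have "t V = s U V" using r_id[OF aff_inD(1)[OF V] t(1)[OF V']] by simp
        then show "restrict T (aff_in U) V = s U V" using V V' by (simp add: T_def)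
      qed
    qed
    fix e assume e: "e \<in> carrier (fam (\<Union>\<U>)) \<and> (\<forall>U\<in>\<U>. restrict e (aff_in U) = s U)"
    then have eD: "e \<in> extensional (aff_in (\<Union>\<U>))" "\<And>V. V \<in> aff_in (\<Union>\<U>) \<Longrightarrow> e V \<in> carrier (L V)"
      "\<And>V W. V \<in> aff_in (\<Union>\<U>) \<Longrightarrow> W \<in> aff_in V \<Longrightarrow> r V W (e V) = e W" using famD by blast+
    show "e = T"
    proof (rule extensionalityI[OF eD(1)])
      show "T \<in> extensional (aff_in (\<Union>\<U>))" by (simp add: T_def)
      fix V assume V: "V \<in> aff_in (\<Union>\<U>)"
      have "e V = t V"
      proof (rule uniq[OF V eD(2)[OF V] t(1)[OF V]])
        fix U W assume *: "U \<in> \<U>" "W \<in> aff_in V" "W \<in> aff_in U"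
        have "restrict e (aff_in U) W = s U W" using e *(1) by simp
        then have "e W = s U W" using *(3) by simp
        then show "r V W (e V) = r V W (t V)" using eD(3)[OF V *(2)] t(2)[OF V *] by simp
      qed
      then show "e V = T V" using V by (simp add: T_def)
    qed
  qed
qed

end

text \<open>Once a representative is chosen for each value of \<open>em\<close>, an element is
  determined by its reduction and by its difference from the representative, which is
  \<open>j b\<close> for some \<open>b\<close>.\<close>

lemma (in p_ext) ex_inj_pair: "\<exists>c :: 'e \<Rightarrow> 'a \<times> 'a. inj_on c (carrier S)"
proof -
  define rep where "rep a = (SOME s. s \<in> carrier S \<and> em s = a)" for a
  have rep: "rep (em s) \<in> carrier S" "em (rep (em s)) = em s" if "s \<in> carrier S" for s
    unfolding rep_def using someI[of "\<lambda>t. t \<in> carrier S \<and> em t = em s" s] that by auto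
  have "\<forall>s. \<exists>b. s \<in> carrier S \<longrightarrow> s = rep (em s) \<oplus>\<^bsub>S\<^esub> j b"
    using em_eqE rep by metis
  then obtain b where b: "\<And>s. s \<in> carrier S \<Longrightarrow> s = rep (em s) \<oplus>\<^bsub>S\<^esub> j (b s)" by metis
  have "inj_on (\<lambda>s. (em s, b s)) (carrier S)"
    by (rule inj_onI) (metis b prod.inject)
  then show ?thesis by blast
qed

context local_lift
begin

lemma aff_in_op: "V \<in> aff_in U \<Longrightarrow> openin (Top X) V"
  by (rule X.affine_open) (rule aff_inD)

lemma sections_aff_eqI:
  assumes "openin (Top X) U" "s \<in> carrier (Sh X U)" "t \<in> carrier (Sh X U)"
    "\<And>V. V \<in> aff_in U \<Longrightarrow> Res X U V s = Res X U V t"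
  shows "s = t"
proof (rule X.sections_eqI[OF assms(1-3)])
  fix x assume "x \<in> U"
  then obtain V where "V \<in> aff_in U" "x \<in> V" using aff_in_nbhd assms(1) by blast
  then show "\<exists>V. openin (Top X) V \<and> x \<in> V \<and> V \<subseteq> U \<and> Res X U V s = Res X U V t"
    using assms(4) by (intro exI[of _ V]) (simp add: aff_in_op aff_inD(2))
qed

lemma glue_aff:
  assumes U: "openin (Top X) U"
    and s: "\<And>V. V \<in> aff_in U \<Longrightarrow> s V \<in> carrier (Sh X V)"
    and comp: "\<And>V W. V \<in> aff_in U \<Longrightarrow> W \<in> aff_in V \<Longrightarrow> Res X V W (s V) = s W"
  obtains t where "t \<in> carrier (Sh X U)" "\<And>V. V \<in> aff_in U \<Longrightarrow> Res X U V t = s V"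
proof (rule X.glue_basis[OF U, of "aff_in U" s])
  show "openin (Top X) V \<and> V \<subseteq> U" if "V \<in> aff_in U" for V
    using that by (simp add: aff_in_op aff_inD(2))
  show "\<exists>V\<in>aff_in U. x \<in> V" if "x \<in> U" for x
    using aff_in_nbhd[OF U that] by metis
  fix V W x assume VW: "V \<in> aff_in U" "W \<in> aff_in U" "x \<in> V" "x \<in> W"
  then have "openin (Top X) (V \<inter> W)" by (simp add: openin_Int aff_in_op)
  then obtain O' where O': "O' \<in> aff_in (V \<inter> W)" "x \<in> O'" using aff_in_nbhd VW by blast
  then have "O' \<in> aff_in V" "O' \<in> aff_in W" by (auto simp: aff_in_def)
  then show "\<exists>O'. openin (Top X) O' \<and> x \<in> O' \<and> O' \<subseteq> V \<and> O' \<subseteq> W \<and> Res X V O' (s V) = Res X W O' (s W)"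
    using O' comp VW by (intro exI[of _ O']) (simp add: aff_in_op aff_inD(2))
qed (use s in auto)

text \<open>The reductions of a compatible family are sections over affine sets that agree on
  smaller ones, hence come from exactly one section over \<open>U\<close>.\<close>

definition emF :: "'x set \<Rightarrow> ('x set \<Rightarrow> 'e) \<Rightarrow> 'r" where
  "emF U e = (THE t. t \<in> carrier (Sh X U) \<and> (\<forall>V\<in>aff_in U. Res X U V t = em V (e V)))"

definition jF :: "'x set \<Rightarrow> 'r \<Rightarrow> 'x set \<Rightarrow> 'e" where
  "jF U a = (\<lambda>V\<in>aff_in U. j V (Res X U V a))"

lemma emF:
  assumes U: "openin (Top X) U" and e: "e \<in> carrier (fam U)"
  shows "emF U e \<in> carrier (Sh X U)" "V \<in> aff_in U \<Longrightarrow> Res X U V (emF U e) = em V (e V)"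
proof -
  have "\<exists>!t. t \<in> carrier (Sh X U) \<and> (\<forall>V\<in>aff_in U. Res X U V t = em V (e V))"
  proof -
    obtain t where t: "t \<in> carrier (Sh X U)" "\<And>V. V \<in> aff_in U \<Longrightarrow> Res X U V t = em V (e V)"
    proof (rule glue_aff[OF U, of "\<lambda>V. em V (e V)"])
      show "em V (e V) \<in> carrier (Sh X V)" if "V \<in> aff_in U" for V
        using em_closed[OF aff_inD(1)[OF that] famD(2)[OF e that]] .
      show "Res X V W (em V (e V)) = em W (e W)" if V: "V \<in> aff_in U" and W: "W \<in> aff_in V" for V W
        using em_r[OF aff_inD(1)[OF V] aff_inD[OF W] famD(2)[OF e V]] famD(3)[OF e V W] by simp
    qed blast
    show ?thesis
    proof (rule ex1I[of _ t])
      show "t' = t" if "t' \<in> carrier (Sh X U) \<and> (\<forall>V\<in>aff_in U. Res X U V t' = em V (e V))" for t'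
        by (rule sections_aff_eqI[OF U]) (use that t in auto)
    qed (use t in auto)
  qed
  then have "emF U e \<in> carrier (Sh X U) \<and> (\<forall>V\<in>aff_in U. Res X U V (emF U e) = em V (e V))"
    unfolding emF_def by (rule theI')
  then show "emF U e \<in> carrier (Sh X U)" "V \<in> aff_in U \<Longrightarrow> Res X U V (emF U e) = em V (e V)" by auto
qed

lemma aff_Res_closed:
  "openin (Top X) U \<Longrightarrow> V \<in> aff_in U \<Longrightarrow> a \<in> carrier (Sh X U) \<Longrightarrow> Res X U V a \<in> carrier (Sh X V)"
  by (simp add: X.Res_closed aff_in_op aff_inD(2))

lemma aff_Res_comp:
  "openin (Top X) U \<Longrightarrow> V \<in> aff_in U \<Longrightarrow> W \<in> aff_in V \<Longrightarrow> a \<in> carrier (Sh X U) \<Longrightarrow>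
    Res X V W (Res X U V a) = Res X U W a"
  by (simp add: X.Res_comp aff_in_op aff_inD(2))

lemma jF_closed:
  assumes U: "openin (Top X) U" and a: "a \<in> carrier (Sh X U)"
  shows "jF U a \<in> carrier (fam U)"
proof (rule famI)
  fix V assume V: "V \<in> aff_in U"
  have Va: "affine_open X V" using V by (rule aff_inD)
  show "jF U a V \<in> carrier (L V)"
    using V j_closed[OF Va aff_Res_closed[OF U V a]] by (simp add: jF_def)
  fix W assume W: "W \<in> aff_in V"
  show "r V W (jF U a V) = jF U a W"
    using V W aff_in_trans[OF V W] j_r[OF Va aff_inD[OF W] aff_Res_closed[OF U V a]] aff_Res_comp[OF U V W a]
    by (simp add: jF_def)
qed (simp add: jF_def)

lemma fam_eqI:
  assumes "e \<in> carrier (fam U)" "e' \<in> carrier (fam U)" "\<And>V. V \<in> aff_in U \<Longrightarrow> e V = e' V"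
  shows "e = e'"
  using extensionalityI[OF famD(1)[OF assms(1)] famD(1)[OF assms(2)]] assms(3) by blast

lemma fam_add_pow: "V \<in> aff_in U \<Longrightarrow> add_pow (fam U) (n::nat) e V = add_pow (L V) n (e V)"
proof (induction n)
  case 0
  then show ?case by (simp add: add_pow_def nat_pow_def fam_simps)
next
  case (Suc n)
  then show ?case by (simp add: add_pow_def nat_pow_def fam_simps)
qed

text \<open>All laws are tested after restriction to affine sets. The outcome is only
  \<open>p_ext\<close>: a section over a general open set lifts on each affine piece, but the lifts
  need not be compatible.\<close>

lemma fam_p_ext:
  assumes U: "openin (Top X) U"
  shows "p_ext p (fam U) (Sh X U) (emF U) (jF U)"
proof (rule p_ext.intro)
  interpret F: cring "fam U" by (rule fam_cring)
  interpret A: cring "Sh X U" using X.Sh_cring U .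
  have ext': "p_ext_surj p (L V) (Sh X V) (em V) (j V)" if "V \<in> aff_in U" for V by (rule ext[OF aff_inD(1)[OF that]])
  have res: "ring_hom_cring (Sh X U) (Sh X V) (Res X U V)" if "V \<in> aff_in U" for V
    by (rule X.Res_ring_hom[OF U aff_in_op[OF that] aff_inD(2)[OF that]])
  note emU = emF[OF U]
  show "prime p" by (rule prime)
  show "cring (fam U)" "cring (Sh X U)" by (rule fam_cring, rule X.Sh_cring[OF U])
  show "emF U \<in> ring_hom (fam U) (Sh X U)"
  proof (rule ring_hom_memI)
    fix e e' assume e: "e \<in> carrier (fam U)"
    show "emF U e \<in> carrier (Sh X U)" using emU(1)[OF e] .
    assume e': "e' \<in> carrier (fam U)"
    show "emF U (e \<otimes>\<^bsub>fam U\<^esub> e') = emF U e \<otimes>\<^bsub>Sh X U\<^esub> emF U e'"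
      "emF U (e \<oplus>\<^bsub>fam U\<^esub> e') = emF U e \<oplus>\<^bsub>Sh X U\<^esub> emF U e'"
    proof (rule_tac [!] sections_aff_eqI[OF U])
      fix V assume V: "V \<in> aff_in U"
      interpret V: p_ext_surj p "L V" "Sh X V" "em V" "j V" using ext' V .
      interpret h: ring_hom_cring "Sh X U" "Sh X V" "Res X U V" using res V .
      show "Res X U V (emF U (e \<otimes>\<^bsub>fam U\<^esub> e')) = Res X U V (emF U e \<otimes>\<^bsub>Sh X U\<^esub> emF U e')"
        "Res X U V (emF U (e \<oplus>\<^bsub>fam U\<^esub> e')) = Res X U V (emF U e \<oplus>\<^bsub>Sh X U\<^esub> emF U e')"
        using V famD(2)[OF e V] famD(2)[OF e' V] emU(1)[OF e] emU(1)[OF e']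
        by (simp_all add: emU(2)[OF e V] emU(2)[OF e' V] emU(2)[OF F.m_closed[OF e e'] V] emU(2)[OF F.a_closed[OF e e'] V])
          (simp_all add: fam_simps)
    qed (use e e' emU(1) in simp_all)
  next
    show "emF U \<one>\<^bsub>fam U\<^esub> = \<one>\<^bsub>Sh X U\<^esub>"
    proof (rule sections_aff_eqI[OF U])
      fix V assume V: "V \<in> aff_in U"
      interpret V: p_ext_surj p "L V" "Sh X V" "em V" "j V" using ext' V .
      interpret h: ring_hom_cring "Sh X U" "Sh X V" "Res X U V" using res V .
      show "Res X U V (emF U \<one>\<^bsub>fam U\<^esub>) = Res X U V \<one>\<^bsub>Sh X U\<^esub>"
        using V by (simp add: emU(2)[OF F.one_closed V]) (simp add: fam_simps)
    qed (use emU(1) in simp_all)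
  qed
  fix a assume a: "a \<in> carrier (Sh X U)"
  show jc: "jF U a \<in> carrier (fam U)" using jF_closed U a .
  show "emF U (jF U a) = \<zero>\<^bsub>Sh X U\<^esub>"
  proof (rule sections_aff_eqI[OF U emU(1)[OF jc]])
    fix V assume V: "V \<in> aff_in U"
    interpret V: p_ext_surj p "L V" "Sh X V" "em V" "j V" using ext' V .
    interpret h: ring_hom_cring "Sh X U" "Sh X V" "Res X U V" using res V .
    show "Res X U V (emF U (jF U a)) = Res X U V \<zero>\<^bsub>Sh X U\<^esub>"
      using V a by (simp add: emU(2)[OF jc V]) (simp add: jF_def V.em_j)
  qed simp
  { fix b assume b: "b \<in> carrier (Sh X U)"
    show "jF U (a \<oplus>\<^bsub>Sh X U\<^esub> b) = jF U a \<oplus>\<^bsub>fam U\<^esub> jF U b"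
    proof (rule fam_eqI)
      fix V assume V: "V \<in> aff_in U"
      interpret V: p_ext_surj p "L V" "Sh X V" "em V" "j V" using ext' V .
      interpret h: ring_hom_cring "Sh X U" "Sh X V" "Res X U V" using res V .
      show "jF U (a \<oplus>\<^bsub>Sh X U\<^esub> b) V = (jF U a \<oplus>\<^bsub>fam U\<^esub> jF U b) V"
        using V a b by (simp add: jF_def fam_simps V.j_add)
    qed (use a b U in \<open>auto intro: jF_closed\<close>)
  }
  fix s assume s: "s \<in> carrier (fam U)"
  show "jF U (emF U s \<otimes>\<^bsub>Sh X U\<^esub> a) = s \<otimes>\<^bsub>fam U\<^esub> jF U a"
  proof (rule fam_eqI)
    fix V assume V: "V \<in> aff_in U"
    interpret V: p_ext_surj p "L V" "Sh X V" "em V" "j V" using ext' V .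
    interpret h: ring_hom_cring "Sh X U" "Sh X V" "Res X U V" using res V .
    show "jF U (emF U s \<otimes>\<^bsub>Sh X U\<^esub> a) V = (s \<otimes>\<^bsub>fam U\<^esub> jF U a) V"
      using V a emU[OF s] famD(2)[OF s V] by (simp add: jF_def fam_simps V.j_mult)
  qed (use s jc emU(1)[OF s] a U in \<open>auto intro: jF_closed\<close>)
next
  interpret F: cring "fam U" by (rule fam_cring)
  have ext': "p_ext_surj p (L V) (Sh X V) (em V) (j V)" if "V \<in> aff_in U" for V by (rule ext[OF aff_inD(1)[OF that]])
  have res: "ring_hom_cring (Sh X U) (Sh X V) (Res X U V)" if "V \<in> aff_in U" for V
    by (rule X.Res_ring_hom[OF U aff_in_op[OF that] aff_inD(2)[OF that]])
  note emU = emF[OF U]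
  show "inj_on (jF U) (carrier (Sh X U))"
  proof (rule inj_onI)
    fix a b assume ab: "a \<in> carrier (Sh X U)" "b \<in> carrier (Sh X U)" "jF U a = jF U b"
    show "a = b"
    proof (rule sections_aff_eqI[OF U ab(1,2)])
      fix V assume V: "V \<in> aff_in U"
      interpret V: p_ext_surj p "L V" "Sh X V" "em V" "j V" using ext' V .
      have "j V (Res X U V a) = j V (Res X U V b)" using fun_cong[OF ab(3), of V] V by (simp add: jF_def)
      then show "Res X U V a = Res X U V b"
        using inj_onD[OF V.j_inj] aff_Res_closed U V ab by blast
    qed
  qed
  fix s assume s: "s \<in> carrier (fam U)"
  show "jF U (emF U s) = add_pow (fam U) p s"
  proof (rule fam_eqI)
    fix V assume V: "V \<in> aff_in U"
    interpret V: p_ext_surj p "L V" "Sh X V" "em V" "j V" using ext' V .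
    show "jF U (emF U s) V = add_pow (fam U) p s V"
      using V emU(2)[OF s V] famD(2)[OF s V] by (simp add: jF_def fam_add_pow V.j_em)
  qed (use jF_closed[OF U emU(1)[OF s]] s in simp_all)
  assume z: "emF U s = \<zero>\<^bsub>Sh X U\<^esub>"
  \<comment> \<open>On each affine set the family lies in the kernel and has the form
    \<open>j V b\<close>. Injectivity of \<open>j\<close> makes the \<open>b\<close> compatible, so
    that they glue.\<close>
  have "\<forall>V. \<exists>b. V \<in> aff_in U \<longrightarrow> b \<in> carrier (Sh X V) \<and> s V = j V b"
  proof (intro allI)
    fix V
    show "\<exists>b. V \<in> aff_in U \<longrightarrow> b \<in> carrier (Sh X V) \<and> s V = j V b"
    proof (cases "V \<in> aff_in U")
      case V: True
      interpret V: p_ext_surj p "L V" "Sh X V" "em V" "j V" using ext' V .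
      interpret h: ring_hom_cring "Sh X U" "Sh X V" "Res X U V" using res V .
      have "em V (s V) = \<zero>\<^bsub>Sh X V\<^esub>" using emU(2)[OF s V] z by simp
      then show ?thesis using V.ker famD(2)[OF s V] by blast
    qed simp
  qed
  then obtain b where b: "\<And>V. V \<in> aff_in U \<Longrightarrow> b V \<in> carrier (Sh X V)" "\<And>V. V \<in> aff_in U \<Longrightarrow> s V = j V (b V)" by metis
  obtain a where a: "a \<in> carrier (Sh X U)" "\<And>V. V \<in> aff_in U \<Longrightarrow> Res X U V a = b V"
  proof (rule glue_aff[OF U, of b])
    fix V W assume V: "V \<in> aff_in U" and W: "W \<in> aff_in V"
    have W': "W \<in> aff_in U" using aff_in_trans V W .
    interpret W: p_ext_surj p "L W" "Sh X W" "em W" "j W" using ext' W' .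
    have "j W (Res X V W (b V)) = j W (b W)"
      using j_r[OF aff_inD(1)[OF V] aff_inD[OF W] b(1)[OF V]] famD(3)[OF s V W] b(2)[OF V] b(2)[OF W'] by simp
    moreover have "Res X V W (b V) \<in> carrier (Sh X W)"
      using aff_Res_closed[OF X.affine_open[OF aff_inD(1)[OF V]] W b(1)[OF V]] .
    ultimately show "Res X V W (b V) = b W" using inj_onD[OF W.j_inj] b(1)[OF W'] by blast
  qed (use b in auto)
  have "s = jF U a"
    by (rule fam_eqI[OF s jF_closed[OF U a(1)]]) (simp add: jF_def a(2) b(2))
  then show "\<exists>a\<in>carrier (Sh X U). s = jF U a" using a by blast
qed

text \<open>If \<open>U\<close> is affine it is the largest index, so a family is determined by its
  value there. This makes \<open>up\<close> the identification of \<open>L U\<close> with the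
  sections of the glued sheaf over \<open>U\<close>.\<close>

definition up :: "'x set \<Rightarrow> 'e \<Rightarrow> 'x set \<Rightarrow> 'e" where
  "up U x = (\<lambda>V\<in>aff_in U. r U V x)"

lemma aff_in_self: "affine_open X U \<Longrightarrow> U \<in> aff_in U" by (simp add: aff_in_def)

lemma up_closed: "affine_open X U \<Longrightarrow> x \<in> carrier (L U) \<Longrightarrow> up U x \<in> carrier (fam U)"
  by (rule famI) (auto simp: up_def r_closed r_comp aff_in_def)

lemma up_self: "affine_open X U \<Longrightarrow> x \<in> carrier (L U) \<Longrightarrow> up U x U = x"
  by (simp add: up_def aff_in_self r_id)

lemma up_surj:
  assumes "affine_open X U" "e \<in> carrier (fam U)"
  shows "e U \<in> carrier (L U)" "up U (e U) = e"
proof -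
  show c: "e U \<in> carrier (L U)" using famD(2)[OF assms(2) aff_in_self[OF assms(1)]] .
  show "up U (e U) = e"
    by (rule fam_eqI[OF up_closed[OF assms(1) c] assms(2)])
      (use famD(3)[OF assms(2) aff_in_self[OF assms(1)]] in \<open>simp add: up_def\<close>)
qed

lemma up_hom: "affine_open X U \<Longrightarrow> up U \<in> ring_hom (L U) (fam U)"
proof (rule ring_hom_memI)
  assume U: "affine_open X U"
  have h: "r U V \<in> ring_hom (L U) (L V)" if "V \<in> aff_in U" for V
    by (rule r_hom[OF U aff_inD[OF that]])
  show "up U \<one>\<^bsub>L U\<^esub> = \<one>\<^bsub>fam U\<^esub>"
    using ring_hom_one[OF h] by (auto simp: up_def fam_simps)
  fix x y assume xy: "x \<in> carrier (L U)" "y \<in> carrier (L U)"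
  show "up U x \<in> carrier (fam U)" using up_closed U xy by blast
  show "up U (x \<otimes>\<^bsub>L U\<^esub> y) = up U x \<otimes>\<^bsub>fam U\<^esub> up U y" "up U (x \<oplus>\<^bsub>L U\<^esub> y) = up U x \<oplus>\<^bsub>fam U\<^esub> up U y"
    using ring_hom_mult[OF h xy] ring_hom_add[OF h xy] by (auto simp: up_def fam_simps)
qed

lemma up_Res: "affine_open X U \<Longrightarrow> affine_open X V \<Longrightarrow> V \<subseteq> U \<Longrightarrow> x \<in> carrier (L U) \<Longrightarrow>
   restrict (up U x) (aff_in V) = up V (r U V x)"
  by (auto simp: up_def restrict_def fun_eq_iff aff_in_def r_comp)

lemma emF_up:
  assumes U: "affine_open X U" and x: "x \<in> carrier (L U)"
  shows "emF U (up U x) = em U x"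
  using emF[OF X.affine_open[OF U] up_closed[OF U x]] aff_in_self[OF U] X.Res_id[OF X.affine_open[OF U]] up_self[OF U x]
  by metis

lemma jF_up:
  assumes U: "affine_open X U" and a: "a \<in> carrier (Sh X U)"
  shows "jF U a = up U (j U a)"
  using j_r[OF U _ _ a] by (auto simp: jF_def up_def aff_in_def)

lemma fam_lift_space: "lift_space X p famspace emF jF"
proof (intro lift_space.intro lift_space_axioms.intro X.scheme_axioms famspace_ringed famspace_simps(1))
  show "p_ext p (Sh famspace U) (Sh X U) (emF U) (jF U)" if "openin (Top X) U" for U
    using fam_p_ext[OF that] by simp
  show "emF U ` carrier (Sh famspace U) = carrier (Sh X U)" if U: "affine_open X U" for U
  proof -
    interpret U: p_ext_surj p "L U" "Sh X U" "em U" "j U" using ext U .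
    have "a \<in> emF U ` carrier (fam U)" if a: "a \<in> carrier (Sh X U)" for a
    proof -
      obtain x where "x \<in> carrier (L U)" "a = em U x" using U.surjE a by blast
      then have "a = emF U (up U x)" "up U x \<in> carrier (fam U)" using emF_up up_closed U by auto
      then show ?thesis by blast
    qed
    then show ?thesis using emF(1)[OF X.affine_open[OF U]] by auto
  qed
  fix U V assume UV: "openin (Top X) U" "openin (Top X) V" "V \<subseteq> U"
  have sub: "W \<in> aff_in U" if "W \<in> aff_in V" for W using that UV by (auto simp: aff_in_def)
  { fix s assume "s \<in> carrier (Sh famspace U)"
    then have s: "s \<in> carrier (fam U)" by simp
    have s': "restrict s (aff_in V) \<in> carrier (fam V)" using ring_hom_closed[OF fam_restrict_hom[OF UV(3)] s] .
    have "emF V (restrict s (aff_in V)) = Res X U V (emF U s)"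
    proof (rule sections_aff_eqI[OF UV(2)])
      fix W assume W: "W \<in> aff_in V"
      have "Res X V W (Res X U V (emF U s)) = Res X U W (emF U s)"
        using X.Res_comp[OF UV(1,2) _ _ UV(3) emF(1)[OF UV(1) s]] X.affine_open[OF aff_inD(1)[OF W]] aff_inD(2)[OF W] by blast
      then show "Res X V W (emF V (restrict s (aff_in V))) = Res X V W (Res X U V (emF U s))"
        using emF(2)[OF UV(2) s' W] emF(2)[OF UV(1) s sub[OF W]] W by simp
    qed (use emF(1)[OF UV(2) s'] X.Res_closed[OF UV emF(1)[OF UV(1) s]] in auto)
    then show "emF V (Res famspace U V s) = Res X U V (emF U s)" by simp
  }
  fix a assume a: "a \<in> carrier (Sh X U)"
  have "j W (Res X V W (Res X U V a)) = j W (Res X U W a)" if W: "W \<in> aff_in V" for W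
    using X.Res_comp[OF UV(1,2) X.affine_open[OF aff_inD(1)[OF W]] aff_inD(2)[OF W] UV(3) a] by simp
  then show "jF V (Res X U V a) = Res famspace U V (jF U a)"
    using sub by (auto simp: jF_def restrict_def fun_eq_iff)
qed

text \<open>A lifting of $\mathcal{O}(U)$ injects into $\mathcal{O}(U) \times \mathcal{O}(U)$; this moves the
  glued sheaf to the type of sections required of a Frobenius lifting.\<close>

definition enc :: "'x set \<Rightarrow> ('x set \<Rightarrow> 'e) \<Rightarrow> 'r \<times> 'r" where
  "enc U = (SOME c. inj_on c (carrier (fam U)))"

lemma enc_inj: "openin (Top X) U \<Longrightarrow> inj_on (enc U) (carrier (fam U))"
  unfolding enc_def using someI_ex[OF p_ext.ex_inj_pair[OF fam_p_ext]] .

definition glued :: "('w \<Rightarrow> 'r \<times> 'r) \<Rightarrow> ('x, 'r \<times> 'r, 'w) scheme_over" where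
  "glued st = transport enc famspace st"

definition emG :: "'x set \<Rightarrow> 'r \<times> 'r \<Rightarrow> 'r" where
  "emG U x = emF U (inv_into (carrier (fam U)) (enc U) x)"

definition jG :: "'x set \<Rightarrow> 'r \<Rightarrow> 'r \<times> 'r" where
  "jG U a = enc U (jF U a)"

text \<open>The canonical identification of the local lifting with the sections of the glued sheaf
  over an affine set. It carries the local structure to the glued one.\<close>

definition qG :: "'x set \<Rightarrow> 'e \<Rightarrow> 'r \<times> 'r" where
  "qG U x = enc U (up U x)"

lemma glued_lift_space: "lift_space X p (glued st) emG jG"
proof -
  have "lift_space X p (transport enc famspace st)
    (\<lambda>U x. emF U (inv_into (carrier (Sh famspace U)) (enc U) x)) (\<lambda>U a. enc U (jF U a))"
    by (rule transport_lift_space[OF fam_lift_space]) (simp add: enc_inj)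
  then show ?thesis by (simp add: glued_def emG_def[abs_def] jG_def[abs_def])
qed

lemma glued_Str: "Str (glued st) = st" by (simp add: glued_def)

lemma qG:
  assumes U: "affine_open X U"
  shows "qG U \<in> ring_hom (L U) (Sh (glued st) U)" "qG U ` carrier (L U) = carrier (Sh (glued st) U)"
    "x \<in> carrier (L U) \<Longrightarrow> emG U (qG U x) = em U x"
    "a \<in> carrier (Sh X U) \<Longrightarrow> qG U (j U a) = jG U a"
    "affine_open X V \<Longrightarrow> V \<subseteq> U \<Longrightarrow> x \<in> carrier (L U) \<Longrightarrow> Res (glued st) U V (qG U x) = qG V (r U V x)"
proof -
  note inj = enc_inj[OF X.affine_open[OF U]]
  have "enc U \<circ> up U \<in> ring_hom (L U) (image_ring (enc U) (fam U))"
    by (rule ring_hom_trans[OF up_hom[OF U] image_ring_iso(2)[OF fam_cring inj]])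
  then show "qG U \<in> ring_hom (L U) (Sh (glued st) U)" by (simp add: qG_def[abs_def] comp_def glued_def)
  have "up U ` carrier (L U) = carrier (fam U)" using up_closed[OF U] up_surj[OF U] by force
  then show "qG U ` carrier (L U) = carrier (Sh (glued st) U)"
    by (simp add: qG_def[abs_def] glued_def image_ring_carrier image_image[symmetric])
  show "emG U (qG U x) = em U x" if x: "x \<in> carrier (L U)" for x
    using inv_into_f_f[OF inj up_closed[OF U x]] emF_up[OF U x] by (simp add: emG_def qG_def)
  show "qG U (j U a) = jG U a" if "a \<in> carrier (Sh X U)" for a
    using jF_up[OF U that] by (simp add: qG_def jG_def)
  show "Res (glued st) U V (qG U x) = qG V (r U V x)" if "affine_open X V" "V \<subseteq> U" "x \<in> carrier (L U)"
    using inv_into_f_f[OF inj up_closed[OF U that(3)]] up_Res[OF U that] by (simp add: qG_def glued_def)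
qed

end

section \<open>The lifting attached to a butterfly\<close>

text \<open>Evaluates \<open>h\<close> at an arbitrary preimage under \<open>q\<close>. A general
  surjection is allowed: \<open>q\<close> will be the projection to a quotient ring and also the
  identification \<open>qG\<close>.\<close>

definition descend :: "('e, 'm) ring_scheme \<Rightarrow> ('e \<Rightarrow> 'l) \<Rightarrow> ('e \<Rightarrow> 'c) \<Rightarrow> 'l \<Rightarrow> 'c" where
  "descend E q h x = h (SOME e. e \<in> carrier E \<and> q e = x)"

lemma descend_eq:
  assumes "\<And>e e'. e \<in> carrier E \<Longrightarrow> e' \<in> carrier E \<Longrightarrow> q e = q e' \<Longrightarrow> h e = h e'" "e \<in> carrier E"
  shows "descend E q h (q e) = h e"
proof -
  have "\<exists>e'. e' \<in> carrier E \<and> q e' = q e" using assms(2) by blast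
  then have "(SOME e'. e' \<in> carrier E \<and> q e' = q e) \<in> carrier E \<and> q (SOME e'. e' \<in> carrier E \<and> q e' = q e) = q e"
    by (rule someI_ex)
  then show ?thesis unfolding descend_def using assms by blast
qed

lemma descend_hom:
  assumes E: "cring E" and q: "q \<in> ring_hom E L" "q ` carrier E = carrier L" and h: "h \<in> ring_hom E M"
    and wd: "\<And>e e'. e \<in> carrier E \<Longrightarrow> e' \<in> carrier E \<Longrightarrow> q e = q e' \<Longrightarrow> h e = h e'"
  shows "descend E q h \<in> ring_hom L M"
proof (rule ring_hom_memI)
  interpret E: cring E by fact
  have d: "descend E q h (q e) = h e" if "e \<in> carrier E" for e
    by (rule descend_eq[OF _ that]) (rule wd)
  fix x assume "x \<in> carrier L"
  then obtain e where e: "e \<in> carrier E" "x = q e" using q(2) by (metis imageE)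
  show "descend E q h x \<in> carrier M" using d e ring_hom_closed[OF h] by simp
  fix y assume "y \<in> carrier L"
  then obtain e' where e': "e' \<in> carrier E" "y = q e'" using q(2) by (metis imageE)
  show "descend E q h (x \<otimes>\<^bsub>L\<^esub> y) = descend E q h x \<otimes>\<^bsub>M\<^esub> descend E q h y"
    using d[OF E.m_closed[OF e(1) e'(1)]] d[OF e(1)] d[OF e'(1)] e e'
    by (simp add: ring_hom_mult[OF q(1)] ring_hom_mult[OF h])
  show "descend E q h (x \<oplus>\<^bsub>L\<^esub> y) = descend E q h x \<oplus>\<^bsub>M\<^esub> descend E q h y"
    using d[OF E.a_closed[OF e(1) e'(1)]] d[OF e(1)] d[OF e'(1)] e e'
    by (simp add: ring_hom_add[OF q(1)] ring_hom_add[OF h])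
next
  interpret E: cring E by fact
  have "descend E q h (q \<one>\<^bsub>E\<^esub>) = h \<one>\<^bsub>E\<^esub>"
    by (rule descend_eq[OF _ E.one_closed]) (rule wd)
  then show "descend E q h \<one>\<^bsub>L\<^esub> = \<one>\<^bsub>M\<^esub>"
    by (simp add: ring_hom_one[OF q(1)] ring_hom_one[OF h])
qed

lemma wtrunc_witt_map: "wtrunc (witt_map f a) = witt2_map f (wtrunc a)"
  by (simp add: wtrunc_def witt_map_def witt2_map_def)

text \<open>The butterfly of a trivialization over an affine set with ring \<open>A\<close>. The
  assumption \<open>tgt0\<close> expresses that the map to the derived quotient lifts the identity
  of \<open>A\<close>.\<close>

locale bfly =
  fixes p :: nat and k :: "('k, 'm) ring_scheme" and A :: "('a, 'n) ring_scheme" and g :: "'k \<Rightarrow> 'a"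
    and E :: "('e, nat \<Rightarrow> 'k, 'a, nat \<Rightarrow> 'a) butterfly"
  assumes prime: "prime p" and k: "cring k" and char_k: "add_pow k p \<one>\<^bsub>k\<^esub> = \<zero>\<^bsub>k\<^esub>"
    and A: "cring A" and g: "g \<in> ring_hom k A"
    and dq: "derived_quotient_map (witt p k) (add_pow (witt p k) p \<one>\<^bsub>witt p k\<^esub>) A (\<lambda>a. g (a 0)) (witt p A) (witt_map g) E"
    and tgt0: "e \<in> carrier E \<Longrightarrow> bf_tgt E e 0 = bf_src E e"
begin

abbreviation "Wk \<equiv> witt p k"
abbreviation "WA \<equiv> witt p A"
abbreviation "src \<equiv> bf_src E"
abbreviation "tgt \<equiv> bf_tgt E"
abbreviation "incl \<equiv> bf_incl E"
abbreviation "base \<equiv> bf_base E"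
abbreviation "rr \<equiv> add_pow (witt p k) p \<one>\<^bsub>witt p k\<^esub>"

sublocale k: cring k by (rule k)
sublocale A: cring A by (rule A)

lemma E: "cring E"
  and src: "src \<in> ring_hom E A" and src_surj: "src ` carrier E = carrier A"
  and tgt: "tgt \<in> ring_hom E WA"
  and incl: "incl \<in> hom (add_monoid WA) (add_monoid E)" and incl_inj: "inj_on incl (carrier WA)"
  and incl_image: "incl ` carrier WA = {e \<in> carrier E. src e = \<zero>\<^bsub>A\<^esub>}"
  and tgt_incl: "w \<in> carrier WA \<Longrightarrow> tgt (incl w) = witt_map g rr \<otimes>\<^bsub>WA\<^esub> w"
  and mult_incl: "e \<in> carrier E \<Longrightarrow> w \<in> carrier WA \<Longrightarrow> e \<otimes>\<^bsub>E\<^esub> incl w = incl (tgt e \<otimes>\<^bsub>WA\<^esub> w)"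
  and base: "base \<in> ring_hom Wk E"
  and base_r: "a \<in> carrier Wk \<Longrightarrow> base (rr \<otimes>\<^bsub>Wk\<^esub> a) = incl (witt_map g a)"
  using dq unfolding derived_quotient_map_def by auto

sublocale E: cring E by (rule E)
sublocale src: ring_hom_cring E A src by unfold_locales (rule src)

lemma incl_closed: "w \<in> carrier WA \<Longrightarrow> incl w \<in> carrier E"
  using incl_image by blast

lemma src_incl: "w \<in> carrier WA \<Longrightarrow> src (incl w) = \<zero>\<^bsub>A\<^esub>"
  using incl_image by blast

lemma incl_add: "w \<in> carrier WA \<Longrightarrow> w' \<in> carrier WA \<Longrightarrow> incl (w \<oplus>\<^bsub>WA\<^esub> w') = incl w \<oplus>\<^bsub>E\<^esub> incl w'"
  using incl unfolding hom_def by simp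

lemma src_zeroE:
  assumes "e \<in> carrier E" "src e = \<zero>\<^bsub>A\<^esub>"
  obtains w where "w \<in> carrier WA" "e = incl w"
  using assms incl_image by (metis (mono_tags, lifting) imageE mem_Collect_eq)

lemma WA0: "w \<in> carrier WA \<Longrightarrow> w n \<in> carrier A" by (simp add: carrier_witt)

lemma add0: "w \<in> carrier WA \<Longrightarrow> w' \<in> carrier WA \<Longrightarrow> (w \<oplus>\<^bsub>WA\<^esub> w') 0 = w 0 \<oplus>\<^bsub>A\<^esub> w' 0"
  using A.wtrunc_add[OF prime, of w w'] by (simp add: wtrunc_def A.witt2_add[OF prime] WA0)

lemma mult0: "w \<in> carrier WA \<Longrightarrow> w' \<in> carrier WA \<Longrightarrow> (w \<otimes>\<^bsub>WA\<^esub> w') 0 = w 0 \<otimes>\<^bsub>A\<^esub> w' 0"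
  using A.wtrunc_mult[OF prime, of w w'] by (simp add: wtrunc_def A.witt2_mult[OF prime] WA0)

lemma tgt_closed: "e \<in> carrier E \<Longrightarrow> tgt e \<in> carrier WA"
  using ring_hom_closed[OF tgt] .

text \<open>Vanishing of the zeroth component is the description of $V W(A)$.\<close>

definition I :: "'e set" where "I = incl ` {w \<in> carrier WA. w 0 = \<zero>\<^bsub>A\<^esub>}"

text \<open>Subtraction takes place in \<open>E\<close>: the difference lies in the kernel of
  \<open>src\<close>, hence is \<open>incl u\<close>, and injectivity of \<open>incl\<close> turns
  this into $w = u + w'$ in $W(A)$. Only additivity of the zeroth component is then needed.\<close>

lemma incl_diff:
  assumes w: "w \<in> carrier WA" "w' \<in> carrier WA"
  shows "incl w \<ominus>\<^bsub>E\<^esub> incl w' \<in> I \<longleftrightarrow> w 0 = w' 0"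
proof -
  have "src (incl w \<ominus>\<^bsub>E\<^esub> incl w') = \<zero>\<^bsub>A\<^esub>"
    using w by (simp add: E.minus_eq incl_closed src_incl)
  then obtain u where u: "u \<in> carrier WA" "incl w \<ominus>\<^bsub>E\<^esub> incl w' = incl u"
    using src_zeroE[of "incl w \<ominus>\<^bsub>E\<^esub> incl w'"] w incl_closed by auto
  have "incl w = (incl w \<ominus>\<^bsub>E\<^esub> incl w') \<oplus>\<^bsub>E\<^esub> incl w'"
    using w by (simp add: E.minus_eq E.a_assoc E.l_neg incl_closed)
  also have "\<dots> = incl (u \<oplus>\<^bsub>WA\<^esub> w')" unfolding u(2) using u w by (simp add: incl_add)
  finally have "w = u \<oplus>\<^bsub>WA\<^esub> w'"
    using inj_onD[OF incl_inj] w u A.witt_add_closed(1) by blast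
  then have w0: "w 0 = u 0 \<oplus>\<^bsub>A\<^esub> w' 0" using add0[OF u(1) w(2)] by simp
  have "incl u \<in> I \<longleftrightarrow> u 0 = \<zero>\<^bsub>A\<^esub>"
    using u(1) inj_onD[OF incl_inj _ u(1)] by (auto simp: I_def)
  also have "\<dots> \<longleftrightarrow> w 0 = w' 0"
    unfolding w0 using WA0[OF u(1), of 0] WA0[OF w(2), of 0] by (simp add: A.a_comm)
  finally show ?thesis unfolding u(2) .
qed

lemma I_ideal: "ideal I E"
proof (rule E.idealI')
  show "I \<subseteq> carrier E" using incl_closed by (auto simp: I_def)
  have "(\<lambda>n. \<zero>\<^bsub>A\<^esub>) \<in> carrier WA" by (simp add: carrier_witt)
  then have "incl (\<lambda>n. \<zero>\<^bsub>A\<^esub>) \<ominus>\<^bsub>E\<^esub> incl (\<lambda>n. \<zero>\<^bsub>A\<^esub>) \<in> I" "incl (\<lambda>n. \<zero>\<^bsub>A\<^esub>) \<in> carrier E"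
    by (simp_all add: incl_diff incl_closed)
  then show "\<zero>\<^bsub>E\<^esub> \<in> I" by (simp add: E.minus_eq E.r_neg)
  fix a b assume "a \<in> I"
  then obtain w where w: "w \<in> carrier WA" "w 0 = \<zero>\<^bsub>A\<^esub>" "a = incl w" by (auto simp: I_def)
  { assume "b \<in> I"
    then obtain w' where w': "w' \<in> carrier WA" "w' 0 = \<zero>\<^bsub>A\<^esub>" "b = incl w'" by (auto simp: I_def)
    have "a \<oplus>\<^bsub>E\<^esub> b = incl (w \<oplus>\<^bsub>WA\<^esub> w')" using w w' by (simp add: incl_add)
    moreover have "(w \<oplus>\<^bsub>WA\<^esub> w') 0 = \<zero>\<^bsub>A\<^esub>" using w w' by (simp add: add0)
    ultimately show "a \<oplus>\<^bsub>E\<^esub> b \<in> I" using A.witt_add_closed(1)[OF w(1) w'(1)] by (auto simp: I_def)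
  }
  assume b: "b \<in> carrier E"
  have "b \<otimes>\<^bsub>E\<^esub> a = incl (tgt b \<otimes>\<^bsub>WA\<^esub> w)" using w b by (simp add: mult_incl)
  moreover have "(tgt b \<otimes>\<^bsub>WA\<^esub> w) 0 = \<zero>\<^bsub>A\<^esub>" using w b by (simp add: mult0 tgt_closed WA0)
  ultimately show "b \<otimes>\<^bsub>E\<^esub> a \<in> I" using A.witt_add_closed(2)[OF tgt_closed[OF b] w(1)] by (auto simp: I_def)
qed

sublocale I: ideal I E by (rule I_ideal)

definition L :: "'e set ring" where "L = E Quot I"
definition q :: "'e \<Rightarrow> 'e set" where "q e = I +>\<^bsub>E\<^esub> e"

lemma L_cring: "cring L" unfolding L_def by (rule I.quotient_is_cring[OF E.is_cring])

lemma q_hom: "q \<in> ring_hom E L"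
  using I.rcos_ring_hom unfolding q_def[abs_def] L_def .

lemma q_surj: "q ` carrier E = carrier L"
  unfolding L_def q_def FactRing_def A_RCOSETS_def' by auto

lemma q_eq_iff: "e \<in> carrier E \<Longrightarrow> e' \<in> carrier E \<Longrightarrow> q e = q e' \<longleftrightarrow> e \<ominus>\<^bsub>E\<^esub> e' \<in> I"
  unfolding q_def using E.quotient_eq_iff_same_a_r_cos[OF I_ideal] by blast

sublocale L: cring L by (rule L_cring)
sublocale q: ring_hom_cring E L q by unfold_locales (rule q_hom)

lemma q_surjE:
  assumes "x \<in> carrier L" obtains e where "e \<in> carrier E" "x = q e"
  using assms q_surj by (metis imageE)

text \<open>The Teichmueller representative. For the definition of \<open>j\<close> any Witt vector
  with zeroth component \<open>a\<close> would do (\<open>q_incl\<close>).\<close>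

definition tau :: "'a \<Rightarrow> nat \<Rightarrow> 'a" where "tau a = (\<lambda>n. if n = 0 then a else \<zero>\<^bsub>A\<^esub>)"

definition j :: "'a \<Rightarrow> 'e set" where "j a = q (incl (tau a))"

definition em :: "'e set \<Rightarrow> 'a" where "em = descend E q src"

lemma tau: "a \<in> carrier A \<Longrightarrow> tau a \<in> carrier WA" "tau a 0 = a"
  by (simp_all add: tau_def carrier_witt)

lemma q_incl: "w \<in> carrier WA \<Longrightarrow> q (incl w) = j (w 0)"
  unfolding j_def by (subst q_eq_iff) (auto simp: incl_closed tau WA0 incl_diff)

lemma q_eqE:
  assumes "e \<in> carrier E" "e' \<in> carrier E" "q e = q e'"
  obtains w where "w \<in> carrier WA" "w 0 = \<zero>\<^bsub>A\<^esub>" "e = e' \<oplus>\<^bsub>E\<^esub> incl w"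
proof -
  have "e \<ominus>\<^bsub>E\<^esub> e' \<in> I" using assms q_eq_iff by blast
  then obtain w where w: "w \<in> carrier WA" "w 0 = \<zero>\<^bsub>A\<^esub>" "e \<ominus>\<^bsub>E\<^esub> e' = incl w" by (auto simp: I_def)
  have "e = e' \<oplus>\<^bsub>E\<^esub> (e \<ominus>\<^bsub>E\<^esub> e')" using assms by (simp add: E.minus_eq E.a_comm[of e] E.r_neg2)
  then show thesis using that w by simp
qed

lemma src_wd: "e \<in> carrier E \<Longrightarrow> e' \<in> carrier E \<Longrightarrow> q e = q e' \<Longrightarrow> src e = src e'"
  by (erule (2) q_eqE) (simp add: incl_closed src_incl)

lemma em_q: "e \<in> carrier E \<Longrightarrow> em (q e) = src e"
  unfolding em_def by (rule descend_eq) (rule src_wd)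

lemma em_hom: "em \<in> ring_hom L A"
  unfolding em_def by (rule descend_hom[OF E.is_cring q_hom q_surj src]) (rule src_wd)

text \<open>This is the only point where linearity over $W(k)/p$ enters the flatness of the lifting:
  as a map of quasi-ideals, \<open>base\<close> sends \<open>rr\<close> times 1 to
  \<open>incl\<close> of 1, while as a ring map it sends \<open>rr\<close> to $p$.\<close>

lemma p_one: "add_pow E p \<one>\<^bsub>E\<^esub> = incl \<one>\<^bsub>WA\<^esub>"
proof -
  have one: "\<one>\<^bsub>Wk\<^esub> \<in> carrier Wk" by (simp add: one_witt carrier_witt)
  have zero: "\<zero>\<^bsub>Wk\<^esub> \<in> carrier Wk" by (simp add: zero_witt carrier_witt)
  have "base \<zero>\<^bsub>Wk\<^esub> \<oplus>\<^bsub>E\<^esub> base \<zero>\<^bsub>Wk\<^esub> = base \<zero>\<^bsub>Wk\<^esub>"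
    using ring_hom_add[OF base zero zero] k.witt_zero_add_zero[OF prime] by simp
  then have b0: "base \<zero>\<^bsub>Wk\<^esub> = \<zero>\<^bsub>E\<^esub>" using ring_hom_closed[OF base zero] by simp
  have "add_pow Wk n \<one>\<^bsub>Wk\<^esub> \<in> carrier Wk \<and> base (add_pow Wk n \<one>\<^bsub>Wk\<^esub>) = add_pow E n \<one>\<^bsub>E\<^esub>" for n :: nat
  proof (induction n)
    case 0
    then show ?case using b0 zero by (simp add: add_pow_def nat_pow_def)
  next
    case (Suc n)
    then show ?case using ring_hom_add[OF base _ one] ring_hom_one[OF base] k.witt_add_closed(1)[OF _ one]
      by (simp add: add_pow_def nat_pow_def)
  qed
  then have r: "rr \<in> carrier Wk" "base rr = add_pow E p \<one>\<^bsub>E\<^esub>" by blast+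
  have "base (rr \<otimes>\<^bsub>Wk\<^esub> \<one>\<^bsub>Wk\<^esub>) = base rr"
    using ring_hom_mult[OF base r(1) one] ring_hom_one[OF base] ring_hom_closed[OF base r(1)] by simp
  moreover have "witt_map g \<one>\<^bsub>Wk\<^esub> = \<one>\<^bsub>WA\<^esub>"
  proof -
    interpret g: ring_hom_cring k A g by unfold_locales (rule g)
    show ?thesis by (auto simp: witt_map_def one_witt)
  qed
  ultimately show ?thesis using base_r[OF one] r by simp
qed

lemma p_ext_surj: "p_ext_surj p L A em j"
proof (intro p_ext_surj.intro p_ext_surj_axioms.intro p_ext.intro)
  show "prime p" "cring L" "cring A" by (rule prime, rule L_cring, rule A)
  show "em \<in> ring_hom L A" by (rule em_hom)
  show "em ` carrier L = carrier A"
    unfolding q_surj[symmetric] using em_q src_surj by (force simp: image_image)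
  show jc: "j a \<in> carrier L" if "a \<in> carrier A" for a
    using that by (simp add: j_def incl_closed tau)
  show "j (a \<oplus>\<^bsub>A\<^esub> b) = j a \<oplus>\<^bsub>L\<^esub> j b" if "a \<in> carrier A" "b \<in> carrier A" for a b
  proof -
    have "j a \<oplus>\<^bsub>L\<^esub> j b = q (incl (tau a \<oplus>\<^bsub>WA\<^esub> tau b))"
      using that by (simp add: j_def incl_add incl_closed tau)
    also have "\<dots> = j ((tau a \<oplus>\<^bsub>WA\<^esub> tau b) 0)"
      using that by (intro q_incl A.witt_add_closed tau)
    finally show ?thesis using that by (simp add: add0 tau)
  qed
  show "inj_on j (carrier A)"
  proof (rule inj_onI)
    fix a b assume ab: "a \<in> carrier A" "b \<in> carrier A" "j a = j b"
    then have "incl (tau a) \<ominus>\<^bsub>E\<^esub> incl (tau b) \<in> I"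
      unfolding j_def using q_eq_iff incl_closed tau by simp
    then show "a = b" using incl_diff[OF tau(1)[OF ab(1)] tau(1)[OF ab(2)]] by (simp add: tau)
  qed
  show "em (j a) = \<zero>\<^bsub>A\<^esub>" if "a \<in> carrier A" for a
    using that by (simp add: j_def em_q incl_closed tau src_incl)
  fix s assume "s \<in> carrier L"
  then obtain e where e: "e \<in> carrier E" "s = q e" by (rule q_surjE)
  { assume "em s = \<zero>\<^bsub>A\<^esub>"
    then obtain w where w: "w \<in> carrier WA" "e = incl w" using src_zeroE e em_q by metis
    then show "\<exists>a\<in>carrier A. s = j a" using q_incl e WA0 by blast
  }
  \<comment> \<open>\<open>E\<close> acts on the copy of $W(A)$ through \<open>tgt\<close>, and
    \<open>tgt0\<close> replaces the zeroth component of \<open>tgt e\<close> by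
    \<open>src e\<close>. With \<open>p_one\<close> this yields the relation between
    \<open>j\<close>, \<open>em\<close> and $p$.\<close>
  have mult: "q (e \<otimes>\<^bsub>E\<^esub> incl w) = j (src e \<otimes>\<^bsub>A\<^esub> w 0)" if w: "w \<in> carrier WA" for w
    using e w q_incl[OF A.witt_add_closed(2)[OF tgt_closed[OF e(1)] w]]
    by (simp add: mult_incl mult0 tgt_closed tgt0 del: q.hom_mult)
  show "j (em s \<otimes>\<^bsub>A\<^esub> a) = s \<otimes>\<^bsub>L\<^esub> j a" if a: "a \<in> carrier A" for a
    using mult[OF tau(1)[OF a]] e a by (simp add: tau em_q incl_closed j_def)
  have one: "\<one>\<^bsub>WA\<^esub> \<in> carrier WA" "\<one>\<^bsub>WA\<^esub> 0 = \<one>\<^bsub>A\<^esub>" by (simp_all add: one_witt carrier_witt)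
  have "add_pow L p s = q (add_pow E p e)"
    using e by (simp add: ring_hom_add_pow_nat[OF E.ring_axioms L.ring_axioms q_hom])
  also have "add_pow E p e = e \<otimes>\<^bsub>E\<^esub> incl \<one>\<^bsub>WA\<^esub>"
    using E.add_pow_rdistr[OF e(1) E.one_closed, of p] e p_one by simp
  also have "q \<dots> = j (em s)" using mult[OF one(1)] e by (simp add: one em_q)
  finally show "j (em s) = add_pow L p s" ..
qed

sublocale P: p_ext_surj p L A em j by (rule p_ext_surj)

text \<open>Truncation is additive, so the image of $p$ can be computed in $W_2(k)$, where it is $V$
  of 1.\<close>

lemma wtrunc_gr: "wtrunc (witt_map g rr) = (\<zero>\<^bsub>A\<^esub>, \<one>\<^bsub>A\<^esub>)" "witt_map g rr \<in> carrier WA"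
proof -
  interpret g: ring_hom_cring k A g by unfold_locales (rule g)
  have one: "\<one>\<^bsub>Wk\<^esub> \<in> carrier Wk" by (simp add: one_witt carrier_witt)
  have *: "add_pow Wk n \<one>\<^bsub>Wk\<^esub> \<in> carrier Wk \<and> wtrunc (add_pow Wk n \<one>\<^bsub>Wk\<^esub>) = add_pow (witt2 p k) n \<one>\<^bsub>witt2 p k\<^esub>" for n :: nat
  proof (induction n)
    case 0
    then show ?case by (simp add: add_pow_def nat_pow_def wtrunc_def zero_witt carrier_witt)
  next
    case (Suc n)
    have "wtrunc \<one>\<^bsub>Wk\<^esub> = \<one>\<^bsub>witt2 p k\<^esub>" by (simp add: wtrunc_def one_witt)
    then show ?case using Suc k.wtrunc_add[OF prime _ one] k.witt_add_closed(1)[OF _ one]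
      by (simp add: add_pow_def nat_pow_def)
  qed
  have "wtrunc rr = (\<zero>\<^bsub>k\<^esub>, \<one>\<^bsub>k\<^esub>)"
    using *[of p] k.witt2_p_mult[OF prime char_k, of "\<one>\<^bsub>witt2 p k\<^esub>"] by simp
  then show "wtrunc (witt_map g rr) = (\<zero>\<^bsub>A\<^esub>, \<one>\<^bsub>A\<^esub>)" by (simp add: wtrunc_witt_map witt2_map_def)
  show "witt_map g rr \<in> carrier WA" using *[of p] by (auto simp: witt_map_def carrier_witt)
qed

text \<open>Two representatives differ by \<open>incl w\<close> with $w_0 = 0$, whose target is $p
  w$. In $W_2(A)$ this is the product of $(0, 1)$ and $(0, w_1)$, that is $(0, p w_1)$, which is
  zero.\<close>

lemma theta_tgt_wd:
  assumes "e \<in> carrier E" "e' \<in> carrier E" "q e = q e'"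
  shows "P.theta (wtrunc (tgt e)) = P.theta (wtrunc (tgt e'))"
proof -
  obtain w where w: "w \<in> carrier WA" "w 0 = \<zero>\<^bsub>A\<^esub>" "e = e' \<oplus>\<^bsub>E\<^esub> incl w" using q_eqE assms .
  note W2 = A.witt2_cring[OF prime]
  interpret W2: cring "witt2 p A" by (rule W2)
  have gw: "witt_map g rr \<otimes>\<^bsub>WA\<^esub> w \<in> carrier WA" using A.witt_add_closed(2)[OF wtrunc_gr(2) w(1)] .
  have "wtrunc (witt_map g rr \<otimes>\<^bsub>WA\<^esub> w) = (\<zero>\<^bsub>A\<^esub>, \<zero>\<^bsub>A\<^esub>)"
    unfolding A.wtrunc_mult[OF prime wtrunc_gr(2) w(1)] wtrunc_gr(1)
    using w WA0[OF w(1)] prime_gt_0_nat[OF prime]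
    by (simp add: wtrunc_def A.witt2_mult[OF prime] A.nat_pow_zero A.char_add_pow[OF P.charA])
  moreover have "tgt e = tgt e' \<oplus>\<^bsub>WA\<^esub> (witt_map g rr \<otimes>\<^bsub>WA\<^esub> w)"
    using ring_hom_add[OF tgt assms(2) incl_closed[OF w(1)]] w tgt_incl by simp
  ultimately have "wtrunc (tgt e) = wtrunc (tgt e') \<oplus>\<^bsub>witt2 p A\<^esub> \<zero>\<^bsub>witt2 p A\<^esub>"
    using A.wtrunc_add[OF prime tgt_closed[OF assms(2)] gw] by simp
  then show ?thesis unfolding W2.r_zero[OF A.wtrunc_closed[OF tgt_closed[OF assms(2)]]] by (rule arg_cong)
qed

definition phi :: "'e set \<Rightarrow> 'e set" where
  "phi = descend E q (\<lambda>e. P.theta (wtrunc (tgt e)))"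

lemma phi_q: "e \<in> carrier E \<Longrightarrow> phi (q e) = P.theta (wtrunc (tgt e))"
  unfolding phi_def by (rule descend_eq) (rule theta_tgt_wd)

lemma phi_hom: "phi \<in> ring_hom L L"
  unfolding phi_def
proof (rule descend_hom[OF E.is_cring q_hom q_surj])
  note th = P.theta_hom and wc = A.wtrunc_closed[OF tgt_closed]
  show "(\<lambda>e. P.theta (wtrunc (tgt e))) \<in> ring_hom E L"
    by (rule ring_hom_memI)
       (simp_all only: ring_hom_closed[OF th wc] ring_hom_mult[OF tgt] ring_hom_add[OF tgt] ring_hom_one[OF tgt]
         A.wtrunc_mult[OF prime tgt_closed tgt_closed] A.wtrunc_add[OF prime tgt_closed tgt_closed] A.wtrunc_one
         ring_hom_mult[OF th wc wc] ring_hom_add[OF th wc wc] ring_hom_one[OF th])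
qed (rule theta_tgt_wd)

lemma em_phi: "x \<in> carrier L \<Longrightarrow> em (phi x) = em x [^]\<^bsub>A\<^esub> p"
  by (erule q_surjE)
    (simp add: phi_q em_q P.em_theta[OF A.wtrunc_closed[OF tgt_closed]], simp add: wtrunc_def tgt0)

end

text \<open>Any lift of Frobenius restricts to \<open>j a \<mapsto> j (a ^ p)\<close>, because \<open>j (em s) = p s\<close>.\<close>

lemma (in p_ext_surj) theta_frob:
  assumes phi: "phi \<in> ring_hom S S" and em_phi: "\<And>s. s \<in> carrier S \<Longrightarrow> em (phi s) = em s [^]\<^bsub>A\<^esub> p"
    and x: "x \<in> carrier (witt2 p A)"
  shows "phi (theta x) = theta (witt2_frob p A x)"
proof -
  interpret phi: ring_hom_cring S S phi by unfold_locales (rule phi)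
  obtain s b where s: "s \<in> carrier S" "b \<in> carrier A" "x = (em s, b)"
    using x by (metis surjE carrier_witt2 mem_Sigma_iff prod.collapse)
  obtain t where t: "t \<in> carrier S" "b = em t" using surjE s(2) .
  have "phi (j b) = j (b [^]\<^bsub>A\<^esub> p)"
    unfolding t(2) using t(1)
    by (simp add: j_em ring_hom_add_pow_nat[OF S.ring_axioms S.ring_axioms phi] em_phi[symmetric])
  moreover have "phi s [^]\<^bsub>S\<^esub> p = (s [^]\<^bsub>S\<^esub> p) [^]\<^bsub>S\<^esub> p"
    by (rule pow_p_eq) (use s em_phi in simp_all)
  ultimately have "phi (theta x) = (s [^]\<^bsub>S\<^esub> p) [^]\<^bsub>S\<^esub> p \<oplus>\<^bsub>S\<^esub> j (b [^]\<^bsub>A\<^esub> p)"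
    using s by (simp add: theta_eq j_closed)
  also have "\<dots> = theta (em (s [^]\<^bsub>S\<^esub> p), b [^]\<^bsub>A\<^esub> p)" using s by (subst theta_eq) simp_all
  finally show ?thesis using s by (simp add: witt2_frob_def)
qed

section \<open>Functoriality of the construction in the butterfly\<close>

locale bfly_map = E: bfly p k A g E + E': bfly p k A' g' E'
  for p :: nat and k :: "('k, 'm) ring_scheme" and A :: "('a, 'n) ring_scheme" and g :: "'k \<Rightarrow> 'a"
    and E :: "('e, nat \<Rightarrow> 'k, 'a, nat \<Rightarrow> 'a) butterfly"
    and A' :: "('a', 'n') ring_scheme" and g' :: "'k \<Rightarrow> 'a'"
    and E' :: "('e', nat \<Rightarrow> 'k, 'a', nat \<Rightarrow> 'a') butterfly" +
  fixes f :: "'a \<Rightarrow> 'a'" and \<rho> :: "'e \<Rightarrow> 'e'"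
  assumes f: "f \<in> ring_hom A A'" and bm: "butterfly_map (witt p k) (witt p A) f (witt_map f) E E' \<rho>"
begin

lemma rho: "\<rho> \<in> ring_hom E E'"
  and rho_incl: "w \<in> carrier E.WA \<Longrightarrow> \<rho> (E.incl w) = E'.incl (witt_map f w)"
  and src_rho: "e \<in> carrier E \<Longrightarrow> E'.src (\<rho> e) = f (E.src e)"
  and tgt_rho: "e \<in> carrier E \<Longrightarrow> E'.tgt (\<rho> e) = witt_map f (E.tgt e)"
  using bm unfolding butterfly_map_def by auto

sublocale f: ring_hom_cring A A' f by unfold_locales (rule f)
sublocale rho: ring_hom_cring E E' \<rho> by unfold_locales (rule rho)

definition ind :: "'e set \<Rightarrow> 'e' set" where "ind = descend E E.q (\<lambda>e. E'.q (\<rho> e))"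

lemma ind_wd:
  assumes "e \<in> carrier E" "e' \<in> carrier E" "E.q e = E.q e'"
  shows "E'.q (\<rho> e) = E'.q (\<rho> e')"
proof -
  obtain w where w: "w \<in> carrier E.WA" "w 0 = \<zero>\<^bsub>A\<^esub>" "e = e' \<oplus>\<^bsub>E\<^esub> E.incl w" using E.q_eqE assms .
  have "witt_map f w \<in> carrier E'.WA" "witt_map f w 0 = \<zero>\<^bsub>A'\<^esub>"
    using w by (simp_all add: witt_map_def carrier_witt)
  then have "E'.q (\<rho> (E.incl w)) = \<zero>\<^bsub>E'.L\<^esub>"
    using w(1) by (simp add: rho_incl E'.q_incl)
  then show ?thesis using assms w by (simp add: E.incl_closed)
qed

lemma ind_q: "e \<in> carrier E \<Longrightarrow> ind (E.q e) = E'.q (\<rho> e)"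
  unfolding ind_def by (rule descend_eq) (rule ind_wd)

lemma ind_hom: "ind \<in> ring_hom E.L E'.L"
  unfolding ind_def
proof (rule descend_hom[OF E.E E.q_hom E.q_surj])
  have "E'.q \<circ> \<rho> \<in> ring_hom E E'.L" by (rule ring_hom_trans[OF rho E'.q_hom])
  then show "(\<lambda>e. E'.q (\<rho> e)) \<in> ring_hom E E'.L" by (simp add: comp_def)
qed (rule ind_wd)

lemma em_ind: "x \<in> carrier E.L \<Longrightarrow> E'.em (ind x) = f (E.em x)"
  by (erule E.q_surjE) (simp add: ind_q E.em_q E'.em_q src_rho)

lemma ind_j: "a \<in> carrier A \<Longrightarrow> ind (E.j a) = E'.j (f a)"
proof -
  assume a: "a \<in> carrier A"
  have "witt_map f (E.tau a) \<in> carrier E'.WA" "witt_map f (E.tau a) 0 = f a"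
    using E.tau(1)[OF a] E.tau(2)[of a] by (simp_all add: witt_map_def carrier_witt)
  then show ?thesis unfolding E.j_def
    using a by (simp add: ind_q E.incl_closed E.tau rho_incl E'.q_incl)
qed

lemma ind_theta:
  assumes x: "x \<in> carrier (witt2 p A)"
  shows "ind (E.P.theta x) = E'.P.theta (witt2_map f x)"
proof (rule theta_natural[OF E.p_ext_surj E'.p_ext_surj ind_hom _ _ x])
  show "E'.em (ind s) = f (E.em s)" if "s \<in> carrier E.L" for s using em_ind that .
  show "ind (E.j a) = E'.j (f a)" if "a \<in> carrier A" for a using ind_j that .
qed

lemma ind_phi: "x \<in> carrier E.L \<Longrightarrow> ind (E.phi x) = E'.phi (ind x)"
  by (erule E.q_surjE)
    (simp add: E.phi_q ind_theta[OF E.A.wtrunc_closed[OF E.tgt_closed]] ind_q E'.phi_q tgt_rho wtrunc_witt_map)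

end

section \<open>Morphisms of ringed spaces\<close>

definition is_base :: "'x topology \<Rightarrow> 'x set set \<Rightarrow> bool" where
  "is_base T B \<longleftrightarrow> (\<forall>U\<in>B. openin T U) \<and> (\<forall>V x. openin T V \<and> x \<in> V \<longrightarrow> (\<exists>U\<in>B. x \<in> U \<and> U \<subseteq> V))"

lemma is_baseE:
  assumes "is_base T B" "openin T V" "x \<in> V"
  obtains U where "U \<in> B" "x \<in> U" "U \<subseteq> V"
  using assms unfolding is_base_def by meson

lemma is_base_open: "is_base T B \<Longrightarrow> U \<in> B \<Longrightarrow> openin T U"
  by (simp add: is_base_def)

text \<open>The condition \<open>down\<close> replaces closure under intersections: a base set
  inside the intersection of two members of \<open>D\<close> is again in \<open>D\<close>, and there
  the sections can be compared.\<close>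

lemma (in rspace) base_glue:
  assumes B: "is_base (Top X) B" and U: "op U"
    and D: "\<And>W. W \<in> D \<Longrightarrow> W \<in> B \<and> W \<subseteq> U" "\<And>x. x \<in> U \<Longrightarrow> \<exists>W\<in>D. x \<in> W"
    and down: "\<And>W W'. W \<in> D \<Longrightarrow> W' \<in> B \<Longrightarrow> W' \<subseteq> W \<Longrightarrow> W' \<in> D"
    and s: "\<And>W. W \<in> D \<Longrightarrow> s W \<in> carrier (Sh X W)"
    and comp: "\<And>W W'. W \<in> D \<Longrightarrow> W' \<in> D \<Longrightarrow> W' \<subseteq> W \<Longrightarrow> Res X W W' (s W) = s W'"
  shows "\<exists>!t. t \<in> carrier (Sh X U) \<and> (\<forall>W\<in>D. Res X U W t = s W)"
proof -
  have oD: "op W" if "W \<in> D" for W using D(1)[OF that] is_base_open[OF B] by simp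
  have "\<exists>t. t \<in> carrier (Sh X U) \<and> (\<forall>W\<in>D. Res X U W t = s W)"
  proof (rule glue_basis[OF U _ D(2) s])
    show "op W \<and> W \<subseteq> U" if "W \<in> D" for W using oD[OF that] D(1)[OF that] by simp
    fix V W x assume VW: "V \<in> D" "W \<in> D" "x \<in> V" "x \<in> W"
    obtain O' where O': "O' \<in> B" "x \<in> O'" "O' \<subseteq> V \<inter> W"
      by (rule is_baseE[OF B openin_Int[OF oD[OF VW(1)] oD[OF VW(2)]]]) (use VW in auto)
    then have "O' \<in> D" using down[OF VW(1) O'(1)] by blast
    then have "Res X V O' (s V) = Res X W O' (s W)" using comp[OF VW(1)] comp[OF VW(2)] O' by simp
    then show "\<exists>O'. op O' \<and> x \<in> O' \<and> O' \<subseteq> V \<and> O' \<subseteq> W \<and> Res X V O' (s V) = Res X W O' (s W)"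
      using O' is_base_open[OF B O'(1)] by blast
  qed auto
  then obtain t where t: "t \<in> carrier (Sh X U)" "\<And>W. W \<in> D \<Longrightarrow> Res X U W t = s W" by blast
  show ?thesis
  proof (rule ex1I[of _ t])
    fix t' assume t': "t' \<in> carrier (Sh X U) \<and> (\<forall>W\<in>D. Res X U W t' = s W)"
    show "t' = t"
    proof (rule sections_eqI[OF U])
      fix x assume "x \<in> U"
      then obtain W where W: "W \<in> D" "x \<in> W" using D(2) by blast
      then show "\<exists>V. op V \<and> x \<in> V \<and> V \<subseteq> U \<and> Res X U V t' = Res X U V t"
        using oD[OF W(1)] D(1)[OF W(1)] t(2)[OF W(1)] t' by (intro exI[of _ W]) simp
    qed (use t' t in auto)
  qed (use t in auto)
qed

lemma is_morD:
  assumes "is_mor X Y f"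
  shows "continuous_map (Top X) (Top Y) (pt f)"
    "\<And>V. openin (Top Y) V \<Longrightarrow> sec f V \<in> ring_hom (Sh Y V) (Sh X (preim X f V))"
    "\<And>V V' s. openin (Top Y) V \<Longrightarrow> openin (Top Y) V' \<Longrightarrow> V' \<subseteq> V \<Longrightarrow> s \<in> carrier (Sh Y V) \<Longrightarrow>
      sec f V' (Res Y V V' s) = Res X (preim X f V) (preim X f V') (sec f V s)"
    "\<And>V x s. openin (Top Y) V \<Longrightarrow> x \<in> preim X f V \<Longrightarrow> s \<in> carrier (Sh Y V) \<Longrightarrow>
      germ_unit X x (preim X f V) (sec f V s) \<Longrightarrow> germ_unit Y (pt f x) V s"
proof -
  note m = assms[unfolded is_mor_def]
  note 2 = conjunct1[OF conjunct2[OF m]] and 3 = conjunct1[OF conjunct2[OF conjunct2[OF m]]]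
    and 4 = conjunct2[OF conjunct2[OF conjunct2[OF m]]]
  show "continuous_map (Top X) (Top Y) (pt f)" by (rule conjunct1[OF m])
  show "sec f V \<in> ring_hom (Sh Y V) (Sh X (preim X f V))" if "openin (Top Y) V" for V
    using 2 that by simp
  show "sec f V' (Res Y V V' s) = Res X (preim X f V) (preim X f V') (sec f V s)"
    if "openin (Top Y) V" "openin (Top Y) V'" "V' \<subseteq> V" "s \<in> carrier (Sh Y V)" for V V' s
    using 3 that by simp
  show "germ_unit Y (pt f x) V s" if "openin (Top Y) V" "x \<in> preim X f V" "s \<in> carrier (Sh Y V)"
    "germ_unit X x (preim X f V) (sec f V s)" for V x s
    using 4[rule_format, of V x s] that by simp
qed

lemma is_morI:
  assumes "continuous_map (Top X) (Top Y) (pt f)"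
    "\<And>V. openin (Top Y) V \<Longrightarrow> sec f V \<in> ring_hom (Sh Y V) (Sh X (preim X f V))"
    "\<And>V V' s. openin (Top Y) V \<Longrightarrow> openin (Top Y) V' \<Longrightarrow> V' \<subseteq> V \<Longrightarrow> s \<in> carrier (Sh Y V) \<Longrightarrow>
      sec f V' (Res Y V V' s) = Res X (preim X f V) (preim X f V') (sec f V s)"
    "\<And>V x s. openin (Top Y) V \<Longrightarrow> x \<in> preim X f V \<Longrightarrow> s \<in> carrier (Sh Y V) \<Longrightarrow>
      germ_unit X x (preim X f V) (sec f V s) \<Longrightarrow> germ_unit Y (pt f x) V s"
  shows "is_mor X Y f"
  unfolding is_mor_def
proof (intro conjI allI impI ballI; (elim conjE)?)
  show "continuous_map (Top X) (Top Y) (pt f)" by (rule assms(1))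
  show "sec f V \<in> ring_hom (Sh Y V) (Sh X (preim X f V))" if "openin (Top Y) V" for V by (rule assms(2)[OF that])
  show "sec f V' (Res Y V V' s) = Res X (preim X f V) (preim X f V') (sec f V s)"
    if "openin (Top Y) V" "openin (Top Y) V'" "V' \<subseteq> V" "s \<in> carrier (Sh Y V)" for V V' s by (rule assms(3)[OF that])
  show "germ_unit Y (pt f x) V s" if "openin (Top Y) V" "x \<in> preim X f V" "s \<in> carrier (Sh Y V)"
    "germ_unit X x (preim X f V) (sec f V s)" for V x s by (rule assms(4)[OF that])
qed

lemma preim_open: "is_mor X Y f \<Longrightarrow> openin (Top Y) V \<Longrightarrow> openin (Top X) (preim X f V)"
  unfolding preim_def by (rule openin_continuous_map_preimage[OF is_morD(1)])

lemma preim_mono: "V' \<subseteq> V \<Longrightarrow> preim X f V' \<subseteq> preim X f V"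
  by (auto simp: preim_def)

lemma pt_closed: "is_mor X Y f \<Longrightarrow> x \<in> topspace (Top X) \<Longrightarrow> pt f x \<in> topspace (Top Y)"
  using is_morD(1) by (metis continuous_map_image_subset_topspace image_subset_iff)

lemma sec_closed: "is_mor X Y f \<Longrightarrow> openin (Top Y) V \<Longrightarrow> s \<in> carrier (Sh Y V) \<Longrightarrow> sec f V s \<in> carrier (Sh X (preim X f V))"
  using is_morD(2) ring_hom_closed by metis

lemma preim_comp:
  assumes "is_mor X Y f"
  shows "preim X (comp_mor Y g f) V = preim X f (preim Y g V)"
  using pt_closed[OF assms] by (auto simp: preim_def comp_mor_def)

lemma comp_mor_simps [simp]:
  "pt (comp_mor Y g f) = pt g \<circ> pt f" "sec (comp_mor Y g f) V s = sec f (preim Y g V) (sec g V s)"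
  by (simp_all add: comp_mor_def)

lemma is_mor_comp:
  assumes f: "is_mor X Y f" and g: "is_mor Y Z g"
  shows "is_mor X Z (comp_mor Y g f)"
proof (rule is_morI)
  show "continuous_map (Top X) (Top Z) (pt (comp_mor Y g f))"
    using continuous_map_compose[OF is_morD(1)[OF f] is_morD(1)[OF g]] by simp
  fix V assume V: "openin (Top Z) V"
  note oV = preim_open[OF g V]
  have "sec f (preim Y g V) \<circ> sec g V \<in> ring_hom (Sh Z V) (Sh X (preim X f (preim Y g V)))"
    by (rule ring_hom_trans[OF is_morD(2)[OF g V] is_morD(2)[OF f oV]])
  then show "sec (comp_mor Y g f) V \<in> ring_hom (Sh Z V) (Sh X (preim X (comp_mor Y g f) V))"
    by (simp add: preim_comp[OF f] comp_def) (simp add: comp_mor_def)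
  { fix V' s assume V': "openin (Top Z) V'" "V' \<subseteq> V" and s: "s \<in> carrier (Sh Z V)"
    show "sec (comp_mor Y g f) V' (Res Z V V' s) =
       Res X (preim X (comp_mor Y g f) V) (preim X (comp_mor Y g f) V') (sec (comp_mor Y g f) V s)"
      using is_morD(3)[OF g V V' s] is_morD(3)[OF f oV preim_open[OF g V'(1)] preim_mono[OF V'(2)] sec_closed[OF g V s]]
      by (simp add: preim_comp[OF f]) }
  fix x s assume x: "x \<in> preim X (comp_mor Y g f) V" and s: "s \<in> carrier (Sh Z V)"
    and gu: "germ_unit X x (preim X (comp_mor Y g f) V) (sec (comp_mor Y g f) V s)"
  have x': "x \<in> preim X f (preim Y g V)" using x by (simp add: preim_comp[OF f])
  then have x'': "pt f x \<in> preim Y g V" by (simp add: preim_def)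
  have "germ_unit X x (preim X f (preim Y g V)) (sec f (preim Y g V) (sec g V s))"
    using gu by (simp add: preim_comp[OF f])
  then have "germ_unit Y (pt f x) (preim Y g V) (sec g V s)"
    by (rule is_morD(4)[OF f oV x' sec_closed[OF g V s]])
  then have "germ_unit Z (pt g (pt f x)) V s"
    by (rule is_morD(4)[OF g V x'' s])
  then show "germ_unit Z (pt (comp_mor Y g f) x) V s" by simp
qed

lemma mor_eqI:
  assumes X: "is_ringed_space X" and Y: "is_ringed_space Y"
    and BX: "is_base (Top X) BX" and BY: "is_base (Top Y) BY"
    and f: "is_mor X Y f" and g: "is_mor X Y g"
    and pt: "\<And>x. x \<in> topspace (Top X) \<Longrightarrow> pt f x = pt g x"
    and sec: "\<And>U U' s. U \<in> BY \<Longrightarrow> U' \<in> BX \<Longrightarrow> U' \<subseteq> preim X f U \<Longrightarrow> s \<in> carrier (Sh Y U) \<Longrightarrow>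
      Res X (preim X f U) U' (sec f U s) = Res X (preim X g U) U' (sec g U s)"
  shows "mor_eq X Y f g"
  unfolding mor_eq_def
proof (intro conjI ballI allI impI)
  interpret X: rspace X by unfold_locales (rule X)
  interpret Y: rspace Y by unfold_locales (rule Y)
  show "pt f x = pt g x" if "x \<in> topspace (Top X)" for x using pt that .
  have pre: "preim X g V = preim X f V" for V using pt by (auto simp: preim_def)
  fix V s assume V: "openin (Top Y) V" and s: "s \<in> carrier (Sh Y V)"
  show "sec f V s = sec g V s"
  proof (rule X.sections_eqI[OF preim_open[OF f V] sec_closed[OF f V s]])
    show "sec g V s \<in> carrier (Sh X (preim X f V))" using sec_closed[OF g V s] by (simp add: pre)
    fix x assume x: "x \<in> preim X f V"
    then have "pt f x \<in> V" by (simp add: preim_def)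
    then obtain U where U: "U \<in> BY" "pt f x \<in> U" "U \<subseteq> V" using is_baseE[OF BY V] by blast
    have oU: "openin (Top Y) U" using is_base_open[OF BY U(1)] .
    have "x \<in> preim X f U" using x U by (simp add: preim_def)
    then obtain U' where U': "U' \<in> BX" "x \<in> U'" "U' \<subseteq> preim X f U" using is_baseE[OF BX preim_open[OF f oU]] by blast
    have oU': "openin (Top X) U'" using is_base_open[OF BX U'(1)] .
    have s': "Res Y V U s \<in> carrier (Sh Y U)" using Y.Res_closed[OF V oU U(3) s] .
    have 1: "Res X (preim X f V) U' (sec f V s) = Res X (preim X f U) U' (sec f U (Res Y V U s))"
      using X.Res_comp[OF preim_open[OF f V] preim_open[OF f oU] oU' U'(3) preim_mono[OF U(3)] sec_closed[OF f V s]]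
        is_morD(3)[OF f V oU U(3) s] by simp
    have 2: "Res X (preim X g V) U' (sec g V s) = Res X (preim X g U) U' (sec g U (Res Y V U s))"
      using X.Res_comp[OF preim_open[OF g V] preim_open[OF g oU] oU' _ preim_mono[OF U(3)] sec_closed[OF g V s]]
        is_morD(3)[OF g V oU U(3) s] U'(3) by (simp add: pre)
    have "Res X (preim X f V) U' (sec f V s) = Res X (preim X f V) U' (sec g V s)"
      using 1 2 sec[OF U(1) U'(1,3) s'] by (simp add: pre)
    then show "\<exists>W. X.op W \<and> x \<in> W \<and> W \<subseteq> preim X f V \<and> Res X (preim X f V) W (sec f V s) = Res X (preim X f V) W (sec g V s)"
      using oU' U'(2,3) preim_mono[OF U(3), of X f] by (intro exI[of _ U']) auto
  qed
qed

text \<open>The local maps are indexed by pairs of base sets with \<open>U'\<close> mapped into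
  \<open>U\<close>, since preimages of base sets need not be base sets. Sections over general open
  sets are recovered by gluing in \<open>X\<close>.\<close>

lemma glue_mor:
  fixes X :: "('x, 'r, 'z) ringed_space_scheme" and Y :: "('y, 's, 'w) ringed_space_scheme" and pf :: "'x \<Rightarrow> 'y"
  assumes X: "is_ringed_space X" and Y: "is_ringed_space Y"
    and cont: "continuous_map (Top X) (Top Y) pf"
    and BX: "is_base (Top X) BX" and BY: "is_base (Top Y) BY"
    and BY_Int: "\<And>U V. U \<in> BY \<Longrightarrow> V \<in> BY \<Longrightarrow> U \<inter> V \<in> BY"
    and tau: "\<And>U U'. U \<in> BY \<Longrightarrow> U' \<in> BX \<Longrightarrow> pf ` U' \<subseteq> U \<Longrightarrow> \<tau> U U' \<in> ring_hom (Sh Y U) (Sh X U')"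
    and nat: "\<And>U U' V V' s. U \<in> BY \<Longrightarrow> U' \<in> BX \<Longrightarrow> V \<in> BY \<Longrightarrow> V' \<in> BX \<Longrightarrow> pf ` U' \<subseteq> U \<Longrightarrow> pf ` V' \<subseteq> V \<Longrightarrow>
      V \<subseteq> U \<Longrightarrow> V' \<subseteq> U' \<Longrightarrow> s \<in> carrier (Sh Y U) \<Longrightarrow> \<tau> V V' (Res Y U V s) = Res X U' V' (\<tau> U U' s)"
    and loc: "\<And>U U' x s. U \<in> BY \<Longrightarrow> U' \<in> BX \<Longrightarrow> pf ` U' \<subseteq> U \<Longrightarrow> x \<in> U' \<Longrightarrow> s \<in> carrier (Sh Y U) \<Longrightarrow>
      germ_unit X x U' (\<tau> U U' s) \<Longrightarrow> germ_unit Y (pf x) U s"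
  obtains f :: "('x, 'r, 'y, 's) mor" where "is_mor X Y f" "pt f = pf"
    "\<And>U U' s. U \<in> BY \<Longrightarrow> U' \<in> BX \<Longrightarrow> pf ` U' \<subseteq> U \<Longrightarrow> s \<in> carrier (Sh Y U) \<Longrightarrow>
      Res X (preim X f U) U' (sec f U s) = \<tau> U U' s"
proof -
  interpret X: rspace X by unfold_locales (rule X)
  interpret Y: rspace Y by unfold_locales (rule Y)
  define pre where "pre V = {x \<in> topspace (Top X). pf x \<in> V}" for V
  define D where "D V = {U' \<in> BX. \<exists>U\<in>BY. U \<subseteq> V \<and> pf ` U' \<subseteq> U}" for V
  \<comment> \<open>Characterizes the image of \<open>s\<close> over \<open>V\<close> by all its
    local values. As exactly one \<open>t\<close> satisfies \<open>Q V s t\<close>, the homomorphism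
    and restriction laws follow by showing that the expected element satisfies it.\<close>
  define Q where "Q V s t \<longleftrightarrow> t \<in> carrier (Sh X (pre V)) \<and>
    (\<forall>U\<in>BY. \<forall>U'\<in>BX. U \<subseteq> V \<and> pf ` U' \<subseteq> U \<longrightarrow> Res X (pre V) U' t = \<tau> U U' (Res Y V U s))" for V s t
  note oX = is_base_open[OF BX] and oY = is_base_open[OF BY]
  have opre: "openin (Top X) (pre V)" if "openin (Top Y) V" for V
    unfolding pre_def using openin_continuous_map_preimage[OF cont that] .
  have sub: "U' \<subseteq> pre V" if "U' \<in> BX" "pf ` U' \<subseteq> V" for U' V
    using that openin_subset[OF oX[OF that(1)]] by (auto simp: pre_def)
  have nbhd: "\<exists>U\<in>BY. \<exists>U'\<in>BX. U \<subseteq> V \<and> pf x \<in> U \<and> x \<in> U' \<and> pf ` U' \<subseteq> U"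
    if V: "openin (Top Y) V" and x: "x \<in> pre V" for V x
  proof -
    obtain U where U: "U \<in> BY" "pf x \<in> U" "U \<subseteq> V" using is_baseE[OF BY V, of "pf x"] x by (auto simp: pre_def)
    obtain U' where U': "U' \<in> BX" "x \<in> U'" "U' \<subseteq> pre U"
      using is_baseE[OF BX opre[OF oY[OF U(1)]], of x] x U by (auto simp: pre_def)
    then have "pf ` U' \<subseteq> U" by (auto simp: pre_def)
    with U U' show ?thesis by blast
  qed
  have ex: "\<exists>!t. Q V s t" if V: "openin (Top Y) V" and s: "s \<in> carrier (Sh Y V)" for V s
  proof -
    \<comment> \<open>Two base sets that both contain the image of \<open>U'\<close> are compared
      through their intersection. This is the purpose of \<open>BY_Int\<close>, which separatedness
      will supply for affine sets.\<close>
    have same: "\<tau> U U' (Res Y V U s) = \<tau> W U' (Res Y V W s)"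
      if "U \<in> BY" "W \<in> BY" "U' \<in> BX" "U \<subseteq> V" "W \<subseteq> V" "pf ` U' \<subseteq> U" "pf ` U' \<subseteq> W" for U W U'
    proof -
      have UW: "U \<inter> W \<in> BY" "pf ` U' \<subseteq> U \<inter> W" using BY_Int that by auto
      have oo: "openin (Top Y) U" "openin (Top Y) W" "openin (Top Y) (U \<inter> W)" "openin (Top X) U'"
        using oY oX that UW by auto
      have a: "\<tau> (U \<inter> W) U' (Res Y V (U \<inter> W) s) = \<tau> C U' (Res Y V C s)" if C: "C \<in> BY" "C \<subseteq> V" "U \<inter> W \<subseteq> C" "pf ` U' \<subseteq> C" for C
      proof -
        have sC: "Res Y V C s \<in> carrier (Sh Y C)" using Y.Res_closed[OF V oY[OF C(1)] C(2) s] .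
        have "\<tau> (U \<inter> W) U' (Res Y C (U \<inter> W) (Res Y V C s)) = Res X U' U' (\<tau> C U' (Res Y V C s))"
          by (rule nat[OF C(1) \<open>U' \<in> BX\<close> UW(1) \<open>U' \<in> BX\<close> C(4) UW(2) C(3) subset_refl sC])
        then show ?thesis
          using X.Res_id[OF oo(4) ring_hom_closed[OF tau[OF C(1) \<open>U' \<in> BX\<close> C(4)] sC]]
            Y.Res_comp[OF V oY[OF C(1)] oo(3) C(3) C(2) s] by simp
      qed
      show ?thesis using a[OF that(1,4) _ that(6)] a[OF that(2,5) _ that(7)] by simp
    qed
    have "\<forall>U'. \<exists>U. U' \<in> D V \<longrightarrow> U \<in> BY \<and> U \<subseteq> V \<and> pf ` U' \<subseteq> U" unfolding D_def by blast
    then obtain c where c: "\<And>U'. U' \<in> D V \<Longrightarrow> c U' \<in> BY \<and> c U' \<subseteq> V \<and> pf ` U' \<subseteq> c U'" by metis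
    have DB: "U' \<in> BX" if "U' \<in> D V" for U' using that by (simp add: D_def)
    have "\<exists>!t. t \<in> carrier (Sh X (pre V)) \<and> (\<forall>W\<in>D V. Res X (pre V) W t = \<tau> (c W) W (Res Y V (c W) s))"
    proof (rule X.base_glue[OF BX opre[OF V]])
      show "W \<in> BX \<and> W \<subseteq> pre V" if "W \<in> D V" for W
        using c[OF that] DB[OF that] sub[of W V] by auto
      show "\<exists>W\<in>D V. x \<in> W" if "x \<in> pre V" for x
        using nbhd[OF V that] unfolding D_def by blast
      show "W' \<in> D V" if "W \<in> D V" "W' \<in> BX" "W' \<subseteq> W" for W W'
        using that unfolding D_def by blast
      show "\<tau> (c W) W (Res Y V (c W) s) \<in> carrier (Sh X W)" if "W \<in> D V" for W
        using ring_hom_closed[OF tau Y.Res_closed[OF V oY _ s]] c[OF that] DB[OF that] by blast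
      show "Res X W W' (\<tau> (c W) W (Res Y V (c W) s)) = \<tau> (c W') W' (Res Y V (c W') s)"
        if W: "W \<in> D V" "W' \<in> D V" "W' \<subseteq> W" for W W'
      proof -
        have cW: "c W \<in> BY" "c W \<subseteq> V" "pf ` W \<subseteq> c W" using c[OF W(1)] by auto
        have p': "pf ` W' \<subseteq> c W" using cW(3) W(3) by blast
        have sc: "Res Y V (c W) s \<in> carrier (Sh Y (c W))" using Y.Res_closed[OF V oY[OF cW(1)] cW(2) s] .
        have "Res X W W' (\<tau> (c W) W (Res Y V (c W) s)) = \<tau> (c W) W' (Res Y (c W) (c W) (Res Y V (c W) s))"
          by (rule nat[OF cW(1) DB[OF W(1)] cW(1) DB[OF W(2)] cW(3) p' subset_refl W(3) sc, symmetric])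
        also have "\<dots> = \<tau> (c W) W' (Res Y V (c W) s)" using Y.Res_id[OF oY[OF cW(1)] sc] by simp
        also have "\<dots> = \<tau> (c W') W' (Res Y V (c W') s)"
          using same[of "c W" "c W'" W'] c[OF W(2)] cW DB[OF W(2)] p' by simp
        finally show ?thesis .
      qed
    qed
    moreover have "Q V s t \<longleftrightarrow> t \<in> carrier (Sh X (pre V)) \<and> (\<forall>W\<in>D V. Res X (pre V) W t = \<tau> (c W) W (Res Y V (c W) s))" for t
    proof
      assume *: "Q V s t"
      show "t \<in> carrier (Sh X (pre V)) \<and> (\<forall>W\<in>D V. Res X (pre V) W t = \<tau> (c W) W (Res Y V (c W) s))"
        using * c DB unfolding Q_def by simp
    next
      assume *: "t \<in> carrier (Sh X (pre V)) \<and> (\<forall>W\<in>D V. Res X (pre V) W t = \<tau> (c W) W (Res Y V (c W) s))"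
      show "Q V s t" unfolding Q_def
      proof (intro conjI ballI impI)
        fix U U' assume U: "U \<in> BY" "U' \<in> BX" "U \<subseteq> V \<and> pf ` U' \<subseteq> U"
        then have "U' \<in> D V" by (auto simp: D_def)
        then show "Res X (pre V) U' t = \<tau> U U' (Res Y V U s)"
          using * same[of "c U'" U U'] c[of U'] U by simp
      qed (use * in simp)
    qed
    ultimately show ?thesis by simp
  qed
  define f where "f = \<lparr>pt = pf, sec = (\<lambda>V s. THE t. Q V s t)\<rparr>"
  have pref: "preim X f V = pre V" for V by (simp add: preim_def f_def pre_def)
  have Qf: "Q V s (sec f V s)" if "openin (Top Y) V" "s \<in> carrier (Sh Y V)" for V s
    unfolding f_def using theI'[OF ex[OF that]] by simp
  have Qu: "t = sec f V s" if "openin (Top Y) V" "s \<in> carrier (Sh Y V)" "Q V s t" for V s t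
    using ex[OF that(1,2)] Qf[OF that(1,2)] that(3) by blast
  have secf: "Res X (pre V) U' (sec f V s) = \<tau> U U' (Res Y V U s)"
    if "openin (Top Y) V" "s \<in> carrier (Sh Y V)" "U \<in> BY" "U' \<in> BX" "U \<subseteq> V" "pf ` U' \<subseteq> U" for V s U U'
    using Qf[OF that(1,2)] that(3-6) unfolding Q_def by blast
  have secc: "sec f V s \<in> carrier (Sh X (pre V))" if "openin (Top Y) V" "s \<in> carrier (Sh Y V)" for V s
    using Qf[OF that] unfolding Q_def by blast
  have "is_mor X Y f"
  proof (rule is_morI; (unfold pref)?)
    show "continuous_map (Top X) (Top Y) (pt f)" using cont by (simp add: f_def)
    fix V assume V: "openin (Top Y) V"
    interpret V: cring "Sh Y V" using Y.Sh_cring[OF V] .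
    interpret P: cring "Sh X (pre V)" using X.Sh_cring[OF opre[OF V]] .
    have homs: "Res X (pre V) U' \<in> ring_hom (Sh X (pre V)) (Sh X U')" "\<tau> U U' \<in> ring_hom (Sh Y U) (Sh X U')"
      "Res Y V U \<in> ring_hom (Sh Y V) (Sh Y U)"
      if "U \<in> BY" "U' \<in> BX" "U \<subseteq> V" "pf ` U' \<subseteq> U" for U U'
    proof -
      have "U' \<subseteq> pre V" using sub[OF that(2)] that(3,4) by (meson order_trans)
      then show "Res X (pre V) U' \<in> ring_hom (Sh X (pre V)) (Sh X U')" by (rule X.Res_hom[OF opre[OF V] oX[OF that(2)]])
      show "\<tau> U U' \<in> ring_hom (Sh Y U) (Sh X U')" using tau that by blast
      show "Res Y V U \<in> ring_hom (Sh Y V) (Sh Y U)" by (rule Y.Res_hom[OF V oY[OF that(1)] that(3)])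
    qed
    show "sec f V \<in> ring_hom (Sh Y V) (Sh X (pre V))"
    proof (rule ring_hom_memI)
      fix s assume s: "s \<in> carrier (Sh Y V)"
      note sc = secc[OF V s]
      show "sec f V s \<in> carrier (Sh X (pre V))" by (rule sc)
      fix s' assume s': "s' \<in> carrier (Sh Y V)"
      note sc' = secc[OF V s']
      have "Q V (s \<otimes>\<^bsub>Sh Y V\<^esub> s') (sec f V s \<otimes>\<^bsub>Sh X (pre V)\<^esub> sec f V s')"
        unfolding Q_def
      proof (intro conjI ballI impI)
        fix U U' assume U: "U \<in> BY" "U' \<in> BX" "U \<subseteq> V \<and> pf ` U' \<subseteq> U"
        then have U3: "U \<subseteq> V" "pf ` U' \<subseteq> U" by auto
        note h = homs[OF U(1,2) U3]
        show "Res X (pre V) U' (sec f V s \<otimes>\<^bsub>Sh X (pre V)\<^esub> sec f V s') = \<tau> U U' (Res Y V U (s \<otimes>\<^bsub>Sh Y V\<^esub> s'))"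
          by (simp add: ring_hom_mult[OF h(1) sc sc'] ring_hom_mult[OF h(3) s s']
              ring_hom_mult[OF h(2) ring_hom_closed[OF h(3) s] ring_hom_closed[OF h(3) s']]
              secf[OF V s U(1,2) U3] secf[OF V s' U(1,2) U3])
      qed (use sc sc' in simp)
      then show "sec f V (s \<otimes>\<^bsub>Sh Y V\<^esub> s') = sec f V s \<otimes>\<^bsub>Sh X (pre V)\<^esub> sec f V s'"
        using Qu[OF V V.m_closed[OF s s']] by simp
      have "Q V (s \<oplus>\<^bsub>Sh Y V\<^esub> s') (sec f V s \<oplus>\<^bsub>Sh X (pre V)\<^esub> sec f V s')"
        unfolding Q_def
      proof (intro conjI ballI impI)
        fix U U' assume U: "U \<in> BY" "U' \<in> BX" "U \<subseteq> V \<and> pf ` U' \<subseteq> U"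
        then have U3: "U \<subseteq> V" "pf ` U' \<subseteq> U" by auto
        note h = homs[OF U(1,2) U3]
        show "Res X (pre V) U' (sec f V s \<oplus>\<^bsub>Sh X (pre V)\<^esub> sec f V s') = \<tau> U U' (Res Y V U (s \<oplus>\<^bsub>Sh Y V\<^esub> s'))"
          by (simp add: ring_hom_add[OF h(1) sc sc'] ring_hom_add[OF h(3) s s']
              ring_hom_add[OF h(2) ring_hom_closed[OF h(3) s] ring_hom_closed[OF h(3) s']]
              secf[OF V s U(1,2) U3] secf[OF V s' U(1,2) U3])
      qed (use sc sc' in simp)
      then show "sec f V (s \<oplus>\<^bsub>Sh Y V\<^esub> s') = sec f V s \<oplus>\<^bsub>Sh X (pre V)\<^esub> sec f V s'"
        using Qu[OF V V.a_closed[OF s s']] by simp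
    next
      have "Q V \<one>\<^bsub>Sh Y V\<^esub> \<one>\<^bsub>Sh X (pre V)\<^esub>"
        unfolding Q_def
      proof (intro conjI ballI impI)
        fix U U' assume U: "U \<in> BY" "U' \<in> BX" "U \<subseteq> V \<and> pf ` U' \<subseteq> U"
        then have U3: "U \<subseteq> V" "pf ` U' \<subseteq> U" by auto
        note h = homs[OF U(1,2) U3]
        show "Res X (pre V) U' \<one>\<^bsub>Sh X (pre V)\<^esub> = \<tau> U U' (Res Y V U \<one>\<^bsub>Sh Y V\<^esub>)"
          by (simp add: ring_hom_one[OF h(1)] ring_hom_one[OF h(2)] ring_hom_one[OF h(3)])
      qed simp
      then show "sec f V \<one>\<^bsub>Sh Y V\<^esub> = \<one>\<^bsub>Sh X (pre V)\<^esub>"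
        using Qu[OF V V.one_closed] by simp
    qed
    { fix V' s assume V': "openin (Top Y) V'" "V' \<subseteq> V" and s: "s \<in> carrier (Sh Y V)"
      have pp: "pre V' \<subseteq> pre V" using V' by (auto simp: pre_def)
      have "Q V' (Res Y V V' s) (Res X (pre V) (pre V') (sec f V s))"
        unfolding Q_def
      proof (intro conjI ballI impI)
        show "Res X (pre V) (pre V') (sec f V s) \<in> carrier (Sh X (pre V'))"
          by (rule X.Res_closed[OF opre[OF V] opre[OF V'(1)] pp secc[OF V s]])
        fix U U' assume U: "U \<in> BY" "U' \<in> BX" "U \<subseteq> V' \<and> pf ` U' \<subseteq> U"
        then have U3: "U \<subseteq> V'" "pf ` U' \<subseteq> U" "U \<subseteq> V" "U' \<subseteq> pre V'" using V' sub[of U' V'] by auto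
        show "Res X (pre V') U' (Res X (pre V) (pre V') (sec f V s)) = \<tau> U U' (Res Y V' U (Res Y V V' s))"
          using X.Res_comp[OF opre[OF V] opre[OF V'(1)] oX[OF U(2)] U3(4) pp secc[OF V s]]
            Y.Res_comp[OF V V'(1) oY[OF U(1)] U3(1) V'(2) s] secf[OF V s U(1,2) U3(3,2)] by simp
      qed
      then show "sec f V' (Res Y V V' s) = Res X (pre V) (pre V') (sec f V s)"
        using Qu[OF V'(1) Y.Res_closed[OF V V' s]] by simp
    }
    fix x s assume x: "x \<in> pre V" and s: "s \<in> carrier (Sh Y V)" and gu: "germ_unit X x (pre V) (sec f V s)"
    obtain U U' where U: "U \<in> BY" "U' \<in> BX" "U \<subseteq> V" "pf x \<in> U" "x \<in> U'" "pf ` U' \<subseteq> U" using nbhd[OF V x] by blast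
    have U'V: "U' \<subseteq> pre V" using sub[OF U(2), of V] U by auto
    have "germ_unit X x U' (Res X (pre V) U' (sec f V s))"
      using X.germ_unit_Res[OF opre[OF V] oX[OF U(2)] U'V U(5) secc[OF V s]] gu by simp
    then have "germ_unit Y (pf x) U (Res Y V U s)"
      unfolding secf[OF V s U(1,2,3,6)] by (rule loc[OF U(1,2,6,5) Y.Res_closed[OF V oY[OF U(1)] U(3) s]])
    then show "germ_unit Y (pt f x) V s"
      using Y.germ_unit_Res[OF V oY[OF U(1)] U(3,4) s] by (simp add: f_def)
  qed
  moreover have "Res X (preim X f U) U' (sec f U s) = \<tau> U U' s" if "U \<in> BY" "U' \<in> BX" "pf ` U' \<subseteq> U" "s \<in> carrier (Sh Y U)" for U U' s
    using secf[OF oY[OF that(1)] that(4) that(1,2) subset_refl that(3)] Y.Res_id[OF oY[OF that(1)] that(4)] by (simp add: pref)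
  ultimately show thesis using that[of f] by (simp add: f_def)
qed

section \<open>The Frobenius lifting attached to a trivialization\<close>

locale perf =
  fixes p :: nat and k :: "'k ring"
  assumes prime: "prime p" and perfect: "perfect_field p k"
begin

lemma kfield: "field k" and char_k: "add_pow k p \<one>\<^bsub>k\<^esub> = \<zero>\<^bsub>k\<^esub>"
  and root: "\<And>a. a \<in> carrier k \<Longrightarrow> \<exists>b\<in>carrier k. b [^]\<^bsub>k\<^esub> p = a"
  using perfect by (auto simp: perfect_field_def)

lemma kcring: "cring k" using kfield fieldE(1) by blast

sublocale k: cring k by (rule kcring)
sublocale kd: field k by (rule kfield)
sublocale W: cring "witt2 p k" by (rule k.witt2_cring[OF prime])

lemma frob_k: "(\<lambda>x. x [^]\<^bsub>k\<^esub> p) \<in> ring_hom k k"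
  by (rule k.frobenius_hom[OF prime char_k])

lemma frob_k_inj:
  assumes "x \<in> carrier k" "y \<in> carrier k" "x [^]\<^bsub>k\<^esub> p = y [^]\<^bsub>k\<^esub> p"
  shows "x = y"
proof -
  interpret f: ring_hom_cring k k "\<lambda>x. x [^]\<^bsub>k\<^esub> p" by unfold_locales (rule frob_k)
  have pz: "(x \<ominus>\<^bsub>k\<^esub> y) [^]\<^bsub>k\<^esub> p = \<zero>\<^bsub>k\<^esub>"
    using assms f.hom_add[of x "\<ominus>\<^bsub>k\<^esub> y"] f.hom_a_inv[of y] by (simp add: k.minus_eq k.r_neg)
  have zz: "z = \<zero>\<^bsub>k\<^esub>" if "z [^]\<^bsub>k\<^esub> n = \<zero>\<^bsub>k\<^esub>" "z \<in> carrier k" for z and n :: nat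
    using that by (induction n) (auto simp: kd.integral_iff)
  have "x \<ominus>\<^bsub>k\<^esub> y = \<zero>\<^bsub>k\<^esub>" by (rule zz[OF pz]) (use assms in simp)
  then show ?thesis by (rule k.minus_eq_zeroD) (use assms in auto)
qed

abbreviation "F \<equiv> witt2_frob p k"

definition Finv :: "'k \<times> 'k \<Rightarrow> 'k \<times> 'k" where "Finv = inv_into (carrier (witt2 p k)) F"

lemma F_hom: "F \<in> ring_hom (witt2 p k) (witt2 p k)"
  by (rule k.witt2_frob_hom[OF prime char_k])

lemma F_bij: "bij_betw F (carrier (witt2 p k)) (carrier (witt2 p k))"
proof (rule bij_betw_imageI)
  show "inj_on F (carrier (witt2 p k))"
    by (rule inj_onI) (auto simp: witt2_frob_def intro: frob_k_inj)
  show "F ` carrier (witt2 p k) = carrier (witt2 p k)"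
  proof
    show "F ` carrier (witt2 p k) \<subseteq> carrier (witt2 p k)" by (auto simp: witt2_frob_def)
    show "carrier (witt2 p k) \<subseteq> F ` carrier (witt2 p k)"
    proof
      fix x assume "x \<in> carrier (witt2 p k)"
      then obtain a b where ab: "a \<in> carrier k" "b \<in> carrier k" "a [^]\<^bsub>k\<^esub> p = fst x" "b [^]\<^bsub>k\<^esub> p = snd x"
        using root[of "fst x"] root[of "snd x"] by auto
      then have "x = F (a, b)" by (simp add: witt2_frob_def prod_eq_iff)
      then show "x \<in> F ` carrier (witt2 p k)" using ab by auto
    qed
  qed
qed

lemma Finv_hom: "Finv \<in> ring_hom (witt2 p k) (witt2 p k)"
proof -
  have "F \<in> ring_iso (witt2 p k) (witt2 p k)" using F_hom F_bij by (simp add: ring_iso_def)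
  from ring_iso_set_sym[OF W.ring_axioms this] show ?thesis by (simp add: ring_iso_def Finv_def)
qed

lemma F_Finv: "x \<in> carrier (witt2 p k) \<Longrightarrow> F (Finv x) = x"
  and Finv_F: "x \<in> carrier (witt2 p k) \<Longrightarrow> Finv (F x) = x"
  unfolding Finv_def using F_bij by (auto simp: bij_betw_def f_inv_into_f simp del: carrier_witt2)

lemma Finv_closed: "x \<in> carrier (witt2 p k) \<Longrightarrow> Finv x \<in> carrier (witt2 p k)"
  using ring_hom_closed[OF Finv_hom] .

text \<open>As \<open>theta\<close> reduces to Frobenius modulo $p$, it is precomposed with the inverse Frobenius
  of $W_2(k)$.\<close>

definition wstr :: "('e, 'm1) ring_scheme \<Rightarrow> ('e \<Rightarrow> 'a) \<Rightarrow> ('a \<Rightarrow> 'e) \<Rightarrow> ('k \<Rightarrow> 'a) \<Rightarrow> 'k \<times> 'k \<Rightarrow> 'e" where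
  "wstr S em j g a = p_ext.theta p S em j (witt2_map g (Finv a))"

lemma witt2_map_closed: "g \<in> ring_hom k A \<Longrightarrow> x \<in> carrier (witt2 p k) \<Longrightarrow> witt2_map g x \<in> carrier (witt2 p A)"
  by (auto simp: witt2_map_def ring_hom_closed)

lemma wstr_hom:
  assumes "p_ext_surj p S A em j" "g \<in> ring_hom k A"
  shows "wstr S em j g \<in> ring_hom (witt2 p k) S"
proof -
  interpret p_ext_surj p S A em j by fact
  have "theta \<circ> (witt2_map g \<circ> Finv) \<in> ring_hom (witt2 p k) S"
    by (intro ring_hom_trans[OF _ theta_hom] ring_hom_trans[OF Finv_hom] witt2_map_hom prime kcring A assms(2))
  then show ?thesis by (simp add: comp_def wstr_def[abs_def])
qed

lemma em_wstr:
  assumes "p_ext_surj p S A em j" "g \<in> ring_hom k A" "a \<in> carrier (witt2 p k)"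
  shows "em (wstr S em j g a) = g (fst a)"
proof -
  interpret p_ext_surj p S A em j by fact
  interpret g: ring_hom_cring k A g by unfold_locales fact
  have c: "Finv a \<in> carrier (witt2 p k)" using Finv_closed assms by blast
  have "em (wstr S em j g a) = fst (witt2_map g (Finv a)) [^]\<^bsub>A\<^esub> p"
    unfolding wstr_def by (rule em_theta[OF witt2_map_closed[OF assms(2) c]])
  also have "\<dots> = g (fst (F (Finv a)))" using c by (auto simp: witt2_map_def witt2_frob_def)
  finally show ?thesis using F_Finv[OF assms(3)] by simp
qed

text \<open>By \<open>theta_frob\<close> any lift of Frobenius passes through \<open>theta\<close>
  as the Frobenius of $W_2(A)$; this commutes with the maps induced by \<open>g\<close>, and
  \<open>F\<close> commutes with its inverse.\<close>

lemma wstr_phi: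
  assumes S: "p_ext_surj p S A em j" and g: "g \<in> ring_hom k A" and a: "a \<in> carrier (witt2 p k)"
    and phi: "phi \<in> ring_hom S S" "\<And>s. s \<in> carrier S \<Longrightarrow> em (phi s) = em s [^]\<^bsub>A\<^esub> p"
  shows "phi (wstr S em j g a) = wstr S em j g (F a)"
proof -
  interpret p_ext_surj p S A em j by fact
  interpret g: ring_hom_cring k A g by unfold_locales fact
  have c: "Finv a \<in> carrier (witt2 p k)" using Finv_closed a by blast
  have "phi (wstr S em j g a) = theta (witt2_frob p A (witt2_map g (Finv a)))"
    unfolding wstr_def by (rule theta_frob[OF phi witt2_map_closed[OF g c]])
  also have "witt2_frob p A (witt2_map g (Finv a)) = witt2_map g (F (Finv a))"
    using c by (auto simp: witt2_map_def witt2_frob_def)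
  also have "\<dots> = witt2_map g (Finv (F a))" using F_Finv[OF a] Finv_F[OF a] by simp
  finally show ?thesis by (simp add: wstr_def)
qed

lemma wstr_nat:
  assumes S: "p_ext_surj p S A em j" and S': "p_ext_surj p S' A' em' j'" and g: "g \<in> ring_hom k A"
    and f: "f \<in> ring_hom S S'" "\<And>s. s \<in> carrier S \<Longrightarrow> em' (f s) = h (em s)" "\<And>a. a \<in> carrier A \<Longrightarrow> f (j a) = j' (h a)"
    and gg: "\<And>c. c \<in> carrier k \<Longrightarrow> h (g c) = g' c" and a: "a \<in> carrier (witt2 p k)"
  shows "f (wstr S em j g a) = wstr S' em' j' g' a"
proof -
  have c: "Finv a \<in> carrier (witt2 p k)" using Finv_closed a by blast
  have "f (wstr S em j g a) = p_ext.theta p S' em' j' (witt2_map h (witt2_map g (Finv a)))"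
    unfolding wstr_def by (rule theta_natural[OF S S' f witt2_map_closed[OF g c]])
  also have "witt2_map h (witt2_map g (Finv a)) = witt2_map g' (Finv a)"
    using c gg by (auto simp: witt2_map_def)
  finally show ?thesis by (simp add: wstr_def)
qed

lemma smooth_lift_W2:
  assumes S: "p_ext_surj p S A em j" and g: "g \<in> ring_hom k A" and sm: "standard_smooth k A g"
    and \<tau>: "\<tau> \<in> ring_hom (witt2 p k) S" "\<And>a. a \<in> carrier (witt2 p k) \<Longrightarrow> em (\<tau> a) = g (fst a)"
  shows "standard_smooth (witt2 p k) S \<tau>"
proof -
  note pm = k.witt2_p_mult[OF prime char_k]
  have "smooth_lift p S A em j (witt2 p k) k fst g \<tau>"
  proof (intro smooth_lift.intro smooth_lift_axioms.intro S W.is_cring kcring char_k g \<tau>)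
    show "fst \<in> ring_hom (witt2 p k) k"
      by (rule ring_hom_memI) (auto simp: k.witt2_add[OF prime] k.witt2_mult[OF prime])
    show "fst ` carrier (witt2 p k) = carrier k" by force
    show "\<exists>y\<in>carrier (witt2 p k). x = add_pow (witt2 p k) p y"
      if "x \<in> carrier (witt2 p k)" "fst x = \<zero>\<^bsub>k\<^esub>" for x
    proof -
      have "snd x \<in> carrier k" using that by auto
      \<comment> \<open>An element $(0, c)$ is $p$ times $(b, 0)$ for a $p$-th root \<open>b\<close>
        of \<open>c\<close>. Perfectness of \<open>k\<close> thus shows that the kernel of reduction
        is generated by $p$.\<close>
      then obtain b where b: "b \<in> carrier k" "b [^]\<^bsub>k\<^esub> p = snd x" using root by blast
      then have "x = add_pow (witt2 p k) p (b, \<zero>\<^bsub>k\<^esub>)" using pm[of "(b, \<zero>\<^bsub>k\<^esub>)"] that by (simp add: prod_eq_iff)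
      then show ?thesis using b by (intro bexI[of _ "(b, \<zero>\<^bsub>k\<^esub>)"]) auto
    qed
    show "add_pow (witt2 p k) p (add_pow (witt2 p k) p x) = \<zero>\<^bsub>witt2 p k\<^esub>" if "x \<in> carrier (witt2 p k)" for x
    proof -
      have x: "fst x \<in> carrier k" "x \<in> carrier k \<times> carrier k" using that by auto
      show ?thesis unfolding pm[OF x(2)] using x pm[of "(\<zero>\<^bsub>k\<^esub>, fst x [^]\<^bsub>k\<^esub> p)"] prime_gt_0_nat[OF prime]
        by (simp add: k.nat_pow_zero)
    qed
  qed
  then show ?thesis using smooth_lift.standard_smooth_lift sm by blast
qed

end

lemma (in local_lift) qG_inj: "affine_open X U \<Longrightarrow> inj_on (qG U) (carrier (L U))"
proof (rule inj_onI)
  fix x y assume U: "affine_open X U" and xy: "x \<in> carrier (L U)" "y \<in> carrier (L U)" "qG U x = qG U y"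
  have "up U x = up U y"
    by (rule inj_onD[OF enc_inj[OF X.affine_open[OF U]], OF xy(3)[unfolded qG_def]]) (rule up_closed[OF U xy(1)], rule up_closed[OF U xy(2)])
  then have "up U x U = up U y U" by (rule fun_cong)
  then show "x = y" unfolding up_self[OF U xy(1)] up_self[OF U xy(2)] .
qed

section \<open>The local liftings of a trivialization\<close>

locale triv = perf p k + scheme X
  for p :: nat and k :: "'k ring" and X :: "('x, 'r, 'k) scheme_over" +
  fixes t :: "('x, 'r, 'k) trivialization"
  assumes str: "Str X \<in> ring_hom k (Sh X (topspace (Top X)))" and t: "t \<in> trivializations p k X"
begin

lemma Str_on_hom: "op U \<Longrightarrow> Str_on X U \<in> ring_hom k (Sh X U)"
proof -
  assume U: "op U"
  have "Res X (topspace (Top X)) U \<circ> Str X \<in> ring_hom k (Sh X U)"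
    by (rule ring_hom_trans[OF str Res_hom]) (use U in \<open>auto simp: openin_subset\<close>)
  then show ?thesis by (simp add: comp_def Str_on_def[abs_def])
qed

lemma Res_Str_on: "op U \<Longrightarrow> op V \<Longrightarrow> V \<subseteq> U \<Longrightarrow> c \<in> carrier k \<Longrightarrow> Res X U V (Str_on X U c) = Str_on X V c"
  unfolding Str_on_def by (rule Res_comp) (auto simp: openin_subset ring_hom_closed[OF str])

lemma HT_index_id: "affine_open X U \<Longrightarrow> affine_open X V \<Longrightarrow> V \<subseteq> U \<Longrightarrow> (U, V) \<in> HT_index X X id_mor"
  using openin_subset[OF affine_open, of V] by (auto simp: HT_index_def preim_def id_mor_def)

text \<open>At a diagonal pair the source ring and the ring of Witt coefficients coincide, so the
  butterfly is an extension of $A$ by $W(A)$ for one and the same $A$.\<close>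

abbreviation bf where "bf U \<equiv> ht_bf t U U"
abbreviation rs where "rs U V \<equiv> ht_res t U U V V"

lemma t_dq:
  assumes U: "affine_open X U"
  shows "derived_quotient_map (witt p k) (add_pow (witt p k) p \<one>\<^bsub>witt p k\<^esub>) (Sh X U) (\<lambda>a. Str_on X U (a 0))
    (witt p (Sh X U)) (witt_map (Str_on X U)) (bf U)"
    "e \<in> carrier (bf U) \<Longrightarrow> bf_tgt (bf U) e 0 = bf_src (bf U) e"
    "e \<in> carrier (bf U) \<Longrightarrow> rs U U e = e"
proof -
  have UU: "(U, U) \<in> HT_index X X id_mor" using HT_index_id U by blast
  have pre: "preim X id_mor U = U" using openin_subset[OF affine_open[OF U]] by (auto simp: preim_def id_mor_def)
  note T = t[unfolded trivializations_def HT_points_def mem_Collect_eq]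
  note T1 = bspec[OF conjunct1[OF T] UU, unfolded prod.case]
  show dq: "derived_quotient_map (witt p k) (add_pow (witt p k) p \<one>\<^bsub>witt p k\<^esub>) (Sh X U) (\<lambda>a. Str_on X U (a 0))
    (witt p (Sh X U)) (witt_map (Str_on X U)) (bf U)" by (rule conjunct1[OF T1])
  { assume e: "e \<in> carrier (bf U)"
    have "bf_src (bf U) \<in> ring_hom (bf U) (Sh X U)" using dq unfolding derived_quotient_map_def by blast
    from ring_hom_closed[OF this e] show "bf_tgt (bf U) e 0 = bf_src (bf U) e"
      using bspec[OF conjunct2[OF T1] e] Res_id[OF affine_open[OF U]] by (simp add: pre) (simp add: id_mor_def)
    show "rs U U e = e"
      using bspec[OF bspec[OF conjunct1[OF conjunct2[OF conjunct2[OF T]]] UU, unfolded prod.case] e] .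
  }
qed

lemma t_map:
  assumes U: "affine_open X U" "affine_open X V" "V \<subseteq> U"
  shows "butterfly_map (witt p k) (witt p (Sh X U)) (Res X U V) (witt_map (Res X U V)) (bf U) (bf V) (rs U V)"
proof -
  have UU: "(U, U) \<in> HT_index X X id_mor" "(V, V) \<in> HT_index X X id_mor" using HT_index_id U by blast+
  note T = t[unfolded trivializations_def HT_points_def mem_Collect_eq]
  show ?thesis
    using bspec[OF bspec[OF conjunct1[OF conjunct2[OF T]] UU(1), unfolded prod.case] UU(2), unfolded prod.case] U(3) by simp
qed

lemma t_comp:
  assumes U: "affine_open X U" "affine_open X V" "affine_open X W" "W \<subseteq> V" "V \<subseteq> U" and e: "e \<in> carrier (bf U)"
  shows "rs V W (rs U V e) = rs U W e"
proof -
  have UU: "(U, U) \<in> HT_index X X id_mor" "(V, V) \<in> HT_index X X id_mor" "(W, W) \<in> HT_index X X id_mor"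
    using HT_index_id U by blast+
  note T = t[unfolded trivializations_def HT_points_def mem_Collect_eq]
  note T4 = bspec[OF bspec[OF bspec[OF conjunct2[OF conjunct2[OF conjunct2[OF T]]] UU(1), unfolded prod.case] UU(2), unfolded prod.case] UU(3), unfolded prod.case]
  show ?thesis using T4 U(4,5) e by simp
qed

lemma bfly: "affine_open X U \<Longrightarrow> bfly p k (Sh X U) (Str_on X U) (bf U)"
  by (intro bfly.intro prime kcring char_k Sh_cring affine_open Str_on_hom t_dq)

lemma bfly_map: "affine_open X U \<Longrightarrow> affine_open X V \<Longrightarrow> V \<subseteq> U \<Longrightarrow>
    bfly_map p k (Sh X U) (Str_on X U) (bf U) (Sh X V) (Str_on X V) (bf V) (Res X U V) (rs U V)"
  by (intro bfly_map.intro bfly_map_axioms.intro bfly t_map Res_hom affine_open)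

definition "LL U = bfly.L p (Sh X U) (bf U)"
definition "qL U = bfly.q p (Sh X U) (bf U)"
definition "emL U = bfly.em p (Sh X U) (bf U)"
definition "jL U = bfly.j p (Sh X U) (bf U)"
definition "phiL U = bfly.phi p (Sh X U) (bf U)"
definition "rL U V = bfly_map.ind p (Sh X U) (bf U) (Sh X V) (bf V) (rs U V)"

lemma qL_surjE:
  assumes "affine_open X U" "x \<in> carrier (LL U)"
  obtains e where "e \<in> carrier (bf U)" "x = qL U e"
  using bfly.q_surjE[OF bfly[OF assms(1)]] assms(2) unfolding LL_def qL_def by metis

lemma rL_qL: "affine_open X U \<Longrightarrow> affine_open X V \<Longrightarrow> V \<subseteq> U \<Longrightarrow> e \<in> carrier (bf U) \<Longrightarrow>
   rL U V (qL U e) = qL V (rs U V e)"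
  unfolding rL_def qL_def by (rule bfly_map.ind_q[OF bfly_map])

lemma LL: "local_lift X p LL rL emL jL"
proof (intro local_lift.intro local_lift_axioms.intro scheme_axioms prime)
  show "p_ext_surj p (LL U) (Sh X U) (emL U) (jL U)" if "affine_open X U" for U
    unfolding LL_def emL_def jL_def by (rule bfly.p_ext_surj[OF bfly[OF that]])
  show "rL U V \<in> ring_hom (LL U) (LL V)" if "affine_open X U" "affine_open X V" "V \<subseteq> U" for U V
    unfolding LL_def rL_def by (rule bfly_map.ind_hom[OF bfly_map[OF that]])
  show "rL U U x = x" if "affine_open X U" "x \<in> carrier (LL U)" for U x
    using that(2) by (rule qL_surjE[OF that(1)]) (simp add: rL_qL that(1) t_dq(3))
  show "emL V (rL U V x) = Res X U V (emL U x)"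
    if "affine_open X U" "affine_open X V" "V \<subseteq> U" "x \<in> carrier (LL U)" for U V x
    using bfly_map.em_ind[OF bfly_map[OF that(1-3)]] that(4) unfolding LL_def emL_def rL_def by blast
  show "jL V (Res X U V a) = rL U V (jL U a)"
    if "affine_open X U" "affine_open X V" "V \<subseteq> U" "a \<in> carrier (Sh X U)" for U V a
    using bfly_map.ind_j[OF bfly_map[OF that(1-3)] that(4)] unfolding jL_def rL_def by simp
  show "rL V W (rL U V x) = rL U W x"
    if H: "affine_open X U" "affine_open X V" "affine_open X W" "W \<subseteq> V" "V \<subseteq> U" "x \<in> carrier (LL U)" for U V W x
  proof -
    obtain e where e: "e \<in> carrier (bf U)" "x = qL U e" using H(6) by (rule qL_surjE[OF H(1)])
    have "rs U V e \<in> carrier (bf V)"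
      using t_map[OF H(1,2,5)] e(1) unfolding butterfly_map_def by (meson ring_hom_closed)
    moreover have "W \<subseteq> U" using H by blast
    ultimately show ?thesis using e H t_comp[OF H(1-5) e(1)] by (simp add: rL_qL)
  qed
qed

lemma phiL_hom: "affine_open X U \<Longrightarrow> phiL U \<in> ring_hom (LL U) (LL U)"
  unfolding phiL_def LL_def by (rule bfly.phi_hom[OF bfly])

lemma em_phiL: "affine_open X U \<Longrightarrow> x \<in> carrier (LL U) \<Longrightarrow> emL U (phiL U x) = emL U x [^]\<^bsub>Sh X U\<^esub> p"
  unfolding phiL_def LL_def emL_def by (rule bfly.em_phi[OF bfly])

lemma rL_phiL: "affine_open X U \<Longrightarrow> affine_open X V \<Longrightarrow> V \<subseteq> U \<Longrightarrow> x \<in> carrier (LL U) \<Longrightarrow>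
   rL U V (phiL U x) = phiL V (rL U V x)"
  unfolding phiL_def LL_def rL_def by (rule bfly_map.ind_phi[OF bfly_map])

sublocale LL: local_lift X p LL rL emL jL by (rule LL)

end

section \<open>The lifted scheme and its structure over $W_2(k)$\<close>

text \<open>Separatedness makes the affine sets closed under intersection, as the gluing of
  morphisms demands; smoothness provides the local presentations to be lifted.\<close>

locale triv_sm = triv p k X t
  for p :: nat and k :: "'k ring" and X :: "('x, 'r, 'k) scheme_over" and t :: "('x, 'r, 'k) trivialization" +
  assumes smooth: "smooth_over k X" and sep: "separated X"
begin

lemma aff_Int: "affine_open X U \<Longrightarrow> affine_open X V \<Longrightarrow> affine_open X (U \<inter> V)"
  using sep unfolding separated_def by blast

definition affs :: "'x set set" where "affs = {U. affine_open X U}"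

lemma affs_base: "is_base (Top X) affs"
  unfolding is_base_def affs_def
proof (intro conjI ballI allI impI; (elim conjE)?)
  show "op U" if "U \<in> {U. affine_open X U}" for U using affine_open that by blast
  show "\<exists>U\<in>{U. affine_open X U}. x \<in> U \<and> U \<subseteq> V" if "op V" "x \<in> V" for V x
    using affine_nbhd[OF that] by (metis mem_Collect_eq)
qed

lemma glued_indep: "Sh (LL.glued s) U = Sh (LL.glued s') U" "Res (LL.glued s) U V x = Res (LL.glued s') U V x"
  "Top (LL.glued s) = Top X"
  by (simp_all add: LL.glued_def)

text \<open>The structure map takes values in global sections of the glued sheaf, so the sheaf must
  be available before it. A placeholder is inserted first, and \<open>glued_indep\<close> shows that
  the sheaf does not depend on it.\<close>

abbreviation "Z0 \<equiv> LL.glued (\<lambda>_::'k \<times> 'k. undefined)"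

sublocale G0: lift_space X p Z0 LL.emG LL.jG by (rule LL.glued_lift_space)

definition strZ :: "'x set \<Rightarrow> 'k \<times> 'k \<Rightarrow> 'r \<times> 'r" where
  "strZ U = wstr (Sh Z0 U) (LL.emG U) (LL.jG U) (Str_on X U)"

lemma strZ_hom: "affine_open X U \<Longrightarrow> strZ U \<in> ring_hom (witt2 p k) (Sh Z0 U)"
  unfolding strZ_def by (rule wstr_hom[OF G0.ext_surj Str_on_hom[OF affine_open]])

lemma strZ_Res:
  assumes U: "affine_open X U" "affine_open X V" "V \<subseteq> U" and a: "a \<in> carrier (witt2 p k)"
  shows "Res Z0 U V (strZ U a) = strZ V a"
  unfolding strZ_def
proof (rule wstr_nat[OF G0.ext_surj[OF U(1)] G0.ext_surj[OF U(2)] Str_on_hom[OF affine_open[OF U(1)]] _ _ _ _ a, where h="Res X U V"])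
  note o = affine_open[OF U(1)] affine_open[OF U(2)]
  show "Res Z0 U V \<in> ring_hom (Sh Z0 U) (Sh Z0 V)" using G0.Z.Res_hom o U(3) by simp
  show "LL.emG V (Res Z0 U V s) = Res X U V (LL.emG U s)" if "s \<in> carrier (Sh Z0 U)" for s
    by (rule G0.em_Res[OF o U(3) that])
  show "Res Z0 U V (LL.jG U b) = LL.jG V (Res X U V b)" if "b \<in> carrier (Sh X U)" for b
    by (rule G0.j_Res[OF o U(3) that, symmetric])
  show "Res X U V (Str_on X U c) = Str_on X V c" if "c \<in> carrier k" for c
    by (rule Res_Str_on[OF o U(3) that])
qed

definition str_section :: "'k \<times> 'k \<Rightarrow> 'r \<times> 'r" where
  "str_section a = (THE s. s \<in> carrier (Sh Z0 (topspace (Top X))) \<and>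
     (\<forall>U\<in>affs. Res Z0 (topspace (Top X)) U s = strZ U a))"

text \<open>The local structure maps are built from \<open>theta\<close> and the given structure of
  \<open>X\<close>, hence are compatible with restriction; their values glue over the affine
  sets.\<close>

lemma str_section:
  assumes a: "a \<in> carrier (witt2 p k)"
  shows "str_section a \<in> carrier (Sh Z0 (topspace (Top X)))"
    "affine_open X U \<Longrightarrow> Res Z0 (topspace (Top X)) U (str_section a) = strZ U a"
proof -
  have "\<exists>!s. s \<in> carrier (Sh Z0 (topspace (Top X))) \<and> (\<forall>U\<in>affs. Res Z0 (topspace (Top X)) U s = strZ U a)"
  proof (rule G0.Z.base_glue)
    show "is_base (Top Z0) affs" using affs_base by (simp add: glued_indep)
    show "openin (Top Z0) (topspace (Top X))" by simp
    show "W \<in> affs \<and> W \<subseteq> topspace (Top X)" if "W \<in> affs" for W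
      using that is_base_open[OF affs_base that] openin_subset by blast
    show "\<exists>W\<in>affs. x \<in> W" if "x \<in> topspace (Top X)" for x
      using is_baseE[OF affs_base openin_topspace that] by metis
    show "strZ W a \<in> carrier (Sh Z0 W)" if "W \<in> affs" for W
      using ring_hom_closed[OF strZ_hom a] that by (simp add: affs_def)
    show "Res Z0 W W' (strZ W a) = strZ W' a" if "W \<in> affs" "W' \<in> affs" "W' \<subseteq> W" for W W'
      using strZ_Res a that by (simp add: affs_def)
  qed
  from theI'[OF this, folded str_section_def]
  have *: "str_section a \<in> carrier (Sh Z0 (topspace (Top X))) \<and> (\<forall>U\<in>affs. Res Z0 (topspace (Top X)) U (str_section a) = strZ U a)"
    .
  then show "str_section a \<in> carrier (Sh Z0 (topspace (Top X)))" by (rule conjunct1)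
  show "Res Z0 (topspace (Top X)) U (str_section a) = strZ U a" if "affine_open X U"
    using bspec[OF conjunct2[OF *], of U] that by (simp add: affs_def)
qed

definition Z :: "('x, 'r \<times> 'r, 'k \<times> 'k) scheme_over" where "Z = LL.glued str_section"

lemma Z_simps: "Sh Z U = Sh Z0 U" "Res Z U V x = Res Z0 U V x" "Top Z = Top X" "Str Z = str_section"
  by (simp_all add: Z_def glued_indep[of str_section] LL.glued_Str)

sublocale G: lift_space X p Z LL.emG LL.jG unfolding Z_def by (rule LL.glued_lift_space)

lemma Str_on_Z: "affine_open X U \<Longrightarrow> a \<in> carrier (witt2 p k) \<Longrightarrow>
  Str_on Z U a = wstr (Sh Z U) (LL.emG U) (LL.jG U) (Str_on X U) a"
  using str_section(2)[of a U] by (simp add: Str_on_def Z_simps strZ_def del: carrier_witt2)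

lemma Z_sections_eqI:
  assumes "op V" "s \<in> carrier (Sh Z V)" "s' \<in> carrier (Sh Z V)"
    "\<And>U. affine_open X U \<Longrightarrow> U \<subseteq> V \<Longrightarrow> Res Z V U s = Res Z V U s'"
  shows "s = s'"
proof (rule G.Z.sections_eqI[OF _ assms(2,3)])
  show "openin (Top Z) V" using assms(1) by simp
  fix x assume "x \<in> V"
  then obtain U where U: "affine_open X U" "x \<in> U" "U \<subseteq> V" using affine_nbhd[OF assms(1)] by blast
  then show "\<exists>U. openin (Top Z) U \<and> x \<in> U \<and> U \<subseteq> V \<and> Res Z V U s = Res Z V U s'"
    using assms(4)[OF U(1,3)] affine_open[OF U(1)] by (intro exI[of _ U]) simp
qed

lemma X_sections_eqI:
  assumes "op V" "s \<in> carrier (Sh X V)" "s' \<in> carrier (Sh X V)"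
    "\<And>U. affine_open X U \<Longrightarrow> U \<subseteq> V \<Longrightarrow> Res X V U s = Res X V U s'"
  shows "s = s'"
proof (rule sections_eqI[OF assms(1-3)])
  fix x assume "x \<in> V"
  then obtain U where U: "affine_open X U" "x \<in> U" "U \<subseteq> V" using affine_nbhd[OF assms(1)] by blast
  then show "\<exists>U. op U \<and> x \<in> U \<and> U \<subseteq> V \<and> Res X V U s = Res X V U s'"
    using assms(4)[OF U(1,3)] affine_open[OF U(1)] by (intro exI[of _ U]) simp
qed

lemma Str_Z_hom: "Str Z \<in> ring_hom (witt2 p k) (Sh Z (topspace (Top Z)))"
proof -
  let ?T = "topspace (Top X)"
  interpret T: cring "Sh Z ?T" using G.Z.Sh_cring[of ?T] by simp
  have oT: "op ?T" by simp
  have cl: "str_section a \<in> carrier (Sh Z ?T)" if "a \<in> carrier (witt2 p k)" for a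
    using str_section(1)[OF that] by (simp add: Z_simps)
  have rh: "Res Z ?T U \<in> ring_hom (Sh Z ?T) (Sh Z U)" "strZ U \<in> ring_hom (witt2 p k) (Sh Z U)"
    "\<And>a. a \<in> carrier (witt2 p k) \<Longrightarrow> Res Z ?T U (str_section a) = strZ U a" if U: "affine_open X U" for U
  proof -
    show "Res Z ?T U \<in> ring_hom (Sh Z ?T) (Sh Z U)"
      by (rule G.Z.Res_hom) (use affine_open[OF U] openin_subset in auto)
    show "strZ U \<in> ring_hom (witt2 p k) (Sh Z U)" using strZ_hom[OF U] by (simp add: Z_simps)
    show "Res Z ?T U (str_section a) = strZ U a" if "a \<in> carrier (witt2 p k)" for a
      using str_section(2)[OF that U] by (simp add: Z_simps)
  qed
  have "str_section \<in> ring_hom (witt2 p k) (Sh Z ?T)"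
  proof (rule ring_hom_memI)
    fix a assume a: "a \<in> carrier (witt2 p k)"
    show "str_section a \<in> carrier (Sh Z ?T)" by (rule cl[OF a])
    fix b assume b: "b \<in> carrier (witt2 p k)"
    show "str_section (a \<otimes>\<^bsub>witt2 p k\<^esub> b) = str_section a \<otimes>\<^bsub>Sh Z ?T\<^esub> str_section b"
    proof (rule Z_sections_eqI[OF oT cl[OF W.m_closed[OF a b]] T.m_closed[OF cl[OF a] cl[OF b]]])
      fix U assume U: "affine_open X U"
      show "Res Z ?T U (str_section (a \<otimes>\<^bsub>witt2 p k\<^esub> b)) = Res Z ?T U (str_section a \<otimes>\<^bsub>Sh Z ?T\<^esub> str_section b)"
        using ring_hom_mult[OF rh(1)[OF U] cl[OF a] cl[OF b]] ring_hom_mult[OF rh(2)[OF U] a b]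
          rh(3)[OF U a] rh(3)[OF U b] rh(3)[OF U W.m_closed[OF a b]] by simp
    qed
    show "str_section (a \<oplus>\<^bsub>witt2 p k\<^esub> b) = str_section a \<oplus>\<^bsub>Sh Z ?T\<^esub> str_section b"
    proof (rule Z_sections_eqI[OF oT cl[OF W.a_closed[OF a b]] T.a_closed[OF cl[OF a] cl[OF b]]])
      fix U assume U: "affine_open X U"
      show "Res Z ?T U (str_section (a \<oplus>\<^bsub>witt2 p k\<^esub> b)) = Res Z ?T U (str_section a \<oplus>\<^bsub>Sh Z ?T\<^esub> str_section b)"
        using ring_hom_add[OF rh(1)[OF U] cl[OF a] cl[OF b]] ring_hom_add[OF rh(2)[OF U] a b]
          rh(3)[OF U a] rh(3)[OF U b] rh(3)[OF U W.a_closed[OF a b]] by simp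
    qed
  next
    show "str_section \<one>\<^bsub>witt2 p k\<^esub> = \<one>\<^bsub>Sh Z ?T\<^esub>"
    proof (rule Z_sections_eqI[OF oT cl[OF W.one_closed] T.one_closed])
      fix U assume U: "affine_open X U"
      show "Res Z ?T U (str_section \<one>\<^bsub>witt2 p k\<^esub>) = Res Z ?T U \<one>\<^bsub>Sh Z ?T\<^esub>"
        unfolding rh(3)[OF U W.one_closed] ring_hom_one[OF rh(1)[OF U]] ring_hom_one[OF rh(2)[OF U]] ..
    qed
  qed
  then show ?thesis by (simp add: Z_simps)
qed

lemma Z_smooth: "smooth_over (witt2 p k) Z"
  unfolding smooth_over_def is_scheme_over_def
proof (intro conjI ballI G.lift_is_scheme Str_Z_hom)
  fix x assume "x \<in> topspace (Top Z)"
  then obtain U where U: "affine_open X U" "x \<in> U" "standard_smooth k (Sh X U) (Str_on X U)"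
    using smooth unfolding smooth_over_def by (auto simp: Z_simps)
  have "standard_smooth (witt2 p k) (Sh Z U) (Str_on Z U)"
  proof (rule smooth_lift_W2[OF G.ext_surj[OF U(1)] Str_on_hom[OF affine_open[OF U(1)]] U(3)])
    show "Str_on Z U \<in> ring_hom (witt2 p k) (Sh Z U)"
    proof -
      have "Res Z (topspace (Top Z)) U \<circ> Str Z \<in> ring_hom (witt2 p k) (Sh Z U)"
        by (rule ring_hom_trans[OF Str_Z_hom G.Z.Res_hom])
          (use affine_open[OF U(1)] openin_subset in \<open>auto simp: Z_simps(3)\<close>)
      then show ?thesis by (simp add: comp_def Str_on_def[abs_def])
    qed
    show "LL.emG U (Str_on Z U a) = Str_on X U (fst a)" if "a \<in> carrier (witt2 p k)" for a
      unfolding Str_on_Z[OF U(1) that] by (rule em_wstr[OF G.ext_surj[OF U(1)] Str_on_hom[OF affine_open[OF U(1)]] that])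
  qed
  then show "\<exists>U. affine_open Z U \<and> x \<in> U \<and> standard_smooth (witt2 p k) (Sh Z U) (Str_on Z U)"
    using G.affine_lift U by blast
qed

end

section \<open>The lift of Frobenius and the resulting Frobenius lifting\<close>

context triv_sm
begin

lemma preim_id: "op V \<Longrightarrow> pt f = (\<lambda>x. x) \<Longrightarrow> Top Y = Top X \<Longrightarrow> preim Y f V = V"
  using openin_subset[of "Top X" V] by (auto simp: preim_def)

definition gphi :: "'x set \<Rightarrow> 'r \<times> 'r \<Rightarrow> 'r \<times> 'r" where
  "gphi U = descend (LL U) (LL.qG U) (\<lambda>x. LL.qG U (phiL U x))"

lemma qGZ:
  assumes U: "affine_open X U"
  shows "LL.qG U \<in> ring_hom (LL U) (Sh Z U)" "LL.qG U ` carrier (LL U) = carrier (Sh Z U)"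
    "x \<in> carrier (LL U) \<Longrightarrow> LL.emG U (LL.qG U x) = emL U x"
    "a \<in> carrier (Sh X U) \<Longrightarrow> LL.qG U (jL U a) = LL.jG U a"
    "affine_open X V \<Longrightarrow> V \<subseteq> U \<Longrightarrow> x \<in> carrier (LL U) \<Longrightarrow> Res Z U V (LL.qG U x) = LL.qG V (rL U V x)"
  unfolding Z_def by (rule LL.qG[OF U]; assumption)+

lemma qGZ_surjE:
  assumes "affine_open X U" "z \<in> carrier (Sh Z U)"
  obtains x where "x \<in> carrier (LL U)" "z = LL.qG U x"
  using assms(2) unfolding qGZ(2)[OF assms(1), symmetric] by blast

lemma LL_cring: "affine_open X U \<Longrightarrow> cring (LL U)"
  using p_ext.S[OF p_ext_surj.axioms(1)[OF LL.ext]] .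

lemma qG_eqD: "affine_open X U \<Longrightarrow> x \<in> carrier (LL U) \<Longrightarrow> y \<in> carrier (LL U) \<Longrightarrow> LL.qG U x = LL.qG U y \<Longrightarrow> x = y"
  using inj_onD[OF LL.qG_inj] by blast

lemma gphi_q: "affine_open X U \<Longrightarrow> x \<in> carrier (LL U) \<Longrightarrow> gphi U (LL.qG U x) = LL.qG U (phiL U x)"
  unfolding gphi_def by (rule descend_eq) (auto dest: qG_eqD)

lemma gphi_hom: "affine_open X U \<Longrightarrow> gphi U \<in> ring_hom (Sh Z U) (Sh Z U)"
  unfolding gphi_def
proof (rule descend_hom[OF LL_cring qGZ(1,2)])
  assume U: "affine_open X U"
  have "LL.qG U \<circ> phiL U \<in> ring_hom (LL U) (Sh Z U)" by (rule ring_hom_trans[OF phiL_hom[OF U] qGZ(1)[OF U]])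
  then show "(\<lambda>x. LL.qG U (phiL U x)) \<in> ring_hom (LL U) (Sh Z U)" by (simp add: comp_def)
qed (auto dest: qG_eqD)

lemma em_gphi:
  assumes U: "affine_open X U" and z: "z \<in> carrier (Sh Z U)"
  shows "LL.emG U (gphi U z) = LL.emG U z [^]\<^bsub>Sh X U\<^esub> p"
proof -
  obtain x where x: "x \<in> carrier (LL U)" "z = LL.qG U x" using qGZ_surjE[OF U z] .
  show ?thesis
    unfolding x(2) gphi_q[OF U x(1)] qGZ(3)[OF U x(1)] qGZ(3)[OF U ring_hom_closed[OF phiL_hom[OF U] x(1)]]
    by (rule em_phiL[OF U x(1)])
qed

lemma gphi_Res:
  assumes U: "affine_open X U" "affine_open X V" "V \<subseteq> U" and z: "z \<in> carrier (Sh Z U)"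
  shows "Res Z U V (gphi U z) = gphi V (Res Z U V z)"
proof -
  obtain x where x: "x \<in> carrier (LL U)" "z = LL.qG U x" using qGZ_surjE U(1) z .
  have rx: "rL U V x \<in> carrier (LL V)" using LL.r_closed[OF U x(1)] .
  show ?thesis unfolding x(2) gphi_q[OF U(1) x(1)] qGZ(5)[OF U x(1)] gphi_q[OF U(2) rx]
    using qGZ(5)[OF U ring_hom_closed[OF phiL_hom[OF U(1)] x(1)]] rL_phiL[OF U x(1)] by simp
qed

lemma Z_base: "is_base (Top Z) affs" using affs_base by (simp add: Z_simps)

lemma germ_unit_pow_iff:
  assumes "op U" "x \<in> U" "s \<in> carrier (Sh X U)" "germ_unit X x U (s [^]\<^bsub>Sh X U\<^esub> p)"
  shows "germ_unit X x U s"
proof -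
  interpret U: cring "Sh X U" using Sh_cring assms(1) .
  obtain n where n: "p = Suc n" using prime_gt_0_nat[OF prime] by (metis gr0_implies_Suc)
  show ?thesis using assms(4) germ_unit_mult[OF assms(1,2) U.nat_pow_closed[OF assms(3)] assms(3), of n]
    unfolding n by simp
qed

text \<open>Gluing gives the existence of such a morphism; one of them is selected. Its prescribed
  values on affine sets, transported from the lifts of Frobenius on the quotients of butterflies,
  are all that is used afterwards.\<close>

definition PhiZ :: "('x, 'r \<times> 'r, 'x, 'r \<times> 'r) mor" where
  "PhiZ = (SOME f. is_mor Z Z f \<and> pt f = (\<lambda>x. x) \<and> (\<forall>U s. affine_open X U \<and> s \<in> carrier (Sh Z U) \<longrightarrow> sec f U s = gphi U s))"

lemma PhiZ: "is_mor Z Z PhiZ" "pt PhiZ = (\<lambda>x. x)"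
    "affine_open X U \<Longrightarrow> s \<in> carrier (Sh Z U) \<Longrightarrow> sec PhiZ U s = gphi U s"
proof -
  obtain f :: "('x, 'r \<times> 'r, 'x, 'r \<times> 'r) mor" where f: "is_mor Z Z f" "pt f = (\<lambda>x. x)"
    and sf: "\<And>U U' s. U \<in> affs \<Longrightarrow> U' \<in> affs \<Longrightarrow> (\<lambda>x. x) ` U' \<subseteq> U \<Longrightarrow> s \<in> carrier (Sh Z U) \<Longrightarrow>
      Res Z (preim Z f U) U' (sec f U s) = Res Z U U' (gphi U s)"
  proof (rule glue_mor[OF G.rsZ G.rsZ _ Z_base Z_base, of "\<lambda>x. x" "\<lambda>U U' s. Res Z U U' (gphi U s)"])
    show "continuous_map (Top Z) (Top Z) (\<lambda>x. x)" by simp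
    show "U \<inter> V \<in> affs" if "U \<in> affs" "V \<in> affs" for U V using that aff_Int by (simp add: affs_def)
    fix U U' assume UU: "U \<in> affs" "U' \<in> affs" "(\<lambda>x. x) ` U' \<subseteq> U"
    then have U: "affine_open X U" "affine_open X U'" "U' \<subseteq> U" by (auto simp: affs_def)
    have oU: "openin (Top Z) U" "openin (Top Z) U'" using affine_open U by auto
    have "Res Z U U' \<circ> gphi U \<in> ring_hom (Sh Z U) (Sh Z U')"
      by (rule ring_hom_trans[OF gphi_hom[OF U(1)] G.Z.Res_hom[OF oU U(3)]])
    then show "(\<lambda>s. Res Z U U' (gphi U s)) \<in> ring_hom (Sh Z U) (Sh Z U')" by (simp add: comp_def)
    { fix V V' s assume VV: "V \<in> affs" "V' \<in> affs" "(\<lambda>x. x) ` V' \<subseteq> V" "V \<subseteq> U" "V' \<subseteq> U'" and s: "s \<in> carrier (Sh Z U)"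
      then have V: "affine_open X V" "affine_open X V'" "V' \<subseteq> V" by (auto simp: affs_def)
      have oV: "openin (Top Z) V" "openin (Top Z) V'" using affine_open V by auto
      have gs: "gphi U s \<in> carrier (Sh Z U)" using ring_hom_closed[OF gphi_hom[OF U(1)] s] .
      show "Res Z V V' (gphi V (Res Z U V s)) = Res Z U' V' (Res Z U U' (gphi U s))"
        unfolding gphi_Res[OF U(1) V(1) VV(4) s, symmetric]
          G.Z.Res_comp[OF oU(1) oV(1,2) V(3) VV(4) gs] G.Z.Res_comp[OF oU oV(2) VV(5) U(3) gs] .. }
    \<comment> \<open>Locality: units of germs are detected after reduction, where
      \<open>gphi\<close> is the $p$-th power, and if $s^p$ is a unit then so is $s$.\<close>
    fix x s assume x: "x \<in> U'" and s: "s \<in> carrier (Sh Z U)" and gu: "germ_unit Z x U' (Res Z U U' (gphi U s))"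
    have xU: "x \<in> U" and oUX: "op U" using x U affine_open by auto
    have gs: "gphi U s \<in> carrier (Sh Z U)" using ring_hom_closed[OF gphi_hom[OF U(1)] s] .
    have "germ_unit Z x U (gphi U s)" using gu G.Z.germ_unit_Res[OF oU U(3) x gs] by simp
    then have "germ_unit X x U (LL.emG U s [^]\<^bsub>Sh X U\<^esub> p)"
      using G.germ_unit_em[OF oUX xU gs] em_gphi[OF U(1) s] by simp
    then have "germ_unit X x U (LL.emG U s)"
      using germ_unit_pow_iff[OF oUX xU G.em_closed[OF oUX s]] by simp
    then show "germ_unit Z x U s" using G.germ_unit_em[OF oUX xU s] by simp
  qed blast
  have "sec f U s = gphi U s" if U: "affine_open X U" and s: "s \<in> carrier (Sh Z U)" for U s
  proof -
    have pre: "preim Z f U = U" by (rule preim_id[OF affine_open[OF U] f(2) G.Top_Z])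
    have oU: "openin (Top Z) U" using affine_open[OF U] by simp
    have fc: "sec f U s \<in> carrier (Sh Z U)" using sec_closed[OF f(1) oU s] by (simp add: pre)
    show ?thesis
      using sf[of U U s] U s G.Z.Res_id[OF oU fc] G.Z.Res_id[OF oU ring_hom_closed[OF gphi_hom[OF U] s]]
      by (simp add: affs_def pre)
  qed
  then have "\<exists>f. is_mor Z Z f \<and> pt f = (\<lambda>x. x) \<and> (\<forall>U s. affine_open X U \<and> s \<in> carrier (Sh Z U) \<longrightarrow> sec f U s = gphi U s)"
    using f by blast
  from someI_ex[OF this, folded PhiZ_def] show "is_mor Z Z PhiZ" "pt PhiZ = (\<lambda>x. x)"
    "affine_open X U \<Longrightarrow> s \<in> carrier (Sh Z U) \<Longrightarrow> sec PhiZ U s = gphi U s" by blast+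
qed

definition EmbZ :: "('x, 'r, 'x, 'r \<times> 'r) mor" where
  "EmbZ = \<lparr>pt = (\<lambda>x. x), sec = LL.emG\<rparr>"

lemma EmbZ_simps [simp]: "pt EmbZ = (\<lambda>x. x)" "sec EmbZ = LL.emG" by (simp_all add: EmbZ_def)

lemma preim_EmbZ: "op V \<Longrightarrow> preim X EmbZ V = V" by (rule preim_id) simp_all

lemma preim_PhiZ: "op V \<Longrightarrow> preim Z PhiZ V = V" by (rule preim_id) (simp_all add: PhiZ(2) Z_simps)

lemma EmbZ_mor: "is_mor X Z EmbZ"
proof (rule is_morI; (unfold G.op_Z)?)
  show "continuous_map (Top X) (Top Z) (pt EmbZ)" by (simp add: Z_simps)
  show "sec EmbZ V \<in> ring_hom (Sh Z V) (Sh X (preim X EmbZ V))" if "op V" for V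
    using G.em_hom[OF that] by (simp add: preim_EmbZ that)
  show "sec EmbZ V' (Res Z V V' s) = Res X (preim X EmbZ V) (preim X EmbZ V') (sec EmbZ V s)"
    if "op V" "op V'" "V' \<subseteq> V" "s \<in> carrier (Sh Z V)" for V V' s
    using G.em_Res[OF that] by (simp add: preim_EmbZ that)
  show "germ_unit Z (pt EmbZ x) V s"
    if "op V" "x \<in> preim X EmbZ V" "s \<in> carrier (Sh Z V)" "germ_unit X x (preim X EmbZ V) (sec EmbZ V s)" for V x s
    using that G.germ_unit_em[OF that(1) _ that(3), of x] by (simp add: preim_EmbZ)
qed

lemma Res_Str_Z: "affine_open X U \<Longrightarrow> a \<in> carrier (witt2 p k) \<Longrightarrow> Res Z (topspace (Top X)) U (Str Z a) = Str_on Z U a"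
  by (simp add: Str_on_def Z_simps(3))

lemma EmbZ_mor_over: "is_mor_over (witt2 p k) fst X Z EmbZ"
  unfolding is_mor_over_def
proof (intro conjI EmbZ_mor ballI)
  fix a assume a: "a \<in> carrier (witt2 p k)"
  let ?T = "topspace (Top X)"
  have oT: "op ?T" by simp
  have Sa: "Str Z a \<in> carrier (Sh Z ?T)" using ring_hom_closed[OF Str_Z_hom a] by (simp add: Z_simps(3))
  have "LL.emG ?T (Str Z a) = Str X (fst a)"
  proof (rule X_sections_eqI[OF oT G.em_closed[OF oT Sa]])
    show "Str X (fst a) \<in> carrier (Sh X ?T)" using ring_hom_closed[OF str] a by auto
    fix U assume U: "affine_open X U" "U \<subseteq> ?T"
    have "Res X ?T U (LL.emG ?T (Str Z a)) = LL.emG U (Str_on Z U a)"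
      using G.em_Res[OF oT affine_open[OF U(1)] U(2) Sa] Res_Str_Z[OF U(1) a] by simp
    also have "\<dots> = Str_on X U (fst a)"
      unfolding Str_on_Z[OF U(1) a] by (rule em_wstr[OF G.ext_surj[OF U(1)] Str_on_hom[OF affine_open[OF U(1)]] a])
    finally show "Res X ?T U (LL.emG ?T (Str Z a)) = Res X ?T U (Str X (fst a))" by (simp add: Str_on_def)
  qed
  then show "sec EmbZ (topspace (Top Z)) (Str Z a) = Str X (fst a)" by (simp add: Z_simps(3))
qed

lemma PhiZ_mor_over: "is_mor_over (witt2 p k) F Z Z PhiZ"
  unfolding is_mor_over_def
proof (intro conjI PhiZ(1) ballI)
  fix a assume a: "a \<in> carrier (witt2 p k)"
  let ?T = "topspace (Top X)"
  have oT: "openin (Top Z) ?T" "op ?T" by simp_all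
  have Fa: "F a \<in> carrier (witt2 p k)" using ring_hom_closed[OF F_hom a] .
  have Sc: "Str Z b \<in> carrier (Sh Z ?T)" if "b \<in> carrier (witt2 p k)" for b
    using ring_hom_closed[OF Str_Z_hom that] by (simp add: Z_simps(3))
  have pT: "preim Z PhiZ ?T = ?T" by (rule preim_PhiZ) simp
  have "sec PhiZ ?T (Str Z a) = Str Z (F a)"
  proof (rule Z_sections_eqI[OF oT(2) _ Sc[OF Fa]])
    show "sec PhiZ ?T (Str Z a) \<in> carrier (Sh Z ?T)" using sec_closed[OF PhiZ(1) oT(1) Sc[OF a]] by (simp add: pT)
    fix U assume U: "affine_open X U" "U \<subseteq> ?T"
    have oU: "openin (Top Z) U" using affine_open[OF U(1)] by simp
    have SU: "Str_on Z U a \<in> carrier (Sh Z U)"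
      using G.Z.Res_closed[OF oT(1) oU U(2) Sc[OF a]] Res_Str_Z[OF U(1) a] by simp
    have "Res Z ?T U (sec PhiZ ?T (Str Z a)) = sec PhiZ U (Res Z ?T U (Str Z a))"
      using is_morD(3)[OF PhiZ(1) oT(1) oU U(2) Sc[OF a]] by (simp add: pT preim_PhiZ[OF affine_open[OF U(1)]])
    also have "\<dots> = gphi U (Str_on Z U a)"
      unfolding Res_Str_Z[OF U(1) a] by (rule PhiZ(3)[OF U(1) SU])
    also have "\<dots> = Str_on Z U (F a)"
      unfolding Str_on_Z[OF U(1) a] Str_on_Z[OF U(1) Fa]
      by (rule wstr_phi[OF G.ext_surj[OF U(1)] Str_on_hom[OF affine_open[OF U(1)]] a gphi_hom[OF U(1)] em_gphi[OF U(1)]])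
    finally show "Res Z ?T U (sec PhiZ ?T (Str Z a)) = Res Z ?T U (Str Z (F a))"
      using Res_Str_Z[OF U(1) Fa] by simp
  qed
  then show "sec PhiZ (topspace (Top Z)) (Str Z a) = Str Z (F a)" by (simp add: Z_simps(3))
qed

lemma PhiZ_frob: "mor_eq X Z (comp_mor Z PhiZ EmbZ) (comp_mor X EmbZ (frob_mor p X))"
  unfolding mor_eq_def
proof (intro conjI ballI allI impI)
  show "pt (comp_mor Z PhiZ EmbZ) x = pt (comp_mor X EmbZ (frob_mor p X)) x" for x
    by (simp add: PhiZ(2) frob_mor_def)
  fix V s assume "openin (Top Z) V" and s: "s \<in> carrier (Sh Z V)"
  then have V: "op V" "openin (Top Z) V" by simp_all
  interpret V: cring "Sh X V" using Sh_cring V(1) .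
  have ps: "sec PhiZ V s \<in> carrier (Sh Z V)" using sec_closed[OF PhiZ(1) V(2) s] by (simp add: preim_PhiZ[OF V(1)])
  have es: "LL.emG V s \<in> carrier (Sh X V)" by (rule G.em_closed[OF V(1) s])
  have "LL.emG V (sec PhiZ V s) = LL.emG V s [^]\<^bsub>Sh X V\<^esub> p"
  proof (rule X_sections_eqI[OF V(1) G.em_closed[OF V(1) ps] V.nat_pow_closed[OF es]])
    fix U assume U: "affine_open X U" "U \<subseteq> V"
    have oU: "op U" "openin (Top Z) U" using affine_open[OF U(1)] by simp_all
    interpret h: ring_hom_cring "Sh X V" "Sh X U" "Res X V U" by (rule Res_ring_hom[OF V(1) oU(1) U(2)])
    have rs: "Res Z V U s \<in> carrier (Sh Z U)" by (rule G.Z.Res_closed[OF V(2) oU(2) U(2) s])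
    have "Res X V U (LL.emG V (sec PhiZ V s)) = LL.emG U (Res Z V U (sec PhiZ V s))"
      by (rule G.em_Res[OF V(1) oU(1) U(2) ps, symmetric])
    also have "Res Z V U (sec PhiZ V s) = sec PhiZ U (Res Z V U s)"
      using is_morD(3)[OF PhiZ(1) V(2) oU(2) U(2) s] by (simp add: preim_PhiZ V(1) oU(1))
    also have "LL.emG U \<dots> = LL.emG U (Res Z V U s) [^]\<^bsub>Sh X U\<^esub> p"
      using PhiZ(3)[OF U(1) rs] em_gphi[OF U(1) rs] by simp
    also have "\<dots> = Res X V U (LL.emG V s [^]\<^bsub>Sh X V\<^esub> p)"
      using G.em_Res[OF V(1) oU(1) U(2) s] es by simp
    finally show "Res X V U (LL.emG V (sec PhiZ V s)) = Res X V U (LL.emG V s [^]\<^bsub>Sh X V\<^esub> p)" .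
  qed
  then show "sec (comp_mor Z PhiZ EmbZ) V s = sec (comp_mor X EmbZ (frob_mor p X)) V s"
    by (simp add: preim_PhiZ[OF V(1)] preim_EmbZ[OF V(1)] frob_mor_def)
qed

definition frobenius_lifting :: "('x, 'r, 'k) frob_lift" where "frobenius_lifting = \<lparr>Lift = Z, Emb = EmbZ, Phi = PhiZ\<rparr>"

lemma frobenius_lifting_simps [simp]: "Lift frobenius_lifting = Z" "Emb frobenius_lifting = EmbZ" "Phi frobenius_lifting = PhiZ" by (simp_all add: frobenius_lifting_def)

text \<open>The set \<open>V\<close> runs over affine open sets of the lift, so surjectivity is
  taken from \<open>em_surj_affine_lift\<close>. It also turns the kernel, which is the image of
  \<open>jG\<close>, into the multiples of $p$.\<close>

lemma frobenius_lifting_frob_lifts: "frobenius_lifting \<in> frob_lifts p k X"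
  unfolding frob_lifts_def mem_Collect_eq frobenius_lifting_simps
proof (intro conjI Z_smooth EmbZ_mor_over PhiZ_mor_over PhiZ_frob allI impI)
  show "homeomorphic_map (Top X) (Top Z) (pt EmbZ)"
    using homeomorphic_map_id[of "Top X" "Top Z"] by (simp add: Z_simps(3) id_def)
  fix V assume V: "affine_open Z V"
  then have oV: "op V" using G.Z.affine_open by simp
  interpret V: p_ext p "Sh Z V" "Sh X V" "LL.emG V" "LL.jG V" using G.ext oV .
  have surj: "LL.emG V ` carrier (Sh Z V) = carrier (Sh X V)" by (rule G.em_surj_affine_lift[OF V])
  then show "sec EmbZ V ` carrier (Sh Z V) = carrier (Sh X (preim X EmbZ V))"
    by (simp add: preim_EmbZ[OF oV])
  have "{s \<in> carrier (Sh Z V). LL.emG V s = \<zero>\<^bsub>Sh X V\<^esub>} = (\<lambda>s. add_pow (Sh Z V) p s) ` carrier (Sh Z V)"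
  proof (intro equalityI subsetI)
    fix s assume s: "s \<in> {s \<in> carrier (Sh Z V). LL.emG V s = \<zero>\<^bsub>Sh X V\<^esub>}"
    then obtain a where a: "a \<in> carrier (Sh X V)" "s = LL.jG V a" using V.ker by blast
    from a(1) obtain z where "z \<in> carrier (Sh Z V)" "a = LL.emG V z" unfolding surj[symmetric] by (rule imageE)
    then show "s \<in> (\<lambda>s. add_pow (Sh Z V) p s) ` carrier (Sh Z V)" using a V.j_em by auto
  next
    fix s assume "s \<in> (\<lambda>s. add_pow (Sh Z V) p s) ` carrier (Sh Z V)"
    then obtain z where z: "z \<in> carrier (Sh Z V)" "s = LL.jG V (LL.emG V z)" using V.j_em by auto
    then show "s \<in> {s \<in> carrier (Sh Z V). LL.emG V s = \<zero>\<^bsub>Sh X V\<^esub>}" by (simp add: V.j_closed V.em_j)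
  qed
  then show "{s \<in> carrier (Sh Z V). sec EmbZ V s = \<zero>\<^bsub>Sh X (preim X EmbZ V)\<^esub>} = (\<lambda>s. add_pow (Sh Z V) p s) ` carrier (Sh Z V)"
    by (simp add: preim_EmbZ[OF oV])
qed

end

section \<open>Functoriality\<close>

text \<open>The homotopies at diagonal pairs are maps of butterflies over pullback along
  \<open>h\<close>. Functoriality of the quotient construction then gives the local pieces of the
  lifted morphism.\<close>

locale triv_mor = T: triv_sm p k X t + T': triv_sm p k X' t'
  for p :: nat and k :: "'k ring" and X :: "('x, 'r, 'k) scheme_over" and t :: "('x, 'r, 'k) trivialization"
    and X' :: "('y, 's, 'k) scheme_over" and t' :: "('y, 's, 'k) trivialization" +
  fixes h :: "('y, 's, 'x, 'r) mor" and \<rho> :: "'x set \<Rightarrow> 'y set \<Rightarrow> 'r \<times> (nat \<Rightarrow> 'r) \<Rightarrow> 's \<times> (nat \<Rightarrow> 's)"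
  assumes h_over: "is_mor_over k (\<lambda>a. a) X' X h"
    and rho_map: "\<And>U U'. affine_open X U \<Longrightarrow> affine_open X' U' \<Longrightarrow> U' \<subseteq> preim X' h U \<Longrightarrow>
      butterfly_map (witt p k) (witt p (Sh X U)) (\<lambda>s. Res X' (preim X' h U) U' (sec h U s))
        (witt_map (\<lambda>s. Res X' (preim X' h U) U' (sec h U s))) (ht_bf t U U) (ht_bf t' U' U') (\<rho> U U')"
    and rho_nat: "\<And>U V U' V' e. affine_open X U \<Longrightarrow> affine_open X V \<Longrightarrow> affine_open X' U' \<Longrightarrow> affine_open X' V' \<Longrightarrow>
      V \<subseteq> U \<Longrightarrow> V' \<subseteq> U' \<Longrightarrow> U' \<subseteq> preim X' h U \<Longrightarrow> V' \<subseteq> preim X' h V \<Longrightarrow> e \<in> carrier (ht_bf t U U) \<Longrightarrow>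
      \<rho> V V' (ht_res t U U V V e) = ht_res t' U' U' V' V' (\<rho> U U' e)"
begin

definition affine_pair :: "'x set \<Rightarrow> 'y set \<Rightarrow> bool" where
  "affine_pair U U' \<longleftrightarrow> affine_open X U \<and> affine_open X' U' \<and> U' \<subseteq> preim X' h U"

lemma affine_pairD:
  assumes "affine_pair U U'"
  shows "affine_open X U" "affine_open X' U'" "U' \<subseteq> preim X' h U" "openin (Top X) U" "openin (Top X') U'"
  using assms T.affine_open T'.affine_open unfolding affine_pair_def by auto

lemma h: "is_mor X' X h" using h_over by (simp add: is_mor_over_def)

lemma preim_h: "openin (Top X) V \<Longrightarrow> openin (Top X') (preim X' h V)"
  by (rule preim_open[OF h])

definition pull :: "'x set \<Rightarrow> 'y set \<Rightarrow> 'r \<Rightarrow> 's" where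
  "pull U U' s = Res X' (preim X' h U) U' (sec h U s)"

lemma pull_hom: "affine_pair U U' \<Longrightarrow> pull U U' \<in> ring_hom (Sh X U) (Sh X' U')"
proof -
  assume affine_pair: "affine_pair U U'"
  note o = affine_pairD[OF affine_pair]
  have "Res X' (preim X' h U) U' \<circ> sec h U \<in> ring_hom (Sh X U) (Sh X' U')"
    by (rule ring_hom_trans[OF is_morD(2)[OF h o(4)] T'.Res_hom[OF preim_h[OF o(4)] o(5,3)]])
  then show ?thesis by (simp add: comp_def pull_def[abs_def])
qed

lemma pull_loc:
  assumes U: "affine_pair U U'" and x: "x \<in> U'" and s: "s \<in> carrier (Sh X U)" and gu: "germ_unit X' x U' (pull U U' s)"
  shows "germ_unit X (pt h x) U s"
proof -
  note o = affine_pairD[OF U]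
  have "germ_unit X' x (preim X' h U) (sec h U s)"
    using gu T'.germ_unit_Res[OF preim_h[OF o(4)] o(5,3) x sec_closed[OF h o(4) s]] by (simp add: pull_def)
  moreover have "x \<in> preim X' h U" using x o(3) by blast
  ultimately show ?thesis using is_morD(4)[OF h o(4) _ s] by blast
qed

lemma pull_Str:
  assumes U: "affine_pair U U'" and c: "c \<in> carrier k"
  shows "pull U U' (Str_on X U c) = Str_on X' U' c"
proof -
  note o = affine_pairD[OF U]
  let ?T = "topspace (Top X)"
  have s: "Str X c \<in> carrier (Sh X ?T)" by (rule ring_hom_closed[OF T.str c])
  have oT: "openin (Top X) ?T" by simp
  have pT: "preim X' h ?T = topspace (Top X')" using pt_closed[OF h] by (auto simp: preim_def)
  have e: "sec h ?T (Str X c) = Str X' c" using h_over c by (simp add: is_mor_over_def)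
  have UT: "U \<subseteq> ?T" by (rule openin_subset[OF o(4)])
  have "pull U U' (Str_on X U c) = Res X' (preim X' h U) U' (Res X' (preim X' h ?T) (preim X' h U) (sec h ?T (Str X c)))"
    unfolding pull_def Str_on_def is_morD(3)[OF h oT o(4) UT s] ..
  also have "\<dots> = Res X' (preim X' h ?T) U' (sec h ?T (Str X c))"
    by (rule T'.Res_comp[OF preim_h[OF oT] preim_h[OF o(4)] o(5,3) preim_mono[OF UT] sec_closed[OF h oT s]])
  finally show ?thesis by (simp add: pT e Str_on_def)
qed

lemma bmap: "affine_pair U U' \<Longrightarrow> bfly_map p k (Sh X U) (Str_on X U) (ht_bf t U U)
    (Sh X' U') (Str_on X' U') (ht_bf t' U' U') (pull U U') (\<rho> U U')"
proof (intro bfly_map.intro bfly_map_axioms.intro)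
  assume affine_pair: "affine_pair U U'"
  note o = affine_pairD[OF affine_pair]
  show "bfly p k (Sh X U) (Str_on X U) (ht_bf t U U)" by (rule T.bfly[OF o(1)])
  show "bfly p k (Sh X' U') (Str_on X' U') (ht_bf t' U' U')" by (rule T'.bfly[OF o(2)])
  show "pull U U' \<in> ring_hom (Sh X U) (Sh X' U')" by (rule pull_hom[OF affine_pair])
  show "butterfly_map (witt p k) (witt p (Sh X U)) (pull U U') (witt_map (pull U U')) (ht_bf t U U) (ht_bf t' U' U') (\<rho> U U')"
    using rho_map[OF o(1-3)] by (simp add: pull_def[abs_def])
qed

definition uL where
  "uL U U' = bfly_map.ind p (Sh X U) (ht_bf t U U) (Sh X' U') (ht_bf t' U' U') (\<rho> U U')"

lemma uL_q: "affine_pair U U' \<Longrightarrow> e \<in> carrier (ht_bf t U U) \<Longrightarrow> uL U U' (T.qL U e) = T'.qL U' (\<rho> U U' e)"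
  unfolding uL_def T.qL_def T'.qL_def by (rule bfly_map.ind_q[OF bmap])

lemma uL_hom: "affine_pair U U' \<Longrightarrow> uL U U' \<in> ring_hom (T.LL U) (T'.LL U')"
  unfolding uL_def T.LL_def T'.LL_def by (rule bfly_map.ind_hom[OF bmap])

lemma em_uL: "affine_pair U U' \<Longrightarrow> x \<in> carrier (T.LL U) \<Longrightarrow> T'.emL U' (uL U U' x) = pull U U' (T.emL U x)"
  unfolding uL_def T.LL_def T.emL_def T'.emL_def by (rule bfly_map.em_ind[OF bmap])

lemma uL_j: "affine_pair U U' \<Longrightarrow> a \<in> carrier (Sh X U) \<Longrightarrow> uL U U' (T.jL U a) = T'.jL U' (pull U U' a)"
  unfolding uL_def T.jL_def T'.jL_def by (rule bfly_map.ind_j[OF bmap])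

lemma uL_phi: "affine_pair U U' \<Longrightarrow> x \<in> carrier (T.LL U) \<Longrightarrow> uL U U' (T.phiL U x) = T'.phiL U' (uL U U' x)"
  unfolding uL_def T.LL_def T.phiL_def T'.phiL_def by (rule bfly_map.ind_phi[OF bmap])

lemma uL_nat:
  assumes U: "affine_pair U U'" and V: "affine_pair V V'" and sub: "V \<subseteq> U" "V' \<subseteq> U'" and x: "x \<in> carrier (T.LL U)"
  shows "uL V V' (T.rL U V x) = T'.rL U' V' (uL U U' x)"
proof -
  note o = affine_pairD[OF U] and o' = affine_pairD[OF V]
  obtain e where e: "e \<in> carrier (ht_bf t U U)" "x = T.qL U e" using T.qL_surjE[OF o(1) x] .
  have re: "\<rho> U U' e \<in> carrier (ht_bf t' U' U')"
    by (rule ring_hom_closed[OF bfly_map.rho[OF bmap[OF U]] e(1)])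
  have se: "ht_res t U U V V e \<in> carrier (ht_bf t V V)"
    by (rule ring_hom_closed[OF bfly_map.rho[OF T.bfly_map[OF o(1) o'(1) sub(1)]] e(1)])
  show ?thesis
    unfolding e(2) T.rL_qL[OF o(1) o'(1) sub(1) e(1)] uL_q[OF V se] uL_q[OF U e(1)]
      T'.rL_qL[OF o(2) o'(2) sub(2) re] rho_nat[OF o(1) o'(1) o(2) o'(2) sub o(3) o'(3) e(1)] ..
qed

definition ug :: "'x set \<Rightarrow> 'y set \<Rightarrow> 'r \<times> 'r \<Rightarrow> 's \<times> 's" where
  "ug U U' = descend (T.LL U) (T.LL.qG U) (\<lambda>x. T'.LL.qG U' (uL U U' x))"

lemma ug_q: "affine_pair U U' \<Longrightarrow> x \<in> carrier (T.LL U) \<Longrightarrow> ug U U' (T.LL.qG U x) = T'.LL.qG U' (uL U U' x)"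
  unfolding ug_def by (rule descend_eq) (auto dest: T.qG_eqD affine_pairD(1))

lemma ug_hom: "affine_pair U U' \<Longrightarrow> ug U U' \<in> ring_hom (Sh T.Z U) (Sh T'.Z U')"
proof -
  assume affine_pair: "affine_pair U U'"
  note o = affine_pairD[OF affine_pair]
  have "T'.LL.qG U' \<circ> uL U U' \<in> ring_hom (T.LL U) (Sh T'.Z U')"
    by (rule ring_hom_trans[OF uL_hom[OF affine_pair] T'.qGZ(1)[OF o(2)]])
  then have h: "(\<lambda>x. T'.LL.qG U' (uL U U' x)) \<in> ring_hom (T.LL U) (Sh T'.Z U')" by (simp add: comp_def)
  show ?thesis unfolding ug_def
    by (rule descend_hom[OF T.LL_cring[OF o(1)] T.qGZ(1,2)[OF o(1)] h]) (auto dest: T.qG_eqD[OF o(1)])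
qed

lemma uL_closed: "affine_pair U U' \<Longrightarrow> x \<in> carrier (T.LL U) \<Longrightarrow> uL U U' x \<in> carrier (T'.LL U')"
  using ring_hom_closed[OF uL_hom] .

lemma ug_closed: "affine_pair U U' \<Longrightarrow> z \<in> carrier (Sh T.Z U) \<Longrightarrow> ug U U' z \<in> carrier (Sh T'.Z U')"
  using ring_hom_closed[OF ug_hom] .

lemma em_ug:
  assumes U: "affine_pair U U'" and z: "z \<in> carrier (Sh T.Z U)"
  shows "T'.LL.emG U' (ug U U' z) = pull U U' (T.LL.emG U z)"
proof -
  note o = affine_pairD[OF U]
  obtain x where x: "x \<in> carrier (T.LL U)" "z = T.LL.qG U x" using T.qGZ_surjE[OF o(1) z] .
  show ?thesis unfolding x(2) ug_q[OF U x(1)] T.qGZ(3)[OF o(1) x(1)] T'.qGZ(3)[OF o(2) uL_closed[OF U x(1)]]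
    by (rule em_uL[OF U x(1)])
qed

lemma ug_j:
  assumes U: "affine_pair U U'" and a: "a \<in> carrier (Sh X U)"
  shows "ug U U' (T.LL.jG U a) = T'.LL.jG U' (pull U U' a)"
proof -
  note o = affine_pairD[OF U]
  have ja: "T.jL U a \<in> carrier (T.LL U)" by (rule T.LL.j_closed[OF o(1) a])
  have ha: "pull U U' a \<in> carrier (Sh X' U')" by (rule ring_hom_closed[OF pull_hom[OF U] a])
  show ?thesis
    unfolding T.qGZ(4)[OF o(1) a, symmetric] ug_q[OF U ja] uL_j[OF U a] by (rule T'.qGZ(4)[OF o(2) ha])
qed

lemma ug_phi:
  assumes U: "affine_pair U U'" and z: "z \<in> carrier (Sh T.Z U)"
  shows "ug U U' (T.gphi U z) = T'.gphi U' (ug U U' z)"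
proof -
  note o = affine_pairD[OF U]
  obtain x where x: "x \<in> carrier (T.LL U)" "z = T.LL.qG U x" using T.qGZ_surjE[OF o(1) z] .
  show ?thesis
    unfolding x(2) T.gphi_q[OF o(1) x(1)] ug_q[OF U ring_hom_closed[OF T.phiL_hom[OF o(1)] x(1)]]
      ug_q[OF U x(1)] T'.gphi_q[OF o(2) uL_closed[OF U x(1)]] uL_phi[OF U x(1)] ..
qed

lemma ug_nat:
  assumes U: "affine_pair U U'" and V: "affine_pair V V'" and sub: "V \<subseteq> U" "V' \<subseteq> U'" and z: "z \<in> carrier (Sh T.Z U)"
  shows "ug V V' (Res T.Z U V z) = Res T'.Z U' V' (ug U U' z)"
proof -
  note o = affine_pairD[OF U] and o' = affine_pairD[OF V]
  obtain x where x: "x \<in> carrier (T.LL U)" "z = T.LL.qG U x" using T.qGZ_surjE[OF o(1) z] .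
  have rx: "T.rL U V x \<in> carrier (T.LL V)" using T.LL.r_closed[OF o(1) o'(1) sub(1) x(1)] .
  show ?thesis
    unfolding x(2) T.qGZ(5)[OF o(1) o'(1) sub(1) x(1)] ug_q[OF V rx] ug_q[OF U x(1)]
      T'.qGZ(5)[OF o(2) o'(2) sub(2) uL_closed[OF U x(1)]] uL_nat[OF U V sub x(1)] ..
qed

lemma ug_Str:
  assumes U: "affine_pair U U'" and a: "a \<in> carrier (witt2 p k)"
  shows "ug U U' (Str_on T.Z U a) = Str_on T'.Z U' a"
proof -
  note o = affine_pairD[OF U]
  show ?thesis
    unfolding T.Str_on_Z[OF o(1) a] T'.Str_on_Z[OF o(2) a]
    by (rule T.wstr_nat[OF T.G.ext_surj[OF o(1)] T'.G.ext_surj[OF o(2)] T.Str_on_hom[OF o(4)] ug_hom[OF U]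
          em_ug[OF U] ug_j[OF U] pull_Str[OF U] a])
qed

lemma affine_pair_image: "U \<in> T.affs \<Longrightarrow> U' \<in> T'.affs \<Longrightarrow> pt h ` U' \<subseteq> U \<Longrightarrow> affine_pair U U'"
  using openin_subset[OF T'.affine_open, of U'] by (auto simp: affine_pair_def preim_def T.affs_def T'.affs_def)

lemma affine_pair_imageD: "affine_pair U U' \<Longrightarrow> U \<in> T.affs \<and> U' \<in> T'.affs \<and> pt h ` U' \<subseteq> U"
  by (auto simp: affine_pair_def preim_def T.affs_def T'.affs_def)

lemma ex_affine_pair:
  assumes "openin (Top X) V" "x \<in> preim X' h V"
  obtains U U' where "affine_pair U U'" "U \<subseteq> V" "x \<in> U'"
proof -
  have "pt h x \<in> V" using assms by (simp add: preim_def)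
  then obtain U where U: "affine_open X U" "pt h x \<in> U" "U \<subseteq> V" using T.affine_nbhd[OF assms(1)] by blast
  then have "x \<in> preim X' h U" using assms by (simp add: preim_def)
  then obtain U' where "affine_open X' U'" "x \<in> U'" "U' \<subseteq> preim X' h U"
    using T'.affine_nbhd[OF preim_h[OF T.affine_open[OF U(1)]]] by blast
  then show thesis using that[of U U'] U by (simp add: affine_pair_def)
qed

text \<open>The local maps commute with restriction because the homotopies do. Locality is inherited
  from \<open>h\<close>, as units of germs are detected modulo $p$.\<close>

lemma ex_lift_mor:
  obtains u :: "('y, 's \<times> 's, 'x, 'r \<times> 'r) mor" where "is_mor T'.Z T.Z u" "pt u = pt h"
    "\<And>U U' s. affine_pair U U' \<Longrightarrow> s \<in> carrier (Sh T.Z U) \<Longrightarrow> Res T'.Z (preim T'.Z u U) U' (sec u U s) = ug U U' s"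
proof (rule glue_mor[OF T'.G.rsZ T.G.rsZ _ T'.Z_base T.Z_base, of "pt h" ug])
  show "continuous_map (Top T'.Z) (Top T.Z) (pt h)" using is_morD(1)[OF h] by (simp add: T.Z_simps(3) T'.Z_simps(3))
  show "U \<inter> V \<in> T.affs" if "U \<in> T.affs" "V \<in> T.affs" for U V using that T.aff_Int by (simp add: T.affs_def)
  show "ug U U' \<in> ring_hom (Sh T.Z U) (Sh T'.Z U')" if "U \<in> T.affs" "U' \<in> T'.affs" "pt h ` U' \<subseteq> U" for U U'
    by (rule ug_hom[OF affine_pair_image[OF that]])
  show "ug V V' (Res T.Z U V s) = Res T'.Z U' V' (ug U U' s)"
    if "U \<in> T.affs" "U' \<in> T'.affs" "V \<in> T.affs" "V' \<in> T'.affs" "pt h ` U' \<subseteq> U" "pt h ` V' \<subseteq> V" "V \<subseteq> U" "V' \<subseteq> U'"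
      "s \<in> carrier (Sh T.Z U)" for U U' V V' s
    by (rule ug_nat[OF affine_pair_image[OF that(1,2,5)] affine_pair_image[OF that(3,4,6)] that(7-9)])
  show "germ_unit T.Z (pt h x) U s"
    if H: "U \<in> T.affs" "U' \<in> T'.affs" "pt h ` U' \<subseteq> U" "x \<in> U'" "s \<in> carrier (Sh T.Z U)" "germ_unit T'.Z x U' (ug U U' s)"
    for U U' x s
  proof -
    have affine_pair: "affine_pair U U'" using affine_pair_image[OF H(1-3)] .
    note o = affine_pairD[OF affine_pair]
    have "germ_unit X' x U' (pull U U' (T.LL.emG U s))"
      using T'.G.germ_unit_em[OF o(5) H(4) ug_closed[OF affine_pair H(5)]] H(6) em_ug[OF affine_pair H(5)] by simp
    then have "germ_unit X (pt h x) U (T.LL.emG U s)"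
      by (rule pull_loc[OF affine_pair H(4) T.G.em_closed[OF o(4) H(5)]])
    moreover have "pt h x \<in> U" using H by blast
    ultimately show ?thesis using T.G.germ_unit_em[OF o(4) _ H(5)] by blast
  qed
  fix f :: "('y, 's \<times> 's, 'x, 'r \<times> 'r) mor" 
  assume f: "is_mor T'.Z T.Z f" "pt f = pt h"
   "\<And>U U' s. U \<in> T.affs \<Longrightarrow> U' \<in> T'.affs \<Longrightarrow> pt h ` U' \<subseteq> U \<Longrightarrow> s \<in> carrier (Sh T.Z U) \<Longrightarrow>
          Res T'.Z (preim T'.Z f U) U' (sec f U s) = ug U U' s"
  show thesis
    by (rule that[OF f(1,2)]) (use f(3) affine_pair_imageD in auto)
qed

text \<open>The three compatibilities, with structure maps, with the embeddings and with the lifts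
  of Frobenius, are equalities of sections and may be tested on affine pairs, where
  \<open>ug\<close> is known to respect all three.\<close>

lemma ex_frob_lift_mor: "\<exists>u. is_frob_lift_mor p k X X' h T.frobenius_lifting T'.frobenius_lifting u"
proof -
  obtain u :: "('y, 's \<times> 's, 'x, 'r \<times> 'r) mor" where u: "is_mor T'.Z T.Z u" "pt u = pt h"
    and us: "\<And>U U' s. affine_pair U U' \<Longrightarrow> s \<in> carrier (Sh T.Z U) \<Longrightarrow> Res T'.Z (preim T'.Z u U) U' (sec u U s) = ug U U' s"
    by (rule ex_lift_mor) blast
  have pre: "preim T'.Z u V = preim X' h V" for V by (simp add: preim_def u(2) T'.Z_simps(3))
  have okI: "affine_pair U U'" if "U \<in> T.affs" "U' \<in> T'.affs" "U' \<subseteq> preim X' h U" for U U'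
    using that by (simp add: affine_pair_def T.affs_def T'.affs_def)
  have oZ: "openin (Top T.Z) V \<longleftrightarrow> openin (Top X) V" "openin (Top T'.Z) V' \<longleftrightarrow> openin (Top X') V'" for V V' by simp_all
  have "is_mor_over (witt2 p k) (\<lambda>a. a) T'.Z T.Z u"
    unfolding is_mor_over_def
  proof (intro conjI u(1) ballI)
    fix a assume a: "a \<in> carrier (witt2 p k)"
    let ?T = "topspace (Top X)" and ?T' = "topspace (Top X')"
    have oT: "openin (Top X) ?T" "openin (Top T.Z) ?T" "openin (Top X') ?T'" "openin (Top T'.Z) ?T'" by simp_all
    have Sa: "Str T.Z a \<in> carrier (Sh T.Z ?T)" using ring_hom_closed[OF T.Str_Z_hom a] by (simp add: T.Z_simps(3))
    have Sa': "Str T'.Z a \<in> carrier (Sh T'.Z ?T')" using ring_hom_closed[OF T'.Str_Z_hom a] by (simp add: T'.Z_simps(3))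
    have pT: "preim X' h ?T = ?T'" using pt_closed[OF h] by (auto simp: preim_def)
    have uc: "sec u ?T (Str T.Z a) \<in> carrier (Sh T'.Z ?T')" using sec_closed[OF u(1) oT(2) Sa] by (simp add: pre pT)
    have "sec u ?T (Str T.Z a) = Str T'.Z a"
    proof (rule T'.G.Z.sections_eqI[OF oT(4) uc Sa'])
      fix x assume "x \<in> ?T'"
      then obtain U U' where U: "affine_pair U U'" "x \<in> U'" "U \<subseteq> ?T" using ex_affine_pair[OF oT(1), of x] pT by metis
      note o = affine_pairD[OF U(1)]
      have U'T: "U' \<subseteq> ?T'" by (rule openin_subset[OF o(5)])
      have oU: "openin (Top T.Z) U" "openin (Top T'.Z) U'" "openin (Top T'.Z) (preim X' h U)" using o preim_h by simp_all
      have SU: "Str_on T.Z U a \<in> carrier (Sh T.Z U)"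
        using T.G.Z.Res_closed[OF oT(2) oU(1) U(3) Sa] T.Res_Str_Z[OF o(1) a] by simp
      have "Res T'.Z ?T' U' (sec u ?T (Str T.Z a)) =
          Res T'.Z (preim X' h U) U' (Res T'.Z (preim X' h ?T) (preim X' h U) (sec u ?T (Str T.Z a)))"
        unfolding pT by (rule T'.G.Z.Res_comp[OF oT(4) oU(3,2) o(3) _ uc, symmetric]) (auto simp: preim_def)
      also have "\<dots> = Res T'.Z (preim X' h U) U' (sec u U (Str_on T.Z U a))"
        using is_morD(3)[OF u(1) oT(2) oU(1) U(3) Sa] T.Res_Str_Z[OF o(1) a] by (simp add: pre)
      also have "\<dots> = Str_on T'.Z U' a"
        using us[OF U(1) SU] ug_Str[OF U(1) a] by (simp add: pre)
      finally have "Res T'.Z ?T' U' (sec u ?T (Str T.Z a)) = Res T'.Z ?T' U' (Str T'.Z a)"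
        using T'.Res_Str_Z[OF o(2) a] by simp
      then show "\<exists>V. openin (Top T'.Z) V \<and> x \<in> V \<and> V \<subseteq> ?T' \<and>
          Res T'.Z ?T' V (sec u ?T (Str T.Z a)) = Res T'.Z ?T' V (Str T'.Z a)"
        using oU(2) U(2) U'T by blast
    qed
    then show "sec u (topspace (Top T.Z)) (Str T.Z a) = Str T'.Z a" by (simp add: T.Z_simps(3))
  qed
  moreover have "mor_eq X' T.Z (comp_mor T'.Z u T'.EmbZ) (comp_mor X T.EmbZ h)"
  proof (rule mor_eqI[OF T'.rs T.G.rsZ T'.affs_base T.Z_base is_mor_comp[OF T'.EmbZ_mor u(1)] is_mor_comp[OF h T.EmbZ_mor]])
    show "pt (comp_mor T'.Z u T'.EmbZ) x = pt (comp_mor X T.EmbZ h) x" for x by (simp add: u(2))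
    fix U U' s assume UU: "U \<in> T.affs" "U' \<in> T'.affs" and sub: "U' \<subseteq> preim X' (comp_mor T'.Z u T'.EmbZ) U"
      and s: "s \<in> carrier (Sh T.Z U)"
    have aU: "openin (Top X) U" "openin (Top T.Z) U" using UU T.affine_open by (auto simp: T.affs_def)
    have opre: "openin (Top X') (preim X' h U)" by (rule preim_h[OF aU(1)])
    have p1: "preim X' (comp_mor T'.Z u T'.EmbZ) U = preim X' h U"
      unfolding preim_comp[OF T'.EmbZ_mor] pre by (rule T'.preim_EmbZ[OF opre])
    have p2: "preim X' (comp_mor X T.EmbZ h) U = preim X' h U"
      unfolding preim_comp[OF h] T.preim_EmbZ[OF aU(1)] ..
    have affine_pair: "affine_pair U U'" using okI[OF UU] sub p1 by simp
    note o = affine_pairD[OF affine_pair]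
    have uc: "sec u U s \<in> carrier (Sh T'.Z (preim X' h U))" using sec_closed[OF u(1) aU(2) s] by (simp add: pre)
    have "Res X' (preim X' h U) U' (T'.LL.emG (preim X' h U) (sec u U s)) = T'.LL.emG U' (Res T'.Z (preim X' h U) U' (sec u U s))"
      by (rule T'.G.em_Res[OF opre o(5,3) uc, symmetric])
    also have "\<dots> = pull U U' (T.LL.emG U s)" using us[OF affine_pair s] em_ug[OF affine_pair s] by (simp add: pre)
    finally show "Res X' (preim X' (comp_mor T'.Z u T'.EmbZ) U) U' (sec (comp_mor T'.Z u T'.EmbZ) U s) =
      Res X' (preim X' (comp_mor X T.EmbZ h) U) U' (sec (comp_mor X T.EmbZ h) U s)"
      unfolding p1 p2 comp_mor_simps pre T.preim_EmbZ[OF aU(1)] by (simp add: pull_def)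
  qed
  moreover have "mor_eq T'.Z T.Z (comp_mor T.Z T.PhiZ u) (comp_mor T'.Z u T'.PhiZ)"
  proof (rule mor_eqI[OF T'.G.rsZ T.G.rsZ T'.Z_base T.Z_base is_mor_comp[OF u(1) T.PhiZ(1)] is_mor_comp[OF T'.PhiZ(1) u(1)]])
    show "pt (comp_mor T.Z T.PhiZ u) x = pt (comp_mor T'.Z u T'.PhiZ) x" for x by (simp add: T.PhiZ(2) T'.PhiZ(2))
    fix U U' s assume UU: "U \<in> T.affs" "U' \<in> T'.affs" and sub: "U' \<subseteq> preim T'.Z (comp_mor T.Z T.PhiZ u) U"
      and s: "s \<in> carrier (Sh T.Z U)"
    have aU: "openin (Top X) U" "openin (Top T.Z) U" using UU T.affine_open by (auto simp: T.affs_def)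
    have opre: "openin (Top X') (preim X' h U)" "openin (Top T'.Z) (preim X' h U)" using preim_h[OF aU(1)] by simp_all
    have p1: "preim T'.Z (comp_mor T.Z T.PhiZ u) U = preim X' h U"
      unfolding preim_comp[OF u(1)] pre T.preim_PhiZ[OF aU(1)] ..
    have p2: "preim T'.Z (comp_mor T'.Z u T'.PhiZ) U = preim X' h U"
      unfolding preim_comp[OF T'.PhiZ(1)] pre by (rule T'.preim_PhiZ[OF opre(1)])
    have affine_pair: "affine_pair U U'" using okI[OF UU] sub p1 by simp
    note o = affine_pairD[OF affine_pair]
    have oU': "openin (Top T'.Z) U'" using o(5) by simp
    have uc: "sec u U s \<in> carrier (Sh T'.Z (preim X' h U))" using sec_closed[OF u(1) aU(2) s] by (simp add: pre)
    have gs: "T.gphi U s \<in> carrier (Sh T.Z U)" by (rule ring_hom_closed[OF T.gphi_hom[OF o(1)] s])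
    have "Res T'.Z (preim X' h U) U' (sec u U (sec T.PhiZ U s)) = ug U U' (T.gphi U s)"
      using us[OF affine_pair gs] T.PhiZ(3)[OF o(1) s] by (simp add: pre)
    also have "\<dots> = sec T'.PhiZ U' (ug U U' s)"
      unfolding ug_phi[OF affine_pair s] T'.PhiZ(3)[OF o(2) ug_closed[OF affine_pair s]] ..
    also have "\<dots> = sec T'.PhiZ U' (Res T'.Z (preim X' h U) U' (sec u U s))"
      using us[OF affine_pair s] by (simp add: pre)
    also have "\<dots> = Res T'.Z (preim X' h U) U' (sec T'.PhiZ (preim X' h U) (sec u U s))"
      using is_morD(3)[OF T'.PhiZ(1) opre(2) oU' o(3) uc] by (simp add: T'.preim_PhiZ[OF opre(1)] T'.preim_PhiZ[OF o(5)])
    finally show "Res T'.Z (preim T'.Z (comp_mor T.Z T.PhiZ u) U) U' (sec (comp_mor T.Z T.PhiZ u) U s) =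
      Res T'.Z (preim T'.Z (comp_mor T'.Z u T'.PhiZ) U) U' (sec (comp_mor T'.Z u T'.PhiZ) U s)"
      unfolding p1 p2 comp_mor_simps pre T.preim_PhiZ[OF aU(1)] .
  qed
  ultimately show ?thesis unfolding is_frob_lift_mor_def T.frobenius_lifting_simps T'.frobenius_lifting_simps by blast
qed

end

section \<open>Composition of morphisms of Frobenius liftings and passage to classes\<close>

lemma compatible_ex_frob_lift_mor:
  assumes T: "triv_sm p k X t" and T': "triv_sm p k X' t'"
    and h: "is_mor_over k (\<lambda>a. a) X' X h" and c: "compatible_trivializations p k X X' h t t'"
  shows "\<exists>u. is_frob_lift_mor p k X X' h (triv_sm.frobenius_lifting p k X t) (triv_sm.frobenius_lifting p k X' t') u"
proof -
  interpret T: triv_sm p k X t by (rule T)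
  interpret T': triv_sm p k X' t' by (rule T')
  obtain \<rho> where r1: "\<forall>(U, V)\<in>HT_index X X id_mor. \<forall>(U', V')\<in>HT_index X' X' id_mor.
          U' \<subseteq> preim X' h U \<and> V' \<subseteq> preim X' h V \<longrightarrow>
          butterfly_map (witt p k) (witt p (Sh X V))
            (\<lambda>s. Res X' (preim X' h U) U' (sec h U s))
            (witt_map (\<lambda>s. Res X' (preim X' h V) V' (sec h V s)))
            (ht_bf t U V) (ht_bf t' U' V') (\<rho> U V U' V')"
     and r2: "\<forall>(U, V)\<in>HT_index X X id_mor. \<forall>(U1, V1)\<in>HT_index X X id_mor.
        \<forall>(U', V')\<in>HT_index X' X' id_mor. \<forall>(U1', V1')\<in>HT_index X' X' id_mor.
          U1 \<subseteq> U \<and> V1 \<subseteq> V \<and> U1' \<subseteq> U' \<and> V1' \<subseteq> V' \<and>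
          U' \<subseteq> preim X' h U \<and> V' \<subseteq> preim X' h V \<and>
          U1' \<subseteq> preim X' h U1 \<and> V1' \<subseteq> preim X' h V1 \<longrightarrow>
          (\<forall>e\<in>carrier (ht_bf t U V).
             \<rho> U1 V1 U1' V1' (ht_res t U V U1 V1 e) =
             ht_res t' U' V' U1' V1' (\<rho> U V U' V' e))"
    using c unfolding compatible_trivializations_def by blast
  have "triv_mor p k X t X' t' h (\<lambda>U U'. \<rho> U U U' U')"
  proof (intro triv_mor.intro triv_mor_axioms.intro T T' h)
    fix U U' assume U: "affine_open X U" "affine_open X' U'" "U' \<subseteq> preim X' h U"
    note i = T.HT_index_id[OF U(1) U(1) subset_refl] and i' = T'.HT_index_id[OF U(2) U(2) subset_refl]
    show "butterfly_map (witt p k) (witt p (Sh X U)) (\<lambda>s. Res X' (preim X' h U) U' (sec h U s))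
        (witt_map (\<lambda>s. Res X' (preim X' h U) U' (sec h U s))) (ht_bf t U U) (ht_bf t' U' U') (\<rho> U U U' U')"
      using bspec[OF bspec[OF r1 i, unfolded prod.case] i', unfolded prod.case] U(3) by simp
    fix V V' e assume V: "affine_open X V" "affine_open X' V'" "V \<subseteq> U" "V' \<subseteq> U'" "V' \<subseteq> preim X' h V"
      and e: "e \<in> carrier (ht_bf t U U)"
    note j = T.HT_index_id[OF V(1) V(1) subset_refl] and j' = T'.HT_index_id[OF V(2) V(2) subset_refl]
    show "\<rho> V V V' V' (ht_res t U U V V e) = ht_res t' U' U' V' V' (\<rho> U U U' U' e)"
      using bspec[OF bspec[OF bspec[OF bspec[OF r2 i, unfolded prod.case] j, unfolded prod.case] i', unfolded prod.case] j', unfolded prod.case]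
        U(3) V e by simp
  qed
  then show ?thesis by (rule triv_mor.ex_frob_lift_mor)
qed

text \<open>Pasting of two commutative squares. Since \<open>mor_eq\<close> compares sections only
  over open sets and only on carriers, the equations cannot simply be substituted into each other
  and the domains have to be followed.\<close>

lemma mor_eq_paste:
  assumes h: "is_mor A' A h" and h': "is_mor A'' A' h'" and e: "is_mor A B e" and e': "is_mor A' B' e'"
    and e'': "is_mor A'' B'' e''" and u: "is_mor B' B u" and u': "is_mor B'' B' u'"
    and sq: "mor_eq A' B (comp_mor B' u e') (comp_mor A e h)"
    and sq': "mor_eq A'' B' (comp_mor B'' u' e'') (comp_mor A' e' h')"
  shows "mor_eq A'' B (comp_mor B'' (comp_mor B' u u') e'') (comp_mor A e (comp_mor A' h h'))"
  unfolding mor_eq_def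
proof (intro conjI ballI allI impI)
  note s1 = conjunct1[OF sq[unfolded mor_eq_def]] and s2 = conjunct2[OF sq[unfolded mor_eq_def]]
  note s1' = conjunct1[OF sq'[unfolded mor_eq_def]] and s2' = conjunct2[OF sq'[unfolded mor_eq_def]]
  fix x assume x: "x \<in> topspace (Top A'')"
  show "pt (comp_mor B'' (comp_mor B' u u') e'') x = pt (comp_mor A e (comp_mor A' h h')) x"
    using bspec[OF s1' x] bspec[OF s1 pt_closed[OF h' x]] by simp
next
  note s1 = conjunct1[OF sq[unfolded mor_eq_def]] and s2 = conjunct2[OF sq[unfolded mor_eq_def]]
  note s2' = conjunct2[OF sq'[unfolded mor_eq_def]]
  fix V s assume V: "openin (Top B) V" and s: "s \<in> carrier (Sh B V)"
  have oV: "openin (Top B') (preim B' u V)" by (rule preim_open[OF u V])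
  \<comment> \<open>The first square commutes on points, so the two routes give the same preimage of
    \<open>V\<close>; otherwise the section maps would be evaluated at different open sets.\<close>
  have pre: "preim A' e' (preim B' u V) = preim A' h (preim A e V)"
    using s1 pt_closed[OF h] pt_closed[OF e'] by (auto simp: preim_def)
  have "sec e'' (preim B'' u' (preim B' u V)) (sec u' (preim B' u V) (sec u V s)) =
      sec h' (preim A' e' (preim B' u V)) (sec e' (preim B' u V) (sec u V s))"
    using s2' oV sec_closed[OF u V s] by simp
  also have "sec e' (preim B' u V) (sec u V s) = sec h (preim A e V) (sec e V s)"
    using s2 V s by simp
  finally show "sec (comp_mor B'' (comp_mor B' u u') e'') V s = sec (comp_mor A e (comp_mor A' h h')) V s"
    by (simp add: preim_comp[OF u'] pre)
qed

lemma mor_eq_sym: "mor_eq X Y f g \<Longrightarrow> mor_eq X Y g f"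
  unfolding mor_eq_def by auto

lemma is_mor_over_comp:
  assumes u: "is_mor_over R (\<lambda>a. a) Y Z u" and u': "is_mor_over R (\<lambda>a. a) X Y u'"
  shows "is_mor_over R (\<lambda>a. a) X Z (comp_mor Y u u')"
proof -
  have m: "is_mor Y Z u" "is_mor X Y u'" using u u' by (simp_all add: is_mor_over_def)
  have "preim Y u (topspace (Top Z)) = topspace (Top Y)" using pt_closed[OF m(1)] by (auto simp: preim_def)
  then show ?thesis using u u' is_mor_comp[OF m(2,1)] by (simp add: is_mor_over_def)
qed

lemma is_frob_lift_mor_comp:
  assumes L: "L \<in> frob_lifts p k X" and L': "L' \<in> frob_lifts p k X'" and L'': "L'' \<in> frob_lifts p k X''"
    and h: "is_mor X' X h" and h': "is_mor X'' X' h'"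
    and u: "is_frob_lift_mor p k X X' h L L' u" and u': "is_frob_lift_mor p k X' X'' h' L' L'' u'"
  shows "is_frob_lift_mor p k X X'' (comp_mor X' h h') L L'' (comp_mor (Lift L') u u')"
proof -
  have E: "is_mor X (Lift L) (Emb L)" "is_mor X' (Lift L') (Emb L')" "is_mor X'' (Lift L'') (Emb L'')"
    and P: "is_mor (Lift L) (Lift L) (Phi L)" "is_mor (Lift L') (Lift L') (Phi L')" "is_mor (Lift L'') (Lift L'') (Phi L'')"
    using L L' L'' unfolding frob_lifts_def is_mor_over_def by simp_all
  note U = u[unfolded is_frob_lift_mor_def] and U' = u'[unfolded is_frob_lift_mor_def]
  have m: "is_mor (Lift L') (Lift L) u" "is_mor (Lift L'') (Lift L') u'"
    using U U' by (simp_all add: is_mor_over_def)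
  \<comment> \<open>Here the squares to be pasted express that \<open>u\<close> and
    \<open>u'\<close> commute with the lifts of Frobenius, which take the place of the
    embeddings.\<close>
  have "mor_eq (Lift L'') (Lift L) (comp_mor (Lift L'') (comp_mor (Lift L') u u') (Phi L''))
      (comp_mor (Lift L) (Phi L) (comp_mor (Lift L') u u'))"
    by (rule mor_eq_paste[OF m P m]) (use U U' in \<open>simp_all add: mor_eq_sym\<close>)
  moreover have "mor_eq X'' (Lift L) (comp_mor (Lift L'') (comp_mor (Lift L') u u') (Emb L''))
      (comp_mor X (Emb L) (comp_mor X' h h'))"
    by (rule mor_eq_paste[OF h h' E m]) (use U U' in simp_all)
  moreover have "is_mor_over (witt2 p k) (\<lambda>a. a) (Lift L'') (Lift L) (comp_mor (Lift L') u u')"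
    using is_mor_over_comp U U' by blast
  ultimately show ?thesis unfolding is_frob_lift_mor_def by (simp add: mor_eq_sym)
qed

lemma comp_mor_id: "comp_mor X h id_mor = h"
  by (cases h) (simp add: comp_mor_def id_mor_def comp_def)

lemma preim_id_mor: "V \<subseteq> topspace (Top X) \<Longrightarrow> preim X id_mor V = V"
  by (auto simp: preim_def id_mor_def)

text \<open>Composition with the identity changes \<open>h\<close> outside the open sets, because
  the preimage under the identity cuts a set down to the space. After composition with
  \<open>e\<close> only sets inside the space occur.\<close>

lemma comp_mor_id_comp: "comp_mor X e (comp_mor X id_mor h) = comp_mor X e h"
proof -
  have "preim X id_mor (preim X e V) = preim X e V" for V
    by (rule preim_id_mor) (auto simp: preim_def)
  then show ?thesis by (simp add: comp_mor_def) (simp add: id_mor_def comp_def)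
qed

lemma is_mor_id: "is_mor X X id_mor"
proof (rule is_morI)
  show "sec id_mor V \<in> ring_hom (Sh X V) (Sh X (preim X id_mor V))" if "openin (Top X) V" for V
    using preim_id_mor[OF openin_subset[OF that]] by (simp add: id_mor_def ring_hom_def)
  show "sec id_mor V' (Res X V V' s) = Res X (preim X id_mor V) (preim X id_mor V') (sec id_mor V s)"
    if "openin (Top X) V" "openin (Top X) V'" for V V' s
    using that by (simp add: preim_id_mor openin_subset) (simp add: id_mor_def)
  show "germ_unit X (pt id_mor x) V s"
    if "openin (Top X) V" "germ_unit X x (preim X id_mor V) (sec id_mor V s)" for V x s
    using that by (simp add: preim_id_mor openin_subset) (simp add: id_mor_def)
qed (simp add: id_mor_def)

lemma is_frob_lift_mor_trans:
  assumes L: "L \<in> frob_lifts p k X" "M \<in> frob_lifts p k X" and L': "L' \<in> frob_lifts p k X'" "M' \<in> frob_lifts p k X'"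
    and h: "is_mor X' X h"
    and u: "is_frob_lift_mor p k X X id_mor L M u" and v: "is_frob_lift_mor p k X X' h M M' v"
    and w: "is_frob_lift_mor p k X' X' id_mor M' L' w"
  shows "is_frob_lift_mor p k X X' h L L' (comp_mor (Lift M') (comp_mor (Lift M) u v) w)"
proof -
  have 1: "is_frob_lift_mor p k X X' h L M' (comp_mor (Lift M) u v)"
    using is_frob_lift_mor_comp[OF L L'(2) is_mor_id h u v] by (simp add: is_frob_lift_mor_def comp_mor_id_comp)
  show ?thesis
    using is_frob_lift_mor_comp[OF L(1) L'(2,1) h is_mor_id 1 w] by (simp add: comp_mor_id)
qed

lemma butterfly_map_id: "butterfly_map R C (\<lambda>s. s) (\<lambda>w. w) E E (\<lambda>e. e)"
  unfolding butterfly_map_def by (auto intro: ring_hom_memI)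

lemma butterfly_map_comp:
  assumes 1: "butterfly_map R C f g E E' \<rho>" and 2: "butterfly_map R C' (\<lambda>s. s) (\<lambda>w. w) E' E'' \<rho>'"
    and g: "\<And>w. w \<in> carrier C \<Longrightarrow> g w \<in> carrier C'"
  shows "butterfly_map R C f g E E'' (\<lambda>e. \<rho>' (\<rho> e))"
proof -
  have h: "\<rho> \<in> ring_hom E E'" "\<rho>' \<in> ring_hom E' E''" using 1 2 by (simp_all add: butterfly_map_def)
  have "\<rho>' \<circ> \<rho> \<in> ring_hom E E''" by (rule ring_hom_trans[OF h])
  then show ?thesis using 1 2 g ring_hom_closed[OF h(1)] by (simp add: butterfly_map_def comp_def)
qed

lemma trivialization_rel_refl: "g \<in> trivializations p k X \<Longrightarrow> (g, g) \<in> trivialization_rel p k X"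
  unfolding trivialization_rel_def HT_iso_def
  by (auto intro!: exI[of _ "\<lambda>U V e. e"] butterfly_map_id simp: bij_betw_def)

text \<open>Over the identity morphism the required homotopy from \<open>(U, V)\<close> to a smaller
  \<open>(U', V')\<close> is restriction followed by the isomorphism at \<open>(U', V')\<close>. Its
  naturality combines that of the isomorphism with functoriality of restriction.\<close>

lemma HT_iso_compatible:
  assumes rs: "is_ringed_space X" and g: "g \<in> trivializations p k X"
    and iso: "HT_iso p k X X id_mor g g'"
  shows "compatible_trivializations p k X X id_mor g g'"
proof -
  interpret rspace X by unfold_locales (rule rs)
  let ?I = "HT_index X X id_mor"
  obtain \<rho> where r1: "\<And>U V. (U, V) \<in> ?I \<Longrightarrow> butterfly_map (witt p k) (witt p (Sh X V)) (\<lambda>s. s) (\<lambda>w. w)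
            (ht_bf g U V) (ht_bf g' U V) (\<rho> U V)"
    and r2: "\<And>U V U' V' e. (U, V) \<in> ?I \<Longrightarrow> (U', V') \<in> ?I \<Longrightarrow> U' \<subseteq> U \<Longrightarrow> V' \<subseteq> V \<Longrightarrow> e \<in> carrier (ht_bf g U V) \<Longrightarrow>
             \<rho> U' V' (ht_res g U V U' V' e) = ht_res g' U V U' V' (\<rho> U V e)"
    using iso unfolding HT_iso_def by fastforce
  note T = g[unfolded trivializations_def HT_points_def mem_Collect_eq]
  have g1: "butterfly_map (witt p k) (witt p (Sh X V)) (Res X U U') (witt_map (Res X V V'))
          (ht_bf g U V) (ht_bf g U' V') (ht_res g U V U' V')"
    if "(U, V) \<in> ?I" "(U', V') \<in> ?I" "U' \<subseteq> U" "V' \<subseteq> V" for U V U' V'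
    using bspec[OF bspec[OF conjunct1[OF conjunct2[OF T]] that(1), unfolded prod.case] that(2), unfolded prod.case] that(3,4) by simp
  have g2: "ht_res g U' V' U'' V'' (ht_res g U V U' V' e) = ht_res g U V U'' V'' e"
    if "(U, V) \<in> ?I" "(U', V') \<in> ?I" "(U'', V'') \<in> ?I" "U'' \<subseteq> U'" "U' \<subseteq> U" "V'' \<subseteq> V'" "V' \<subseteq> V" "e \<in> carrier (ht_bf g U V)"
    for U V U' V' U'' V'' e
    using bspec[OF bspec[OF bspec[OF conjunct2[OF conjunct2[OF conjunct2[OF T]]] that(1), unfolded prod.case] that(2), unfolded prod.case]
        that(3), unfolded prod.case] that(4-8) by simp
  have g3: "ht_res g U V U' V' e \<in> carrier (ht_bf g U' V')"
    if "(U, V) \<in> ?I" "(U', V') \<in> ?I" "U' \<subseteq> U" "V' \<subseteq> V" "e \<in> carrier (ht_bf g U V)" for U V U' V' e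
    using g1[OF that(1-4)] that(5) ring_hom_closed unfolding butterfly_map_def by metis
  have opn: "openin (Top X) U" "openin (Top X) V" if "(U, V) \<in> ?I" for U V
    using that by (auto simp: HT_index_def affine_open_def)
  have pre: "preim X id_mor U = U" "preim X id_mor V = V" if "(U, V) \<in> ?I" for U V
    using opn[OF that] openin_subset by (auto intro!: preim_id_mor)
  have sec: "sec id_mor U s = s" for U :: "'a set" and s :: 'b by (simp add: id_mor_def)
  show ?thesis unfolding compatible_trivializations_def
  proof (rule exI[of _ "\<lambda>U V U' V' e. \<rho> U' V' (ht_res g U V U' V' e)"], intro conjI ballI; clarify)
    fix U V U' V' assume I: "(U, V) \<in> ?I" "(U', V') \<in> ?I" and sub: "U' \<subseteq> preim X id_mor U" "V' \<subseteq> preim X id_mor V"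
    have sub': "U' \<subseteq> U" "V' \<subseteq> V" using sub pre[OF I(1)] by auto
    show "butterfly_map (witt p k) (witt p (Sh X V))
            (\<lambda>s. Res X (preim X id_mor U) U' (sec id_mor U s))
            (witt_map (\<lambda>s. Res X (preim X id_mor V) V' (sec id_mor V s)))
            (ht_bf g U V) (ht_bf g' U' V') (\<lambda>e. \<rho> U' V' (ht_res g U V U' V' e))"
      unfolding pre[OF I(1)] sec
      by (rule butterfly_map_comp[OF g1[OF I sub'] r1[OF I(2)]])
        (auto simp: carrier_witt witt_map_def intro!: Res_closed opn[OF I(1)] opn[OF I(2)] sub')
  next
    fix U V U1 V1 U' V' U1' V1' e
    assume I: "(U, V) \<in> ?I" "(U1, V1) \<in> ?I" "(U', V') \<in> ?I" "(U1', V1') \<in> ?I"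
      and sub: "U1 \<subseteq> U" "V1 \<subseteq> V" "U1' \<subseteq> U'" "V1' \<subseteq> V'" "U' \<subseteq> preim X id_mor U" "V' \<subseteq> preim X id_mor V"
          "U1' \<subseteq> preim X id_mor U1" "V1' \<subseteq> preim X id_mor V1"
      and e: "e \<in> carrier (ht_bf g U V)"
    have s: "U' \<subseteq> U" "V' \<subseteq> V" "U1' \<subseteq> U1" "V1' \<subseteq> V1" using sub(5-8) pre[OF I(1)] pre[OF I(2)] by simp_all
    show "\<rho> U1' V1' (ht_res g U1 V1 U1' V1' (ht_res g U V U1 V1 e)) =
       ht_res g' U' V' U1' V1' (\<rho> U' V' (ht_res g U V U' V' e))"
      unfolding r2[OF I(3,4) sub(3,4) g3[OF I(1,3) s(1,2) e], symmetric]
        g2[OF I(1,3,4) sub(3) s(1) sub(4) s(2) e] g2[OF I(1,2,4) s(3) sub(1) s(4) sub(2) e] ..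
  qed
qed

lemma is_mor_over_id: "is_mor_over k (\<lambda>a. a) X X id_mor"
  unfolding is_mor_over_def using is_mor_id by (auto simp: id_mor_def)

lemma smooth_variety_triv_sm:
  assumes "prime p" "perfect_field p k" "smooth_variety k X" "t \<in> trivializations p k X"
  shows "triv_sm p k X t"
  using assms by unfold_locales (simp_all add: smooth_variety_def smooth_over_def is_scheme_over_def)

theorem theorem1p2:
  fixes p :: nat and k :: "'k ring"
  assumes "prime p" and "perfect_field p k"
  shows "\<exists>\<Phi> :: ('x, 'r, 'k) scheme_over \<Rightarrow>
            ('x, 'r, 'k) trivialization set \<Rightarrow> ('x, 'r, 'k) frob_lift set.
           (\<forall>X. smooth_variety k X \<longrightarrow>
              \<Phi> X \<in> trivializations p k X // trivialization_rel p k X \<rightarrow>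
                    frob_lifts p k X // frob_lift_rel p k X) \<and>
           canonical_map p k \<Phi>"
proof -
  \<comment> \<open>The construction starts from a trivialization, so each class needs a chosen
    representative. A different representative yields a Frobenius lifting related by morphisms in
    both directions, by \<open>FL_mor\<close> below.\<close>
  define rep where "rep X C = (SOME g. g \<in> trivializations p k X \<and> C = trivialization_rel p k X `` {g})"
    for X :: "('x, 'r, 'k) scheme_over" and C
  define \<Phi> where "\<Phi> X C = frob_lift_rel p k X `` {triv_sm.frobenius_lifting p k X (rep X C)}" for X :: "('x, 'r, 'k) scheme_over" and C
  note sm = smooth_variety_triv_sm[OF assms]
  have rep: "rep X C \<in> trivializations p k X" "C = trivialization_rel p k X `` {rep X C}"
    if "g \<in> trivializations p k X" "C = trivialization_rel p k X `` {g}" for X C g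
    using someI[of "\<lambda>g. g \<in> trivializations p k X \<and> C = trivialization_rel p k X `` {g}" g] that
    unfolding rep_def by blast+
  have frobenius_lifting: "triv_sm.frobenius_lifting p k X g \<in> frob_lifts p k X" if "smooth_variety k X" "g \<in> trivializations p k X" for X :: "('x, 'r, 'k) scheme_over" and g
    by (rule triv_sm.frobenius_lifting_frob_lifts[OF sm[OF that]])
  have FL_mor: "\<exists>u. is_frob_lift_mor p k X X id_mor (triv_sm.frobenius_lifting p k X g) (triv_sm.frobenius_lifting p k X g') u"
    if X: "smooth_variety k X" and g: "g \<in> trivializations p k X" "g' \<in> trivializations p k X"
      and iso: "(g, g') \<in> trivialization_rel p k X"
    for X :: "('x, 'r, 'k) scheme_over" and g g'
  proof (rule compatible_ex_frob_lift_mor[OF sm[OF X g(1)] sm[OF X g(2)] is_mor_over_id])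
    have "is_ringed_space X" using X by (simp add: smooth_variety_def smooth_over_def is_scheme_over_def is_scheme_def)
    then show "compatible_trivializations p k X X id_mor g g'"
      by (rule HT_iso_compatible[OF _ g(1)]) (use iso in \<open>simp add: trivialization_rel_def\<close>)
  qed
  \<comment> \<open>A member of the class assigned to \<open>g\<close> is isomorphic to the lifting
    built from the chosen representative, not from \<open>g\<close> itself. Both directions of
    comparison pass through that representative.\<close>
  have lift: "L \<in> frob_lifts p k X \<and> (\<exists>u. is_frob_lift_mor p k X X id_mor (triv_sm.frobenius_lifting p k X g) L u) \<and>
      (\<exists>v. is_frob_lift_mor p k X X id_mor L (triv_sm.frobenius_lifting p k X g) v)"
    if X: "smooth_variety k X" and g: "g \<in> trivializations p k X" and L: "L \<in> \<Phi> X (trivialization_rel p k X `` {g})"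
    for X :: "('x, 'r, 'k) scheme_over" and g L
  proof -
    define g0 where "g0 = rep X (trivialization_rel p k X `` {g})"
    have g0: "g0 \<in> trivializations p k X" "trivialization_rel p k X `` {g} = trivialization_rel p k X `` {g0}"
      using rep[OF g refl] unfolding g0_def by auto
    \<comment> \<open>By reflexivity each of \<open>g\<close> and \<open>g0\<close> lies in its own
      class; as the two classes are equal, each is related to the other.\<close>
    have rel: "(g0, g) \<in> trivialization_rel p k X" "(g, g0) \<in> trivialization_rel p k X"
      using trivialization_rel_refl[OF g] trivialization_rel_refl[OF g0(1)] g0(2) by auto
    have Lr: "(triv_sm.frobenius_lifting p k X g0, L) \<in> frob_lift_rel p k X" using L by (simp add: \<Phi>_def g0_def)
    then have Lc: "L \<in> frob_lifts p k X" by (simp add: frob_lift_rel_def)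
    from Lr obtain u v where uv: "is_frob_lift_mor p k X X id_mor (triv_sm.frobenius_lifting p k X g0) L u"
      "is_frob_lift_mor p k X X id_mor L (triv_sm.frobenius_lifting p k X g0) v"
      by (auto simp: frob_lift_rel_def)
    obtain a b where ab: "is_frob_lift_mor p k X X id_mor (triv_sm.frobenius_lifting p k X g) (triv_sm.frobenius_lifting p k X g0) a"
      "is_frob_lift_mor p k X X id_mor (triv_sm.frobenius_lifting p k X g0) (triv_sm.frobenius_lifting p k X g) b"
      using FL_mor[OF X g g0(1) rel(2)] FL_mor[OF X g0(1) g rel(1)] by blast
    note FLg = frobenius_lifting[OF X g] and FL0 = frobenius_lifting[OF X g0(1)]
    show ?thesis
      using Lc is_frob_lift_mor_comp[OF FLg FL0 Lc is_mor_id is_mor_id ab(1) uv(1)]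
        is_frob_lift_mor_comp[OF Lc FL0 FLg is_mor_id is_mor_id uv(2) ab(2)] by (auto simp: comp_mor_id)
  qed
  have "\<Phi> X \<in> trivializations p k X // trivialization_rel p k X \<rightarrow> frob_lifts p k X // frob_lift_rel p k X"
    if X: "smooth_variety k X" for X
  proof
    fix C assume "C \<in> trivializations p k X // trivialization_rel p k X"
    then obtain g where "g \<in> trivializations p k X" "C = trivialization_rel p k X `` {g}" by (rule quotientE)
    from rep(1)[OF this] show "\<Phi> X C \<in> frob_lifts p k X // frob_lift_rel p k X"
      unfolding \<Phi>_def by (intro quotientI frobenius_lifting X)
  qed
  moreover have "canonical_map p k \<Phi>"
    unfolding canonical_map_def
  proof (intro allI impI ballI, elim conjE)
    fix X X' :: "('x, 'r, 'k) scheme_over" and h g g' L L'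
    assume g: "g \<in> trivializations p k X" "g' \<in> trivializations p k X'"
      and c: "compatible_trivializations p k X X' h g g'"
      and L: "L \<in> \<Phi> X (trivialization_rel p k X `` {g})" "L' \<in> \<Phi> X' (trivialization_rel p k X' `` {g'})"
      and X: "smooth_variety k X" "smooth_variety k X'" and h: "is_mor_over k (\<lambda>a. a) X' X h"
    obtain v where v: "is_frob_lift_mor p k X X' h (triv_sm.frobenius_lifting p k X g) (triv_sm.frobenius_lifting p k X' g') v"
      using compatible_ex_frob_lift_mor[OF sm[OF X(1) g(1)] sm[OF X(2) g(2)] h c] by blast
    obtain u where u: "L \<in> frob_lifts p k X" "is_frob_lift_mor p k X X id_mor L (triv_sm.frobenius_lifting p k X g) u"
      using lift[OF X(1) g(1) L(1)] by blast
    obtain w where w: "L' \<in> frob_lifts p k X'" "is_frob_lift_mor p k X' X' id_mor (triv_sm.frobenius_lifting p k X' g') L' w"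
      using lift[OF X(2) g(2) L(2)] by blast
    have "is_mor X' X h" using h by (simp add: is_mor_over_def)
    then show "\<exists>u. is_frob_lift_mor p k X X' h L L' u"
      using is_frob_lift_mor_trans[OF u(1) frobenius_lifting[OF X(1) g(1)] w(1) frobenius_lifting[OF X(2) g(2)] _ u(2) v w(2)] by blast
  qed
  ultimately show ?thesis by blast
qed

end
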